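(* Let $\rho_0$ be a Borel probability measure on $\mathbb{R}$ with $\int_{\mathbb{R}}x^2\,d\rho_0(x)<\infty$ and let $v_0:\mathbb{R}\to\mathbb{R}$ be absolutely continuous. Let $W:\mathbb{R}\to\mathbb{R}$ be continuously differentiable and even, with $\sup_{x\in\mathbb{R}}\frac{|W'(x)|}{1+|x|}<\infty$, and let $c>0$ be such that $x\mapsto W(x)+\frac{c}{2}x^2$ is convex. Then there exists a weak solution pair $\rho$ and $v$ of the pressureless Euler equations $$\partial_t\rho+\partial_x(\rho v)=0,\qquad \partial_t(\rho v)+\partial_x(\rho v^2)=-\rho(W'*\rho)\qquad\text{on }\mathbb{R}\times(0,\infty)$$ which satisfies the initial conditions $\rho|_{t=0}=\rho_0$ and $v|_{t=0}=v_0$. Moreover, this solution pair has the following two properties. (i) For almost every $0\le s\le t$, $$\int_{\mathbb{R}}\frac12v(x,t)^2d\rho_t(x)+\iint_{\mathbb{R}^2}\frac12W(x-y)\,d\rho_t(x)d\rho_t(y)\le\int_{\mathbb{R}}\frac12v(x,s)^2d\rho_s(x)+\iint_{\mathbb{R}^2}\frac12W(x-y)\,d\rho_s(x)d\rho_s(y).$$ (ii) For almost every $t>0$ and $\rho_t$ almost every $x,y\in\mathbb{R}$, $$(v(x,t)-v(y,t))(x-y)\le\frac{\sqrt{c}}{\tanh(\sqrt{c}\,t)}(x-y)^2.$$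
   Context: Absolute continuity of $v_0$ on $\mathbb{R}$ is meant in the usual $\varepsilon$-$\delta$ sense on the whole line: for each $\varepsilon>0$ there is $\delta>0$ such that $\sum_i|v_0(b_i)-v_0(a_i)|<\varepsilon$ for every finite family of disjoint intervals $(a_i,b_i)$ with $\sum_i(b_i-a_i)<\delta$. $\mathcal{P}(\mathbb{R})$ is the set of Borel probability measures on $\mathbb{R}$; narrow convergence is convergence of integrals against every bounded continuous function. $(W'*\mu)(x)=\int_{\mathbb{R}}W'(x-y)\,d\mu(y)$. Definition. A narrowly continuous $\rho:[0,\infty)\to\mathcal{P}(\mathbb{R})$, $t\mapsto\rho_t$, and a Borel measurable $v:\mathbb{R}\times[0,\infty)\to\mathbb{R}$ form a weak solution pair of the pressureless Euler equations satisfying the initial conditions $\rho|_{t=0}=\rho_0$, $v|_{t=0}=v_0$ if: (a) for each $T>0$, $\int_0^T\left\{\int_{\mathbb{R}}v^2d\rho_t+\iint_{\mathbb{R}^2}|W'(x-y)|\,d\rho_t(x)d\rho_t(y)\right\}dt<\infty$; (b) for each $\phi\in C_c^\infty(\mathbb{R}\times[0,\infty))$, $\int_0^\infty\int_{\mathbb{R}}(\partial_t\phi+v\,\partial_x\phi)\,d\rho_t\,dt+\int_{\mathbb{R}}\phi(\cdot,0)\,d\rho_0=0$; (c) for each $\phi\in C_c^\infty(\mathbb{R}\times[0,\infty))$, $\int_0^\infty\int_{\mathbb{R}}(v\,\partial_t\phi+v^2\partial_x\phi)\,d\rho_t\,dt+\int_{\mathbb{R}}\phi(\cdot,0)v_0\,d\rho_0=\int_0^\infty\int_{\mathbb{R}}\phi\,(W'*\rho_t)\,d\rho_t\,dt$.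 *)

theory Defs
  imports "HOL-Probability.Probability"
begin

definition abs_continuous_real :: "(real \<Rightarrow> real) \<Rightarrow> bool" where
  "abs_continuous_real f \<longleftrightarrow>
     (\<forall>\<epsilon>>0. \<exists>\<delta>>0. \<forall>(n::nat) a b.
        (\<forall>i<n. a i < b i) \<and> disjoint_family_on (\<lambda>i. {a i<..<b i}) {..<n} \<and>
        (\<Sum>i<n. b i - a i) < \<delta> \<longrightarrow>
        (\<Sum>i<n. \<bar>f (b i) - f (a i)\<bar>) < \<epsilon>)"

text \<open>
  The locale \<open>real_distribution\<close> describes the Borel probability measures on the line.
  A curve is a function of all real times of which only the values at times \<open>t \<ge> 0\<close> matter.
\<close>

definition narrowly_continuous :: "(real \<Rightarrow> real measure) \<Rightarrow> bool" where
  "narrowly_continuous \<rho> \<longleftrightarrow>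
     (\<forall>f :: real \<Rightarrow> real. continuous_on UNIV f \<and> bounded (range f) \<longrightarrow>
        continuous_on {0..} (\<lambda>t. \<integral>x. f x \<partial>\<rho> t))"

primrec times_cont_diff :: "nat \<Rightarrow> ('a::euclidean_space \<Rightarrow> real) \<Rightarrow> bool" where
  "times_cont_diff 0 f \<longleftrightarrow> continuous_on UNIV f"
| "times_cont_diff (Suc k) f \<longleftrightarrow>
     f differentiable_on UNIV \<and> (\<forall>v. times_cont_diff k (\<lambda>z. frechet_derivative f (at z) v))"

text \<open>
  A test function on \<open>\<real> \<times> [0,\<infinity>)\<close>, smooth up to the boundary and possibly nonzero at time 0, is
  the restriction of a smooth, compactly supported function on the plane. We quantify over
  the latter; their values at negative times play no role below. Points are pairs \<open>(x, t)\<close>.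
\<close>

definition test_function :: "(real \<times> real \<Rightarrow> real) \<Rightarrow> bool" where
  "test_function \<phi> \<longleftrightarrow>
     (\<forall>k. times_cont_diff k \<phi>) \<and> compact (closure {z. \<phi> z \<noteq> 0})"

definition partial_x :: "(real \<times> real \<Rightarrow> real) \<Rightarrow> real \<Rightarrow> real \<Rightarrow> real" where
  "partial_x \<phi> x t = deriv (\<lambda>y. \<phi> (y, t)) x"

definition partial_t :: "(real \<times> real \<Rightarrow> real) \<Rightarrow> real \<Rightarrow> real \<Rightarrow> real" where
  "partial_t \<phi> x t = deriv (\<lambda>s. \<phi> (x, s)) t"

definition conv_measure :: "(real \<Rightarrow> real) \<Rightarrow> real measure \<Rightarrow> real \<Rightarrow> real" where
  "conv_measure g \<mu> x = (\<integral>y. g (x - y) \<partial>\<mu>)"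

text \<open>
  The first three conditions say that \<open>\<rho>\<close> is a narrowly continuous curve of probability
  measures and that \<open>v\<close> is Borel on \<open>\<real> \<times> [0,\<infinity>)\<close>. By the fourth, which is stated with
  nonnegative integrals, the time integrals in the two weak equations exist (the inner
  integrals for almost every time), so that no default value enters.
\<close>

definition weak_solution_pair ::
  "(real \<Rightarrow> real) \<Rightarrow> real measure \<Rightarrow> (real \<Rightarrow> real) \<Rightarrow>
   (real \<Rightarrow> real measure) \<Rightarrow> (real \<times> real \<Rightarrow> real) \<Rightarrow> bool" where
  "weak_solution_pair W \<rho>0 v0 \<rho> v \<longleftrightarrow>
     (\<forall>t\<ge>0. real_distribution (\<rho> t)) \<and>
     narrowly_continuous \<rho> \<and>
     v \<in> borel_measurable (restrict_space borel (UNIV \<times> {0..})) \<and>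
     (\<forall>T>0. (\<integral>\<^sup>+t\<in>{0..T}.
          ((\<integral>\<^sup>+x. ennreal ((v (x, t))\<^sup>2) \<partial>\<rho> t) +
           (\<integral>\<^sup>+z. ennreal \<bar>deriv W (fst z - snd z)\<bar> \<partial>(\<rho> t \<Otimes>\<^sub>M \<rho> t))) \<partial>lborel) < \<infinity>) \<and>
     (\<forall>\<phi>. test_function \<phi> \<longrightarrow>
        (LBINT t:{0..}. \<integral>x. partial_t \<phi> x t + v (x, t) * partial_x \<phi> x t \<partial>\<rho> t)
          + (\<integral>x. \<phi> (x, 0) \<partial>\<rho>0) = 0) \<and>
     (\<forall>\<phi>. test_function \<phi> \<longrightarrow>
        (LBINT t:{0..}. \<integral>x. v (x, t) * partial_t \<phi> x t + (v (x, t))\<^sup>2 * partial_x \<phi> x t \<partial>\<rho> t)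
          + (\<integral>x. \<phi> (x, 0) * v0 x \<partial>\<rho>0)
        = (LBINT t:{0..}. \<integral>x. \<phi> (x, t) * conv_measure (deriv W) (\<rho> t) x \<partial>\<rho> t))"

definition energy ::
  "(real \<Rightarrow> real) \<Rightarrow> (real \<Rightarrow> real measure) \<Rightarrow> (real \<times> real \<Rightarrow> real) \<Rightarrow> real \<Rightarrow> real" where
  "energy W \<rho> v t =
     (\<integral>x. 1/2 * (v (x, t))\<^sup>2 \<partial>\<rho> t) +
     (\<integral>z. 1/2 * W (fst z - snd z) \<partial>(\<rho> t \<Otimes>\<^sub>M \<rho> t))"

text \<open>
  ``For almost every \<open>0 \<le> s \<le> t\<close>'' refers to all pairs of times outside one Lebesgue null set.
  The integrability clauses make the energies genuine finite numbers: the growth bound on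
  \<open>W'\<close> only makes \<open>W\<close> grow at most quadratically, and the weak solution property gives no
  second moments for \<open>\<rho> t\<close>.
\<close>

definition energy_nonincreasing ::
  "(real \<Rightarrow> real) \<Rightarrow> (real \<Rightarrow> real measure) \<Rightarrow> (real \<times> real \<Rightarrow> real) \<Rightarrow> bool" where
  "energy_nonincreasing W \<rho> v \<longleftrightarrow>
     (\<exists>N \<in> null_sets lborel.
        (\<forall>t. 0 \<le> t \<and> t \<notin> N \<longrightarrow>
           integrable (\<rho> t) (\<lambda>x. (v (x, t))\<^sup>2) \<and>
           integrable (\<rho> t \<Otimes>\<^sub>M \<rho> t) (\<lambda>z. W (fst z - snd z))) \<and>
        (\<forall>s t. 0 \<le> s \<and> s \<le> t \<and> s \<notin> N \<and> t \<notin> N \<longrightarrow> energy W \<rho> v t \<le> energy W \<rho> v s))"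

definition entropy_inequality ::
  "real \<Rightarrow> (real \<Rightarrow> real measure) \<Rightarrow> (real \<times> real \<Rightarrow> real) \<Rightarrow> bool" where
  "entropy_inequality c \<rho> v \<longleftrightarrow>
     (AE t in lborel. t > 0 \<longrightarrow>
        (\<exists>N \<in> null_sets (\<rho> t). \<forall>x y. x \<notin> N \<and> y \<notin> N \<longrightarrow>
           (v (x, t) - v (y, t)) * (x - y) \<le> sqrt c / tanh (sqrt c * t) * (x - y)\<^sup>2))"

end

theory Submission
  imports Defs
begin

text \<open>
  The solution is built in Lagrangian form, as the law of a flow \<open>X\<^sub>t\<close> on the probability space
  \<open>\<rho>\<^sub>0\<close> with \<open>X\<^sub>0 = id\<close>. For finitely many particles one moves freely up to the next collision
  (or the end of a short time step), then replaces the velocities in each cluster by their mean and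
  applies the force. Differences of trajectories are dominated by solutions of \<open>x'' = c x\<close>,
  because \<open>W' + c x\<close> is increasing. This gives equicontinuity in the label, and that
  \<open>(X\<^sub>t z - X\<^sub>t y) / sinh (sqrt c t)\<close> is nonincreasing in \<open>t\<close>. Along a subsequence of
  discretisations of \<open>\<rho>\<^sub>0\<close> the trajectories converge to a monotone, sticky flow, and with the impulse
  \<open>A\<^sub>t = v\<^sub>0 - \<integral>\<^sub>0\<^sup>t (W' * \<rho>\<^sub>r)(X\<^sub>r) dr\<close> the identity \<open>E [(X\<^sub>t - X\<^sub>s - \<integral>\<^sub>s\<^sup>t A\<^sub>r dr) g(X\<^sub>t)] = 0\<close> survives.

  The velocity is \<open>v(X\<^sub>t, t) = E [A\<^sub>t | X\<^sub>t]\<close>, obtained from a Radon-Nikodym density in space-time. By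
  stickiness the defects \<open>X\<^sub>t - X\<^sub>s - \<integral>\<^sub>s\<^sup>t v(X\<^sub>r, r) dr\<close> of disjoint time intervals are orthogonal; being
  of the order of \<open>t - s\<close> in \<open>L\<^sup>2\<close> they vanish. So \<open>X\<close> is a flow of \<open>v\<close>, and the chain rule along its
  paths yields both weak equations. The entropy inequality is the contraction estimate
  differentiated at \<open>t\<close> and tested against pairs of half lines. For the energy \<open>e\<close>, conditioning
  decreases the kinetic part while the semiconvexity of \<open>W\<close> bounds the potential part, so that
  \<open>e(t) - e(s) \<le> \<epsilon> (t - s)\<close> for close times \<open>s \<le> t\<close>; chaining such times gives monotonicity.
\<close>

section \<open>Discrete sticky particle schemes\<close>

text \<open>The obstacle is the quadratic flux: compactness is available for positions only, and a
  weak limit of velocities may lose \<open>v^2\<close>. The identity that survives the limit is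
  linear in the impulse, which is itself a function of the positions and \<open>v0\<close>. Products
  are recovered afterwards. Labels that have met never separate, so a function of \<open>X_r\<close>
  is also a function of \<open>X_t\<close> whenever t \<le> r: the sigma-algebras of the positions
  decrease in time. Hence the conditional expectation given \<open>X_t\<close> may be tested against
  functions of every later position, which makes later defects orthogonal to earlier ones. Likewise
  the derivative of a test function along a path of \<open>v\<close> is a function of the position,
  so the factor \<open>v\<close> in front of it may be exchanged for the impulse, and
  \<open>v^2\<close> never has to be computed as a limit.

  The function sinh (sqrt c t) / sqrt c solves x'' = c x and leaves the origin with speed 1. Its
  logarithmic derivative is the constant of the entropy inequality. The same comparison gives
  stickiness in the limit: two labels at distance zero at a positive time stay at distance
  zero.\<close>

text \<open>A discrete Gronwall inequality for x' = y, y' = c x in which the velocity update sees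
  the already updated position. It serves with the one-sided constant of the force for differences
  of trajectories and for the comparison particle, and with twice the growth constant of the force
  for norms.\<close>

lemma second_order_growth:
  fixes a b \<tau> :: "nat \<Rightarrow> real"
  assumes \<tau>: "\<And>n. n < N \<Longrightarrow> 0 \<le> \<tau> n \<and> \<tau> n \<le> 1" and c: "0 \<le> c" and M: "0 \<le> M"
    and a0: "a 0 \<le> M" and b0: "b 0 \<le> (1 + c) * M"
    and a: "\<And>n. n < N \<Longrightarrow> a (Suc n) \<le> a n + \<tau> n * b n"
    and b: "\<And>n. n < N \<Longrightarrow> b (Suc n) \<le> b n + c * \<tau> n * a (Suc n)"
  shows "n \<le> N \<Longrightarrow> a n \<le> M * exp ((1 + c) * (\<Sum>j<n. \<tau> j)) \<and>
     b n \<le> (1 + c) * (M * exp ((1 + c) * (\<Sum>j<n. \<tau> j)))"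
proof (induction n)
  case 0
  then show ?case using a0 b0 by simp
next
  case (Suc n)
  define E where "E = M * exp ((1 + c) * (\<Sum>j<n. \<tau> j))"
  define E' where "E' = M * exp ((1 + c) * (\<Sum>j<Suc n. \<tau> j))"
  have t: "0 \<le> \<tau> n" "\<tau> n \<le> 1" using \<tau>[of n] Suc.prems by auto
  have E0: "0 \<le> E" using M by (simp add: E_def)
  have E'eq: "E' = E * exp ((1 + c) * \<tau> n)"
    by (simp add: E'_def E_def exp_add[symmetric] algebra_simps)
  have "1 + (1 + c) * \<tau> n \<le> exp ((1 + c) * \<tau> n)" by (rule exp_ge_add_one_self)
  then have EE': "E * (1 + (1 + c) * \<tau> n) \<le> E'"
    unfolding E'eq using E0 by (rule mult_left_mono)
  have IH: "a n \<le> E" "b n \<le> (1 + c) * E" using Suc by (auto simp: E_def)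
  have "a (Suc n) \<le> a n + \<tau> n * b n" using a Suc.prems by auto
  also have "\<dots> \<le> E + \<tau> n * ((1 + c) * E)"
    using IH t by (intro add_mono mult_left_mono) auto
  also have "\<dots> \<le> E'" using EE' by (simp add: algebra_simps)
  finally have 1: "a (Suc n) \<le> E'" .
  have "b (Suc n) \<le> b n + c * \<tau> n * a (Suc n)" using b Suc.prems by auto
  also have "\<dots> \<le> (1 + c) * E + c * \<tau> n * E'"
    using IH t c 1 by (intro add_mono mult_left_mono) auto
  \<comment> \<open>After c \<tau> E' is moved to the right, the claim is (1 + c) E \<le> E' (1 + c
    - c \<tau>). It follows from E (1 + (1 + c) \<tau>) \<le> E', because the product of 1 + (1 + c)
    \<tau> and 1 + c - c \<tau> is at least 1 + c for \<tau> in [0, 1].\<close>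
  also have "\<dots> \<le> (1 + c) * E'"
  proof -
    have k: "0 \<le> 1 + c - c * \<tau> n" using mult_left_le[OF t(2) c] by simp
    have "(1 + c) * E \<le> E * (1 + (1 + c) * \<tau> n) * (1 + c - c * \<tau> n)"
    proof -
      have "0 \<le> \<tau> n * ((1 + c) * (1 + c) - c - (1 + c) * c * \<tau> n)"
      proof -
        have "(1 + c) * c * \<tau> n \<le> (1 + c) * c" using mult_left_le[OF t(2), of "(1+c)*c"] c by simp
        then have "0 \<le> (1 + c) * (1 + c) - c - (1 + c) * c * \<tau> n" using c by (simp add: algebra_simps)
        then show ?thesis using t by simp
      qed
      then have "(1 + c) \<le> (1 + (1 + c) * \<tau> n) * (1 + c - c * \<tau> n)" by (simp add: algebra_simps)
      from mult_left_mono[OF this E0] show ?thesis by (simp add: algebra_simps)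
    qed
    also have "\<dots> \<le> E' * (1 + c - c * \<tau> n)" using EE' k by (rule mult_right_mono)
    finally show ?thesis by (simp add: algebra_simps)
  qed
  finally show ?case using 1 by (simp add: E'_def)
qed

lemma factor_through:
  assumes "\<And>y z. y \<in> S \<Longrightarrow> z \<in> S \<Longrightarrow> X y = X z \<Longrightarrow> \<phi> y = \<phi> z"
  shows "\<exists>J. \<forall>z\<in>S. J (X z) = \<phi> z"
proof (intro exI ballI)
  fix z assume z: "z \<in> S"
  have "(SOME z'. z' \<in> S \<and> X z' = X z) \<in> S \<and> X (SOME z'. z' \<in> S \<and> X z' = X z) = X z"
    by (rule someI[of "\<lambda>z'. z' \<in> S \<and> X z' = X z" z]) (simp add: z)
  then show "(\<lambda>x. \<phi> (SOME z'. z' \<in> S \<and> X z' = x)) (X z) = \<phi> z"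
    using assms z by blast
qed

section \<open>One step of the particle scheme\<close>

text \<open>Particles are named by their initial positions, the elements of \<open>S\<close>, and
  keep their names after merging; a cluster is a level set of the position. For f = W' the condition
  \<open>one_sided\<close> says that f(x) + c x is nondecreasing, that is, that W + c x^2 / 2 is
  convex.\<close>

locale sticky_scheme =
  fixes S :: "real set" and m f v0 :: "real \<Rightarrow> real" and c h :: real
  assumes finite_S: "finite S" and S_nonempty: "S \<noteq> {}"
    and m_pos: "\<And>z. z \<in> S \<Longrightarrow> 0 < m z" and m_sum: "(\<Sum>z\<in>S. m z) = 1"
    and c_pos: "0 < c" and h_pos: "0 < h" and h_le_1: "h \<le> 1"
    and one_sided: "\<And>x y. x \<le> y \<Longrightarrow> f x - f y \<le> c * (y - x)"
begin

lemma c_nonneg: "0 \<le> c"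
  using c_pos by simp

definition force :: "(real \<Rightarrow> real) \<Rightarrow> real \<Rightarrow> real" where
  "force X z = - (\<Sum>w\<in>S. m w * f (X z - X w))"

definition cluster :: "(real \<Rightarrow> real) \<Rightarrow> real \<Rightarrow> real set" where
  "cluster X z = {w \<in> S. X w = X z}"

definition avg :: "(real \<Rightarrow> real) \<Rightarrow> (real \<Rightarrow> real) \<Rightarrow> real \<Rightarrow> real" where
  "avg X V z = (\<Sum>w\<in>cluster X z. m w * V w) / (\<Sum>w\<in>cluster X z. m w)"

definition colliding :: "(real \<Rightarrow> real) \<Rightarrow> (real \<Rightarrow> real) \<Rightarrow> (real \<times> real) set" where
  "colliding X V = {(y, z) \<in> S \<times> S. X y < X z \<and> V z < V y}"

text \<open>Each quotient is the time after which an approaching pair would meet. Stopping at the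
  first such time preserves the order; \<open>h\<close> keeps the set nonempty and bounds the step
  when nothing collides.\<close>

definition step :: "(real \<Rightarrow> real) \<Rightarrow> (real \<Rightarrow> real) \<Rightarrow> real" where
  "step X V = Min (insert h ((\<lambda>(y, z). (X z - X y) / (V y - V z)) ` colliding X V))"

definition move :: "(real \<Rightarrow> real) \<Rightarrow> (real \<Rightarrow> real) \<Rightarrow> real \<Rightarrow> real" where
  "move X V z = X z + step X V * V z"

text \<open>The force is taken at the new positions and added after averaging, so particles that
  share a position leave the step with a common velocity.\<close>

definition kick :: "(real \<Rightarrow> real) \<Rightarrow> (real \<Rightarrow> real) \<Rightarrow> real \<Rightarrow> real" where
  "kick X V z = avg (move X V) V z + step X V * force (move X V) z"

definition ordered :: "(real \<Rightarrow> real) \<Rightarrow> (real \<Rightarrow> real) \<Rightarrow> bool" where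
  "ordered X V \<longleftrightarrow> (\<forall>y\<in>S. \<forall>z\<in>S. (y \<le> z \<longrightarrow> X y \<le> X z) \<and> (X y = X z \<longrightarrow> V y = V z))"

lemma ordered_le: "ordered X V \<Longrightarrow> y \<in> S \<Longrightarrow> z \<in> S \<Longrightarrow> y \<le> z \<Longrightarrow> X y \<le> X z"
  unfolding ordered_def by blast

lemma ordered_eq: "ordered X V \<Longrightarrow> y \<in> S \<Longrightarrow> z \<in> S \<Longrightarrow> X y = X z \<Longrightarrow> V y = V z"
  unfolding ordered_def by blast

lemma finite_colliding: "finite (colliding X V)"
  by (rule finite_subset[of _ "S \<times> S"]) (auto simp: colliding_def finite_S)

lemma step_pos: "0 < step X V"
  unfolding step_def using finite_colliding h_pos
  by (subst Min_gr_iff) (auto simp: colliding_def)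

lemma step_le: "step X V \<le> h"
  unfolding step_def using finite_colliding by (intro Min_le) auto

lemma step_le_1: "step X V \<le> 1"
  using step_le[of X V] h_le_1 by simp

lemma step_le_collision:
  assumes "y \<in> S" "z \<in> S" "X y < X z" "V z < V y"
  shows "step X V * (V y - V z) \<le> X z - X y"
proof -
  have "step X V \<le> (X z - X y) / (V y - V z)"
    unfolding step_def using finite_colliding assms
    by (intro Min_le) (auto simp: colliding_def image_iff intro!: bexI[of _ "(y,z)"])
  then show ?thesis using assms by (simp add: field_simps)
qed

lemma move_mono:
  assumes "ordered X V" "y \<in> S" "z \<in> S" "y \<le> z"
  shows "move X V y \<le> move X V z"
proof (cases "X y < X z \<and> V z < V y")
  case True
  then show ?thesis using step_le_collision[of y z X V] assms by (simp add: move_def algebra_simps)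
next
  case False
  have "X y \<le> X z" using assms by (blast intro: ordered_le)
  then consider "X y = X z" | "X y \<le> X z" "V y \<le> V z" using False by fastforce
  then show ?thesis
  proof cases
    case 1
    then have "V y = V z" using assms by (blast intro: ordered_eq)
    with 1 show ?thesis by (simp add: move_def)
  next
    case 2
    then show ?thesis using step_pos[of X V] by (auto simp: move_def intro!: add_mono mult_left_mono)
  qed
qed

text \<open>The particle on the left can catch up only if it is not slower.\<close>

lemma merged_antimono:
  assumes "ordered X V" "y \<in> S" "z \<in> S" "y \<le> z" "move X V y = move X V z"
  shows "V z \<le> V y"
proof -
  have "X y \<le> X z" using assms by (blast intro: ordered_le)
  then have "0 \<le> step X V * (V y - V z)" using assms(5) by (simp add: move_def algebra_simps)
  then show ?thesis using step_pos[of X V] by (simp add: zero_le_mult_iff)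
qed

lemma cluster_mass_pos: "z \<in> S \<Longrightarrow> 0 < (\<Sum>w\<in>cluster X z. m w)"
  using finite_S m_pos by (intro sum_pos) (auto simp: cluster_def)

lemma avg_le:
  assumes "z \<in> S" "\<And>w. w \<in> cluster X z \<Longrightarrow> V w \<le> u"
  shows "avg X V z \<le> u"
proof -
  have "(\<Sum>w\<in>cluster X z. m w * V w) \<le> (\<Sum>w\<in>cluster X z. m w * u)"
    using assms m_pos by (intro sum_mono mult_left_mono) (auto simp: cluster_def less_imp_le)
  then show ?thesis using cluster_mass_pos[OF assms(1), of X]
    by (simp add: avg_def divide_le_eq sum_distrib_right[symmetric] mult.commute[of u])
qed

lemma avg_ge:
  assumes "z \<in> S" "\<And>w. w \<in> cluster X z \<Longrightarrow> u \<le> V w"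
  shows "u \<le> avg X V z"
proof -
  have "(\<Sum>w\<in>cluster X z. m w * u) \<le> (\<Sum>w\<in>cluster X z. m w * V w)"
    using assms m_pos by (intro sum_mono mult_left_mono) (auto simp: cluster_def less_imp_le)
  then show ?thesis using cluster_mass_pos[OF assms(1), of X]
    by (simp add: avg_def le_divide_eq sum_distrib_right[symmetric] mult.commute[of u])
qed

lemma avg_cong: "X y = X z \<Longrightarrow> avg X V y = avg X V z"
  by (simp add: avg_def cluster_def)

text \<open>Inside a newly formed cluster velocities decrease from left to right, so its mean velocity
  lies between those of its last and its first member.\<close>

lemma avg_difference:
  assumes "ordered X V" "y \<in> S" "z \<in> S" "y \<le> z"
  obtains y' z' where "y' \<in> S" "z' \<in> S" "y \<le> y'" "y' \<le> z'" "z' \<le> z"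
    "move X V y' = move X V y" "move X V z' = move X V z"
    "avg (move X V) V z - avg (move X V) V y \<le> V z' - V y'"
proof (cases "move X V y = move X V z")
  case True
  show ?thesis by (rule that[of y y]) (use True assms avg_cong[of "move X V" y z V] in auto)
next
  case False
  let ?C = "\<lambda>z. cluster (move X V) z"
  have fin: "finite (?C u)" for u using finite_S by (simp add: cluster_def)
  have mem: "y \<in> ?C y" "z \<in> ?C z" using assms by (auto simp: cluster_def)
  define y' z' where "y' = Max (?C y)" and "z' = Min (?C z)"
  have y': "y' \<in> ?C y" "\<And>w. w \<in> ?C y \<Longrightarrow> w \<le> y'"
    using fin mem unfolding y'_def by (auto intro: Max_in)
  have z': "z' \<in> ?C z" "\<And>w. w \<in> ?C z \<Longrightarrow> z' \<le> w"
    using fin mem unfolding z'_def by (auto intro: Min_in)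
  have "avg (move X V) V z \<le> V z'"
  proof (rule avg_le[OF assms(3)])
    fix w assume w: "w \<in> ?C z"
    show "V w \<le> V z'"
      using z'(1) w by (intro merged_antimono[OF assms(1) _ _ z'(2)[OF w]]) (simp_all add: cluster_def)
  qed
  moreover have "V y' \<le> avg (move X V) V y"
  proof (rule avg_ge[OF assms(2)])
    fix w assume w: "w \<in> ?C y"
    show "V y' \<le> V w"
      using y'(1) w by (intro merged_antimono[OF assms(1) _ _ y'(2)[OF w]]) (simp_all add: cluster_def)
  qed
  moreover have "y' \<le> z'"
  proof (rule ccontr)
    assume "\<not> y' \<le> z'"
    then have "move X V z' \<le> move X V y'" using y' z' by (intro move_mono assms) (auto simp: cluster_def)
    moreover have "move X V y \<le> move X V z" by (intro move_mono assms)
    ultimately show False using y' z' False by (auto simp: cluster_def)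
  qed
  ultimately show ?thesis using y' z' mem
    by (intro that[of y' z']) (auto simp: cluster_def)
qed

text \<open>Each summand is one use of \<open>one_sided\<close>, and the total mass 1 returns the
  same constant c.\<close>

lemma force_difference:
  assumes "X y \<le> X z"
  shows "force X z - force X y \<le> c * (X z - X y)"
proof -
  have "force X z - force X y = (\<Sum>w\<in>S. m w * (f (X y - X w) - f (X z - X w)))"
    by (simp add: force_def sum_subtractf[symmetric] algebra_simps)
  also have "\<dots> \<le> (\<Sum>w\<in>S. m w * (c * (X z - X y)))"
    using one_sided[of "X y - X w" "X z - X w" for w] assms m_pos
    by (intro sum_mono mult_left_mono) (auto simp: less_imp_le)
  also have "\<dots> = c * (X z - X y)" by (simp add: sum_distrib_right[symmetric] m_sum)
  finally show ?thesis .
qed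

lemma ordered_step:
  assumes "ordered X V"
  shows "ordered (move X V) (kick X V)"
  unfolding ordered_def
proof (intro ballI conjI impI)
  fix y z assume yz: "y \<in> S" "z \<in> S"
  show "move X V y \<le> move X V z" if "y \<le> z" using move_mono[OF assms yz that] .
  show "kick X V y = kick X V z" if eq: "move X V y = move X V z"
    unfolding kick_def force_def eq avg_cong[of "move X V" y z V, OF eq] ..
qed

lemma move_cong:
  "ordered X V \<Longrightarrow> y \<in> S \<Longrightarrow> z \<in> S \<Longrightarrow> X y = X z \<Longrightarrow> move X V y = move X V z"
  using ordered_eq by (simp add: move_def)

text \<open>Averaging over clusters is the conditional expectation given the position, hence
  invisible to functions of the position. The sum is split over the level sets of \<open>X\<close>,
  where the average is momentum divided by mass.\<close>

lemma sum_avg: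
  "(\<Sum>z\<in>S. m z * avg X V z * g (X z)) = (\<Sum>z\<in>S. m z * V z * g (X z))"
proof -
  have *: "(\<Sum>z\<in>{z\<in>S. X z = x}. m z * avg X V z * g (X z)) = (\<Sum>z\<in>{z\<in>S. X z = x}. m z * V z * g (X z))"
    if x: "x \<in> X ` S" for x
  proof -
    obtain z0 where z0: "z0 \<in> S" "x = X z0" using x by auto
    have C: "{z\<in>S. X z = x} = cluster X z0" using z0 by (auto simp: cluster_def)
    have "(\<Sum>z\<in>cluster X z0. m z * avg X V z * g (X z)) = (\<Sum>z\<in>cluster X z0. m z * (avg X V z0 * g x))"
    proof (rule sum.cong[OF refl])
      fix z assume "z \<in> cluster X z0"
      then have "X z = X z0" by (simp add: cluster_def)
      from this avg_cong[of X z z0 V, OF this] show "m z * avg X V z * g (X z) = m z * (avg X V z0 * g x)"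
        using z0 by (simp only: mult.assoc)
    qed
    also have "\<dots> = (\<Sum>z\<in>cluster X z0. m z) * avg X V z0 * g x"
      by (simp only: sum_distrib_right[symmetric] mult.assoc)
    also have "\<dots> = (\<Sum>z\<in>cluster X z0. m z * V z) * g x"
      using cluster_mass_pos[OF z0(1), of X] by (simp add: avg_def)
    also have "\<dots> = (\<Sum>z\<in>cluster X z0. m z * V z * g (X z))"
      using z0 unfolding sum_distrib_right by (intro sum.cong) (auto simp: cluster_def)
    finally show ?thesis by (simp only: C)
  qed
  have im: "sum F S = (\<Sum>x\<in>X ` S. sum F {z\<in>S. X z = x})" for F :: "real \<Rightarrow> real"
    using sum.image_gen[OF finite_S, of F X] .
  show ?thesis unfolding im by (rule sum.cong[OF refl]) (rule *)
qed

section \<open>The mass-weighted L2 norm of functions of the label\<close>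

text \<open>Absorbing the masses as sqrt (m z) makes this an unweighted \<open>L2_set\<close>, for
  which the triangle and Cauchy-Schwarz inequalities are at hand.\<close>

definition wnorm :: "(real \<Rightarrow> real) \<Rightarrow> real" where
  "wnorm X = L2_set (\<lambda>z. sqrt (m z) * X z) S"

lemma wnorm_sq: "(wnorm X)\<^sup>2 = (\<Sum>z\<in>S. m z * (X z)\<^sup>2)"
  using m_pos unfolding wnorm_def L2_set_def
  by (subst real_sqrt_pow2) (auto simp: power_mult_distrib less_imp_le intro!: sum_nonneg sum.cong)

lemma wnorm_nonneg: "0 \<le> wnorm X"
  by (simp add: wnorm_def)

lemma wnorm_triangle: "wnorm (\<lambda>z. X z + Y z) \<le> wnorm X + wnorm Y"
  unfolding wnorm_def using L2_set_triangle_ineq[of "\<lambda>z. sqrt (m z) * X z" "\<lambda>z. sqrt (m z) * Y z" S]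
  by (simp add: algebra_simps)

lemma wnorm_scale: "0 \<le> r \<Longrightarrow> wnorm (\<lambda>z. r * X z) = r * wnorm X"
  unfolding wnorm_def by (subst L2_set_right_distrib) (auto simp: algebra_simps)

lemma wnorm_mono:
  assumes "\<And>z. z \<in> S \<Longrightarrow> \<bar>X z\<bar> \<le> \<bar>Y z\<bar>"
  shows "wnorm X \<le> wnorm Y"
proof (rule power2_le_imp_le)
  show "(wnorm X)\<^sup>2 \<le> (wnorm Y)\<^sup>2"
    unfolding wnorm_sq using assms m_pos
    by (intro sum_mono mult_left_mono) (auto simp: less_imp_le abs_le_square_iff)
qed (rule wnorm_nonneg)

lemma wnorm_const: "wnorm (\<lambda>z. r) = \<bar>r\<bar>"
proof -
  have "(wnorm (\<lambda>z. r))\<^sup>2 = r\<^sup>2" unfolding wnorm_sq by (simp add: sum_distrib_right[symmetric] m_sum)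
  then have "(wnorm (\<lambda>z. r))\<^sup>2 = \<bar>r\<bar>\<^sup>2" by simp
  then show ?thesis using wnorm_nonneg by (rule power2_eq_imp_eq) simp
qed

lemma wsum_abs_le: "(\<Sum>z\<in>S. m z * \<bar>X z\<bar>) \<le> wnorm X"
proof -
  have "(\<Sum>z\<in>S. m z * \<bar>X z\<bar>) = (\<Sum>z\<in>S. \<bar>sqrt (m z)\<bar> * \<bar>sqrt (m z) * X z\<bar>)"
    using m_pos by (intro sum.cong) (auto simp: abs_mult less_imp_le mult.assoc[symmetric])
  also have "\<dots> \<le> L2_set (\<lambda>z. sqrt (m z)) S * wnorm X"
    unfolding wnorm_def by (rule L2_set_mult_ineq)
  also have "L2_set (\<lambda>z. sqrt (m z)) S = 1" using wnorm_const[of 1] by (simp add: wnorm_def)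
  finally show ?thesis by simp
qed

text \<open>Conditional expectations contract the L2 norm: by \<open>sum_avg\<close> the average
  tested against itself equals \<open>V\<close> tested against the average, and 2 a b \<le> a^2 +
  b^2 does the rest.\<close>

lemma wnorm_avg: "wnorm (avg X V) \<le> wnorm V"
proof -
  \<comment> \<open>The average is a function of the label that is constant on clusters; g is the
    same function read off at the position, as \<open>sum_avg\<close> requires.\<close>
  define g where "g x = avg X V (SOME z. X z = x)" for x
  have X: "g (X z) = avg X V z" for z
    unfolding g_def by (rule avg_cong) (rule someI[of "\<lambda>z'. X z' = X z" z], rule refl)
  have "(wnorm (avg X V))\<^sup>2 = (\<Sum>z\<in>S. m z * avg X V z * g (X z))"
    unfolding wnorm_sq by (simp add: X power2_eq_square mult.assoc)
  also have "\<dots> = (\<Sum>z\<in>S. m z * V z * avg X V z)" by (simp only: sum_avg) (simp only: X)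
  also have "\<dots> \<le> (\<Sum>z\<in>S. m z * ((V z)\<^sup>2 / 2 + (avg X V z)\<^sup>2 / 2))"
  proof (rule sum_mono)
    fix z assume "z \<in> S"
    have "V z * avg X V z \<le> (V z)\<^sup>2 / 2 + (avg X V z)\<^sup>2 / 2"
      using sum_squares_bound[of "V z" "avg X V z"] by simp
    from mult_left_mono[OF this less_imp_le[OF m_pos[OF \<open>z \<in> S\<close>]]]
    show "m z * V z * avg X V z \<le> m z * ((V z)\<^sup>2 / 2 + (avg X V z)\<^sup>2 / 2)"
      by (simp only: mult.assoc)
  qed
  also have "\<dots> = (wnorm V)\<^sup>2 / 2 + (wnorm (avg X V))\<^sup>2 / 2"
    unfolding wnorm_sq by (simp add: distrib_left sum.distrib sum_divide_distrib)
  finally have "(wnorm (avg X V))\<^sup>2 \<le> (wnorm V)\<^sup>2" by simp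
  then show ?thesis by (rule power2_le_imp_le) (rule wnorm_nonneg)
qed


section \<open>The iterated scheme and its clock\<close>

primrec state :: "nat \<Rightarrow> (real \<Rightarrow> real) \<times> (real \<Rightarrow> real)" where
  "state 0 = (\<lambda>z. z, v0)"
| "state (Suc n) = (move (fst (state n)) (snd (state n)), kick (fst (state n)) (snd (state n)))"

definition pos :: "nat \<Rightarrow> real \<Rightarrow> real" where "pos n = fst (state n)"
definition vel :: "nat \<Rightarrow> real \<Rightarrow> real" where "vel n = snd (state n)"
definition dt :: "nat \<Rightarrow> real" where "dt n = step (pos n) (vel n)"
definition clock :: "nat \<Rightarrow> real" where "clock n = (\<Sum>j<n. dt j)"

lemma pos_0: "pos 0 z = z" and vel_0: "vel 0 z = v0 z"
  by (simp_all add: pos_def vel_def)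

lemma pos_Suc_move: "pos (Suc n) = move (pos n) (vel n)"
  by (simp add: pos_def vel_def)

lemma pos_Suc: "pos (Suc n) z = pos n z + dt n * vel n z"
  by (simp add: pos_Suc_move move_def dt_def)

lemma vel_Suc_kick: "vel (Suc n) = kick (pos n) (vel n)"
  by (simp add: pos_def vel_def)

lemma vel_Suc: "vel (Suc n) z = avg (pos (Suc n)) (vel n) z + dt n * force (pos (Suc n)) z"
  by (simp add: vel_Suc_kick kick_def pos_Suc_move dt_def)

lemma clock_0: "clock 0 = 0" and clock_Suc: "clock (Suc n) = clock n + dt n"
  by (simp_all add: clock_def)

lemma dt_pos: "0 < dt n" and dt_le: "dt n \<le> h" and dt_le_1: "dt n \<le> 1"
  using step_pos step_le step_le_1 by (simp_all add: dt_def)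

lemma ordered_state: "ordered (pos n) (vel n)"
proof (induction n)
  case 0
  show ?case by (simp add: ordered_def pos_0 vel_0)
next
  case (Suc n)
  then show ?case by (simp only: pos_Suc_move vel_Suc_kick ordered_step)
qed

lemma pos_mono: "y \<in> S \<Longrightarrow> z \<in> S \<Longrightarrow> y \<le> z \<Longrightarrow> pos n y \<le> pos n z"
  using ordered_le[OF ordered_state] by blast

lemma pos_sticky: "l \<le> n \<Longrightarrow> y \<in> S \<Longrightarrow> z \<in> S \<Longrightarrow> pos l y = pos l z \<Longrightarrow> pos n y = pos n z"
  by (induction n rule: dec_induct) (auto simp: pos_Suc_move intro: move_cong[OF ordered_state])

lemma next_pos_factors: "\<exists>J. \<forall>z\<in>S. J (pos n z) = pos (Suc n) z"
proof (rule factor_through)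
  fix y z assume "y \<in> S" "z \<in> S" "pos n y = pos n z"
  then show "pos (Suc n) y = pos (Suc n) z" by (rule pos_sticky[of n "Suc n", rotated]) simp
qed

lemma clock_mono: "l \<le> n \<Longrightarrow> clock l \<le> clock n"
  by (induction n rule: dec_induct) (auto simp: clock_Suc intro: order_trans less_imp_le[OF dt_pos] add_increasing2)

section \<open>Comparison of trajectories with x'' = c x\<close>

text \<open>Averaging mixes labels, so the new velocities of y and z cannot be compared with their
  own old ones. The pair y', z' lies between y and z and has the same new positions, so inductions
  over all ordered pairs can use it.\<close>

lemma vel_difference:
  assumes "y \<in> S" "z \<in> S" "y \<le> z"
  obtains y' z' where "y' \<in> S" "z' \<in> S" "y \<le> y'" "y' \<le> z'" "z' \<le> z"
    "pos (Suc n) y' = pos (Suc n) y" "pos (Suc n) z' = pos (Suc n) z"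
    "vel (Suc n) z - vel (Suc n) y \<le>
       (vel n z' - vel n y') + c * dt n * (pos (Suc n) z - pos (Suc n) y)"
proof -
  obtain y' z' where *: "y' \<in> S" "z' \<in> S" "y \<le> y'" "y' \<le> z'" "z' \<le> z"
    "pos (Suc n) y' = pos (Suc n) y" "pos (Suc n) z' = pos (Suc n) z"
    "avg (pos (Suc n)) (vel n) z - avg (pos (Suc n)) (vel n) y \<le> vel n z' - vel n y'"
    unfolding pos_Suc_move by (rule avg_difference[OF ordered_state assms])
  have "force (pos (Suc n)) z - force (pos (Suc n)) y \<le> c * (pos (Suc n) z - pos (Suc n) y)"
    by (intro force_difference pos_mono assms)
  from mult_left_mono[OF this less_imp_le[OF dt_pos[of n]]] *(8)
  have "vel (Suc n) z - vel (Suc n) y \<le>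
       (vel n z' - vel n y') + c * dt n * (pos (Suc n) z - pos (Suc n) y)"
    by (simp add: vel_Suc algebra_simps)
  then show ?thesis using that * by blast
qed

text \<open>The positions and velocities of a single particle pushed away from the origin by the force
  \<open>c x\<close>, computed with the same time steps; they dominate differences of particle trajectories.\<close>

primrec cmp :: "real \<Rightarrow> real \<Rightarrow> nat \<Rightarrow> real \<times> real" where
  "cmp d w 0 = (d, w)"
| "cmp d w (Suc n) = (fst (cmp d w n) + dt n * snd (cmp d w n),
     snd (cmp d w n) + c * dt n * (fst (cmp d w n) + dt n * snd (cmp d w n)))"

lemma cmp_nonneg: "0 \<le> d \<Longrightarrow> 0 \<le> w \<Longrightarrow> 0 \<le> fst (cmp d w n) \<and> 0 \<le> snd (cmp d w n)"
  using c_nonneg dt_pos by (induction n) (auto simp: less_imp_le)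

lemma cmp_le:
  assumes "0 \<le> d" "0 \<le> w"
  shows "fst (cmp d w n) \<le> (d + w) * exp ((1 + c) * clock n)"
proof -
  have "w \<le> (1 + c) * (d + w)" using assms c_nonneg by (simp add: algebra_simps)
  then show ?thesis
    using second_order_growth[of n dt c "d + w" "\<lambda>n. fst (cmp d w n)" "\<lambda>n. snd (cmp d w n)" n]
      assms c_nonneg dt_pos dt_le_1
    by (simp add: clock_def less_imp_le)
qed

text \<open>The induction runs over all ordered pairs of labels at distance at most d, because the
  inner pair from \<open>vel_difference\<close> is again such a pair. The comparison particle starts
  at d with velocity w.\<close>

lemma pos_modulus:
  assumes "y \<in> S" "z \<in> S" "y \<le> z" "z - y \<le> d" "0 \<le> w"
    and v0: "\<And>y z. y \<in> S \<Longrightarrow> z \<in> S \<Longrightarrow> y \<le> z \<Longrightarrow> z - y \<le> d \<Longrightarrow> v0 z - v0 y \<le> w"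
  shows "pos n z - pos n y \<le> (d + w) * exp ((1 + c) * clock n)"
proof -
  have "pos n z - pos n y \<le> fst (cmp d w n) \<and> vel n z - vel n y \<le> snd (cmp d w n)"
    using assms(1-4)
  proof (induction n arbitrary: y z)
    case 0
    then show ?case using v0 by (simp add: pos_0 vel_0)
  next
    case (Suc n)
    have "dt n * (vel n z - vel n y) \<le> dt n * snd (cmp d w n)"
      using Suc.IH[OF Suc.prems] dt_pos by (auto simp: less_imp_le intro!: mult_left_mono)
    then have 1: "pos (Suc n) z - pos (Suc n) y \<le> fst (cmp d w (Suc n))"
      using Suc.IH[OF Suc.prems] by (simp add: pos_Suc algebra_simps)
    obtain y' z' where *: "y' \<in> S" "z' \<in> S" "y \<le> y'" "y' \<le> z'" "z' \<le> z"
      "vel (Suc n) z - vel (Suc n) y \<le>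
         (vel n z' - vel n y') + c * dt n * (pos (Suc n) z - pos (Suc n) y)"
      using vel_difference[OF Suc.prems(1-3)] by metis
    have "vel n z' - vel n y' \<le> snd (cmp d w n)" using Suc.IH[of y' z'] * Suc.prems by auto
    moreover have "c * dt n * (pos (Suc n) z - pos (Suc n) y) \<le> c * dt n * fst (cmp d w (Suc n))"
      using 1 c_nonneg dt_pos by (intro mult_left_mono) (auto simp: less_imp_le)
    ultimately show ?case using 1 * by simp
  qed
  then show ?thesis using cmp_le[of d w n] assms by linarith
qed

lemma cmp_01_pos: "0 < n \<Longrightarrow> 0 < fst (cmp 0 1 n)"
proof (induction n)
  case (Suc n)
  have "1 \<le> snd (cmp 0 1 n)"
  proof (induction n)
    case (Suc n)
    have "0 \<le> c * dt n * fst (cmp 0 1 (Suc n))"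
      using cmp_nonneg[of 0 1 "Suc n"] c_nonneg dt_pos[of n] by (intro mult_nonneg_nonneg) auto
    then show ?case using Suc by simp
  qed simp
  then show ?case using cmp_nonneg[of 0 1 n] dt_pos[of n] by (simp add: add_nonneg_pos)
qed simp

text \<open>The ratio of velocity to position of the comparison particle bounds the same ratio for
  the difference of two trajectories. The inequality is multiplied out because that particle starts
  at position 0.\<close>

lemma vel_one_sided:
  assumes "y \<in> S" "z \<in> S" "y \<le> z"
  shows "(vel n z - vel n y) * fst (cmp 0 1 n) \<le> snd (cmp 0 1 n) * (pos n z - pos n y)"
  using assms
proof (induction n arbitrary: y z)
  case 0
  then show ?case by (simp add: pos_0)
next
  case (Suc n)
  let ?q = "fst (cmp 0 1 n)" and ?p = "snd (cmp 0 1 n)"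
  let ?q' = "fst (cmp 0 1 (Suc n))" and ?B = "pos (Suc n) z - pos (Suc n) y"
  have q': "?q' = ?q + dt n * ?p" by simp
  have alg: "u * q \<le> p * B \<Longrightarrow> W * q \<le> (u + k * B) * q \<Longrightarrow> W * q \<le> (p + k * q) * B"
    for u q p B W k :: real by (simp add: algebra_simps)
  have nn: "0 \<le> ?q'" using cmp_nonneg[of 0 1 "Suc n"] by simp
  obtain y' z' where *: "y' \<in> S" "z' \<in> S" "y' \<le> z'"
    "pos (Suc n) y' = pos (Suc n) y" "pos (Suc n) z' = pos (Suc n) z"
    "vel (Suc n) z - vel (Suc n) y \<le> (vel n z' - vel n y') + c * dt n * ?B"
    using vel_difference[OF Suc.prems] by metis
  have B: "?B = (pos n z' - pos n y') + dt n * (vel n z' - vel n y')"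
    using *(4,5) by (simp add: pos_Suc algebra_simps)
  \<comment> \<open>Free motion adds the same term, dt n times ?p times the velocity difference, to
    both sides of the induction hypothesis for the inner pair.\<close>
  have "(vel n z' - vel n y') * ?q' \<le> ?p * ?B"
    using Suc.IH[OF *(1-3)] unfolding B q' by (simp add: algebra_simps)
  moreover have "(vel (Suc n) z - vel (Suc n) y) * ?q' \<le> ((vel n z' - vel n y') + c * dt n * ?B) * ?q'"
    using *(6) nn by (rule mult_right_mono)
  ultimately have "(vel (Suc n) z - vel (Suc n) y) * ?q' \<le> (?p + c * dt n * ?q') * ?B"
    using alg by blast
  then show ?case by simp
qed

text \<open>By \<open>vel_one_sided\<close> the distance grows, relatively, no faster than the
  comparison position, so their quotient decreases from step to step. For l = 0 that quotient makes
  no sense; there the left side is 0 and the right side is nonnegative.\<close>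

lemma pos_contraction:
  assumes "y \<in> S" "z \<in> S" "y \<le> z" "l \<le> n"
  shows "(pos n z - pos n y) * fst (cmp 0 1 l) \<le> (pos l z - pos l y) * fst (cmp 0 1 n)"
  using assms(4)
proof (induction n rule: dec_induct)
  case (step n)
  let ?q = "\<lambda>n. fst (cmp 0 1 n)" and ?B = "\<lambda>n. pos n z - pos n y"
  show ?case
  proof (cases "l = 0")
    case True
    then show ?thesis using cmp_nonneg[of 0 1 "Suc n"] assms(3) by (simp add: pos_0)
  next
    case False
    then have qn: "0 < ?q n" using step by (intro cmp_01_pos) auto
    have ql: "0 \<le> ?q l" and qs: "0 \<le> ?q (Suc n)" using cmp_nonneg[of 0 1 l] cmp_nonneg[of 0 1 "Suc n"] by simp_all
    have "dt n * ((vel n z - vel n y) * ?q n) \<le> dt n * (snd (cmp 0 1 n) * ?B n)"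
      using vel_one_sided[OF assms(1-3)] dt_pos[of n] by (intro mult_left_mono) auto
    then have 1: "?B (Suc n) * ?q n \<le> ?B n * ?q (Suc n)"
      by (simp add: pos_Suc algebra_simps)
    have "?q n * (?B (Suc n) * ?q l) = (?B (Suc n) * ?q n) * ?q l" by (simp only: mult_ac)
    also have "\<dots> \<le> (?B n * ?q (Suc n)) * ?q l" using 1 ql by (rule mult_right_mono)
    also have "\<dots> = (?B n * ?q l) * ?q (Suc n)" by (simp only: mult_ac)
    also have "\<dots> \<le> (?B l * ?q n) * ?q (Suc n)" using step(3) qs by (rule mult_right_mono)
    also have "\<dots> = ?q n * (?B l * ?q (Suc n))" by (simp only: mult_ac)
    finally show ?thesis using qn by simp
  qed
qed simp

section \<open>Convergence of the comparison particle to the hyperbolic sine\<close>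

text \<open>Local truncation errors of the time stepping on the exact solution sinh (\<kappa> t) /
  \<kappa> of x'' = \<kappa>^2 x and its velocity cosh (\<kappa> t). Each is one use of the mean
  value theorem followed by a Lipschitz bound over a time of at most \<tau>. The second error is
  measured at the updated position, as in the scheme.\<close>

lemma sinh_step:
  fixes \<kappa> t \<tau> T :: real
  assumes "0 < \<kappa>" "0 \<le> t" "0 \<le> \<tau>" "t + \<tau> \<le> T"
  shows "\<bar>sinh (\<kappa> * (t + \<tau>)) / \<kappa> - sinh (\<kappa> * t) / \<kappa> - \<tau> * cosh (\<kappa> * t)\<bar> \<le> \<tau> * (\<tau> * (\<kappa> * sinh (\<kappa> * T)))"
    and "\<bar>cosh (\<kappa> * (t + \<tau>)) - cosh (\<kappa> * t) - \<kappa>\<^sup>2 * \<tau> * (sinh (\<kappa> * (t + \<tau>)) / \<kappa>)\<bar> \<le> \<kappa>\<^sup>2 * \<tau> * (\<tau> * cosh (\<kappa> * T))"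
proof -
  have ds: "((\<lambda>r. sinh (\<kappa> * r) / \<kappa>) has_real_derivative cosh (\<kappa> * r)) (at r)" for r
    using assms by (auto intro!: derivative_eq_intros)
  have dc: "((\<lambda>r. cosh (\<kappa> * r)) has_real_derivative \<kappa> * sinh (\<kappa> * r)) (at r)" for r
    by (auto intro!: derivative_eq_intros)
  have sm: "sinh (\<kappa> * x) \<le> sinh (\<kappa> * y)" if "x \<le> y" for x y using that assms by simp
  have sn: "0 \<le> sinh (\<kappa> * x)" if "0 \<le> x" for x using that assms by simp
  have cm: "cosh (\<kappa> * x) \<le> cosh (\<kappa> * y)" if "0 \<le> x" "x \<le> y" for x y
    using that assms cosh_real_nonneg_le_iff[of "\<kappa> * x" "\<kappa> * y"] by simp
  have lip_c: "\<bar>cosh (\<kappa> * y) - cosh (\<kappa> * x)\<bar> \<le> \<tau> * (\<kappa> * sinh (\<kappa> * T))" if xy: "0 \<le> x" "x \<le> y" "y \<le> x + \<tau>" "y \<le> T" for x y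
  proof (cases "x = y")
    case True
    then show ?thesis using assms sn[of T] by simp
  next
    case False
    then obtain r where r: "x < r" "r < y" "cosh (\<kappa> * y) - cosh (\<kappa> * x) = (y - x) * (\<kappa> * sinh (\<kappa> * r))"
      using MVT2[of x y "\<lambda>r. cosh (\<kappa> * r)" "\<lambda>r. \<kappa> * sinh (\<kappa> * r)"] dc xy by auto
    have "(y - x) * (\<kappa> * sinh (\<kappa> * r)) \<le> \<tau> * (\<kappa> * sinh (\<kappa> * T))"
      using r xy assms sm[of r T] sn[of r] by (intro mult_mono mult_left_mono mult_nonneg_nonneg) auto
    moreover have "0 \<le> (y - x) * (\<kappa> * sinh (\<kappa> * r))"
      using r xy assms sn[of r] by (intro mult_nonneg_nonneg) auto
    ultimately show ?thesis using r(3) by linarith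
  qed
  have lip_s: "\<bar>sinh (\<kappa> * y) / \<kappa> - sinh (\<kappa> * x) / \<kappa>\<bar> \<le> \<tau> * cosh (\<kappa> * T)" if xy: "0 \<le> x" "x \<le> y" "y \<le> x + \<tau>" "y \<le> T" for x y
  proof (cases "x = y")
    case True
    then show ?thesis using assms by (simp add: cosh_real_nonneg)
  next
    case False
    then obtain r where r: "x < r" "r < y" "sinh (\<kappa> * y) / \<kappa> - sinh (\<kappa> * x) / \<kappa> = (y - x) * cosh (\<kappa> * r)"
      using MVT2[of x y "\<lambda>r. sinh (\<kappa> * r) / \<kappa>" "\<lambda>r. cosh (\<kappa> * r)"] ds xy by auto
    have "(y - x) * cosh (\<kappa> * r) \<le> \<tau> * cosh (\<kappa> * T)"
      using r xy assms cm[of r T] by (intro mult_mono) (auto simp: cosh_real_nonneg)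
    moreover have "0 \<le> (y - x) * cosh (\<kappa> * r)"
      using r xy by (intro mult_nonneg_nonneg) (auto simp: cosh_real_nonneg)
    ultimately show ?thesis using r(3) by linarith
  qed
  show "\<bar>sinh (\<kappa> * (t + \<tau>)) / \<kappa> - sinh (\<kappa> * t) / \<kappa> - \<tau> * cosh (\<kappa> * t)\<bar> \<le> \<tau> * (\<tau> * (\<kappa> * sinh (\<kappa> * T)))"
  proof (cases "\<tau> = 0")
    case False
    then obtain r where r: "t < r" "r < t + \<tau>" "sinh (\<kappa> * (t + \<tau>)) / \<kappa> - sinh (\<kappa> * t) / \<kappa> = \<tau> * cosh (\<kappa> * r)"
      using MVT2[of t "t + \<tau>" "\<lambda>r. sinh (\<kappa> * r) / \<kappa>" "\<lambda>r. cosh (\<kappa> * r)"] ds assms by auto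
    have "\<tau> * \<bar>cosh (\<kappa> * r) - cosh (\<kappa> * t)\<bar> \<le> \<tau> * (\<tau> * (\<kappa> * sinh (\<kappa> * T)))"
      using r assms by (intro mult_left_mono lip_c) auto
    then show ?thesis unfolding r(3) right_diff_distrib[symmetric] abs_mult abs_of_nonneg[OF assms(3)] .
  qed simp
  show "\<bar>cosh (\<kappa> * (t + \<tau>)) - cosh (\<kappa> * t) - \<kappa>\<^sup>2 * \<tau> * (sinh (\<kappa> * (t + \<tau>)) / \<kappa>)\<bar> \<le> \<kappa>\<^sup>2 * \<tau> * (\<tau> * cosh (\<kappa> * T))"
  proof (cases "\<tau> = 0")
    case False
    then obtain r where r: "t < r" "r < t + \<tau>" "cosh (\<kappa> * (t + \<tau>)) - cosh (\<kappa> * t) = \<tau> * (\<kappa> * sinh (\<kappa> * r))"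
      using MVT2[of t "t + \<tau>" "\<lambda>r. cosh (\<kappa> * r)" "\<lambda>r. \<kappa> * sinh (\<kappa> * r)"] dc assms by auto
    have e: "\<tau> * (\<kappa> * sinh (\<kappa> * r)) = \<kappa>\<^sup>2 * \<tau> * (sinh (\<kappa> * r) / \<kappa>)"
      using assms by (simp add: power2_eq_square)
    have "\<kappa>\<^sup>2 * \<tau> * \<bar>sinh (\<kappa> * (t + \<tau>)) / \<kappa> - sinh (\<kappa> * r) / \<kappa>\<bar> \<le> \<kappa>\<^sup>2 * \<tau> * (\<tau> * cosh (\<kappa> * T))"
      using r assms by (intro mult_left_mono lip_s) auto
    moreover have "\<bar>\<kappa>\<^sup>2 * \<tau> * (sinh (\<kappa> * r) / \<kappa>) - \<kappa>\<^sup>2 * \<tau> * (sinh (\<kappa> * (t + \<tau>)) / \<kappa>)\<bar> =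
      \<kappa>\<^sup>2 * \<tau> * \<bar>sinh (\<kappa> * (t + \<tau>)) / \<kappa> - sinh (\<kappa> * r) / \<kappa>\<bar>"
      unfolding right_diff_distrib[symmetric] abs_mult using assms by (simp add: abs_minus_commute)
    ultimately show ?thesis unfolding r(3) e by simp
  qed simp
qed

lemma cmp_error:
  assumes "clock N \<le> T"
  shows "\<bar>fst (cmp 0 1 N) - sinh (sqrt c * clock N) / sqrt c\<bar> \<le>
     h * (sqrt c * sinh (sqrt c * T) + cosh (sqrt c * T)) * exp ((1 + c) * clock N)"
proof -
  define \<kappa> where "\<kappa> = sqrt c"
  have \<kappa>: "0 < \<kappa>" "\<kappa>\<^sup>2 = c" using c_pos by (simp_all add: \<kappa>_def)
  define M where "M = h * (\<kappa> * sinh (\<kappa> * T) + cosh (\<kappa> * T))"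
  have T: "0 \<le> T" using clock_mono[of 0 N] assms by (simp add: clock_0)
  have sT: "0 \<le> sinh (\<kappa> * T)" using \<kappa> T by simp
  have M0: "0 \<le> M" unfolding M_def using h_pos sT \<kappa>
    by (intro mult_nonneg_nonneg add_nonneg_nonneg) (auto simp: cosh_real_nonneg)
  \<comment> \<open>Adding M to both errors absorbs the truncation errors: they are at most dt M and
    c dt M, which is what dt b and c dt a gain by the shift. So \<open>second_order_growth\<close>
    applies although it has no source term.\<close>
  define a where "a n = \<bar>fst (cmp 0 1 n) - sinh (\<kappa> * clock n) / \<kappa>\<bar> + M" for n
  define b where "b n = \<bar>snd (cmp 0 1 n) - cosh (\<kappa> * clock n)\<bar> + M" for n
  have step: "a (Suc n) \<le> a n + dt n * b n \<and> b (Suc n) \<le> b n + c * dt n * a (Suc n)" if n: "n < N" for n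
  proof -
    have le: "clock n + dt n \<le> T" using n assms clock_mono[of "Suc n" N] by (simp add: clock_Suc)
    have t0: "0 \<le> clock n" using clock_mono[of 0 n] by (simp add: clock_0)
    note S = sinh_step[OF \<kappa>(1) t0 less_imp_le[OF dt_pos[of n]] le, unfolded \<kappa>(2), folded clock_Suc]
    have "dt n * (dt n * (\<kappa> * sinh (\<kappa> * T))) \<le> dt n * M"
      unfolding M_def using sT \<kappa> dt_pos[of n] dt_le[of n] h_pos
      by (intro mult_left_mono mult_mono) (auto simp: cosh_real_nonneg)
    moreover have "dt n * \<bar>snd (cmp 0 1 n) - cosh (\<kappa> * clock n)\<bar> =
       \<bar>dt n * snd (cmp 0 1 n) - dt n * cosh (\<kappa> * clock n)\<bar>"
      unfolding right_diff_distrib[symmetric] abs_mult using dt_pos[of n] by simp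
    ultimately have A: "a (Suc n) \<le> a n + dt n * b n"
      using S(1) by (simp add: a_def b_def distrib_left)
    let ?q = "fst (cmp 0 1 (Suc n))"
    have "c * dt n * (dt n * cosh (\<kappa> * T)) \<le> c * dt n * M"
      unfolding M_def using sT \<kappa> dt_pos[of n] dt_le[of n] h_pos c_nonneg
      by (intro mult_left_mono mult_mono) (auto simp: cosh_real_nonneg)
    moreover have "c * dt n * \<bar>?q - sinh (\<kappa> * clock (Suc n)) / \<kappa>\<bar> =
       \<bar>c * dt n * ?q - c * dt n * (sinh (\<kappa> * clock (Suc n)) / \<kappa>)\<bar>"
      unfolding right_diff_distrib[symmetric] abs_mult using dt_pos[of n] c_pos by simp
    moreover have "snd (cmp 0 1 (Suc n)) = snd (cmp 0 1 n) + c * dt n * ?q" by simp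
    ultimately have B: "b (Suc n) \<le> b n + c * dt n * a (Suc n)"
      using S(2) unfolding a_def b_def distrib_left by linarith
    show ?thesis using A B by simp
  qed
  have "a N \<le> M * exp ((1 + c) * clock N)"
    using second_order_growth[of N dt c M a b N] step dt_pos dt_le_1 M0 c_nonneg
    by (auto simp: clock_def less_imp_le a_def[of 0] b_def[of 0] distrib_right)
  then show ?thesis using M0 by (simp add: a_def M_def \<kappa>_def)
qed


section \<open>Bounds on second moments and kinetic energy\<close>

lemma wnorm_force:
  assumes "0 \<le> K" "\<And>x. \<bar>f x\<bar> \<le> K * (1 + \<bar>x\<bar>)"
  shows "wnorm (force X) \<le> 2 * K * (1 + wnorm X)"
proof -
  have "\<bar>force X z\<bar> \<le> K * (1 + wnorm X) + K * \<bar>X z\<bar>" for z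
  proof -
    have "\<bar>force X z\<bar> \<le> (\<Sum>w\<in>S. \<bar>m w * f (X z - X w)\<bar>)"
      unfolding force_def abs_minus_cancel by (rule sum_abs)
    also have "\<dots> \<le> (\<Sum>w\<in>S. m w * (K * (1 + \<bar>X z\<bar>)) + K * (m w * \<bar>X w\<bar>))"
    proof (rule sum_mono)
      fix w assume "w \<in> S"
      then have m: "0 \<le> m w" using m_pos[of w] by simp
      have "\<bar>f (X z - X w)\<bar> \<le> K * (1 + \<bar>X z - X w\<bar>)" using assms by blast
      also have "\<dots> \<le> K * (1 + \<bar>X z\<bar> + \<bar>X w\<bar>)" using assms(1) by (intro mult_left_mono) auto
      finally have "m w * \<bar>f (X z - X w)\<bar> \<le> m w * (K * (1 + \<bar>X z\<bar> + \<bar>X w\<bar>))"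
        using m by (rule mult_left_mono)
      then show "\<bar>m w * f (X z - X w)\<bar> \<le> m w * (K * (1 + \<bar>X z\<bar>)) + K * (m w * \<bar>X w\<bar>)"
        using m by (simp add: abs_mult algebra_simps)
    qed
    also have "\<dots> = K * (1 + \<bar>X z\<bar>) + K * (\<Sum>w\<in>S. m w * \<bar>X w\<bar>)"
      by (simp add: sum.distrib sum_distrib_right[symmetric] sum_distrib_left[symmetric] m_sum)
    also have "\<dots> \<le> K * (1 + \<bar>X z\<bar>) + K * wnorm X"
      using assms(1) by (intro add_left_mono mult_left_mono wsum_abs_le)
    finally show ?thesis by (simp add: algebra_simps)
  qed
  then have "wnorm (force X) \<le> wnorm (\<lambda>z. K * (1 + wnorm X) + K * \<bar>X z\<bar>)"
    using assms(1) wnorm_nonneg by (intro wnorm_mono) auto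
  also have "\<dots> \<le> wnorm (\<lambda>z. K * (1 + wnorm X)) + wnorm (\<lambda>z. K * \<bar>X z\<bar>)"
    by (rule wnorm_triangle)
  also have "\<dots> \<le> K * (1 + wnorm X) + K * wnorm X"
    using assms(1) wnorm_nonneg[of X] wnorm_mono[of "\<lambda>z. \<bar>X z\<bar>" X]
    by (auto simp: wnorm_const wnorm_scale abs_mult intro!: add_mono mult_left_mono)
  also have "\<dots> \<le> 2 * K * (1 + wnorm X)" using assms(1) by (simp add: algebra_simps)
  finally show ?thesis .
qed

text \<open>The bound of \<open>second_order_growth\<close> with 2 K in place of c; the summand 1 is
  there because the force is controlled by 1 plus the norm of the position.\<close>

definition energy_bound :: "real \<Rightarrow> real \<Rightarrow> real" where
  "energy_bound K t = (1 + wnorm (\<lambda>z. z) + wnorm v0) * exp ((1 + 2 * K) * t)"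

lemma wnorm_bounds:
  assumes "0 \<le> K" "\<And>x. \<bar>f x\<bar> \<le> K * (1 + \<bar>x\<bar>)"
  shows "wnorm (pos n) \<le> energy_bound K (clock n)"
    and "wnorm (vel n) \<le> (1 + 2 * K) * energy_bound K (clock n)"
proof -
  define a b where "a n = 1 + wnorm (pos n)" and "b n = wnorm (vel n)" for n
  have a: "a (Suc n) \<le> a n + dt n * b n" for n
  proof -
    have "wnorm (pos (Suc n)) \<le> wnorm (pos n) + wnorm (\<lambda>z. dt n * vel n z)"
      using wnorm_triangle[of "pos n" "\<lambda>z. dt n * vel n z"] by (simp add: pos_Suc[abs_def])
    then show ?thesis using dt_pos[of n] by (simp add: a_def b_def wnorm_scale)
  qed
  have b: "b (Suc n) \<le> b n + 2 * K * dt n * a (Suc n)" for n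
  proof -
    have "wnorm (vel (Suc n)) \<le> wnorm (avg (pos (Suc n)) (vel n)) + wnorm (\<lambda>z. dt n * force (pos (Suc n)) z)"
      using wnorm_triangle[of "avg (pos (Suc n)) (vel n)"] by (simp add: vel_Suc[abs_def])
    also have "\<dots> \<le> wnorm (vel n) + dt n * (2 * K * (1 + wnorm (pos (Suc n))))"
      using dt_pos[of n] wnorm_force[OF assms, of "pos (Suc n)"]
      by (auto simp: wnorm_scale less_imp_le intro!: add_mono wnorm_avg)
    finally show ?thesis by (simp add: a_def b_def algebra_simps)
  qed
  define M where "M = 1 + wnorm (\<lambda>z. z) + wnorm v0"
  have eq: "pos 0 = (\<lambda>z. z)" "vel 0 = v0" by (simp_all add: pos_0 vel_0 fun_eq_iff)
  have M: "0 \<le> M" "a 0 \<le> M" "b 0 \<le> (1 + 2 * K) * M"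
    using wnorm_nonneg[of "\<lambda>z. z"] wnorm_nonneg[of v0] assms(1)
    by (simp_all add: M_def a_def b_def eq distrib_right add_increasing2)
  have "a n \<le> M * exp ((1 + 2 * K) * clock n) \<and> b n \<le> (1 + 2 * K) * (M * exp ((1 + 2 * K) * clock n))"
    using second_order_growth[of n dt "2 * K" M a b n] a b M dt_pos dt_le_1 assms(1)
    by (simp add: clock_def less_imp_le)
  then show "wnorm (pos n) \<le> energy_bound K (clock n)"
    and "wnorm (vel n) \<le> (1 + 2 * K) * energy_bound K (clock n)"
    by (simp_all add: a_def b_def energy_bound_def M_def)
qed

lemma energy_bound_mono: "0 \<le> K \<Longrightarrow> s \<le> t \<Longrightarrow> energy_bound K s \<le> energy_bound K t"
  unfolding energy_bound_def using wnorm_nonneg[of "\<lambda>z. z"] wnorm_nonneg[of v0]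
  by (intro mult_left_mono iffD2[OF exp_le_cancel_iff]) simp_all

lemma wnorm_increment:
  assumes "0 \<le> K" "\<And>x. \<bar>f x\<bar> \<le> K * (1 + \<bar>x\<bar>)" "l \<le> n"
  shows "wnorm (\<lambda>z. pos n z - pos l z) \<le> (clock n - clock l) * ((1 + 2 * K) * energy_bound K (clock n))"
  using assms(3)
proof (induction n rule: dec_induct)
  case base
  then show ?case by (simp add: wnorm_const)
next
  case (step n)
  have "wnorm (\<lambda>z. pos (Suc n) z - pos l z) \<le> wnorm (\<lambda>z. pos n z - pos l z) + dt n * wnorm (vel n)"
    using wnorm_triangle[of "\<lambda>z. pos n z - pos l z" "\<lambda>z. dt n * vel n z"] dt_pos[of n]
    by (simp add: pos_Suc[abs_def] wnorm_scale algebra_simps)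
  also have "\<dots> \<le> (clock n - clock l) * ((1 + 2 * K) * energy_bound K (clock n)) +
      dt n * ((1 + 2 * K) * energy_bound K (clock n))"
    using wnorm_bounds(2)[OF assms(1,2)] dt_pos[of n] step by (intro add_mono mult_left_mono) auto
  also have "\<dots> = (clock (Suc n) - clock l) * ((1 + 2 * K) * energy_bound K (clock n))"
    by (simp add: clock_Suc algebra_simps)
  also have "\<dots> \<le> (clock (Suc n) - clock l) * ((1 + 2 * K) * energy_bound K (clock (Suc n)))"
    using assms(1) clock_mono[of n "Suc n"] clock_mono[of l "Suc n"] step
    by (intro mult_left_mono energy_bound_mono) auto
  finally show ?case .
qed

section \<open>The clock of the scheme is unbounded\<close>

text \<open>If the number of positions does not drop, the map from old to new positions is
  injective. But a step shorter than h ends at a collision time, where two distinct positions are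
  sent to one.\<close>

lemma dt_or_card: "dt n = h \<or> card (pos (Suc n) ` S) < card (pos n ` S)"
proof (rule disjCI)
  assume "\<not> card (pos (Suc n) ` S) < card (pos n ` S)"
  moreover obtain J where J: "\<And>z. z \<in> S \<Longrightarrow> J (pos n z) = pos (Suc n) z"
    using next_pos_factors[of n] by blast
  moreover have im: "pos (Suc n) ` S = J ` (pos n ` S)" using J by (simp add: image_image)
  ultimately have "card (J ` (pos n ` S)) = card (pos n ` S)"
    using card_image_le[of "pos n ` S" J] finite_S by simp
  then have inj: "inj_on J (pos n ` S)" using finite_S by (intro eq_card_imp_inj_on) auto
  show "dt n = h"
  proof (rule ccontr)
    assume "dt n \<noteq> h"
    moreover have "dt n \<in> insert h ((\<lambda>(y, z). (pos n z - pos n y) / (vel n y - vel n z)) ` colliding (pos n) (vel n))"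
      unfolding dt_def step_def using finite_colliding by (intro Min_in) auto
    ultimately obtain y z where yz: "y \<in> S" "z \<in> S" "pos n y < pos n z" "vel n z < vel n y"
      "dt n = (pos n z - pos n y) / (vel n y - vel n z)" by (auto simp: colliding_def)
    then have "dt n * (vel n y - vel n z) = pos n z - pos n y" by simp
    then have "pos (Suc n) y = pos (Suc n) z" by (simp add: pos_Suc algebra_simps)
    then have "J (pos n y) = J (pos n z)" using J yz by simp
    with inj yz show False by (auto dest: inj_onD)
  qed
qed

text \<open>A step shorter than h loses less than h of time and also, by \<open>dt_or_card\<close>,
  at least one cluster. The lost time is charged to the lost clusters, so collisions cannot
  accumulate at a finite time.\<close>

lemma clock_lower: "h * real n \<le> clock n + h * (real (card S) - real (card (pos n ` S)))"
proof (induction n)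
  case 0
  have "inj_on (pos 0) S" by (simp add: inj_on_def pos_0)
  then show ?case by (simp add: clock_0 card_image)
next
  case (Suc n)
  have *: "h * (real (card (pos (Suc n) ` S)) + 1) \<le> dt n + h * real (card (pos n ` S))"
    if "card (pos (Suc n) ` S) < card (pos n ` S)"
  proof -
    have "h * (real (card (pos (Suc n) ` S)) + 1) \<le> h * real (card (pos n ` S))"
      using that h_pos by (intro mult_left_mono) auto
    then show ?thesis using dt_pos[of n] by simp
  qed
  have "card (pos (Suc n) ` S) \<le> card (pos n ` S)"
  proof -
    obtain J where "\<And>z. z \<in> S \<Longrightarrow> J (pos n z) = pos (Suc n) z"
      using next_pos_factors[of n] by blast
    then have "pos (Suc n) ` S = J ` (pos n ` S)" by (simp add: image_image)
    then show ?thesis using card_image_le[of "pos n ` S"] finite_S by simp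
  qed
  then have "h * (real (card (pos (Suc n) ` S)) + 1) \<le> dt n + h * real (card (pos n ` S))"
  proof (cases "card (pos (Suc n) ` S) < card (pos n ` S)")
    case True
    then show ?thesis by (rule *)
  next
    case False
    then have "dt n = h" using dt_or_card[of n] by blast
    moreover have "h * real (card (pos (Suc n) ` S)) \<le> h * real (card (pos n ` S))"
      using \<open>card (pos (Suc n) ` S) \<le> card (pos n ` S)\<close> h_pos by simp
    ultimately show ?thesis by (simp add: distrib_left)
  qed
  then show ?case using Suc by (simp add: clock_Suc algebra_simps)
qed

lemma clock_unbounded: "\<exists>n. t < clock n"
proof -
  obtain n where n: "t / h + real (card S) < real n" using reals_Archimedean2 by blast
  have "t < h * (real n - real (card S))" using n h_pos by (simp add: field_simps)
  also have "\<dots> \<le> clock n - h * real (card (pos n ` S))" using clock_lower[of n] by (simp add: algebra_simps)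
  also have "\<dots> \<le> clock n" using h_pos by simp
  finally show ?thesis by blast
qed

section \<open>Trajectories in continuous time\<close>

text \<open>For t \<ge> 0 this is the step whose half-open time interval [clock n, clock (Suc n))
  contains t. Trajectories are piecewise constant on these intervals rather than interpolated, so
  that sums over steps are exactly integrals over time.\<close>

definition idx :: "real \<Rightarrow> nat" where "idx t = (LEAST n. t < clock (Suc n))"
definition prev_time :: "real \<Rightarrow> real" where "prev_time t = clock (idx t)"
definition next_time :: "real \<Rightarrow> real" where "next_time t = clock (Suc (idx t))"
definition traj :: "real \<Rightarrow> real \<Rightarrow> real" where "traj t z = pos (idx t) z"

lemma idx_eq:
  assumes "clock n \<le> t" "t < clock (Suc n)"
  shows "idx t = n"
  unfolding idx_def
proof (rule Least_equality, rule assms(2))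
  fix k assume "t < clock (Suc k)"
  then have "\<not> Suc k \<le> n" using clock_mono[of "Suc k" n] assms(1) by auto
  then show "n \<le> k" by simp
qed

lemma idx_clock: "idx (clock n) = n"
  by (rule idx_eq) (auto simp: clock_Suc dt_pos)

lemma idx_bounds:
  assumes "0 \<le> t"
  shows "clock (idx t) \<le> t" "t < clock (Suc (idx t))"
proof -
  obtain n where n: "t < clock n" using clock_unbounded by blast
  then have "t < clock (Suc n)" using clock_mono[of n "Suc n"] by simp
  then show 1: "t < clock (Suc (idx t))" unfolding idx_def by (rule LeastI)
  show "clock (idx t) \<le> t"
  proof (cases "idx t")
    case 0
    then show ?thesis using assms by (simp add: clock_0)
  next
    case (Suc k)
    then have "\<not> t < clock (Suc k)" using not_less_Least[of k "\<lambda>n. t < clock (Suc n)"] by (simp add: idx_def)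
    then show ?thesis using Suc by simp
  qed
qed

lemma idx_mono:
  assumes "0 \<le> s" "s \<le> t"
  shows "idx s \<le> idx t"
  unfolding idx_def[of s] using idx_bounds[of t] assms by (intro Least_le) auto

lemma step_integral:
  fixes F :: "nat \<Rightarrow> real"
  assumes "l \<le> n"
  shows "set_integrable lborel {clock l..<clock n} (\<lambda>u. F (idx u)) \<and>
     (LBINT u:{clock l..<clock n}. F (idx u)) = (\<Sum>j=l..<n. dt j * F j)"
  using assms
proof (induction n rule: dec_induct)
  case base
  then show ?case by (simp add: set_integrable_def set_lebesgue_integral_def)
next
  case (step n)
  let ?B = "{clock n..<clock (Suc n)}"
  have U: "{clock l..<clock (Suc n)} = {clock l..<clock n} \<union> ?B"
    using clock_mono[of l n] clock_mono[of n "Suc n"] step by auto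
  have c: "indicator ?B u * F (idx u) = indicator ?B u * F n" for u
    using idx_eq[of n u] by (auto simp: indicator_def)
  have iB: "set_integrable lborel ?B (\<lambda>u. F (idx u))"
    unfolding set_integrable_def real_scaleR_def c using dt_pos[of n]
    by (intro integrable_mult_left) (simp add: clock_Suc)
  have "(LBINT u:?B. F (idx u)) = dt n * F n"
    unfolding set_lebesgue_integral_def real_scaleR_def c using dt_pos[of n] by (simp add: clock_Suc)
  then show ?case unfolding U using step iB
    by (subst set_integral_Un) (auto intro: set_integrable_Un)
qed

section \<open>Conservation of momentum\<close>

text \<open>The velocity that label z would have if its initial velocity and all later kicks were
  added up without any averaging; the discrete form of the impulse.\<close>

definition acc :: "nat \<Rightarrow> real \<Rightarrow> real" where
  "acc n z = v0 z + (\<Sum>j<n. dt j * force (pos (Suc j)) z)"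

text \<open>The actual velocity is the conditional expectation of \<open>acc\<close> given the
  position. In the induction the new average disappears against a function of the new positions, and
  by stickiness such a function is also one of the old positions.\<close>

lemma momentum:
  assumes "\<And>y z. y \<in> S \<Longrightarrow> z \<in> S \<Longrightarrow> pos n y = pos n z \<Longrightarrow> \<phi> y = \<phi> z"
  shows "(\<Sum>z\<in>S. m z * (vel n z - acc n z) * \<phi> z) = 0"
  using assms
proof (induction n)
  case 0
  show ?case by (simp add: vel_0 acc_def)
next
  case (Suc n)
  let ?X = "pos (Suc n)"
  obtain g where g: "\<And>z. z \<in> S \<Longrightarrow> g (?X z) = \<phi> z"
    using factor_through[of S ?X \<phi>, OF Suc.prems] by blast
  have 1: "(\<Sum>z\<in>S. m z * avg ?X (vel n) z * \<phi> z) = (\<Sum>z\<in>S. m z * vel n z * \<phi> z)"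
  proof -
    have "(\<Sum>z\<in>S. m z * avg ?X (vel n) z * \<phi> z) = (\<Sum>z\<in>S. m z * avg ?X (vel n) z * g (?X z))"
      by (rule sum.cong[OF refl]) (simp add: g)
    also have "\<dots> = (\<Sum>z\<in>S. m z * vel n z * g (?X z))" by (rule sum_avg)
    also have "\<dots> = (\<Sum>z\<in>S. m z * vel n z * \<phi> z)"
      by (rule sum.cong[OF refl]) (simp add: g)
    finally show ?thesis .
  qed
  have "vel (Suc n) z - acc (Suc n) z = avg ?X (vel n) z - acc n z" for z
    by (simp add: vel_Suc acc_def)
  then have "(\<Sum>z\<in>S. m z * (vel (Suc n) z - acc (Suc n) z) * \<phi> z) =
    (\<Sum>z\<in>S. m z * avg ?X (vel n) z * \<phi> z - m z * acc n z * \<phi> z)"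
    by (simp only: left_diff_distrib right_diff_distrib)
  also have "\<dots> = (\<Sum>z\<in>S. m z * (vel n z - acc n z) * \<phi> z)"
    by (simp only: sum_subtractf 1 left_diff_distrib right_diff_distrib)
  also have "\<dots> = 0"
  proof (rule Suc.IH)
    fix y z assume yz: "y \<in> S" "z \<in> S" "pos n y = pos n z"
    have "?X y = ?X z" by (rule pos_sticky[OF _ yz]) simp
    then show "\<phi> y = \<phi> z" by (rule Suc.prems[OF yz(1,2)])
  qed
  finally show ?case .
qed

text \<open>A function of the last positions is compatible with the clusters of every earlier step,
  so \<open>momentum\<close> applies to each summand with the same \<phi>.\<close>

lemma momentum_increment:
  assumes "l \<le> n" "\<And>y z. y \<in> S \<Longrightarrow> z \<in> S \<Longrightarrow> pos n y = pos n z \<Longrightarrow> \<phi> y = \<phi> z"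
  shows "(\<Sum>z\<in>S. m z * (pos n z - pos l z - (\<Sum>j=l..<n. dt j * acc j z)) * \<phi> z) = 0"
  using assms
proof (induction n rule: dec_induct)
  case base
  show ?case by simp
next
  case (step n)
  have comp: "\<phi> y = \<phi> z" if "y \<in> S" "z \<in> S" "pos n y = pos n z" for y z
    by (rule step.prems[OF that(1,2)]) (rule pos_sticky[OF _ that], simp)
  have "(\<Sum>z\<in>S. m z * (pos (Suc n) z - pos l z - (\<Sum>j=l..<Suc n. dt j * acc j z)) * \<phi> z) =
    (\<Sum>z\<in>S. m z * (pos n z - pos l z - (\<Sum>j=l..<n. dt j * acc j z)) * \<phi> z) +
    dt n * (\<Sum>z\<in>S. m z * (vel n z - acc n z) * \<phi> z)"
  proof -
    have "m z * (pos (Suc n) z - pos l z - (\<Sum>j=l..<Suc n. dt j * acc j z)) * \<phi> z =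
      m z * (pos n z - pos l z - (\<Sum>j=l..<n. dt j * acc j z)) * \<phi> z + dt n * (m z * (vel n z - acc n z) * \<phi> z)" for z
      unfolding pos_Suc sum.atLeastLessThan_Suc[OF step(1)] by (simp only: algebra_simps)
    then show ?thesis by (simp only: sum.distrib sum_distrib_left)
  qed
  also have "(\<Sum>z\<in>S. m z * (pos n z - pos l z - (\<Sum>j=l..<n. dt j * acc j z)) * \<phi> z) = 0"
    by (rule step.IH) (rule comp)
  also have "(\<Sum>z\<in>S. m z * (vel n z - acc n z) * \<phi> z) = 0"
    by (rule momentum) (rule comp)
  also have "0 + dt n * 0 = (0::real)" by simp
  finally show ?case .
qed

section \<open>The scheme's estimates in terms of real times\<close>

lemma prev_next_time:
  assumes "0 \<le> t"
  shows "prev_time t \<le> t" "t < next_time t" "next_time t \<le> prev_time t + h" "0 \<le> prev_time t"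
  using idx_bounds[OF assms] dt_le[of "idx t"] clock_mono[of 0 "idx t"]
  by (simp_all add: prev_time_def next_time_def clock_Suc clock_0)

lemma prev_time_mono: "0 \<le> s \<Longrightarrow> s \<le> t \<Longrightarrow> prev_time s \<le> prev_time t"
  by (simp add: prev_time_def idx_mono clock_mono)

lemma traj_0: "traj 0 z = z"
  using idx_clock[of 0] by (simp add: traj_def clock_0 pos_0)

lemma traj_mono: "y \<in> S \<Longrightarrow> z \<in> S \<Longrightarrow> y \<le> z \<Longrightarrow> traj t y \<le> traj t z"
  by (simp add: traj_def pos_mono)

lemma traj_modulus:
  assumes "0 \<le> t" "y \<in> S" "z \<in> S" "y \<le> z" "z - y \<le> d" "0 \<le> w"
    and "\<And>y z. y \<in> S \<Longrightarrow> z \<in> S \<Longrightarrow> y \<le> z \<Longrightarrow> z - y \<le> d \<Longrightarrow> v0 z - v0 y \<le> w"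
  shows "traj t z - traj t y \<le> (d + w) * exp ((1 + c) * t)"
proof -
  have "traj t z - traj t y \<le> (d + w) * exp ((1 + c) * prev_time t)"
    unfolding traj_def prev_time_def by (rule pos_modulus[OF assms(2-6)]) (rule assms(7))
  also have "\<dots> \<le> (d + w) * exp ((1 + c) * t)"
    using prev_next_time(1)[OF assms(1)] assms(4-6) c_nonneg
    by (intro mult_left_mono) (simp_all add: mult_left_mono)
  finally show ?thesis .
qed

text \<open>The discrete counterpart of sinh (sqrt c t) / sqrt c.\<close>

definition spread :: "real \<Rightarrow> real" where "spread t = fst (cmp 0 1 (idx t))"

lemma traj_contraction:
  assumes "0 \<le> s" "s \<le> t" "y \<in> S" "z \<in> S" "y \<le> z"
  shows "(traj t z - traj t y) * spread s \<le> (traj s z - traj s y) * spread t"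
  unfolding traj_def spread_def by (rule pos_contraction[OF assms(3-5) idx_mono[OF assms(1,2)]])

lemma spread_error:
  assumes "0 \<le> t"
  shows "\<bar>spread t - sinh (sqrt c * prev_time t) / sqrt c\<bar> \<le>
     h * (sqrt c * sinh (sqrt c * t) + cosh (sqrt c * t)) * exp ((1 + c) * t)"
proof -
  have "\<bar>spread t - sinh (sqrt c * prev_time t) / sqrt c\<bar> \<le>
     h * (sqrt c * sinh (sqrt c * t) + cosh (sqrt c * t)) * exp ((1 + c) * prev_time t)"
    unfolding spread_def prev_time_def
    by (rule cmp_error) (rule prev_next_time(1)[OF assms, unfolded prev_time_def])
  also have "\<dots> \<le> h * (sqrt c * sinh (sqrt c * t) + cosh (sqrt c * t)) * exp ((1 + c) * t)"
  proof (rule mult_left_mono)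
    show "exp ((1 + c) * prev_time t) \<le> exp ((1 + c) * t)"
      using prev_next_time(1)[OF assms] c_nonneg
      by (intro iffD2[OF exp_le_cancel_iff] mult_left_mono) simp_all
    have "0 \<le> sinh (sqrt c * t)" using assms c_pos by simp
    then show "0 \<le> h * (sqrt c * sinh (sqrt c * t) + cosh (sqrt c * t))"
      using h_pos c_pos cosh_real_nonneg[of "sqrt c * t"] by simp
  qed
  finally show ?thesis .
qed

lemma traj_bounds:
  assumes "0 \<le> K" "\<And>x. \<bar>f x\<bar> \<le> K * (1 + \<bar>x\<bar>)" "0 \<le> s" "s \<le> t"
  shows "(\<Sum>z\<in>S. m z * (traj t z)\<^sup>2) \<le> (energy_bound K t)\<^sup>2"
    and "(\<Sum>z\<in>S. m z * (traj t z - traj s z)\<^sup>2) \<le> ((t - s + h) * ((1 + 2 * K) * energy_bound K t))\<^sup>2"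
proof -
  have t: "0 \<le> t" using assms by simp
  have e: "energy_bound K (clock (idx t)) \<le> energy_bound K t"
    using prev_next_time[OF t] assms(1) by (intro energy_bound_mono) (auto simp: prev_time_def)
  have "wnorm (pos (idx t)) \<le> energy_bound K t"
    using wnorm_bounds(1)[OF assms(1,2), of "idx t"] e by simp
  then have "(wnorm (pos (idx t)))\<^sup>2 \<le> (energy_bound K t)\<^sup>2"
    by (intro power_mono wnorm_nonneg)
  then show "(\<Sum>z\<in>S. m z * (traj t z)\<^sup>2) \<le> (energy_bound K t)\<^sup>2"
    by (simp add: wnorm_sq traj_def)
  have e0: "0 \<le> energy_bound K t" using e wnorm_bounds(1)[OF assms(1,2), of "idx t"] wnorm_nonneg[of "pos (idx t)"] by linarith
  have "wnorm (\<lambda>z. pos (idx t) z - pos (idx s) z) \<le>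
      (clock (idx t) - clock (idx s)) * ((1 + 2 * K) * energy_bound K (clock (idx t)))"
    by (intro wnorm_increment assms(1,2) idx_mono[OF assms(3,4)])
  also have "\<dots> \<le> (clock (idx t) - clock (idx s)) * ((1 + 2 * K) * energy_bound K t)"
    using e clock_mono[OF idx_mono[OF assms(3,4)]] \<open>0 \<le> K\<close> by (intro mult_left_mono) simp_all
  also have "\<dots> \<le> (t - s + h) * ((1 + 2 * K) * energy_bound K t)"
    using prev_next_time(1)[OF t] prev_next_time(2,3)[OF assms(3)] e0 assms(1)
    by (intro mult_right_mono) (auto simp: prev_time_def)
  finally have "(wnorm (\<lambda>z. pos (idx t) z - pos (idx s) z))\<^sup>2 \<le> ((t - s + h) * ((1 + 2 * K) * energy_bound K t))\<^sup>2"
    by (intro power_mono wnorm_nonneg)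
  then show "(\<Sum>z\<in>S. m z * (traj t z - traj s z)\<^sup>2) \<le> ((t - s + h) * ((1 + 2 * K) * energy_bound K t))\<^sup>2"
    by (simp add: wnorm_sq traj_def)
qed

text \<open>The kick of a step uses the positions after its move, hence \<open>next_time\<close>;
  the integral ends at \<open>prev_time u\<close> so that only completed steps count.\<close>

definition accel :: "real \<Rightarrow> real \<Rightarrow> real" where
  "accel u z = v0 z + (LBINT r:{0..<prev_time u}. force (traj (next_time r)) z)"

lemma accel_eq: "accel u z = acc (idx u) z"
proof -
  have "(LBINT r:{0..<clock (idx u)}. force (traj (next_time r)) z) =
     (\<Sum>j=0..<idx u. dt j * force (pos (Suc j)) z)"
    using step_integral[of 0 "idx u" "\<lambda>j. force (pos (Suc j)) z"]
    by (simp add: traj_def[abs_def] next_time_def idx_clock clock_0)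
  then show ?thesis by (simp add: accel_def acc_def prev_time_def atLeast0LessThan)
qed

lemma accel_integrable:
  "0 \<le> s \<Longrightarrow> s \<le> t \<Longrightarrow> set_integrable lborel {prev_time s..<prev_time t} (\<lambda>u. accel u z)"
  using step_integral[of "idx s" "idx t" "\<lambda>n. acc n z"] idx_mono[of s t]
  by (simp add: accel_eq prev_time_def)

lemma force_integrable:
  "set_integrable lborel {0..<prev_time u} (\<lambda>r. force (traj (next_time r)) z)"
  using step_integral[of 0 "idx u" "\<lambda>j. force (pos (Suc j)) z"]
  by (simp add: traj_def[abs_def] next_time_def idx_clock clock_0 prev_time_def)

lemma traj_momentum:
  assumes "0 \<le> s" "s \<le> t"
  shows "(\<Sum>z\<in>S. m z * (traj t z - traj s z - (LBINT u:{prev_time s..<prev_time t}. accel u z)) * g (traj t z)) = 0"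
proof -
  have "(LBINT u:{prev_time s..<prev_time t}. accel u z) = (\<Sum>j=idx s..<idx t. dt j * acc j z)" for z
    using step_integral[of "idx s" "idx t" "\<lambda>n. acc n z"] idx_mono[OF assms]
    by (simp add: accel_eq prev_time_def)
  then show ?thesis
    using momentum_increment[OF idx_mono[OF assms], of "\<lambda>z. g (traj t z)"]
    by (simp only: traj_def)
qed

end

section \<open>Approximation of the initial data\<close>

text \<open>The values along an enumeration of I lie in a countable product of compact intervals.
  This product is compact and metrizable, hence sequentially compact, which replaces a diagonal
  argument.\<close>

lemma pointwise_convergent_subsequence:
  fixes F :: "nat \<Rightarrow> 'i \<Rightarrow> real"
  assumes I: "countable I" and bd: "\<And>i. i \<in> I \<Longrightarrow> \<exists>B. \<forall>k. \<bar>F k i\<bar> \<le> B"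
  obtains r where "strict_mono r" "\<And>i. i \<in> I \<Longrightarrow> convergent (\<lambda>k. F (r k) i)"
proof (cases "I = {}")
  case True
  then show ?thesis using that[of id] by (auto simp: strict_mono_def)
next
  case False
  define e where "e = from_nat_into I"
  have e: "e n \<in> I" for n using False by (simp add: e_def from_nat_into)
  obtain B where B: "\<And>i k. i \<in> I \<Longrightarrow> \<bar>F k i\<bar> \<le> B i" using bd by metis
  define C where "C = Pi\<^sub>E UNIV (\<lambda>n. {- B (e n)..B (e n)})"
  have "compact C"
    unfolding C_def compactin_euclidean_iff[symmetric] euclidean_product_topology[symmetric] compactin_PiE
    by (simp add: compactin_euclidean_iff)
  then have "seq_compact C" by (simp add: compact_eq_seq_compact_metric)
  moreover have "\<forall>k. (\<lambda>n. F k (e n)) \<in> C"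
    using B[OF e] by (auto simp: C_def abs_le_iff minus_le_iff)
  ultimately obtain l r where r: "strict_mono r" "((\<lambda>k. (\<lambda>n. F k (e n))) \<circ> r) \<longlonglongrightarrow> l"
    by (rule seq_compactE) auto
  have "convergent (\<lambda>k. F (r k) i)" if i: "i \<in> I" for i
  proof -
    obtain n where n: "i = e n" using from_nat_into_surj[OF I i] by (auto simp: e_def)
    have "(\<lambda>k. (\<lambda>x. x n) (((\<lambda>k. (\<lambda>n. F k (e n))) \<circ> r) k)) \<longlonglongrightarrow> l n"
      by (rule continuous_on_tendsto_compose[OF continuous_on_product_coordinates r(2)]) auto
    then show ?thesis unfolding n comp_def by (rule convergentI)
  qed
  with r(1) show ?thesis by (rule that)
qed

text \<open>The segment between x and y is cut into n equal pieces of length at most \<delta>, each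
  costing at most 1. At most 1 + |x - y| / \<delta> pieces are needed, which yields the constant 1 +
  1 / \<delta>.\<close>

lemma uniformly_continuous_linear_growth:
  fixes v :: "real \<Rightarrow> real"
  assumes uc: "\<And>\<epsilon>. 0 < \<epsilon> \<Longrightarrow> \<exists>\<delta>>0. \<forall>x y. \<bar>x - y\<bar> \<le> \<delta> \<longrightarrow> \<bar>v x - v y\<bar> \<le> \<epsilon>"
  obtains L where "0 \<le> L" "\<And>x y. \<bar>v x - v y\<bar> \<le> L * (1 + \<bar>x - y\<bar>)"
proof -
  obtain \<delta> where \<delta>: "0 < \<delta>" "\<And>x y. \<bar>x - y\<bar> \<le> \<delta> \<Longrightarrow> \<bar>v x - v y\<bar> \<le> 1"
    using uc[of 1] by auto
  have *: "\<bar>v x - v y\<bar> \<le> real n" if "\<bar>x - y\<bar> \<le> real n * \<delta>" "0 < n" for n :: nat and x y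
    using that
  proof (induction n arbitrary: x)
    case (Suc n)
    show ?case
    proof (cases "n = 0")
      case True
      then show ?thesis using Suc \<delta>(2)[of x y] by simp
    next
      case False
      define x' where "x' = y + (x - y) * (real n / real (Suc n))"
      have 1: "x' - y = (x - y) * (real n / real (Suc n))" by (simp add: x'_def)
      have 2: "x - x' = (x - y) * (1 / real (Suc n))" by (simp add: x'_def field_simps)
      have "\<bar>x' - y\<bar> \<le> real n * \<delta>"
        using mult_right_mono[OF Suc.prems(1), of "real n / real (Suc n)"] unfolding 1 abs_mult
        by (simp add: mult.commute)
      moreover have "\<bar>x - x'\<bar> \<le> \<delta>"
        using mult_right_mono[OF Suc.prems(1), of "1 / real (Suc n)"] unfolding 2 abs_mult by simp
      ultimately show ?thesis using Suc.IH[of x'] \<delta>(2)[of x x'] False by simp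
    qed
  qed simp
  show ?thesis
  proof (rule that[of "1 + 1 / \<delta>"])
    show "0 \<le> 1 + 1 / \<delta>" using \<delta> by simp
    fix x y
    define n where "n = Suc (nat \<lfloor>\<bar>x - y\<bar> / \<delta>\<rfloor>)"
    have n: "\<bar>x - y\<bar> / \<delta> \<le> real n" "real n \<le> 1 + \<bar>x - y\<bar> / \<delta>"
      using \<delta>(1) unfolding n_def by (simp_all add: le_of_int_ceiling) linarith+
    have "\<bar>v x - v y\<bar> \<le> real n" using n(1) \<delta>(1) by (intro *) (simp_all add: field_simps n_def)
    also have "\<dots> \<le> (1 + 1 / \<delta>) * (1 + \<bar>x - y\<bar>)"
    proof -
      have "0 \<le> 1 / \<delta>" using \<delta>(1) by simp
      then have "0 \<le> 1 / \<delta> + \<bar>x - y\<bar>" by (intro add_nonneg_nonneg) auto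
      moreover have "(1 + 1 / \<delta>) * (1 + \<bar>x - y\<bar>) = (1 + \<bar>x - y\<bar> / \<delta>) + (1 / \<delta> + \<bar>x - y\<bar>)"
        by (simp add: distrib_left distrib_right)
      ultimately show ?thesis using n(2) by linarith
    qed
    finally show "\<bar>v x - v y\<bar> \<le> (1 + 1 / \<delta>) * (1 + \<bar>x - y\<bar>)" .
  qed
qed

text \<open>The evolution sees the potential through f = W' alone; W itself joins in
  \<open>euler_potential\<close>, for the energy.\<close>

locale euler_data = real_distribution \<rho>0 for \<rho>0 :: "real measure" +
  fixes v0 f :: "real \<Rightarrow> real" and c K :: real
  assumes second_moment: "integrable \<rho>0 (\<lambda>x. x\<^sup>2)"
    and v0_uniform: "\<And>\<epsilon>. 0 < \<epsilon> \<Longrightarrow> \<exists>\<delta>>0. \<forall>x y. \<bar>x - y\<bar> \<le> \<delta> \<longrightarrow> \<bar>v0 x - v0 y\<bar> \<le> \<epsilon>"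
    and f_cont: "continuous_on UNIV f"
    and K_nonneg: "0 \<le> K" and f_growth: "\<And>x. \<bar>f x\<bar> \<le> K * (1 + \<bar>x\<bar>)"
    and c_gt_0: "0 < c" and f_one_sided: "\<And>x y. x \<le> y \<Longrightarrow> f x - f y \<le> c * (y - x)"
begin

lemma prob_UNIV: "prob UNIV = 1"
  using prob_space by simp

lemma v0_cont: "continuous_on UNIV v0"
  unfolding continuous_on_iff
proof (intro ballI allI impI)
  fix x e :: real assume "0 < e"
  then obtain \<delta> where \<delta>: "0 < \<delta>" "\<And>x y. \<bar>x - y\<bar> \<le> \<delta> \<Longrightarrow> \<bar>v0 x - v0 y\<bar> \<le> e / 2"
    using v0_uniform[of "e/2"] by auto
  have "dist (v0 x') (v0 x) < e" if "dist x' x < \<delta>" for x'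
    using \<delta>(2)[of x' x] that \<open>0 < e\<close> by (simp add: dist_real_def)
  then show "\<exists>d>0. \<forall>x'\<in>UNIV. dist x' x < d \<longrightarrow> dist (v0 x') (v0 x) < e"
    using \<delta>(1) by blast
qed

lemma v0_measurable [measurable]: "v0 \<in> borel_measurable borel"
  using v0_cont by (rule borel_measurable_continuous_onI)

lemma f_measurable [measurable]: "f \<in> borel_measurable borel"
  using f_cont by (rule borel_measurable_continuous_onI)

lemma integrable_affine: "integrable \<rho>0 (\<lambda>y. a + b * \<bar>y\<bar>)"
proof -
  have "integrable \<rho>0 (\<lambda>y. 1 + y\<^sup>2)" using second_moment by auto
  then have "integrable \<rho>0 (\<lambda>y. \<bar>y\<bar>)"
  proof (rule Bochner_Integration.integrable_bound)
    have "\<bar>y\<bar> \<le> 1 + y\<^sup>2" for y :: real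
      using zero_le_power2[of "\<bar>y\<bar> - 1"] by (simp add: power2_diff) 
    then show "AE y in \<rho>0. norm \<bar>y\<bar> \<le> norm (1 + y\<^sup>2)" by auto
  qed auto
  then show ?thesis by auto
qed

lemma integrable_affine_sq: "integrable \<rho>0 (\<lambda>y. (a + b * \<bar>y\<bar>)\<^sup>2)"
proof -
  have "integrable \<rho>0 (\<lambda>y. (a\<^sup>2 + 2 * a * b * \<bar>y\<bar>) + b\<^sup>2 * y\<^sup>2)"
    using second_moment integrable_affine by auto
  moreover have "(a\<^sup>2 + 2 * a * b * \<bar>y\<bar>) + b\<^sup>2 * y\<^sup>2 = (a + b * \<bar>y\<bar>)\<^sup>2" for y
    by (simp add: power2_sum power_mult_distrib algebra_simps)
  ultimately show ?thesis by simp
qed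

section \<open>Discretisation of the initial measure\<close>

definition mesh :: "nat \<Rightarrow> real" where "mesh k = 1 / real (Suc k)"

text \<open>Rounding down to the grid of width \<open>mesh k\<close>, truncated to make the range
  finite. Both operations are monotone, so the order of labels is respected.\<close>

definition cell :: "nat \<Rightarrow> real \<Rightarrow> real" where
  "cell k y = max (- real (Suc k)) (min (real (Suc k)) (of_int \<lfloor>y * real (Suc k)\<rfloor> / real (Suc k)))"

definition mass :: "nat \<Rightarrow> real \<Rightarrow> real" where "mass k z = prob {y. cell k y = z}"
definition nodes :: "nat \<Rightarrow> real set" where "nodes k = {z \<in> range (cell k). 0 < mass k z}"
text \<open>The estimates of the scheme hold on nodes, which carry mass by definition. A good label
  lies in a cell of positive mass at every level, so it can be followed through all
  approximations.\<close>

definition good :: "real set" where "good = {y. \<forall>k. cell k y \<in> nodes k}"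

lemma mesh: "0 < mesh k" "mesh k \<le> 1" by (simp_all add: mesh_def)

lemma mesh_tendsto: "mesh \<longlonglongrightarrow> 0"
  unfolding mesh_def[abs_def] using LIMSEQ_inverse_real_of_nat by (simp add: inverse_eq_divide)

lemma cell_measurable [measurable]: "cell k \<in> borel_measurable borel"
  unfolding cell_def[abs_def] by measurable

lemma cell_mono: "y \<le> z \<Longrightarrow> cell k y \<le> cell k z"
  unfolding cell_def by (intro max.mono min.mono divide_right_mono) (auto intro!: floor_mono mult_right_mono)

lemma floor_div: "y - mesh k \<le> of_int \<lfloor>y * real (Suc k)\<rfloor> / real (Suc k)"
  "of_int \<lfloor>y * real (Suc k)\<rfloor> / real (Suc k) \<le> y"
proof -
  have *: "y - 1 / N \<le> of_int \<lfloor>y * N\<rfloor> / N \<and> of_int \<lfloor>y * N\<rfloor> / N \<le> y" if "0 < N" for N :: real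
  proof -
    have "y * N - 1 \<le> of_int \<lfloor>y * N\<rfloor>" "of_int \<lfloor>y * N\<rfloor> \<le> y * N" by linarith+
    then show ?thesis using that by (simp add: pos_le_divide_eq pos_divide_le_eq left_diff_distrib)
  qed
  show "y - mesh k \<le> of_int \<lfloor>y * real (Suc k)\<rfloor> / real (Suc k)"
    "of_int \<lfloor>y * real (Suc k)\<rfloor> / real (Suc k) \<le> y"
    using *[of "real (Suc k)"] unfolding mesh_def by auto
qed

lemma cell_abs_le: "\<bar>cell k y\<bar> \<le> \<bar>y\<bar> + 1"
  using floor_div[of y k] mesh[of k] by (simp add: cell_def max_def min_def abs_if split: if_splits)

lemma cell_near:
  assumes "\<bar>y\<bar> \<le> real (Suc k)"
  shows "\<bar>cell k y - y\<bar> \<le> mesh k"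
proof -
  have *: "- N \<le> of_int \<lfloor>y * N\<rfloor> / N" if "N = real n" "0 < N" "\<bar>y\<bar> \<le> N" for N n
  proof -
    have "- N * N \<le> y * N" using that by (intro mult_right_mono) auto
    then have "of_int (- int (n * n)) \<le> y * N" using that by simp
    then have "- int (n * n) \<le> \<lfloor>y * N\<rfloor>" by (simp only: le_floor_iff)
    then have "real_of_int (- int (n * n)) \<le> real_of_int \<lfloor>y * N\<rfloor>" by (simp only: of_int_le_iff)
    then show ?thesis using that by (simp add: pos_le_divide_eq)
  qed
  have "- real (Suc k) \<le> of_int \<lfloor>y * real (Suc k)\<rfloor> / real (Suc k)"
    by (rule *[OF refl _ assms]) simp
  then have "cell k y = of_int \<lfloor>y * real (Suc k)\<rfloor> / real (Suc k)"
    using floor_div(2)[of y k] assms by (simp add: cell_def)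
  then show ?thesis using floor_div[of y k] mesh[of k] by (simp add: abs_le_iff)
qed

lemma finite_range_cell: "finite (range (cell k))"
proof -
  let ?N = "int (Suc k * Suc k)"
  have "cell k y \<in> insert (real (Suc k)) (insert (- real (Suc k)) ((\<lambda>i. of_int i / real (Suc k)) ` {- ?N..?N}))" for y
  proof -
    let ?i = "\<lfloor>y * real (Suc k)\<rfloor>" and ?q = "of_int \<lfloor>y * real (Suc k)\<rfloor> / real (Suc k)"
    have "max (- N) (min N q) = N \<or> max (- N) (min N q) = - N \<or>
       (max (- N) (min N q) = q \<and> - N \<le> q \<and> q \<le> N)" for N q :: real
      by (auto simp: max_def min_def)
    then consider "cell k y = real (Suc k)" | "cell k y = - real (Suc k)"
      | "cell k y = ?q" "- real (Suc k) \<le> ?q" "?q \<le> real (Suc k)"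
      unfolding cell_def by metis
    then show ?thesis
    proof cases
      case 3
      have "- real (Suc k) * real (Suc k) \<le> of_int ?i" "of_int ?i \<le> real (Suc k) * real (Suc k)"
        using 3(2,3) by (simp_all only: pos_le_divide_eq pos_divide_le_eq of_nat_0_less_iff zero_less_Suc)
      then have "of_int (- ?N) \<le> real_of_int ?i" "real_of_int ?i \<le> of_int ?N"
        by (simp_all only: of_int_minus of_int_of_nat_eq of_nat_mult of_int_mult mult_minus_left)
      then have "?i \<in> {- ?N..?N}" by (simp only: of_int_le_iff atLeastAtMost_iff)
      then show ?thesis using 3 by blast
    qed auto
  qed
  then have "range (cell k) \<subseteq> insert (real (Suc k)) (insert (- real (Suc k)) ((\<lambda>i. of_int i / real (Suc k)) ` {- ?N..?N}))"
    by blast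
  then show ?thesis by (rule finite_subset) simp
qed

lemma cell_expand: "\<phi> (cell k y) = (\<Sum>z\<in>range (cell k). \<phi> z * indicator {y. cell k y = z} y)" for \<phi> :: "real \<Rightarrow> real"
proof -
  have "(\<Sum>z\<in>range (cell k). \<phi> z * indicator {y. cell k y = z} y) = (\<Sum>z\<in>range (cell k). if z = cell k y then \<phi> z else 0)"
    by (intro sum.cong) (auto simp: indicator_def)
  also have "\<dots> = \<phi> (cell k y)" using finite_range_cell by simp
  finally show ?thesis ..
qed

lemma cell_comp_measurable: "(\<lambda>y. \<phi> (cell k y)) \<in> borel_measurable borel" for \<phi> :: "real \<Rightarrow> real"
  by (subst cell_expand) measurable

lemma cell_comp_integrable: "integrable \<rho>0 (\<lambda>y. \<phi> (cell k y))" for \<phi> :: "real \<Rightarrow> real"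
  by (subst cell_expand) (auto simp: emeasure_eq_measure)

text \<open>Puts all approximations on the one probability space \<rho>0, so that limits can be
  taken label by label.\<close>

lemma sum_nodes: "(\<Sum>z\<in>nodes k. mass k z * \<phi> z) = (\<integral>y. \<phi> (cell k y) \<partial>\<rho>0)" for \<phi> :: "real \<Rightarrow> real"
proof -
  have "(\<integral>y. \<phi> (cell k y) \<partial>\<rho>0) = (\<Sum>z\<in>range (cell k). \<phi> z * mass k z)"
    by (subst cell_expand) (auto simp: emeasure_eq_measure mass_def)
  also have "\<dots> = (\<Sum>z\<in>nodes k. \<phi> z * mass k z)"
    using finite_range_cell by (intro sum.mono_neutral_right) (auto simp: nodes_def mass_def not_less measure_le_0_iff)
  finally show ?thesis by (simp add: mult.commute)
qed

lemma mass_pos: "z \<in> nodes k \<Longrightarrow> 0 < mass k z" by (simp add: nodes_def)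

lemma mass_sum: "(\<Sum>z\<in>nodes k. mass k z) = 1"
  using sum_nodes[of k "\<lambda>_. 1"] prob_space by simp

lemma good_measurable [measurable]: "good \<in> sets borel"
proof -
  have "good = (\<Inter>k. \<Union>z\<in>nodes k. {y. cell k y = z})" by (auto simp: good_def)
  moreover have "finite (nodes k)" for k using finite_range_cell by (simp add: nodes_def)
  moreover have "{y. cell k y = z} \<in> sets borel" for k z by measurable
  ultimately show ?thesis by (auto intro!: sets.countable_INT' sets.finite_UN)
qed

lemma AE_good: "AE y in \<rho>0. y \<in> good"
proof -
  have "AE y in \<rho>0. cell k y \<in> nodes k" for k
  proof -
    have "AE y in \<rho>0. \<forall>z\<in>range (cell k) - nodes k. cell k y \<noteq> z"
    proof (subst AE_ball_countable)
      show "countable (range (cell k) - nodes k)" using finite_range_cell by (simp add: countable_finite)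
      show "\<forall>z\<in>range (cell k) - nodes k. AE y in \<rho>0. cell k y \<noteq> z"
      proof
        fix z assume "z \<in> range (cell k) - nodes k"
        then have "prob {y. cell k y = z} = 0" by (auto simp: nodes_def mass_def not_less measure_le_0_iff)
        then have "{y. cell k y = z} \<in> null_sets \<rho>0" by (auto simp: null_sets_def emeasure_eq_measure)
        then show "AE y in \<rho>0. cell k y \<noteq> z" by (rule AE_I') auto
      qed
    qed
    then show ?thesis by (rule AE_mp) auto
  qed
  then show ?thesis by (simp add: good_def AE_all_countable)
qed

sublocale scheme: sticky_scheme "nodes k" "mass k" f v0 c "mesh k" for k
proof
  show "finite (nodes k)" using finite_range_cell by (simp add: nodes_def)
  show "nodes k \<noteq> {}" using mass_sum[of k] by auto
qed (use mass_pos mass_sum c_gt_0 mesh f_one_sided in auto)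

section \<open>Bounds and equicontinuity, uniform in the level\<close>

definition path :: "nat \<Rightarrow> real \<Rightarrow> real \<Rightarrow> real" where
  "path k t y = scheme.traj k t (cell k y)"

lemma path_measurable [measurable]: "path k t \<in> borel_measurable borel"
  unfolding path_def[abs_def] by (rule cell_comp_measurable)

lemma path_0: "path k 0 y = cell k y"
  by (simp add: path_def scheme.traj_0)

lemma good_node: "y \<in> good \<Longrightarrow> cell k y \<in> nodes k" by (simp add: good_def)

lemma path_mono: "y \<in> good \<Longrightarrow> z \<in> good \<Longrightarrow> y \<le> z \<Longrightarrow> path k t y \<le> path k t z"
  unfolding path_def by (intro scheme.traj_mono good_node cell_mono)

lemma path_modulus:
  assumes "y \<in> good" "z \<in> good" "0 \<le> t" "\<bar>cell k y - cell k z\<bar> \<le> d" "0 \<le> w"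
    and v: "\<And>y z. \<bar>y - z\<bar> \<le> d \<Longrightarrow> \<bar>v0 y - v0 z\<bar> \<le> w"
  shows "\<bar>path k t y - path k t z\<bar> \<le> (d + w) * exp ((1 + c) * t)"
proof -
  have *: "\<bar>path k t y - path k t z\<bar> \<le> (d + w) * exp ((1 + c) * t)"
    if "y \<in> good" "z \<in> good" "y \<le> z" "\<bar>cell k y - cell k z\<bar> \<le> d" for y z
  proof -
    have "path k t z - path k t y \<le> (d + w) * exp ((1 + c) * t)"
      unfolding path_def
    proof (rule scheme.traj_modulus[OF assms(3) good_node good_node _ _ assms(5)])
      show "cell k y \<le> cell k z" using that by (simp add: cell_mono)
      show "cell k z - cell k y \<le> d" using that by (simp add: abs_le_iff)
      show "v0 z' - v0 y' \<le> w" if "y' \<le> z'" "z' - y' \<le> d" for y' z'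
        using v[of z' y'] that by (simp add: abs_le_iff)
    qed (use that in auto)
    then show ?thesis using path_mono[OF that(1-3), of k t] by simp
  qed
  show ?thesis
  proof (cases "y \<le> z")
    case True
    then show ?thesis using * assms(1,2,4) by blast
  next
    case False
    have "\<bar>path k t z - path k t y\<bar> \<le> (d + w) * exp ((1 + c) * t)"
      by (rule *) (use False assms(1,2,4) in auto)
    then show ?thesis by (simp add: abs_minus_commute)
  qed
qed


lemma exp_growth_mono: "s \<le> t \<Longrightarrow> exp ((1 + c) * s) \<le> exp ((1 + c) * t)"
  using c_gt_0 by simp

lemma v0_growth: obtains L where "0 \<le> L" "\<And>x y. \<bar>v0 x - v0 y\<bar> \<le> L * (1 + \<bar>x - y\<bar>)"
  using uniformly_continuous_linear_growth[of v0] v0_uniform by blast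

lemma v0_affine: obtains L where "0 \<le> L" "\<And>x. \<bar>v0 x\<bar> \<le> L * (1 + \<bar>x\<bar>)"
proof -
  obtain L where L: "0 \<le> L" "\<And>x y. \<bar>v0 x - v0 y\<bar> \<le> L * (1 + \<bar>x - y\<bar>)" by (rule v0_growth) blast
  have "\<bar>v0 x\<bar> \<le> (L + \<bar>v0 0\<bar>) * (1 + \<bar>x\<bar>)" for x
  proof -
    have "\<bar>v0 x\<bar> \<le> L * (1 + \<bar>x\<bar>) + \<bar>v0 0\<bar>" using L(2)[of x 0] by simp
    also have "\<dots> \<le> (L + \<bar>v0 0\<bar>) * (1 + \<bar>x\<bar>)" by (simp add: distrib_left distrib_right)
    finally show ?thesis .
  qed
  then show ?thesis using L(1) by (intro that[of "L + \<bar>v0 0\<bar>"]) auto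
qed

text \<open>The norms of the discrete data are integrals over \<rho>0. Since |cell k y| \<le> |y| +
  1 and \<open>v0\<close> grows at most linearly, the second moment of \<rho>0 bounds them
  independently of k.\<close>

lemma energy_bound_uniform:
  obtains E where "1 \<le> E" "\<And>k T. 0 \<le> T \<Longrightarrow> 0 \<le> scheme.energy_bound k K T \<and> scheme.energy_bound k K T \<le> E * exp ((1 + 2 * K) * T)"
proof -
  obtain L where L: "0 \<le> L" "\<And>x. \<bar>v0 x\<bar> \<le> L * (1 + \<bar>x\<bar>)" by (rule v0_affine) blast
  define I where "I a b = (\<integral>y. (a + b * \<bar>y\<bar>)\<^sup>2 \<partial>\<rho>0)" for a b
  have I0: "0 \<le> I a b" for a b by (simp add: I_def)
  have *: "scheme.wnorm k \<phi> \<le> sqrt (I a b)" if "0 \<le> a" "0 \<le> b" "\<And>y. \<bar>\<phi> (cell k y)\<bar> \<le> a + b * \<bar>y\<bar>" for \<phi> a b k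
  proof -
    have "(scheme.wnorm k \<phi>)\<^sup>2 = (\<integral>y. (\<phi> (cell k y))\<^sup>2 \<partial>\<rho>0)"
      unfolding scheme.wnorm_sq by (rule sum_nodes)
    also have "\<dots> \<le> I a b" unfolding I_def
    proof (rule integral_mono)
      show "integrable \<rho>0 (\<lambda>y. (\<phi> (cell k y))\<^sup>2)" by (rule cell_comp_integrable)
      show "(\<phi> (cell k y))\<^sup>2 \<le> (a + b * \<bar>y\<bar>)\<^sup>2" for y
        using power_mono[OF that(3)[of y], of 2] by simp
    qed (rule integrable_affine_sq)
    finally show ?thesis by (rule real_le_rsqrt)
  qed
  have 1: "scheme.wnorm k (\<lambda>z. z) \<le> sqrt (I 1 1)" for k
    using cell_abs_le[of k] by (intro *) (auto simp: add.commute)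
  have 2: "scheme.wnorm k v0 \<le> sqrt (I (2 * L) L)" for k
  proof (rule *)
    show "\<bar>v0 (cell k y)\<bar> \<le> 2 * L + L * \<bar>y\<bar>" for y
      using L(2)[of "cell k y"] mult_left_mono[OF cell_abs_le[of k y] L(1)] by (simp add: distrib_left)
  qed (use L in auto)
  show ?thesis
  proof (rule that[of "1 + sqrt (I 1 1) + sqrt (I (2 * L) L)"])
    fix k T assume "0 \<le> (T::real)"
    show "0 \<le> scheme.energy_bound k K T \<and> scheme.energy_bound k K T \<le> (1 + sqrt (I 1 1) + sqrt (I (2 * L) L)) * exp ((1 + 2 * K) * T)"
      unfolding scheme.energy_bound_def
      using 1[of k] 2[of k] scheme.wnorm_nonneg[of k v0] scheme.wnorm_nonneg[of k "\<lambda>z. z"] by simp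
  qed (simp add: I0)
qed

text \<open>The summand \<open>mesh k\<close> pays for the jumps of piecewise constant trajectories:
  between s and t the clock of the scheme may advance by up to one step more than t - s.\<close>

lemma path_L2:
  obtains Q where "\<And>T. 0 < Q T"
    "\<And>k s t T. 0 \<le> s \<Longrightarrow> s \<le> t \<Longrightarrow> t \<le> T \<Longrightarrow> (\<integral>y. (path k t y - path k s y)\<^sup>2 \<partial>\<rho>0) \<le> ((t - s + mesh k) * Q T)\<^sup>2"
    "\<And>k t T. 0 \<le> t \<Longrightarrow> t \<le> T \<Longrightarrow> (\<integral>y. (path k t y)\<^sup>2 \<partial>\<rho>0) \<le> (Q T)\<^sup>2"
proof -
  obtain E where E: "1 \<le> E" "\<And>k T. 0 \<le> T \<Longrightarrow> 0 \<le> scheme.energy_bound k K T \<and> scheme.energy_bound k K T \<le> E * exp ((1 + 2 * K) * T)"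
    by (rule energy_bound_uniform) blast
  define Q where "Q T = (1 + 2 * K) * (E * exp ((1 + 2 * K) * T))" for T
  have E': "scheme.energy_bound k K t \<le> E * exp ((1 + 2 * K) * T)" if "0 \<le> t" "t \<le> T" for k t T
    using scheme.energy_bound_mono[OF K_nonneg that(2)] E(2)[of T k] that by (meson order_trans)
  have EQ: "E * exp ((1 + 2 * K) * T) \<le> Q T" for T
    using mult_right_mono[of 1 "1 + 2 * K" "E * exp ((1 + 2 * K) * T)"] K_nonneg E(1) by (simp add: Q_def)
  show ?thesis
  proof (rule that[of Q])
    show "0 < Q T" for T using K_nonneg E(1) by (simp add: Q_def add_pos_nonneg)
    show "(\<integral>y. (path k t y - path k s y)\<^sup>2 \<partial>\<rho>0) \<le> ((t - s + mesh k) * Q T)\<^sup>2" if "0 \<le> s" "s \<le> t" "t \<le> T" for k s t T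
    proof -
      have "(\<integral>y. (path k t y - path k s y)\<^sup>2 \<partial>\<rho>0) = (\<Sum>z\<in>nodes k. mass k z * (scheme.traj k t z - scheme.traj k s z)\<^sup>2)"
        unfolding path_def by (rule sum_nodes[symmetric])
      also have "\<dots> \<le> ((t - s + mesh k) * ((1 + 2 * K) * scheme.energy_bound k K t))\<^sup>2"
        by (rule scheme.traj_bounds(2)[OF K_nonneg f_growth that(1,2)])
      also have "\<dots> \<le> ((t - s + mesh k) * Q T)\<^sup>2"
        unfolding Q_def using E'[of t T k] E(2)[of t k] that K_nonneg mesh[of k]
        by (intro power_mono mult_left_mono mult_nonneg_nonneg) auto
      finally show ?thesis .
    qed
    show "(\<integral>y. (path k t y)\<^sup>2 \<partial>\<rho>0) \<le> (Q T)\<^sup>2" if "0 \<le> t" "t \<le> T" for k t T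
    proof -
      have "(\<integral>y. (path k t y)\<^sup>2 \<partial>\<rho>0) = (\<Sum>z\<in>nodes k. mass k z * (scheme.traj k t z)\<^sup>2)"
        unfolding path_def by (rule sum_nodes[symmetric])
      also have "\<dots> \<le> (scheme.energy_bound k K t)\<^sup>2"
        by (rule scheme.traj_bounds(1)[OF K_nonneg f_growth that(1)]) simp
      also have "\<dots> \<le> (Q T)\<^sup>2"
        using E'[of t T k] E(2)[of t k] EQ[of T] that by (intro power_mono) auto
      finally show ?thesis .
    qed
  qed
qed

lemma path_integrable: "integrable \<rho>0 (path k t)" "integrable \<rho>0 (\<lambda>y. (path k t y)\<^sup>2)"
  "integrable \<rho>0 (\<lambda>y. (path k t y - path k s y)\<^sup>2)"
  using cell_comp_integrable[of "scheme.traj k t" k] cell_comp_integrable[of "\<lambda>z. (scheme.traj k t z)\<^sup>2" k]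
    cell_comp_integrable[of "\<lambda>z. (scheme.traj k t z - scheme.traj k s z)\<^sup>2" k]
  by (simp_all add: path_def[abs_def])

text \<open>The L2 bound says nothing at a single label. Averaging the modulus estimate |path y -
  path z| \<le> D (1 + |y| + |z|) over z turns the bound on the mean into a pointwise one.\<close>

lemma path_bound:
  obtains B where "\<And>T. 0 < B T"
    "\<And>k t T y. 0 \<le> t \<Longrightarrow> t \<le> T \<Longrightarrow> y \<in> good \<Longrightarrow> \<bar>path k t y\<bar> \<le> B T * (1 + \<bar>y\<bar>)"
proof -
  obtain L where L: "0 \<le> L" "\<And>x y. \<bar>v0 x - v0 y\<bar> \<le> L * (1 + \<bar>x - y\<bar>)" by (rule v0_growth) blast
  obtain Q where Q: "\<And>T. 0 < Q T"
    "\<And>k t T. 0 \<le> t \<Longrightarrow> t \<le> T \<Longrightarrow> (\<integral>y. (path k t y)\<^sup>2 \<partial>\<rho>0) \<le> (Q T)\<^sup>2"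
    by (rule path_L2) blast
  define D where "D T = 3 * (1 + L) * exp ((1 + c) * T)" for T
  define m1 where "m1 = (\<integral>z. \<bar>z\<bar> \<partial>\<rho>0)"
  have D0: "0 < D T" for T using L by (simp add: D_def add_pos_nonneg)
  have m10: "0 \<le> m1" by (simp add: m1_def)
  have diff: "\<bar>path k t y - path k t z\<bar> \<le> D T * (1 + \<bar>y\<bar> + \<bar>z\<bar>)"
    if "0 \<le> t" "t \<le> T" "y \<in> good" "z \<in> good" for k t T y z
  proof -
    let ?d = "\<bar>cell k y - cell k z\<bar>"
    have "\<bar>path k t y - path k t z\<bar> \<le> (?d + L * (1 + ?d)) * exp ((1 + c) * t)"
    proof (rule path_modulus[OF that(3,4,1) order_refl])
      show "\<bar>v0 y' - v0 z'\<bar> \<le> L * (1 + ?d)" if "\<bar>y' - z'\<bar> \<le> ?d" for y' z'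
        using L(2)[of y' z'] mult_left_mono[of "1 + \<bar>y' - z'\<bar>" "1 + ?d" L] that L(1) by linarith
    qed (use L in simp)
    also have "\<dots> \<le> ((1 + L) * (1 + ?d)) * exp ((1 + c) * T)"
      using exp_growth_mono[OF that(2)] L(1) by (intro mult_mono) (simp_all add: algebra_simps)
    also have "\<dots> \<le> ((1 + L) * (3 * (1 + \<bar>y\<bar> + \<bar>z\<bar>))) * exp ((1 + c) * T)"
      using L cell_abs_le[of k y] cell_abs_le[of k z] by (intro mult_right_mono mult_left_mono) auto
    finally show ?thesis by (simp add: D_def algebra_simps)
  qed
  have bound: "\<bar>path k t y\<bar> \<le> (Q T + D T * (1 + m1)) * (1 + \<bar>y\<bar>)"
    if t: "0 \<le> t" "t \<le> T" and y: "y \<in> good" for k t T y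
  proof -
    have "\<bar>path k t y\<bar> = (\<integral>z. \<bar>path k t y\<bar> \<partial>\<rho>0)" using prob_space by simp
    also have "\<dots> \<le> (\<integral>z. \<bar>path k t z\<bar> + (D T * (1 + \<bar>y\<bar>) + D T * \<bar>z\<bar>) \<partial>\<rho>0)"
    proof (rule integral_mono_AE)
      show "integrable \<rho>0 (\<lambda>z. \<bar>path k t z\<bar> + (D T * (1 + \<bar>y\<bar>) + D T * \<bar>z\<bar>))"
        by (intro Bochner_Integration.integrable_add integrable_abs path_integrable integrable_affine)
      show "AE z in \<rho>0. \<bar>path k t y\<bar> \<le> \<bar>path k t z\<bar> + (D T * (1 + \<bar>y\<bar>) + D T * \<bar>z\<bar>)"
        using AE_good
      proof eventually_elim
        case (elim z)
        then show ?case using diff[OF t y elim, of k] by (simp add: distrib_left)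
      qed
    qed auto
    also have "\<dots> = (\<integral>z. \<bar>path k t z\<bar> \<partial>\<rho>0) + (\<integral>z. D T * (1 + \<bar>y\<bar>) + D T * \<bar>z\<bar> \<partial>\<rho>0)"
      by (intro Bochner_Integration.integral_add integrable_abs path_integrable integrable_affine)
    also have "(\<integral>z. D T * (1 + \<bar>y\<bar>) + D T * \<bar>z\<bar> \<partial>\<rho>0) = D T * (1 + \<bar>y\<bar>) + D T * m1"
    proof -
      have "integrable \<rho>0 (\<lambda>z. \<bar>z\<bar>)" using integrable_affine[of 0 1] by simp
      then show ?thesis by (simp add: m1_def prob_UNIV)
    qed
    also have "(\<integral>z. \<bar>path k t z\<bar> \<partial>\<rho>0) \<le> Q T"
    proof -
      have q: "0 < Q T" by (rule Q(1))
      \<comment> \<open>Young's inequality, weighted so that each of the two terms contributes at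
        most Q T / 2.\<close>
      have "(\<integral>z. \<bar>path k t z\<bar> \<partial>\<rho>0) \<le> (\<integral>z. (path k t z)\<^sup>2 / (2 * Q T) + Q T / 2 \<partial>\<rho>0)"
      proof (rule integral_mono)
        fix z
        have "2 * \<bar>path k t z\<bar> * Q T \<le> \<bar>path k t z\<bar>\<^sup>2 + (Q T)\<^sup>2" by (rule sum_squares_bound)
        then show "\<bar>path k t z\<bar> \<le> (path k t z)\<^sup>2 / (2 * Q T) + Q T / 2"
          using q by (simp add: field_simps power2_eq_square)
      next
        show "integrable \<rho>0 (\<lambda>z. \<bar>path k t z\<bar>)" by (intro integrable_abs path_integrable)
        show "integrable \<rho>0 (\<lambda>z. (path k t z)\<^sup>2 / (2 * Q T) + Q T / 2)"
          by (intro Bochner_Integration.integrable_add integrable_divide path_integrable integrable_const)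
      qed
      also have "\<dots> = (\<integral>z. (path k t z)\<^sup>2 \<partial>\<rho>0) / (2 * Q T) + Q T / 2"
        using path_integrable(2)[of k t] by (simp add: prob_UNIV)
      also have "\<dots> \<le> (Q T)\<^sup>2 / (2 * Q T) + Q T / 2"
        by (rule add_right_mono, rule divide_right_mono[OF Q(2)[OF t]]) (use q in simp)
      also have "\<dots> = Q T" using q by (simp add: power2_eq_square)
      finally show ?thesis .
    qed
    also have "Q T + (D T * (1 + \<bar>y\<bar>) + D T * m1) \<le> (Q T + D T * (1 + m1)) * (1 + \<bar>y\<bar>)"
    proof -
      have "0 \<le> Q T * \<bar>y\<bar> + D T * (m1 * \<bar>y\<bar>)"
        using Q(1)[of T] D0[of T] m10 by (intro add_nonneg_nonneg mult_nonneg_nonneg) auto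
      then show ?thesis by (simp add: algebra_simps)
    qed
    finally show ?thesis by simp
  qed
  show ?thesis
  proof (rule that[of "\<lambda>T. Q T + D T * (1 + m1)"])
    show "0 < Q T + D T * (1 + m1)" for T
      using Q(1)[of T] D0[of T] m10 by (intro add_pos_nonneg mult_nonneg_nonneg) auto
  qed (rule bound)
qed

text \<open>The modulus \<delta> is chosen before R. The range R only decides from which k on the
  truncation in \<open>cell\<close> is inactive, and k must also be so large that rounding costs
  less than the margin between d' / 2 and d'.\<close>

lemma path_space_equicontinuous:
  assumes "0 < \<epsilon>"
  obtains \<delta> where "0 < \<delta>"
    "\<And>R. \<exists>k0. \<forall>k\<ge>k0. \<forall>y\<in>good. \<forall>z\<in>good. \<forall>t\<in>{0..T}.
       \<bar>y\<bar> \<le> R \<and> \<bar>z\<bar> \<le> R \<and> \<bar>y - z\<bar> \<le> \<delta> \<longrightarrow> \<bar>path k t y - path k t z\<bar> \<le> \<epsilon>"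
proof -
  define e where "e = exp ((1 + c) * T)"
  have e: "0 < e" by (simp add: e_def)
  define \<eta> where "\<eta> = \<epsilon> / (2 * e)"
  have \<eta>: "0 < \<eta>" using assms e by (simp add: \<eta>_def)
  obtain d where d: "0 < d" "\<And>x y. \<bar>x - y\<bar> \<le> d \<Longrightarrow> \<bar>v0 x - v0 y\<bar> \<le> \<eta>" using v0_uniform[OF \<eta>] by blast
  define d' where "d' = min d \<eta>"
  have d': "0 < d'" "d' \<le> d" "d' \<le> \<eta>" using d \<eta> by (simp_all add: d'_def)
  show ?thesis
  proof (rule that[of "d' / 2"])
    fix R
    obtain k1 where k1: "\<And>k. k1 \<le> k \<Longrightarrow> mesh k < d' / 4"
      using order_tendstoD(2)[OF mesh_tendsto, of "d' / 4"] d' by (auto simp: eventually_sequentially)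
    obtain k2 :: nat where k2: "R \<le> real k2" using real_arch_simple by blast
    show "\<exists>k0. \<forall>k\<ge>k0. \<forall>y\<in>good. \<forall>z\<in>good. \<forall>t\<in>{0..T}.
       \<bar>y\<bar> \<le> R \<and> \<bar>z\<bar> \<le> R \<and> \<bar>y - z\<bar> \<le> d' / 2 \<longrightarrow> \<bar>path k t y - path k t z\<bar> \<le> \<epsilon>"
    proof (intro exI[of _ "max k1 k2"] allI impI ballI)
      fix k y z t
      assume k: "max k1 k2 \<le> k" and y: "y \<in> good" and z: "z \<in> good" and t: "t \<in> {0..T}"
        and yz: "\<bar>y\<bar> \<le> R \<and> \<bar>z\<bar> \<le> R \<and> \<bar>y - z\<bar> \<le> d' / 2"
      have "R \<le> real (Suc k)" using k k2 by simp
      then have "\<bar>cell k y - y\<bar> \<le> mesh k" "\<bar>cell k z - z\<bar> \<le> mesh k"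
        using yz by (auto intro!: cell_near)
      moreover have "mesh k < d' / 4" using k1[of k] k by simp
      moreover have "\<bar>y - z\<bar> \<le> d' / 2" using yz by simp
      ultimately have cl: "\<bar>cell k y - cell k z\<bar> \<le> d'" by linarith
      have "\<bar>path k t y - path k t z\<bar> \<le> (d' + \<eta>) * exp ((1 + c) * t)"
        by (rule path_modulus[OF y z _ cl]) (use t \<eta> d d' in auto)
      also have "\<dots> \<le> (2 * \<eta>) * e"
        unfolding e_def using d' \<eta> t exp_growth_mono[of t T] by (intro mult_mono) simp_all
      also have "\<dots> = \<epsilon>" using e by (simp add: \<eta>_def)
      finally show "\<bar>path k t y - path k t z\<bar> \<le> \<epsilon>" .
    qed
  qed (use d' in simp)
qed

text \<open>Labels near a good one carry positive mass, so the \<open>L\<^sup>2\<close> bound controls their displacement.\<close>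

lemma path_time_equicontinuous:
  assumes "0 < \<epsilon>" and y: "y \<in> good"
  obtains \<tau> k0 where "0 < \<tau>"
    "\<And>k s t. k0 \<le> k \<Longrightarrow> 0 \<le> s \<Longrightarrow> s \<le> t \<Longrightarrow> t \<le> T \<Longrightarrow> t - s \<le> \<tau> \<Longrightarrow> \<bar>path k t y - path k s y\<bar> \<le> \<epsilon>"
proof -
  obtain Q where Q: "\<And>T. 0 < Q T"
    "\<And>k s t T. 0 \<le> s \<Longrightarrow> s \<le> t \<Longrightarrow> t \<le> T \<Longrightarrow> (\<integral>y. (path k t y - path k s y)\<^sup>2 \<partial>\<rho>0) \<le> ((t - s + mesh k) * Q T)\<^sup>2"
    by (rule path_L2) blast
  obtain \<delta> where \<delta>: "0 < \<delta>"
    "\<And>R. \<exists>k0. \<forall>k\<ge>k0. \<forall>y\<in>good. \<forall>z\<in>good. \<forall>t\<in>{0..T}.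
       \<bar>y\<bar> \<le> R \<and> \<bar>z\<bar> \<le> R \<and> \<bar>y - z\<bar> \<le> \<delta> \<longrightarrow> \<bar>path k t y - path k t z\<bar> \<le> \<epsilon> / 3"
    by (rule path_space_equicontinuous[of "\<epsilon> / 3" T]) (use assms in auto)
  define R where "R = \<bar>y\<bar> + 1 + \<delta>"
  obtain k1 where k1: "\<forall>k\<ge>k1. \<forall>y\<in>good. \<forall>z\<in>good. \<forall>t\<in>{0..T}.
       \<bar>y\<bar> \<le> R \<and> \<bar>z\<bar> \<le> R \<and> \<bar>y - z\<bar> \<le> \<delta> \<longrightarrow> \<bar>path k t y - path k t z\<bar> \<le> \<epsilon> / 3"
    using \<delta>(2) by blast
  obtain k2 where k2: "\<And>k. k2 \<le> k \<Longrightarrow> mesh k < min 1 (\<delta> / 2)"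
    using order_tendstoD(2)[OF mesh_tendsto, of "min 1 (\<delta> / 2)"] \<delta>(1) by (auto simp: eventually_sequentially)
  obtain k3 :: nat where k3: "R + 1 \<le> real k3" using real_arch_simple by blast
  define j where "j = max k2 k3"
  \<comment> \<open>One fixed cell around y: its mass is positive because y is good, and at level j
    it lies within \<delta> of y.\<close>
  define C where "C = {z. cell j z = cell j y}"
  have C[measurable]: "C \<in> sets borel" unfolding C_def by measurable
  define \<mu> where "\<mu> = prob C"
  have \<mu>: "0 < \<mu>" using good_node[OF y, of j] by (simp add: nodes_def mass_def C_def \<mu>_def)
  have jR: "R + 1 \<le> real (Suc j)" using k3 by (simp add: j_def)
  have cj: "\<bar>cell j y - y\<bar> \<le> mesh j" by (rule cell_near) (use jR \<delta>(1) in \<open>simp add: R_def\<close>)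
  have mj: "mesh j < 1" "mesh j < \<delta> / 2" using k2[of j] by (simp_all add: j_def)
  have C_near: "\<bar>z - y\<bar> \<le> \<delta>" "\<bar>z\<bar> \<le> R" if "z \<in> C" for z
  proof -
    have z: "cell j z = cell j y" using that by (simp add: C_def)
    \<comment> \<open>The common cell value stays away from the truncation levels, so z itself
      cannot lie outside the grid and \<open>cell_near\<close> applies to it.\<close>
    have "\<bar>cell j z\<bar> < real j"  using cj mj z jR \<delta>(1) by (simp add: R_def)
    then have "\<bar>z\<bar> \<le> real (Suc j)"
    proof -
      have "z \<le> real (Suc j)"
      proof (rule ccontr)
        assume "\<not> z \<le> real (Suc j)"
        then have "cell j (real (Suc j)) \<le> cell j z" by (intro cell_mono) simp
        moreover have "\<bar>cell j (real (Suc j)) - real (Suc j)\<bar> \<le> mesh j" by (rule cell_near) simp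
        ultimately show False using \<open>\<bar>cell j z\<bar> < real j\<close> mj by simp
      qed
      moreover have "- real (Suc j) \<le> z"
      proof (rule ccontr)
        assume "\<not> - real (Suc j) \<le> z"
        then have "cell j z \<le> cell j (- real (Suc j))" by (intro cell_mono) simp
        moreover have "\<bar>cell j (- real (Suc j)) - (- real (Suc j))\<bar> \<le> mesh j" by (rule cell_near) simp
        ultimately show False using \<open>\<bar>cell j z\<bar> < real j\<close> mj by simp
      qed
      ultimately show ?thesis by simp
    qed
    then have "\<bar>cell j z - z\<bar> \<le> mesh j" by (rule cell_near)
    then show 1: "\<bar>z - y\<bar> \<le> \<delta>" using cj mj z by simp
    then show "\<bar>z\<bar> \<le> R" by (simp add: R_def)
  qed
  \<comment> \<open>If y moved by more than \<epsilon>, every good label of C would move by at least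
    \<epsilon> / 3, which contributes \<epsilon>^2 \<mu> / 9. With t - s and the mesh both bounded
    by \<tau>, the L2 estimate allows only (2 \<tau> Q)^2 = \<epsilon>^2 \<mu> / 36.\<close>
  define \<tau> where "\<tau> = sqrt \<mu> * \<epsilon> / (12 * Q T)"
  have \<tau>: "0 < \<tau>" using \<mu> assms Q(1)[of T] by (simp add: \<tau>_def)
  obtain k4 where k4: "\<And>k. k4 \<le> k \<Longrightarrow> mesh k < \<tau>"
    using order_tendstoD(2)[OF mesh_tendsto \<tau>] by (auto simp: eventually_sequentially)
  show ?thesis
  proof (rule that[OF \<tau>, of "max k1 k4"])
    fix k s t assume k: "max k1 k4 \<le> k" and st: "0 \<le> s" "s \<le> t" "t \<le> T" "t - s \<le> \<tau>"
    show "\<bar>path k t y - path k s y\<bar> \<le> \<epsilon>"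
    proof (rule ccontr)
      assume far: "\<not> \<bar>path k t y - path k s y\<bar> \<le> \<epsilon>"
      have "\<epsilon>\<^sup>2 / 9 * \<mu> = (\<integral>z. \<epsilon>\<^sup>2 / 9 * indicator C z \<partial>\<rho>0)" by (simp add: \<mu>_def)
      also have "\<dots> \<le> (\<integral>z. (path k t z - path k s z)\<^sup>2 \<partial>\<rho>0)"
      proof (rule integral_mono_AE)
        show "AE z in \<rho>0. \<epsilon>\<^sup>2 / 9 * indicator C z \<le> (path k t z - path k s z)\<^sup>2"
          using AE_good
        proof eventually_elim
          case (elim z)
          show ?case
          proof (cases "z \<in> C")
            case True
            have k1': "\<bar>path k r y - path k r z\<bar> \<le> \<epsilon> / 3" if "r \<in> {0..T}" for r
              using k1 k y elim that C_near[OF True] \<delta>(1) by (auto simp: R_def abs_minus_commute)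
            have "\<epsilon> / 3 \<le> \<bar>path k t z - path k s z\<bar>"
              using k1'[of t] k1'[of s] st far by (auto simp: abs_if split: if_splits)
            from power_mono[OF this, of 2] show ?thesis using True assms by (simp add: power_divide)
          qed simp
        qed
      qed (auto intro!: path_integrable simp: emeasure_eq_measure)
      also have "\<dots> \<le> ((t - s + mesh k) * Q T)\<^sup>2" by (rule Q(2)[OF st(1-3)])
      also have "\<dots> < (2 * \<tau> * Q T)\<^sup>2"
        using st k k4[of k] mesh[of k] Q(1)[of T] \<tau>
        by (intro power_strict_mono mult_strict_right_mono) auto
      also have "2 * \<tau> * Q T = sqrt \<mu> * \<epsilon> / 6" using Q(1)[of T] by (simp add: \<tau>_def)
      also have "(sqrt \<mu> * \<epsilon> / 6)\<^sup>2 = \<epsilon>\<^sup>2 / 36 * \<mu>" using \<mu> by (simp add: power_mult_distrib power_divide)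
      finally show False using \<mu> assms by (simp add: mult_less_cancel_right)
    qed
  qed
qed

end

section \<open>The limit flow\<close>

lemma integral_abs_le_AE:
  fixes F :: "'a \<Rightarrow> real"
  assumes "integrable M F" "integrable M w" "AE x in M. \<bar>F x\<bar> \<le> w x"
  shows "\<bar>integral\<^sup>L M F\<bar> \<le> integral\<^sup>L M w"
proof -
  have "\<bar>integral\<^sup>L M F\<bar> \<le> (\<integral>x. \<bar>F x\<bar> \<partial>M)" by (rule integral_abs_bound)
  also have "\<dots> \<le> integral\<^sup>L M w" using assms by (intro integral_mono_AE integrable_abs)
  finally show ?thesis .
qed

lemma set_integral_abs_le:
  fixes F :: "real \<Rightarrow> real"
  assumes "a \<le> b" "set_integrable lborel {a..<b} F" "\<And>u. a \<le> u \<Longrightarrow> u < b \<Longrightarrow> \<bar>F u\<bar> \<le> C"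
  shows "\<bar>LBINT u:{a..<b}. F u\<bar> \<le> C * (b - a)"
proof -
  have "\<bar>LBINT u:{a..<b}. F u\<bar> \<le> (\<integral>u. indicator {a..<b} u * C \<partial>lborel)"
    unfolding set_lebesgue_integral_def
  proof (rule integral_abs_le_AE)
    show "integrable lborel (\<lambda>u. indicator {a..<b} u *\<^sub>R F u)" using assms(2) by (simp add: set_integrable_def)
    show "integrable lborel (\<lambda>u. indicator {a..<b} u * C)" using assms(1) by (intro integrable_mult_left) simp
    show "AE u in lborel. \<bar>indicator {a..<b} u *\<^sub>R F u\<bar> \<le> indicator {a..<b} u * C"
      using assms(3) by (auto simp: indicator_def)
  qed
  also have "\<dots> = C * (b - a)" using assms(1) by simp
  finally show ?thesis .
qed

text \<open>The endpoints approach from below, as \<open>prev_time\<close> does. For half-open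
  intervals this gives convergence of the cut-off integrands at every point, the endpoints included,
  so dominated convergence applies.\<close>

lemma set_integral_step_limit:
  fixes F :: "nat \<Rightarrow> real \<Rightarrow> real"
  assumes a: "a' \<longlonglongrightarrow> a" "\<And>k. 0 \<le> a' k" "\<And>k. a' k \<le> a" and b: "b' \<longlonglongrightarrow> b" "\<And>k. b' k \<le> b"
    and ab: "0 \<le> b"
    and F: "\<And>u. a \<le> u \<Longrightarrow> u < b \<Longrightarrow> (\<lambda>k. F k u) \<longlonglongrightarrow> F' u"
    and bd: "\<And>k u. 0 \<le> u \<Longrightarrow> u < b \<Longrightarrow> \<bar>F k u\<bar> \<le> C"
    and int: "\<And>k. set_integrable lborel {a' k..<b' k} (F k)"
  shows "set_integrable lborel {a..<b} F' \<and>
    (\<lambda>k. LBINT u:{a' k..<b' k}. F k u) \<longlonglongrightarrow> (LBINT u:{a..<b}. F' u)"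
proof -
  define s where "s k u = indicator {a' k..<b' k} u *\<^sub>R F k u" for k u
  define s' where "s' u = indicator {a..<b} u *\<^sub>R F' u" for u
  have lim: "(\<lambda>k. s k u) \<longlonglongrightarrow> s' u" for u
  proof -
    consider "u < a" | "a \<le> u" "u < b" | "b \<le> u" by linarith
    then show ?thesis
    proof cases
      case 1
      then have "\<forall>\<^sub>F k in sequentially. u < a' k" using order_tendstoD(1)[OF a(1)] by blast
      then have "\<forall>\<^sub>F k in sequentially. s k u = 0" by eventually_elim (simp add: s_def)
      then show ?thesis using 1 by (simp add: s'_def tendsto_eventually)
    next
      case 2
      then have "\<forall>\<^sub>F k in sequentially. u < b' k" using order_tendstoD(1)[OF b(1)] by blast
      then have "\<forall>\<^sub>F k in sequentially. F k u = s k u"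
        by eventually_elim (use 2 a(3) in \<open>auto simp: s_def indicator_def intro: order_trans\<close>)
      from Lim_transform_eventually[OF F[OF 2] this] show ?thesis using 2 by (simp add: s'_def)
    next
      case 3
      then have "s k u = 0" for k using b(2)[of k] by (simp add: s_def)
      then show ?thesis using 3 by (simp add: s'_def)
    qed
  qed
  have m: "s k \<in> borel_measurable lborel" for k
    using int[of k] borel_measurable_integrable by (auto simp: s_def[abs_def] set_integrable_def)
  have m': "s' \<in> borel_measurable lborel" by (rule borel_measurable_LIMSEQ_real[OF lim m])
  have w: "integrable lborel (\<lambda>u. indicator {0..<b} u * \<bar>C\<bar>)"
    using ab by (intro integrable_mult_left) simp
  have bd': "AE u in lborel. norm (s k u) \<le> indicator {0..<b} u * \<bar>C\<bar>" for k
  proof (rule AE_I2)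
    fix u
    show "norm (s k u) \<le> indicator {0..<b} u * \<bar>C\<bar>"
      using bd[of u k] a(2)[of k] b(2)[of k] by (auto simp: s_def indicator_def)
  qed
  have "integrable lborel s'" "(\<lambda>k. integral\<^sup>L lborel (s k)) \<longlonglongrightarrow> integral\<^sup>L lborel s'"
    using integrable_dominated_convergence[OF m' m w AE_I2[OF lim] bd']
      integral_dominated_convergence[OF m' m w AE_I2[OF lim] bd'] by auto
  then show ?thesis unfolding set_integrable_def set_lebesgue_integral_def s_def[abs_def] s'_def[abs_def] by auto
qed

context euler_data
begin

section \<open>The limit flow\<close>

text \<open>Convergence is arranged on a countable dense set of good labels and at rational times;
  equicontinuity in label and time carries it to all good labels and all t \<ge> 0.\<close>

lemma path_convergent_subsequence:
  obtains r where "strict_mono r" "\<And>y t. y \<in> good \<Longrightarrow> 0 \<le> t \<Longrightarrow> convergent (\<lambda>k. path (r k) t y)"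
proof -
  obtain D where D: "countable D" "D \<subseteq> good" "good \<subseteq> closure D" using separable by blast
  define I where "I = D \<times> (\<rat> \<inter> {0::real..})"
  obtain B where B: "\<And>T. 0 < B T"
    "\<And>k t T y. 0 \<le> t \<Longrightarrow> t \<le> T \<Longrightarrow> y \<in> good \<Longrightarrow> \<bar>path k t y\<bar> \<le> B T * (1 + \<bar>y\<bar>)"
    by (rule path_bound) blast
  have "countable I" unfolding I_def using D(1) countable_rat by (intro countable_SIGMA countable_Int1) auto
  moreover have "\<exists>B. \<forall>k. \<bar>path k (snd i) (fst i)\<bar> \<le> B" if "i \<in> I" for i
    by (rule exI[of _ "B (snd i) * (1 + \<bar>fst i\<bar>)"]) (use that D(2) B(2) in \<open>auto simp: I_def\<close>)
  ultimately obtain r where r: "strict_mono r" "\<And>i. i \<in> I \<Longrightarrow> convergent (\<lambda>k. path (r k) (snd i) (fst i))"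
    using pointwise_convergent_subsequence[of I "\<lambda>k i. path k (snd i) (fst i)"] by metis
  have "convergent (\<lambda>k. path (r k) t y)" if y: "y \<in> good" and t: "0 \<le> t" for y t
  proof -
    have "Cauchy (\<lambda>k. path (r k) t y)"
    proof (rule metric_CauchyI)
      fix e :: real assume "0 < e"
      \<comment> \<open>Each of the two paths costs 2 \<epsilon> to reach the countable set, and the
        Cauchy condition there costs less than \<epsilon>.\<close>
      define \<epsilon> where "\<epsilon> = e / 6"
      have \<epsilon>: "0 < \<epsilon>" using \<open>0 < e\<close> by (simp add: \<epsilon>_def)
      obtain \<delta> where \<delta>: "0 < \<delta>"
        "\<And>R. \<exists>k0. \<forall>k\<ge>k0. \<forall>y\<in>good. \<forall>z\<in>good. \<forall>s\<in>{0..t + 1}.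
           \<bar>y\<bar> \<le> R \<and> \<bar>z\<bar> \<le> R \<and> \<bar>y - z\<bar> \<le> \<delta> \<longrightarrow> \<bar>path k s y - path k s z\<bar> \<le> \<epsilon>"
        by (rule path_space_equicontinuous[OF \<epsilon>, of "t + 1"]) blast
      obtain y' where y': "y' \<in> D" "dist y' y < \<delta>"
        using D(3) y \<delta>(1) unfolding closure_approachable subset_iff by blast
      then have y'g: "y' \<in> good" and yd: "\<bar>y - y'\<bar> \<le> \<delta>" using D(2) by (auto simp: dist_real_def)
      obtain k0 where k0: "\<forall>k\<ge>k0. \<forall>u\<in>good. \<forall>z\<in>good. \<forall>s\<in>{0..t + 1}.
           \<bar>u\<bar> \<le> \<bar>y\<bar> + \<delta> \<and> \<bar>z\<bar> \<le> \<bar>y\<bar> + \<delta> \<and> \<bar>u - z\<bar> \<le> \<delta> \<longrightarrow> \<bar>path k s u - path k s z\<bar> \<le> \<epsilon>"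
        using \<delta>(2) by blast
      obtain \<tau> k1 where \<tau>: "0 < \<tau>" "\<And>k s s'. k1 \<le> k \<Longrightarrow> 0 \<le> s \<Longrightarrow> s \<le> s' \<Longrightarrow> s' \<le> t + 1 \<Longrightarrow> s' - s \<le> \<tau> \<Longrightarrow>
           \<bar>path k s' y' - path k s y'\<bar> \<le> \<epsilon>"
        by (rule path_time_equicontinuous[OF \<epsilon> y'g, of "t + 1"]) blast
      obtain q where q: "q \<in> \<rat>" "t < q" "q < t + min \<tau> 1"
        using Rats_dense_in_real[of t "t + min \<tau> 1"] \<tau>(1) by auto
      have "(y', q) \<in> I" using y' q t by (auto simp: I_def)
      from r(2)[OF this] have "Cauchy (\<lambda>k. path (r k) q y')" by (simp add: convergent_Cauchy)
      from metric_CauchyD[OF this \<epsilon>] obtain M where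
        M: "\<And>m n. M \<le> m \<Longrightarrow> M \<le> n \<Longrightarrow> \<bar>path (r m) q y' - path (r n) q y'\<bar> < \<epsilon>"
        by (auto simp: dist_real_def)
      have near: "\<bar>path (r m) t y - path (r m) q y'\<bar> \<le> 2 * \<epsilon>" if "max k0 k1 \<le> m" for m
      proof -
        have rm: "k0 \<le> r m" "k1 \<le> r m" using that seq_suble[OF r(1), of m] by auto
        have "\<bar>path (r m) t y - path (r m) t y'\<bar> \<le> \<epsilon>"
          using k0[rule_format, OF rm(1) y y'g, of t] t yd \<delta>(1) by auto
        moreover have "\<bar>path (r m) q y' - path (r m) t y'\<bar> \<le> \<epsilon>"
          using \<tau>(2)[OF rm(2), of t q] t q by auto
        ultimately show ?thesis by linarith
      qed
      show "\<exists>M. \<forall>m\<ge>M. \<forall>n\<ge>M. dist (path (r m) t y) (path (r n) t y) < e"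
      proof (intro exI[of _ "max M (max k0 k1)"] allI impI)
        fix m n assume "max M (max k0 k1) \<le> m" "max M (max k0 k1) \<le> n"
        then show "dist (path (r m) t y) (path (r n) t y) < e"
          using near[of m] near[of n] M[of m n] \<epsilon>_def unfolding dist_real_def max.bounded_iff by linarith
      qed
    qed
    then show ?thesis by (rule real_Cauchy_convergent)
  qed
  with r(1) show ?thesis by (rule that)
qed

definition selection :: "nat \<Rightarrow> nat" where
  "selection = (SOME r. strict_mono r \<and> (\<forall>y t. y \<in> good \<and> 0 \<le> t \<longrightarrow> convergent (\<lambda>k. path (r k) t y)))"

lemma selection: "strict_mono selection" "y \<in> good \<Longrightarrow> 0 \<le> t \<Longrightarrow> convergent (\<lambda>k. path (selection k) t y)"
proof -
  have "\<exists>r. strict_mono r \<and> (\<forall>y t. y \<in> good \<and> 0 \<le> t \<longrightarrow> convergent (\<lambda>k. path (r k) t y))"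
    using path_convergent_subsequence by metis
  then have "strict_mono selection \<and> (\<forall>y t. y \<in> good \<and> 0 \<le> t \<longrightarrow> convergent (\<lambda>k. path (selection k) t y))"
    unfolding selection_def by (rule someI_ex)
  then show "strict_mono selection" "y \<in> good \<Longrightarrow> 0 \<le> t \<Longrightarrow> convergent (\<lambda>k. path (selection k) t y)" by auto
qed

text \<open>The value at negative times is frozen at time 0, and exceptional labels stay at rest, so
  that every path is continuous on the whole line.\<close>

definition flow :: "real \<Rightarrow> real \<Rightarrow> real" where
  "flow t y = (if y \<in> good then lim (\<lambda>k. path (selection k) (max 0 t) y) else y)"

lemma flow_limit: "y \<in> good \<Longrightarrow> 0 \<le> t \<Longrightarrow> (\<lambda>k. path (selection k) t y) \<longlonglongrightarrow> flow t y"
  using selection(2)[of y t] by (simp add: flow_def convergent_LIMSEQ_iff)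

lemma selection_tendsto:
  assumes "\<phi> \<longlonglongrightarrow> l"
  shows "(\<lambda>k. \<phi> (selection k)) \<longlonglongrightarrow> l"
  using LIMSEQ_subseq_LIMSEQ[OF assms selection(1)] by (simp add: comp_def)

lemma flow_measurable: "flow t \<in> borel_measurable borel"
proof -
  have "(\<lambda>y. lim (\<lambda>k. path (selection k) (max 0 t) y)) \<in> borel_measurable borel"
    by (rule borel_measurable_lim_metric) measurable
  then show ?thesis unfolding flow_def[abs_def] by measurable
qed

lemma flow_0: "flow 0 y = y"
proof (cases "y \<in> good")
  case True
  have "(\<lambda>k. cell k y) \<longlonglongrightarrow> y"
  proof (rule LIMSEQ_I)
    fix e :: real assume "0 < e"
    obtain k1 where k1: "\<And>k. k1 \<le> k \<Longrightarrow> mesh k < e"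
      using order_tendstoD(2)[OF mesh_tendsto \<open>0 < e\<close>] by (auto simp: eventually_sequentially)
    obtain k2 :: nat where k2: "\<bar>y\<bar> \<le> real k2" using real_arch_simple by blast
    show "\<exists>no. \<forall>n\<ge>no. norm (cell n y - y) < e"
    proof (intro exI[of _ "max k1 k2"] allI impI)
      fix n assume n: "max k1 k2 \<le> n"
      then have "\<bar>cell n y - y\<bar> \<le> mesh n" using k2 by (intro cell_near) simp
      with k1[of n] n show "norm (cell n y - y) < e" by simp
    qed
  qed
  from selection_tendsto[OF this] flow_limit[OF True, of 0] show ?thesis
    by (simp add: path_0 LIMSEQ_unique)
qed (simp add: flow_def)

lemma flow_mono: "y \<in> good \<Longrightarrow> z \<in> good \<Longrightarrow> y \<le> z \<Longrightarrow> 0 \<le> t \<Longrightarrow> flow t y \<le> flow t z"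
  by (rule LIMSEQ_le[OF flow_limit flow_limit]) (auto intro: path_mono)

lemma path_flow_bound:
  obtains B where "\<And>T. 1 \<le> B T"
    "\<And>k t T y. 0 \<le> t \<Longrightarrow> t \<le> T \<Longrightarrow> y \<in> good \<Longrightarrow> \<bar>path k t y\<bar> \<le> B T * (1 + \<bar>y\<bar>)"
    "\<And>t T y. 0 \<le> t \<Longrightarrow> t \<le> T \<Longrightarrow> \<bar>flow t y\<bar> \<le> B T * (1 + \<bar>y\<bar>)"
proof -
  obtain B where B: "\<And>T. 0 < B T"
    "\<And>k t T y. 0 \<le> t \<Longrightarrow> t \<le> T \<Longrightarrow> y \<in> good \<Longrightarrow> \<bar>path k t y\<bar> \<le> B T * (1 + \<bar>y\<bar>)"
    by (rule path_bound) blast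
  have le: "x \<le> B T * (1 + \<bar>y\<bar>) \<Longrightarrow> x \<le> max 1 (B T) * (1 + \<bar>y\<bar>)" for x y T
    by (rule order_trans) (auto intro: mult_right_mono)
  show ?thesis
  proof (rule that[of "\<lambda>T. max 1 (B T)"])
    show "\<bar>path k t y\<bar> \<le> max 1 (B T) * (1 + \<bar>y\<bar>)" if "0 \<le> t" "t \<le> T" "y \<in> good" for k t T y
      using B(2)[OF that] by (rule le)
    show "\<bar>flow t y\<bar> \<le> max 1 (B T) * (1 + \<bar>y\<bar>)" if t: "0 \<le> t" "t \<le> T" for t T y
    proof (cases "y \<in> good")
      case True
      have "\<bar>flow t y\<bar> \<le> B T * (1 + \<bar>y\<bar>)"
        by (rule LIMSEQ_le_const2[OF tendsto_rabs[OF flow_limit[OF True t(1)]]]) (use B(2)[OF t True] in auto)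
      then show ?thesis by (rule le)
    next
      case False
      have "1 * \<bar>y\<bar> \<le> max 1 (B T) * (1 + \<bar>y\<bar>)" by (intro mult_mono) auto
      then show ?thesis using False by (simp add: flow_def)
    qed
  qed simp
qed

lemma flow_time_modulus:
  assumes "0 < \<epsilon>" and y: "y \<in> good"
  obtains \<tau> where "0 < \<tau>" "\<And>s t. 0 \<le> s \<Longrightarrow> s \<le> t \<Longrightarrow> t \<le> T \<Longrightarrow> t - s \<le> \<tau> \<Longrightarrow> \<bar>flow t y - flow s y\<bar> \<le> \<epsilon>"
proof -
  obtain \<tau> k0 where \<tau>: "0 < \<tau>"
    "\<And>k s t. k0 \<le> k \<Longrightarrow> 0 \<le> s \<Longrightarrow> s \<le> t \<Longrightarrow> t \<le> T \<Longrightarrow> t - s \<le> \<tau> \<Longrightarrow> \<bar>path k t y - path k s y\<bar> \<le> \<epsilon>"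
    by (rule path_time_equicontinuous[OF assms, of T]) blast
  show ?thesis
  proof (rule that[OF \<tau>(1)])
    fix s t assume st: "0 \<le> s" "s \<le> t" "t \<le> T" "t - s \<le> \<tau>"
    have "(\<lambda>k. \<bar>path (selection k) t y - path (selection k) s y\<bar>) \<longlonglongrightarrow> \<bar>flow t y - flow s y\<bar>"
      using st y by (intro tendsto_rabs tendsto_diff flow_limit) auto
    then show "\<bar>flow t y - flow s y\<bar> \<le> \<epsilon>"
    proof (rule LIMSEQ_le_const2)
      have "\<bar>path (selection k) t y - path (selection k) s y\<bar> \<le> \<epsilon>" if "k0 \<le> k" for k
        using \<tau>(2)[of "selection k" s t] seq_suble[OF selection(1), of k] that st by auto
      then show "\<exists>N. \<forall>n\<ge>N. \<bar>path (selection n) t y - path (selection n) s y\<bar> \<le> \<epsilon>" by blast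
    qed
  qed
qed

lemma flow_continuous_nonneg: "continuous_on {0..} (\<lambda>t. flow t y)"
proof (cases "y \<in> good")
  case True
  show ?thesis unfolding continuous_on_iff
  proof (intro ballI allI impI)
    fix t e :: real assume t: "t \<in> {0..}" and e: "0 < e"
    have e2: "0 < e / 2" using e by simp
    obtain \<tau> where \<tau>: "0 < \<tau>" "\<And>s s'. 0 \<le> s \<Longrightarrow> s \<le> s' \<Longrightarrow> s' \<le> t + 1 \<Longrightarrow> s' - s \<le> \<tau> \<Longrightarrow> \<bar>flow s' y - flow s y\<bar> \<le> e / 2"
      by (rule flow_time_modulus[OF e2 True, of "t + 1"]) blast
    show "\<exists>d>0. \<forall>x'\<in>{0..}. dist x' t < d \<longrightarrow> dist (flow x' y) (flow t y) < e"
    proof (intro exI[of _ "min \<tau> 1"] conjI ballI impI)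
      fix x' assume x': "x' \<in> {0..}" "dist x' t < min \<tau> 1"
      have "\<bar>flow x' y - flow t y\<bar> \<le> e / 2"
      proof (cases "x' \<le> t")
        case True
        then show ?thesis using \<tau>(2)[of x' t] x' by (simp add: dist_real_def abs_minus_commute)
      next
        case False
        then show ?thesis using \<tau>(2)[of t x'] x' t by (simp add: dist_real_def)
      qed
      then show "dist (flow x' y) (flow t y) < e" using e by (simp add: dist_real_def)
    qed (use \<tau> in simp)
  qed
qed (simp add: flow_def)

lemma flow_continuous: "continuous_on UNIV (\<lambda>t. flow t y)"
proof -
  have "continuous_on UNIV (\<lambda>t. flow (max 0 t) y)"
    by (rule continuous_on_compose2[OF flow_continuous_nonneg]) (auto intro!: continuous_intros)
  moreover have "flow (max 0 t) y = flow t y" for t by (simp add: flow_def)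
  ultimately show ?thesis by simp
qed

text \<open>Measurable in the label and continuous in time implies jointly measurable: time is
  rounded down to a grid, which leaves countably many label functions, and the grid is
  refined.\<close>

lemma flow_pair_measurable: "(\<lambda>p. flow (fst p) (snd p)) \<in> borel_measurable (borel \<Otimes>\<^sub>M borel)"
proof (rule borel_measurable_LIMSEQ_real)
  define a where "a n t = of_int \<lfloor>t * real (Suc n)\<rfloor> / real (Suc n)" for n and t :: real
  show "(\<lambda>n. flow (a n (fst p)) (snd p)) \<longlonglongrightarrow> flow (fst p) (snd p)" for p
  proof (rule continuous_on_tendsto_compose[OF flow_continuous])
    show "(\<lambda>n. a n (fst p)) \<longlonglongrightarrow> fst p"
    proof (rule tendsto_sandwich)
      show "\<forall>\<^sub>F n in sequentially. fst p - mesh n \<le> a n (fst p)" "\<forall>\<^sub>F n in sequentially. a n (fst p) \<le> fst p"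
        unfolding a_def using floor_div by auto
      show "(\<lambda>n. fst p - mesh n) \<longlonglongrightarrow> fst p" using tendsto_diff[OF tendsto_const mesh_tendsto] by simp
    qed simp
  qed auto
  fix n
  have "(\<lambda>p. (\<lambda>i p. flow (of_int i / real (Suc n)) (snd p)) \<lfloor>fst p * real (Suc n)\<rfloor> p) \<in> borel_measurable (borel \<Otimes>\<^sub>M borel)"
    by (rule measurable_compose_countable)
      (rule measurable_compose[OF measurable_snd flow_measurable], measurable)
  then show "(\<lambda>p. flow (a n (fst p)) (snd p)) \<in> borel_measurable (borel \<Otimes>\<^sub>M borel)" by (simp add: a_def)
qed

lemma flow_measurable2 [measurable (raw)]:
  assumes "T \<in> borel_measurable M" "Y \<in> borel_measurable M"
  shows "(\<lambda>x. flow (T x) (Y x)) \<in> borel_measurable M"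
  using measurable_compose[OF measurable_Pair[OF assms] flow_pair_measurable] by simp

lemma prev_time_tendsto: "0 \<le> t \<Longrightarrow> (\<lambda>k. scheme.prev_time k t) \<longlonglongrightarrow> t"
proof (rule tendsto_sandwich)
  assume t: "0 \<le> t"
  have "t - mesh k \<le> scheme.prev_time k t" for k
    using scheme.prev_next_time[OF t, of k] by linarith
  then show "\<forall>\<^sub>F k in sequentially. t - mesh k \<le> scheme.prev_time k t" by simp
  show "\<forall>\<^sub>F k in sequentially. scheme.prev_time k t \<le> t" using scheme.prev_next_time(1)[OF t] by simp
  show "(\<lambda>k. t - mesh k) \<longlonglongrightarrow> t" using tendsto_diff[OF tendsto_const mesh_tendsto] by simp
qed simp

lemma spread_tendsto:
  assumes t: "0 \<le> t"
  shows "(\<lambda>k. scheme.spread k t) \<longlonglongrightarrow> sinh (sqrt c * t) / sqrt c"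
proof -
  define M where "M = (sqrt c * sinh (sqrt c * t) + cosh (sqrt c * t)) * exp ((1 + c) * t)"
  have "(\<lambda>k. scheme.spread k t - sinh (sqrt c * scheme.prev_time k t) / sqrt c) \<longlonglongrightarrow> 0"
  proof (rule tendsto_rabs_zero_cancel, rule tendsto_sandwich[OF _ _ tendsto_const])
    show "\<forall>\<^sub>F k in sequentially. \<bar>scheme.spread k t - sinh (sqrt c * scheme.prev_time k t) / sqrt c\<bar> \<le> mesh k * M"
      using scheme.spread_error[OF t] by (simp add: M_def mult.assoc)
    show "(\<lambda>k. mesh k * M) \<longlonglongrightarrow> 0" using tendsto_mult_right[OF mesh_tendsto, of M] by simp
  qed simp
  moreover have "(\<lambda>k. sinh (sqrt c * scheme.prev_time k t) / sqrt c) \<longlonglongrightarrow> sinh (sqrt c * t) / sqrt c"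
    using c_gt_0 by (intro tendsto_intros tendsto_sinh prev_time_tendsto t) auto
  ultimately show ?thesis using tendsto_add by fastforce
qed

text \<open>The limit of \<open>scheme.traj_contraction\<close>, with \<open>spread\<close>
  converging to sinh (sqrt c t) / sqrt c; the factor 1 / sqrt c cancels.\<close>

lemma flow_contraction:
  assumes "0 \<le> s" "s \<le> t" "y \<in> good" "z \<in> good" "y \<le> z"
  shows "(flow t z - flow t y) * sinh (sqrt c * s) \<le> (flow s z - flow s y) * sinh (sqrt c * t)"
proof -
  have "(flow t z - flow t y) * (sinh (sqrt c * s) / sqrt c) \<le> (flow s z - flow s y) * (sinh (sqrt c * t) / sqrt c)"
  proof (rule LIMSEQ_le)
    show "(\<lambda>k. (path (selection k) t z - path (selection k) t y) * scheme.spread (selection k) s) \<longlonglongrightarrow>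
      (flow t z - flow t y) * (sinh (sqrt c * s) / sqrt c)"
      using assms by (intro tendsto_mult tendsto_diff flow_limit selection_tendsto spread_tendsto) auto
    show "(\<lambda>k. (path (selection k) s z - path (selection k) s y) * scheme.spread (selection k) t) \<longlonglongrightarrow>
      (flow s z - flow s y) * (sinh (sqrt c * t) / sqrt c)"
      using assms by (intro tendsto_mult tendsto_diff flow_limit selection_tendsto spread_tendsto) auto
    show "\<exists>N. \<forall>n\<ge>N. (path (selection n) t z - path (selection n) t y) * scheme.spread (selection n) s
      \<le> (path (selection n) s z - path (selection n) s y) * scheme.spread (selection n) t"
      unfolding path_def using assms
      by (intro exI allI impI scheme.traj_contraction good_node cell_mono) auto
  qed
  then show ?thesis using c_gt_0 by (simp add: divide_le_cancel field_simps)
qed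


section \<open>Force and impulse in the limit\<close>

text \<open>The convolution of f with the law of the flow, evaluated along the path of y; the
  acceleration is its negative.\<close>

definition drag :: "real \<Rightarrow> real \<Rightarrow> real" where
  "drag t y = (\<integral>z. f (flow t y - flow t z) \<partial>\<rho>0)"

lemma drag_measurable [measurable (raw)]:
  assumes [measurable]: "T \<in> borel_measurable M" "Y \<in> borel_measurable M"
  shows "(\<lambda>x. drag (T x) (Y x)) \<in> borel_measurable M"
  unfolding drag_def by measurable

text \<open>The process A of the overview. It keeps the label's own momentum even after a collision,
  so it need not be a function of the current position.\<close>

definition impulse :: "real \<Rightarrow> real \<Rightarrow> real" where
  "impulse u y = v0 y - (LBINT r:{0..<u}. drag r y)"

lemma impulse_measurable [measurable (raw)]:
  assumes [measurable]: "T \<in> borel_measurable M" "Y \<in> borel_measurable M"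
  shows "(\<lambda>x. impulse (T x) (Y x)) \<in> borel_measurable M"
proof -
  have "(\<lambda>x. \<integral>r. (if 0 \<le> r \<and> r < T x then drag r (Y x) else 0) \<partial>lborel) \<in> borel_measurable M"
    by measurable
  moreover have "(if 0 \<le> r \<and> r < T x then drag r (Y x) else 0) = indicator {0..<T x} r *\<^sub>R drag r (Y x)" for r x
    by (simp add: indicator_def)
  ultimately show ?thesis unfolding impulse_def set_lebesgue_integral_def by simp
qed

lemma scheme_force_eq:
  "scheme.force k (scheme.traj k t) (cell k y) = - (\<integral>z. f (path k t y - path k t z) \<partial>\<rho>0)"
  unfolding scheme.force_def path_def by (subst sum_nodes) simp

lemma path_next_tendsto:
  assumes y: "y \<in> good" and r: "0 \<le> r"
  shows "(\<lambda>k. path (selection k) (scheme.next_time (selection k) r) y) \<longlonglongrightarrow> flow r y"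
proof -
  have "(\<lambda>k. path k (scheme.next_time k r) y - path k r y) \<longlonglongrightarrow> 0"
  proof (rule LIMSEQ_I)
    fix e :: real assume "0 < e"
    then have e2: "0 < e / 2" by simp
    obtain \<tau> k0 where \<tau>: "0 < \<tau>"
      "\<And>k s t. k0 \<le> k \<Longrightarrow> 0 \<le> s \<Longrightarrow> s \<le> t \<Longrightarrow> t \<le> r + 1 \<Longrightarrow> t - s \<le> \<tau> \<Longrightarrow> \<bar>path k t y - path k s y\<bar> \<le> e / 2"
      by (rule path_time_equicontinuous[OF e2 y, of "r + 1"]) blast
    obtain k1 where k1: "\<And>k. k1 \<le> k \<Longrightarrow> mesh k < \<tau>"
      using order_tendstoD(2)[OF mesh_tendsto \<tau>(1)] by (auto simp: eventually_sequentially)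
    show "\<exists>no. \<forall>n\<ge>no. norm (path n (scheme.next_time n r) y - path n r y - 0) < e"
    proof (intro exI[of _ "max k0 k1"] allI impI)
      fix n assume n: "max k0 k1 \<le> n"
      then have "\<bar>path n (scheme.next_time n r) y - path n r y\<bar> \<le> e / 2"
        using scheme.prev_next_time[OF r, of n] mesh[of n] k1[of n] r by (intro \<tau>(2)) auto
      then show "norm (path n (scheme.next_time n r) y - path n r y - 0) < e" using \<open>0 < e\<close> by simp
    qed
  qed
  from tendsto_add[OF selection_tendsto[OF this] flow_limit[OF y r]] show ?thesis by simp
qed

lemma drag_limit:
  obtains C where "\<And>T. 0 < C T"
    "\<And>k r T y. 0 \<le> r \<Longrightarrow> r \<le> T \<Longrightarrow> y \<in> good \<Longrightarrow>
       \<bar>scheme.force k (scheme.traj k (scheme.next_time k r)) (cell k y)\<bar> \<le> C T * (1 + \<bar>y\<bar>)"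
    "\<And>r y. 0 \<le> r \<Longrightarrow> y \<in> good \<Longrightarrow>
       (\<lambda>k. scheme.force (selection k) (scheme.traj (selection k) (scheme.next_time (selection k) r)) (cell (selection k) y)) \<longlonglongrightarrow> - drag r y"
    "\<And>r T y. 0 \<le> r \<Longrightarrow> r \<le> T \<Longrightarrow> \<bar>drag r y\<bar> \<le> C T * (1 + \<bar>y\<bar>)"
    "\<And>r T y z. 0 \<le> r \<Longrightarrow> r \<le> T \<Longrightarrow> \<bar>f (flow r y - flow r z)\<bar> \<le> C T * (1 + \<bar>y\<bar>) + C T * \<bar>z\<bar>"
proof -
  obtain B where B: "\<And>T. 1 \<le> B T"
    "\<And>k t T y. 0 \<le> t \<Longrightarrow> t \<le> T \<Longrightarrow> y \<in> good \<Longrightarrow> \<bar>path k t y\<bar> \<le> B T * (1 + \<bar>y\<bar>)"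
    "\<And>t T y. 0 \<le> t \<Longrightarrow> t \<le> T \<Longrightarrow> \<bar>flow t y\<bar> \<le> B T * (1 + \<bar>y\<bar>)"
    by (rule path_flow_bound) blast
  \<comment> \<open>The force is evaluated at \<open>next_time r\<close>, which may exceed T by a
    mesh width, hence T + 1.\<close>
  define D where "D T = 3 * (K + 1) * B (T + 1)" for T
  define m1 where "m1 = (\<integral>z. \<bar>z\<bar> \<partial>\<rho>0)"
  have m10: "0 \<le> m1" by (simp add: m1_def)
  have D0: "0 < D T" for T using K_nonneg B(1)[of "T+1"] by (simp add: D_def)
  have fb: "\<bar>f (p - q)\<bar> \<le> D T * (1 + \<bar>y\<bar>) + D T * \<bar>z\<bar>"
    if "\<bar>p\<bar> \<le> B (T+1) * (1 + \<bar>y\<bar>)" "\<bar>q\<bar> \<le> B (T+1) * (1 + \<bar>z\<bar>)" for p q T y z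
  proof -
    let ?b = "B (T + 1)"
    have "\<bar>f (p - q)\<bar> \<le> K * (1 + \<bar>p - q\<bar>)" by (rule f_growth)
    also have "\<dots> \<le> (K + 1) * (?b * (3 * (1 + \<bar>y\<bar> + \<bar>z\<bar>)))"
    proof (rule mult_mono)
      have "1 + \<bar>p - q\<bar> \<le> ?b + ?b * (1 + \<bar>y\<bar>) + ?b * (1 + \<bar>z\<bar>)"
        using that B(1)[of "T+1"] by linarith
      also have "\<dots> = ?b * (3 + \<bar>y\<bar> + \<bar>z\<bar>)" by (simp add: algebra_simps)
      also have "\<dots> \<le> ?b * (3 * (1 + \<bar>y\<bar> + \<bar>z\<bar>))" using B(1)[of "T+1"] by (intro mult_left_mono) auto
      finally show "1 + \<bar>p - q\<bar> \<le> ?b * (3 * (1 + \<bar>y\<bar> + \<bar>z\<bar>))" .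
    qed (use K_nonneg in auto)
    also have "\<dots> = D T * (1 + \<bar>y\<bar>) + D T * \<bar>z\<bar>" by (simp add: D_def algebra_simps)
    finally show ?thesis .
  qed
  have intb: "integrable \<rho>0 (\<lambda>z. D T * (1 + \<bar>y\<bar>) + D T * \<bar>z\<bar>)" for T y
    by (rule integrable_affine)
  have intv: "(\<integral>z. D T * (1 + \<bar>y\<bar>) + D T * \<bar>z\<bar> \<partial>\<rho>0) \<le> D T * (1 + m1) * (1 + \<bar>y\<bar>)" for T y
  proof -
    have "integrable \<rho>0 (\<lambda>z. \<bar>z\<bar>)" using integrable_affine[of 0 1] by simp
    then have "(\<integral>z. D T * (1 + \<bar>y\<bar>) + D T * \<bar>z\<bar> \<partial>\<rho>0) = D T * (1 + \<bar>y\<bar>) + D T * m1"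
      by (simp add: m1_def prob_UNIV)
    also have "\<dots> \<le> D T * (1 + \<bar>y\<bar>) + D T * m1 * (1 + \<bar>y\<bar>)"
      using D0[of T] m10 by (simp add: distrib_left)
    also have "\<dots> = D T * (1 + m1) * (1 + \<bar>y\<bar>)" by (simp add: algebra_simps)
    finally show ?thesis .
  qed
  have le: "D T \<le> D T * (1 + m1)" for T using D0[of T] m10 by (simp add: distrib_left)
  show ?thesis
  proof (rule that[of "\<lambda>T. D T * (1 + m1)"])
    show "0 < D T * (1 + m1)" for T using D0[of T] le[of T] by linarith
    have pb: "\<bar>path k (scheme.next_time k r) y\<bar> \<le> B (T + 1) * (1 + \<bar>y\<bar>)"
      if "0 \<le> r" "r \<le> T" "y \<in> good" for k r T y
      using scheme.prev_next_time[OF that(1), of k] mesh[of k] that by (intro B(2)) auto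
    show "\<bar>scheme.force k (scheme.traj k (scheme.next_time k r)) (cell k y)\<bar> \<le> D T * (1 + m1) * (1 + \<bar>y\<bar>)"
      if "0 \<le> r" "r \<le> T" "y \<in> good" for k r T y
    proof -
      let ?t = "scheme.next_time k r"
      have "\<bar>\<integral>z. f (path k ?t y - path k ?t z) \<partial>\<rho>0\<bar> \<le> (\<integral>z. D T * (1 + \<bar>y\<bar>) + D T * \<bar>z\<bar> \<partial>\<rho>0)"
      proof (rule integral_abs_le_AE)
        show "integrable \<rho>0 (\<lambda>z. f (path k ?t y - path k ?t z))"
          using cell_comp_integrable[of "\<lambda>w. f (path k ?t y - scheme.traj k ?t w)" k] by (simp add: path_def)
        show "AE z in \<rho>0. \<bar>f (path k ?t y - path k ?t z)\<bar> \<le> D T * (1 + \<bar>y\<bar>) + D T * \<bar>z\<bar>"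
          using AE_good by eventually_elim (use pb[OF that(1,2)] that(3) fb in auto)
      qed (rule intb)
      then show ?thesis using intv[of T y] unfolding scheme_force_eq by simp
    qed
    show "(\<lambda>k. scheme.force (selection k) (scheme.traj (selection k) (scheme.next_time (selection k) r)) (cell (selection k) y)) \<longlonglongrightarrow> - drag r y"
      if r: "0 \<le> r" and y: "y \<in> good" for r y
      unfolding scheme_force_eq drag_def
    proof (rule tendsto_minus, rule integral_dominated_convergence[OF _ _ intb[of r y]])
      show "AE z in \<rho>0. (\<lambda>k. f (path (selection k) (scheme.next_time (selection k) r) y - path (selection k) (scheme.next_time (selection k) r) z)) \<longlonglongrightarrow> f (flow r y - flow r z)"
        using AE_good
      proof eventually_elim
        case (elim z)
        show ?case
          by (rule continuous_on_tendsto_compose[OF f_cont]) (auto intro!: tendsto_diff path_next_tendsto y r elim)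
      qed
      show "AE z in \<rho>0. norm (f (path (selection k) (scheme.next_time (selection k) r) y - path (selection k) (scheme.next_time (selection k) r) z)) \<le> D r * (1 + \<bar>y\<bar>) + D r * \<bar>z\<bar>" for k
        using AE_good by eventually_elim (use pb[OF r order_refl] y fb in auto)
    qed auto
    have ff: "\<bar>f (flow r y - flow r z)\<bar> \<le> D T * (1 + \<bar>y\<bar>) + D T * \<bar>z\<bar>"
      if "0 \<le> r" "r \<le> T" for r T y z
      using that by (intro fb B(3)) auto
    show "\<bar>drag r y\<bar> \<le> D T * (1 + m1) * (1 + \<bar>y\<bar>)" if "0 \<le> r" "r \<le> T" for r T y
    proof -
      have "\<bar>drag r y\<bar> \<le> (\<integral>z. D T * (1 + \<bar>y\<bar>) + D T * \<bar>z\<bar> \<partial>\<rho>0)"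
        unfolding drag_def
      proof (rule integral_abs_le_AE)
        show "integrable \<rho>0 (\<lambda>z. f (flow r y - flow r z))"
          proof (rule Bochner_Integration.integrable_bound[OF intb[of T y]])
            show "AE z in \<rho>0. norm (f (flow r y - flow r z)) \<le> norm (D T * (1 + \<bar>y\<bar>) + D T * \<bar>z\<bar>)"
              by (rule AE_I2) (simp only: real_norm_def, rule order_trans[OF ff[OF that] abs_ge_self])
          qed measurable
        show "AE z in \<rho>0. \<bar>f (flow r y - flow r z)\<bar> \<le> D T * (1 + \<bar>y\<bar>) + D T * \<bar>z\<bar>" using ff[OF that] by simp
      qed (rule intb)
      then show ?thesis using intv[of T y] by simp
    qed
    show "\<bar>f (flow r y - flow r z)\<bar> \<le> D T * (1 + m1) * (1 + \<bar>y\<bar>) + D T * (1 + m1) * \<bar>z\<bar>"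
      if "0 \<le> r" "r \<le> T" for r T y z
    proof -
      have "D T * (1 + \<bar>y\<bar>) \<le> D T * (1 + m1) * (1 + \<bar>y\<bar>)" "D T * \<bar>z\<bar> \<le> D T * (1 + m1) * \<bar>z\<bar>"
        using le by (auto intro: mult_right_mono)
      with ff[OF that, of y z] show ?thesis by linarith
    qed
  qed
qed

lemma impulse_limit:
  obtains C where "\<And>T. 0 < C T"
    "\<And>k u T y. 0 \<le> u \<Longrightarrow> u \<le> T \<Longrightarrow> y \<in> good \<Longrightarrow> \<bar>scheme.accel k u (cell k y)\<bar> \<le> C T * (1 + \<bar>y\<bar>)"
    "\<And>u y. 0 \<le> u \<Longrightarrow> y \<in> good \<Longrightarrow> (\<lambda>k. scheme.accel (selection k) u (cell (selection k) y)) \<longlonglongrightarrow> impulse u y"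
proof -
  obtain C where C: "\<And>T. 0 < C T"
    "\<And>k r T y. 0 \<le> r \<Longrightarrow> r \<le> T \<Longrightarrow> y \<in> good \<Longrightarrow>
       \<bar>scheme.force k (scheme.traj k (scheme.next_time k r)) (cell k y)\<bar> \<le> C T * (1 + \<bar>y\<bar>)"
    "\<And>r y. 0 \<le> r \<Longrightarrow> y \<in> good \<Longrightarrow>
       (\<lambda>k. scheme.force (selection k) (scheme.traj (selection k) (scheme.next_time (selection k) r)) (cell (selection k) y)) \<longlonglongrightarrow> - drag r y"
    by (rule drag_limit) blast
  obtain L where L: "0 \<le> L" "\<And>x. \<bar>v0 x\<bar> \<le> L * (1 + \<bar>x\<bar>)" by (rule v0_affine) blast
  define C' where "C' T = 2 * L + C T * \<bar>T\<bar> + 1" for T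
  show ?thesis
  proof (rule that[of C'])
    show "0 < C' T" for T using L(1) C(1)[of T] by (simp add: C'_def add_nonneg_pos)
    show "\<bar>scheme.accel k u (cell k y)\<bar> \<le> C' T * (1 + \<bar>y\<bar>)" if "0 \<le> u" "u \<le> T" "y \<in> good" for k u T y
    proof -
      have p: "0 \<le> scheme.prev_time k u" "scheme.prev_time k u \<le> u" using scheme.prev_next_time[OF that(1)] by auto
      have "\<bar>LBINT r:{0..<scheme.prev_time k u}. scheme.force k (scheme.traj k (scheme.next_time k r)) (cell k y)\<bar>
        \<le> (C T * (1 + \<bar>y\<bar>)) * (scheme.prev_time k u - 0)"
        by (rule set_integral_abs_le[OF p(1) scheme.force_integrable]) (use C(2) p that in auto)
      also have "\<dots> \<le> (C T * (1 + \<bar>y\<bar>)) * \<bar>T\<bar>"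
        using p that C(1)[of T] by (intro mult_left_mono) auto
      finally have 1: "\<bar>LBINT r:{0..<scheme.prev_time k u}. scheme.force k (scheme.traj k (scheme.next_time k r)) (cell k y)\<bar> \<le> C T * \<bar>T\<bar> * (1 + \<bar>y\<bar>)"
        by (simp add: mult_ac)
      have "\<bar>v0 (cell k y)\<bar> \<le> L * (1 + (\<bar>y\<bar> + 1))"
        using L(2)[of "cell k y"] mult_left_mono[OF cell_abs_le[of k y] L(1)] by (simp add: distrib_left)
      also have "\<dots> \<le> L * (2 * (1 + \<bar>y\<bar>))" using L(1) by (intro mult_left_mono) auto
      also have "\<dots> = 2 * L * (1 + \<bar>y\<bar>)" by simp
      finally have 2: "\<bar>v0 (cell k y)\<bar> \<le> 2 * L * (1 + \<bar>y\<bar>)" .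
      have "C' T * (1 + \<bar>y\<bar>) = 2 * L * (1 + \<bar>y\<bar>) + C T * \<bar>T\<bar> * (1 + \<bar>y\<bar>) + (1 + \<bar>y\<bar>)"
        by (simp add: C'_def distrib_right)
      with 1 2 show ?thesis unfolding scheme.accel_def by linarith
    qed
    show "(\<lambda>k. scheme.accel (selection k) u (cell (selection k) y)) \<longlonglongrightarrow> impulse u y"
      if u: "0 \<le> u" and y: "y \<in> good" for u y
    proof -
      have "(\<lambda>k. LBINT r:{0..<scheme.prev_time (selection k) u}. scheme.force (selection k) (scheme.traj (selection k) (scheme.next_time (selection k) r)) (cell (selection k) y))
        \<longlonglongrightarrow> (LBINT r:{0..<u}. - drag r y)"
      proof (rule conjunct2[OF set_integral_step_limit[where C="C u * (1 + \<bar>y\<bar>)" and a'="\<lambda>_. 0"]])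
        show "(\<lambda>k. scheme.prev_time (selection k) u) \<longlonglongrightarrow> u"
          by (rule selection_tendsto[OF prev_time_tendsto[OF u]])
      qed (use scheme.prev_next_time[OF u] C(2,3) u y scheme.force_integrable in auto)
      moreover have "(\<lambda>k. v0 (cell (selection k) y)) \<longlonglongrightarrow> v0 y"
      proof (rule continuous_on_tendsto_compose[OF v0_cont])
        show "(\<lambda>k. cell (selection k) y) \<longlonglongrightarrow> y"
          using flow_limit[OF y, of 0] by (simp add: path_0 flow_0)
      qed auto
      ultimately show ?thesis unfolding scheme.accel_def impulse_def
        using tendsto_add by (fastforce simp: set_lebesgue_integral_def)
    qed
  qed
qed

text \<open>\<open>scheme.traj_momentum\<close> in the limit. Everything in it is linear except g,
  whose argument converges pointwise and which is continuous; affine growth in the label and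
  boundedness of g supply the dominating function.\<close>

lemma flow_momentum:
  assumes st: "0 \<le> s" "s \<le> t" and g: "continuous_on UNIV g" "\<And>x. \<bar>g x\<bar> \<le> b"
  shows "(\<integral>y. (flow t y - flow s y - (LBINT u:{s..<t}. impulse u y)) * g (flow t y) \<partial>\<rho>0) = 0"
proof -
  obtain C where C: "\<And>T. 0 < C T"
    "\<And>k u T y. 0 \<le> u \<Longrightarrow> u \<le> T \<Longrightarrow> y \<in> good \<Longrightarrow> \<bar>scheme.accel k u (cell k y)\<bar> \<le> C T * (1 + \<bar>y\<bar>)"
    "\<And>u y. 0 \<le> u \<Longrightarrow> y \<in> good \<Longrightarrow> (\<lambda>k. scheme.accel (selection k) u (cell (selection k) y)) \<longlonglongrightarrow> impulse u y"
    by (rule impulse_limit) blast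
  obtain B where B: "\<And>T. 1 \<le> B T"
    "\<And>k t T y. 0 \<le> t \<Longrightarrow> t \<le> T \<Longrightarrow> y \<in> good \<Longrightarrow> \<bar>path k t y\<bar> \<le> B T * (1 + \<bar>y\<bar>)"
    by (rule path_flow_bound) blast
  have t: "0 \<le> t" using st by simp
  have b0: "0 \<le> b" using g(2)[of 0] by simp
  have [measurable]: "g \<in> borel_measurable borel" using g(1) by (rule borel_measurable_continuous_onI)
  define I where "I k y = (LBINT u:{scheme.prev_time k s..<scheme.prev_time k t}. scheme.accel k u (cell k y))" for k y
  define J where "J y = (LBINT u:{s..<t}. impulse u y)" for y
  define \<Phi> where "\<Phi> k y = (path k t y - path k s y - I k y) * g (path k t y)" for k y
  have zero: "(\<integral>y. \<Phi> k y \<partial>\<rho>0) = 0" for k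
  proof -
    have "(\<integral>y. \<Phi> k y \<partial>\<rho>0) = (\<Sum>z\<in>nodes k. mass k z * ((scheme.traj k t z - scheme.traj k s z -
        (LBINT u:{scheme.prev_time k s..<scheme.prev_time k t}. scheme.accel k u z)) * g (scheme.traj k t z)))"
      unfolding \<Phi>_def path_def I_def by (rule sum_nodes[symmetric])
    also have "\<dots> = 0" using scheme.traj_momentum[OF st, of k g] by (simp only: mult.assoc)
    finally show ?thesis .
  qed
  have \<Phi>m: "\<Phi> k \<in> borel_measurable \<rho>0" for k
    using cell_comp_measurable[of "\<lambda>z. (scheme.traj k t z - scheme.traj k s z -
        (LBINT u:{scheme.prev_time k s..<scheme.prev_time k t}. scheme.accel k u z)) * g (scheme.traj k t z)" k]
    unfolding \<Phi>_def[abs_def] path_def I_def by simp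
  have Ilim: "(\<lambda>k. I (selection k) y) \<longlonglongrightarrow> J y" if y: "y \<in> good" for y
    unfolding I_def J_def
  proof (rule conjunct2[OF set_integral_step_limit[where C="C t * (1 + \<bar>y\<bar>)"]])
    show "(\<lambda>k. scheme.prev_time (selection k) s) \<longlonglongrightarrow> s"
      by (rule selection_tendsto[OF prev_time_tendsto[OF st(1)]])
    show "(\<lambda>k. scheme.prev_time (selection k) t) \<longlonglongrightarrow> t"
      by (rule selection_tendsto[OF prev_time_tendsto[OF t]])
  qed (use scheme.prev_next_time[OF st(1)] scheme.prev_next_time[OF t] C(2,3) st y scheme.accel_integrable[OF st] in auto)
  have \<Phi>lim: "(\<lambda>k. \<Phi> (selection k) y) \<longlonglongrightarrow> (flow t y - flow s y - J y) * g (flow t y)" if y: "y \<in> good" for y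
    unfolding \<Phi>_def using st t y
    by (intro tendsto_mult tendsto_diff flow_limit Ilim continuous_on_tendsto_compose[OF g(1)]) auto
  define w where "w y = (2 * B t + C t * t) * b + (2 * B t + C t * t) * b * \<bar>y\<bar>" for y
  have \<Phi>bd: "\<bar>\<Phi> k y\<bar> \<le> w y" if y: "y \<in> good" for k y
  proof -
    have pt: "scheme.prev_time k s \<le> scheme.prev_time k t" by (rule scheme.prev_time_mono[OF st])
    have "\<bar>I k y\<bar> \<le> (C t * (1 + \<bar>y\<bar>)) * (scheme.prev_time k t - scheme.prev_time k s)"
      unfolding I_def
    proof (rule set_integral_abs_le[OF pt scheme.accel_integrable[OF st]])
      fix u assume "scheme.prev_time k s \<le> u" "u < scheme.prev_time k t"
      then show "\<bar>scheme.accel k u (cell k y)\<bar> \<le> C t * (1 + \<bar>y\<bar>)"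
        using scheme.prev_next_time[OF st(1), of k] scheme.prev_next_time[OF t, of k] by (intro C(2) y) auto
    qed
    also have "\<dots> \<le> (C t * (1 + \<bar>y\<bar>)) * t"
      using scheme.prev_next_time[OF st(1), of k] scheme.prev_next_time[OF t, of k] C(1)[of t]
      by (intro mult_left_mono) auto
    finally have "\<bar>path k t y - path k s y - I k y\<bar> \<le> B t * (1 + \<bar>y\<bar>) + B t * (1 + \<bar>y\<bar>) + C t * t * (1 + \<bar>y\<bar>)"
    proof -
      assume "\<bar>I k y\<bar> \<le> C t * (1 + \<bar>y\<bar>) * t"
      moreover have "C t * (1 + \<bar>y\<bar>) * t = C t * t * (1 + \<bar>y\<bar>)" by simp
      ultimately show ?thesis using B(2)[OF t order_refl y, of k] B(2)[OF st y, of k] by linarith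
    qed
    also have "\<dots> = (2 * B t + C t * t) * (1 + \<bar>y\<bar>)" by (simp add: algebra_simps)
    finally have "\<bar>\<Phi> k y\<bar> \<le> ((2 * B t + C t * t) * (1 + \<bar>y\<bar>)) * b"
      unfolding \<Phi>_def abs_mult using g(2) b0 by (intro mult_mono) (auto intro: order_trans[OF abs_ge_zero])
    then show ?thesis by (simp add: w_def algebra_simps)
  qed
  \<comment> \<open>Convergence is known on good labels only; setting the limit to 0 elsewhere makes
    it a pointwise limit of measurable functions.\<close>
  have "(\<lambda>k. \<integral>y. \<Phi> (selection k) y \<partial>\<rho>0) \<longlonglongrightarrow> (\<integral>y. (if y \<in> good then (flow t y - flow s y - J y) * g (flow t y) else 0) \<partial>\<rho>0)"
  proof (rule integral_dominated_convergence[where w=w])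
    show lim: "AE y in \<rho>0. (\<lambda>k. \<Phi> (selection k) y) \<longlonglongrightarrow> (if y \<in> good then (flow t y - flow s y - J y) * g (flow t y) else 0)"
      using AE_good by eventually_elim (simp add: \<Phi>lim)
    show "integrable \<rho>0 w" unfolding w_def by (rule integrable_affine)
    show "AE y in \<rho>0. norm (\<Phi> (selection k) y) \<le> w y" for k
      using AE_good by eventually_elim (simp add: \<Phi>bd)
    show "(\<lambda>y. if y \<in> good then (flow t y - flow s y - J y) * g (flow t y) else 0) \<in> borel_measurable \<rho>0"
    proof (rule borel_measurable_LIMSEQ_real)
      show "(\<lambda>k. if y \<in> good then \<Phi> (selection k) y else 0) \<longlonglongrightarrow> (if y \<in> good then (flow t y - flow s y - J y) * g (flow t y) else 0)" for y
        using \<Phi>lim[of y] by auto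
    qed (use \<Phi>m in measurable)
  qed (rule \<Phi>m)
  then have "(\<integral>y. (if y \<in> good then (flow t y - flow s y - J y) * g (flow t y) else 0) \<partial>\<rho>0) = 0"
    by (simp add: zero LIMSEQ_const_iff)
  moreover have "(\<integral>y. (flow t y - flow s y - J y) * g (flow t y) \<partial>\<rho>0) = (\<integral>y. (if y \<in> good then (flow t y - flow s y - J y) * g (flow t y) else 0) \<partial>\<rho>0)"
  proof (rule integral_cong_AE)
    show "(\<lambda>y. (flow t y - flow s y - J y) * g (flow t y)) \<in> borel_measurable \<rho>0"
    proof -
      have "(\<lambda>y. \<integral>u. indicator {s..<t} u *\<^sub>R impulse u y \<partial>lborel) \<in> borel_measurable \<rho>0" by measurable
      then show ?thesis unfolding J_def set_lebesgue_integral_def by measurable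
    qed
    then show "(\<lambda>y. if y \<in> good then (flow t y - flow s y - J y) * g (flow t y) else 0) \<in> borel_measurable \<rho>0"
      by measurable
    show "AE y in \<rho>0. (flow t y - flow s y - J y) * g (flow t y) = (if y \<in> good then (flow t y - flow s y - J y) * g (flow t y) else 0)"
      using AE_good by eventually_elim simp
  qed
  ultimately show ?thesis by (simp add: J_def)
qed

end

section \<open>The velocity field\<close>

text \<open>The sets \<open>{q<..}\<close> with rational \<open>q\<close> determine finite measures, here those with densities
  the positive and the negative part of \<open>h\<close>, transported by \<open>X\<close>.\<close>

lemma orthogonal_to_functions_of:
  fixes h X :: "'a \<Rightarrow> real" and g :: "real \<Rightarrow> real"
  assumes h: "integrable M h" and X[measurable]: "X \<in> borel_measurable M"
    and q: "\<And>q. q \<in> \<rat> \<Longrightarrow> (\<integral>x. h x * indicator {q<..} (X x) \<partial>M) = 0"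
    and g[measurable]: "g \<in> borel_measurable borel" and hg: "integrable M (\<lambda>x. h x * g (X x))"
  shows "(\<integral>x. h x * g (X x) \<partial>M) = 0"
proof -
  have [measurable]: "h \<in> borel_measurable M" using h by simp
  \<comment> \<open>Rational thresholds decreasing to a are enough, since the indicators of the open
    half lines then converge pointwise.\<close>
  have real_q: "(\<integral>x. h x * indicator {a<..} (X x) \<partial>M) = 0" for a
  proof -
    have "\<exists>q\<in>\<rat>. a < q \<and> q < a + 1 / real (Suc n)" for n
      using Rats_dense_in_real[of a "a + 1 / real (Suc n)"] by auto
    then obtain r where r: "\<And>n. r n \<in> \<rat>" "\<And>n. a < r n" "\<And>n. r n < a + 1 / real (Suc n)" by metis
    have ra: "r \<longlonglongrightarrow> a"
    proof (rule tendsto_sandwich)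
      show "\<forall>\<^sub>F n in sequentially. a \<le> r n" "\<forall>\<^sub>F n in sequentially. r n \<le> a + 1 / real (Suc n)"
        by (rule always_eventually, rule allI, rule less_imp_le, rule r)+
      show "(\<lambda>n. a + 1 / real (Suc n)) \<longlonglongrightarrow> a"
        using tendsto_add[OF tendsto_const LIMSEQ_inverse_real_of_nat] by (simp add: inverse_eq_divide)
    qed simp
    have "(\<lambda>n. \<integral>x. h x * indicator {r n<..} (X x) \<partial>M) \<longlonglongrightarrow> (\<integral>x. h x * indicator {a<..} (X x) \<partial>M)"
    proof (rule integral_dominated_convergence[where w="\<lambda>x. \<bar>h x\<bar>"])
      show "AE x in M. (\<lambda>n. h x * indicator {r n<..} (X x)) \<longlonglongrightarrow> h x * indicator {a<..} (X x)"
      proof (rule AE_I2)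
        fix x
        have "(\<lambda>n. indicator {r n<..} (X x) :: real) \<longlonglongrightarrow> indicator {a<..} (X x)"
        proof (cases "a < X x")
          case True
          then have "\<forall>\<^sub>F n in sequentially. r n < X x" using order_tendstoD(2)[OF ra] by blast
          then have "\<forall>\<^sub>F n in sequentially. indicator {r n<..} (X x) = (1::real)" by eventually_elim simp
          then show ?thesis using True by (simp add: tendsto_eventually)
        next
          case False
          then have "\<not> r n < X x" for n using r(2)[of n] by simp
          then show ?thesis using False by simp
        qed
        then show "(\<lambda>n. h x * indicator {r n<..} (X x)) \<longlonglongrightarrow> h x * indicator {a<..} (X x)"
          by (rule tendsto_mult_left)
      qed
    qed (use h in \<open>auto simp: indicator_def\<close>)
    then show ?thesis using q r(1) by (simp add: LIMSEQ_const_iff)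
  qed
  define p n where "p x = max 0 (h x)" and "n x = max 0 (- h x)" for x
  have pn: "h x = p x - n x" "0 \<le> p x" "0 \<le> n x" "\<bar>p x\<bar> \<le> \<bar>h x\<bar>" "\<bar>n x\<bar> \<le> \<bar>h x\<bar>" for x
    by (auto simp: p_def n_def)
  have [measurable]: "p \<in> borel_measurable M" "n \<in> borel_measurable M" unfolding p_def n_def by measurable
  have ip: "integrable M (\<lambda>x. p x * k x)" if [measurable]: "integrable M (\<lambda>x. h x * k x)" "k \<in> borel_measurable M" for k
  proof (rule Bochner_Integration.integrable_bound[OF that(1)])
    show "AE x in M. norm (p x * k x) \<le> norm (h x * k x)"
      unfolding real_norm_def abs_mult by (intro AE_I2 mult_right_mono pn(4) abs_ge_zero)
  qed measurable
  have inn: "integrable M (\<lambda>x. n x * k x)" if [measurable]: "integrable M (\<lambda>x. h x * k x)" "k \<in> borel_measurable M" for k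
  proof (rule Bochner_Integration.integrable_bound[OF that(1)])
    show "AE x in M. norm (n x * k x) \<le> norm (h x * k x)"
      unfolding real_norm_def abs_mult by (intro AE_I2 mult_right_mono pn(5) abs_ge_zero)
  qed measurable
  have hi: "integrable M (\<lambda>x. h x * indicator {a<..} (X x))" for a
    by (rule Bochner_Integration.integrable_bound[OF h]) (auto simp: indicator_def)
  define \<mu> \<nu> where "\<mu> = distr (density M p) borel X" and "\<nu> = distr (density M n) borel X"
  have em: "emeasure (distr (density M (\<lambda>x. ennreal (k x))) borel X) {a<..} = ennreal (\<integral>x. k x * indicator {a<..} (X x) \<partial>M)"
    if [measurable]: "k \<in> borel_measurable M" and "\<And>x. 0 \<le> k x" "integrable M (\<lambda>x. k x * indicator {a<..} (X x))" for k a
  proof -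
    have "emeasure (distr (density M (\<lambda>x. ennreal (k x))) borel X) {a<..} = (\<integral>\<^sup>+x. ennreal (k x) * indicator (X -` {a<..} \<inter> space M) x \<partial>M)"
      by (subst emeasure_distr) (auto intro!: emeasure_density)
    also have "\<dots> = (\<integral>\<^sup>+x. ennreal (k x * indicator {a<..} (X x)) \<partial>M)"
      using that by (intro nn_integral_cong) (auto simp: indicator_def)
    also have "\<dots> = ennreal (\<integral>x. k x * indicator {a<..} (X x) \<partial>M)"
      using that by (intro nn_integral_eq_integral) auto
    finally show ?thesis .
  qed
  have "\<mu> = \<nu>"
  proof (rule measure_eqI_lessThan)
    fix a
    have "(\<integral>x. p x * indicator {a<..} (X x) \<partial>M) - (\<integral>x. n x * indicator {a<..} (X x) \<partial>M) = (\<integral>x. h x * indicator {a<..} (X x) \<partial>M)"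
      using ip[OF hi] inn[OF hi] by (subst Bochner_Integration.integral_diff[symmetric]) (auto simp: pn(1) left_diff_distrib)
    then have "(\<integral>x. p x * indicator {a<..} (X x) \<partial>M) = (\<integral>x. n x * indicator {a<..} (X x) \<partial>M)"
      using real_q[of a] by simp
    then show "emeasure \<mu> {a<..} = emeasure \<nu> {a<..}" "emeasure \<mu> {a<..} < \<infinity>"
      unfolding \<mu>_def \<nu>_def using ip[OF hi] inn[OF hi] pn by (simp_all add: em)
  qed (auto simp: \<mu>_def \<nu>_def)
  then have "(\<integral>x. g x \<partial>\<mu>) = (\<integral>x. g x \<partial>\<nu>)" by simp
  then have eq: "(\<integral>x. p x * g (X x) \<partial>M) = (\<integral>x. n x * g (X x) \<partial>M)"
    unfolding \<mu>_def \<nu>_def using pn by (simp add: integral_distr integral_density)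
  have "(\<integral>x. h x * g (X x) \<partial>M) = (\<integral>x. p x * g (X x) \<partial>M) - (\<integral>x. n x * g (X x) \<partial>M)"
    using ip[OF hg] inn[OF hg] by (subst Bochner_Integration.integral_diff[symmetric]) (auto simp: pn(1) left_diff_distrib)
  then show ?thesis using eq by simp
qed

context euler_data
begin

lemma impulse_diff:
  assumes "0 \<le> s" "s \<le> t"
  shows "impulse t y = impulse s y - (LBINT r:{s..<t}. drag r y)"
  and "set_integrable lborel {s..<t} (\<lambda>r. drag r y)"
proof -
  obtain C where C: "\<And>r T y. 0 \<le> r \<Longrightarrow> r \<le> T \<Longrightarrow> \<bar>drag r y\<bar> \<le> C T * (1 + \<bar>y\<bar>)"
    by (rule drag_limit) blast
  have int: "set_integrable lborel {a..<b} (\<lambda>r. drag r y)" if "0 \<le> a" "a \<le> b" for a b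
    unfolding set_integrable_def
  proof (rule Bochner_Integration.integrable_bound)
    show "integrable lborel (\<lambda>r. indicator {a..<b} r * (C b * (1 + \<bar>y\<bar>)))"
      using that by (intro integrable_mult_left) simp
    show "AE r in lborel. norm (indicator {a..<b} r *\<^sub>R drag r y) \<le> norm (indicator {a..<b} r * (C b * (1 + \<bar>y\<bar>)))"
    proof (rule AE_I2)
      fix r
      show "norm (indicator {a..<b} r *\<^sub>R drag r y) \<le> norm (indicator {a..<b} r * (C b * (1 + \<bar>y\<bar>)))"
        using C[of r b y] that by (cases "r \<in> {a..<b}") auto
    qed
  qed measurable
  have "{0..<t} = {0..<s} \<union> {s..<t}" using assms by auto
  then have "(LBINT r:{0..<t}. drag r y) = (LBINT r:{0..<s}. drag r y) + (LBINT r:{s..<t}. drag r y)"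
    using int assms by (simp add: set_integral_Un)
  then show "impulse t y = impulse s y - (LBINT r:{s..<t}. drag r y)" by (simp add: impulse_def)
  show "set_integrable lborel {s..<t} (\<lambda>r. drag r y)" using int assms by simp
qed

lemma growth_bound:
  obtains B where "\<And>T. 0 < B T"
    "\<And>t T y. 0 \<le> t \<Longrightarrow> t \<le> T \<Longrightarrow> \<bar>flow t y\<bar> \<le> B T * (1 + \<bar>y\<bar>)"
    "\<And>t T y. 0 \<le> t \<Longrightarrow> t \<le> T \<Longrightarrow> \<bar>drag t y\<bar> \<le> B T * (1 + \<bar>y\<bar>)"
    "\<And>t T y. 0 \<le> t \<Longrightarrow> t \<le> T \<Longrightarrow> \<bar>impulse t y\<bar> \<le> B T * (1 + \<bar>y\<bar>)"
proof -
  obtain A where A: "\<And>T. 1 \<le> A T" "\<And>t T y. 0 \<le> t \<Longrightarrow> t \<le> T \<Longrightarrow> \<bar>flow t y\<bar> \<le> A T * (1 + \<bar>y\<bar>)"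
    by (rule path_flow_bound) blast
  obtain C where C: "\<And>T. 0 < C T" "\<And>r T y. 0 \<le> r \<Longrightarrow> r \<le> T \<Longrightarrow> \<bar>drag r y\<bar> \<le> C T * (1 + \<bar>y\<bar>)"
    by (rule drag_limit) blast
  obtain L where L: "0 \<le> L" "\<And>x. \<bar>v0 x\<bar> \<le> L * (1 + \<bar>x\<bar>)" by (rule v0_affine) blast
  define B where "B T = A T + C T + (L + C T * \<bar>T\<bar>)" for T
  have AB: "A T \<le> B T" "C T \<le> B T" "L + C T * \<bar>T\<bar> \<le> B T" for T
  proof -
    have "0 \<le> C T * \<bar>T\<bar>" using C(1)[of T] by simp
    then show "A T \<le> B T" "C T \<le> B T" "L + C T * \<bar>T\<bar> \<le> B T"
      using A(1)[of T] C(1)[of T] L(1) by (simp_all add: B_def)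
  qed
  have le: "x \<le> a * (1 + \<bar>y\<bar>) \<Longrightarrow> a \<le> b \<Longrightarrow> x \<le> b * (1 + \<bar>y\<bar>)" for x a b y :: real
    by (rule order_trans, assumption, rule mult_right_mono) auto
  show ?thesis
  proof (rule that[of B])
    show "0 < B T" for T using A(1)[of T] AB(1)[of T] by linarith
    show "\<bar>flow t y\<bar> \<le> B T * (1 + \<bar>y\<bar>)" if "0 \<le> t" "t \<le> T" for t T y
      by (rule le[OF A(2)[OF that] AB(1)])
    show "\<bar>drag t y\<bar> \<le> B T * (1 + \<bar>y\<bar>)" if "0 \<le> t" "t \<le> T" for t T y
      by (rule le[OF C(2)[OF that] AB(2)])
    show "\<bar>impulse t y\<bar> \<le> B T * (1 + \<bar>y\<bar>)" if t: "0 \<le> t" "t \<le> T" for t T y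
    proof (rule le[OF _ AB(3)])
      have "\<bar>LBINT r:{0..<t}. drag r y\<bar> \<le> (C T * (1 + \<bar>y\<bar>)) * (t - 0)"
        using t by (intro set_integral_abs_le impulse_diff(2) C(2)) auto
      also have "\<dots> \<le> (C T * (1 + \<bar>y\<bar>)) * \<bar>T\<bar>" using t C(1)[of T] by (intro mult_left_mono) auto
      finally have "\<bar>LBINT r:{0..<t}. drag r y\<bar> \<le> C T * \<bar>T\<bar> * (1 + \<bar>y\<bar>)" by (simp add: mult_ac)
      then show "\<bar>impulse t y\<bar> \<le> (L + C T * \<bar>T\<bar>) * (1 + \<bar>y\<bar>)"
        using L(2)[of y] unfolding impulse_def distrib_right[of L "C T * \<bar>T\<bar>" "1 + \<bar>y\<bar>"] by linarith
    qed
  qed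
qed

lemma integrable_affine_bounded:
  assumes "h \<in> borel_measurable borel" "\<And>y. \<bar>h y\<bar> \<le> b * (1 + \<bar>y\<bar>)"
  shows "integrable \<rho>0 h" "integrable \<rho>0 (\<lambda>y. (h y)\<^sup>2)"
proof -
  have b: "b * (1 + \<bar>y\<bar>) = b + b * \<bar>y\<bar>" for y by (simp add: distrib_left)
  show "integrable \<rho>0 h"
    by (rule Bochner_Integration.integrable_bound[OF integrable_affine[of b b]])
      (use assms b in \<open>auto intro: order_trans[OF _ abs_ge_self]\<close>)
  show "integrable \<rho>0 (\<lambda>y. (h y)\<^sup>2)"
  proof (rule Bochner_Integration.integrable_bound[OF integrable_affine_sq[of b b]])
    have "(h y)\<^sup>2 \<le> (b + b * \<bar>y\<bar>)\<^sup>2" for y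
      using power_mono[OF assms(2)[of y], of 2] by (simp add: b)
    then show "AE y in \<rho>0. norm ((h y)\<^sup>2) \<le> norm ((b + b * \<bar>y\<bar>)\<^sup>2)" by simp
  qed (use assms in measurable)
qed

lemma flow_integrable: "0 \<le> t \<Longrightarrow> integrable \<rho>0 (flow t)" "0 \<le> t \<Longrightarrow> integrable \<rho>0 (\<lambda>y. (flow t y)\<^sup>2)"
  and drag_integrable: "0 \<le> t \<Longrightarrow> integrable \<rho>0 (drag t)" "0 \<le> t \<Longrightarrow> integrable \<rho>0 (\<lambda>y. (drag t y)\<^sup>2)"
  and impulse_integrable: "0 \<le> t \<Longrightarrow> integrable \<rho>0 (impulse t)" "0 \<le> t \<Longrightarrow> integrable \<rho>0 (\<lambda>y. (impulse t y)\<^sup>2)"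
proof -
  obtain B where B: "\<And>t T y. 0 \<le> t \<Longrightarrow> t \<le> T \<Longrightarrow> \<bar>flow t y\<bar> \<le> B T * (1 + \<bar>y\<bar>)"
    "\<And>t T y. 0 \<le> t \<Longrightarrow> t \<le> T \<Longrightarrow> \<bar>drag t y\<bar> \<le> B T * (1 + \<bar>y\<bar>)"
    "\<And>t T y. 0 \<le> t \<Longrightarrow> t \<le> T \<Longrightarrow> \<bar>impulse t y\<bar> \<le> B T * (1 + \<bar>y\<bar>)"
    by (rule growth_bound) blast
  show "0 \<le> t \<Longrightarrow> integrable \<rho>0 (flow t)" "0 \<le> t \<Longrightarrow> integrable \<rho>0 (\<lambda>y. (flow t y)\<^sup>2)"
    using integrable_affine_bounded[of "flow t", OF _ B(1)[OF _ order_refl]] by auto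
  show "0 \<le> t \<Longrightarrow> integrable \<rho>0 (drag t)" "0 \<le> t \<Longrightarrow> integrable \<rho>0 (\<lambda>y. (drag t y)\<^sup>2)"
    using integrable_affine_bounded[of "drag t", OF _ B(2)[OF _ order_refl]] by auto
  show "0 \<le> t \<Longrightarrow> integrable \<rho>0 (impulse t)" "0 \<le> t \<Longrightarrow> integrable \<rho>0 (\<lambda>y. (impulse t y)\<^sup>2)"
    using integrable_affine_bounded[of "impulse t", OF _ B(3)[OF _ order_refl]] by auto
qed

section \<open>Stickiness and its consequences for test functions\<close>

text \<open>Monotonicity in the label settles the case y \<le> z. Otherwise the two labels must
  coincide at time t, which excludes t = 0, and the contraction estimate with a zero distance on the
  right keeps them together.\<close>

lemma flow_order_preserved:
  assumes "0 \<le> t" "t \<le> r" "y \<in> good" "z \<in> good" "flow t y \<le> flow t z"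
  shows "flow r y \<le> flow r z"
proof (cases "y \<le> z")
  case True
  then show ?thesis using assms by (intro flow_mono) auto
next
  case False
  then have "z \<le> y" by simp
  have "flow t z \<le> flow t y" using assms False by (intro flow_mono) auto
  then have eq: "flow t y = flow t z" using assms(5) by simp
  have "t \<noteq> 0" using False eq by (auto simp: flow_0)
  then have "0 < sinh (sqrt c * t)" using assms(1) c_gt_0 by simp
  moreover have "(flow r y - flow r z) * sinh (sqrt c * t) \<le> 0"
    using flow_contraction[OF assms(1,2,4,3) \<open>z \<le> y\<close>] eq by simp
  ultimately show ?thesis
    using mult_pos_pos[of "flow r y - flow r z" "sinh (sqrt c * t)"] by linarith
qed

text \<open>The supremum is taken after the bounded change of variable \<open>arctan\<close>.\<close>

lemma flow_factors:
  assumes "0 \<le> t" "t \<le> r"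
  obtains J where "J \<in> borel_measurable borel" "\<And>y. y \<in> good \<Longrightarrow> flow r y = J (flow t y)"
proof -
  \<comment> \<open>The inserted value lies below the range of arctan: it keeps the set nonempty and
    does not affect the supremum at positions that are attained.\<close>
  define A where "A x = insert (- (pi / 2)) ((\<lambda>y. arctan (flow r y)) ` {y \<in> good. flow t y \<le> x})" for x
  define G where "G x = Sup (A x)" for x
  have bdd: "bdd_above (A x)" for x
  proof (rule bdd_aboveI[of _ "pi / 2"])
    fix a assume "a \<in> A x"
    then show "a \<le> pi / 2"
      using less_imp_le[OF arctan_ubound] pi_gt_zero unfolding A_def by fastforce
  qed
  \<comment> \<open>Taking the supremum over all positions up to x, instead of choosing a label at
    x, yields a monotone function, and monotone functions are Borel.\<close>
  have "mono G"
    unfolding G_def by (intro monoI cSup_subset_mono bdd) (auto simp: A_def)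
  then have [measurable]: "G \<in> borel_measurable borel" by (rule borel_measurable_mono)
  have "G (flow t z) = arctan (flow r z)" if z: "z \<in> good" for z
    unfolding G_def
  proof (rule cSup_eq_maximum)
    show "arctan (flow r z) \<in> A (flow t z)" using z by (auto simp: A_def)
    fix a assume "a \<in> A (flow t z)"
    then show "a \<le> arctan (flow r z)"
      using flow_order_preserved[OF assms] z by (auto simp: A_def arctan_monotone' less_imp_le[OF arctan_lbound])
  qed
  then have "flow r z = tan (G (flow t z))" if "z \<in> good" for z
    using that arctan[of "flow r z"] by metis
  moreover have "(\<lambda>x. tan (G x)) \<in> borel_measurable borel"
    unfolding tan_def by measurable
  ultimately show ?thesis by (rule that[rotated])
qed


text \<open>Extends \<open>flow_momentum\<close> from bounded continuous functions of the position
  at t to Borel functions of the position at a later r. Continuous ramps give the indicators of half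
  lines, these give all Borel functions, and \<open>flow_factors\<close> allows the later
  time.\<close>

lemma flow_momentum_le:
  assumes st: "0 \<le> s" "s \<le> t" "t \<le> r" and g[measurable]: "g \<in> borel_measurable borel"
    and int: "integrable \<rho>0 (\<lambda>y. (flow t y - flow s y - (LBINT u:{s..<t}. impulse u y)) * g (flow r y))"
  shows "(\<integral>y. (flow t y - flow s y - (LBINT u:{s..<t}. impulse u y)) * g (flow r y) \<partial>\<rho>0) = 0"
proof -
  obtain B where B: "\<And>T. 0 < B T"
    "\<And>t T y. 0 \<le> t \<Longrightarrow> t \<le> T \<Longrightarrow> \<bar>flow t y\<bar> \<le> B T * (1 + \<bar>y\<bar>)"
    "\<And>t T y. 0 \<le> t \<Longrightarrow> t \<le> T \<Longrightarrow> \<bar>impulse t y\<bar> \<le> B T * (1 + \<bar>y\<bar>)"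
    by (rule growth_bound) blast
  have t: "0 \<le> t" using st by simp
  define h where "h y = flow t y - flow s y - (LBINT u:{s..<t}. impulse u y)" for y
  have Im: "(\<lambda>y. LBINT u:{s..<t}. impulse u y) \<in> borel_measurable borel"
    unfolding set_lebesgue_integral_def by measurable
  have Ib: "\<bar>LBINT u:{s..<t}. impulse u y\<bar> \<le> (B t * t) * (1 + \<bar>y\<bar>)" for y
  proof (cases "set_integrable lborel {s..<t} (\<lambda>u. impulse u y)")
    case True
    have "\<bar>LBINT u:{s..<t}. impulse u y\<bar> \<le> (B t * (1 + \<bar>y\<bar>)) * (t - s)"
      using st by (intro set_integral_abs_le True B(3)) auto
    also have "\<dots> \<le> (B t * (1 + \<bar>y\<bar>)) * t" using st B(1)[of t] by (intro mult_left_mono) auto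
    finally show ?thesis by (simp add: mult_ac)
  next
    case False
    \<comment> \<open>The default value of the integral satisfies the bound as well.\<close>
    then have "(LBINT u:{s..<t}. impulse u y) = 0"
      by (simp add: set_integrable_def set_lebesgue_integral_def not_integrable_integral_eq)
    then show ?thesis using B(1)[of t] t by simp
  qed
  have h: "integrable \<rho>0 h" unfolding h_def
    by (intro Bochner_Integration.integrable_diff flow_integrable t st(1) integrable_affine_bounded(1)[OF Im Ib])
  have [measurable]: "h \<in> borel_measurable borel" using Im unfolding h_def by measurable
  have 0: "(\<integral>y. h y * indicator {q<..} (flow t y) \<partial>\<rho>0) = 0" for q
  proof -
    \<comment> \<open>Continuous ramps that vanish up to q and increase to the indicator of the open
      half line.\<close>
    define \<gamma> where "\<gamma> n x = min 1 (max 0 (real n * (x - q)))" for n x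
    have "(\<lambda>n. \<integral>y. h y * \<gamma> n (flow t y) \<partial>\<rho>0) \<longlonglongrightarrow> (\<integral>y. h y * indicator {q<..} (flow t y) \<partial>\<rho>0)"
    proof (rule integral_dominated_convergence[where w="\<lambda>y. \<bar>h y\<bar>"])
      show "AE y in \<rho>0. (\<lambda>n. h y * \<gamma> n (flow t y)) \<longlonglongrightarrow> h y * indicator {q<..} (flow t y)"
      proof (rule AE_I2, rule tendsto_mult_left)
        fix y
        show "(\<lambda>n. \<gamma> n (flow t y)) \<longlonglongrightarrow> indicator {q<..} (flow t y)"
        proof (cases "q < flow t y")
          case True
          obtain N :: nat where N: "1 / (flow t y - q) \<le> real N" using real_arch_simple by blast
          have "\<gamma> n (flow t y) = 1" if "N \<le> n" for n
          proof -
            have "1 / (flow t y - q) \<le> real n" using N that by simp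
            then have "1 \<le> real n * (flow t y - q)" using True by (simp add: pos_divide_le_eq)
            then show ?thesis by (simp add: \<gamma>_def)
          qed
          then have "\<forall>\<^sub>F n in sequentially. \<gamma> n (flow t y) = 1" by (auto simp: eventually_sequentially)
          then show ?thesis using True by (simp add: tendsto_eventually)
        next
          case False
          then have "\<gamma> n (flow t y) = 0" for n
            using False mult_nonneg_nonpos[of "real n" "flow t y - q"] by (simp add: \<gamma>_def)
          then show ?thesis using False by simp
        qed
      qed
      show "AE y in \<rho>0. norm (h y * \<gamma> n (flow t y)) \<le> \<bar>h y\<bar>" for n
        by (auto simp: abs_mult \<gamma>_def intro!: mult_left_le)
      show "integrable \<rho>0 (\<lambda>y. \<bar>h y\<bar>)" using h by simp
      show "(\<lambda>y. h y * indicator {q<..} (flow t y)) \<in> borel_measurable \<rho>0" by measurable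
      show "(\<lambda>y. h y * \<gamma> n (flow t y)) \<in> borel_measurable \<rho>0" for n unfolding \<gamma>_def by measurable
    qed
    moreover have "(\<integral>y. h y * \<gamma> n (flow t y) \<partial>\<rho>0) = 0" for n
      unfolding h_def
      by (rule flow_momentum[OF st(1,2), of "\<gamma> n" 1]) (auto simp: \<gamma>_def intro!: continuous_intros)
    ultimately show ?thesis by (simp add: LIMSEQ_const_iff)
  qed
  obtain J where J[measurable]: "J \<in> borel_measurable borel" and J_eq: "\<And>y. y \<in> good \<Longrightarrow> flow r y = J (flow t y)"
    by (rule flow_factors[OF t st(3)]) blast
  have AEJ: "AE y in \<rho>0. h y * g (flow r y) = h y * g (J (flow t y))"
    using AE_good by eventually_elim (simp add: J_eq)
  have int': "integrable \<rho>0 (\<lambda>y. h y * (g \<circ> J) (flow t y))"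
    unfolding comp_def using int by (subst integrable_cong_AE[OF _ _ AEJ, symmetric]) (auto simp: h_def[symmetric])
  have "(\<integral>y. h y * (g \<circ> J) (flow t y) \<partial>\<rho>0) = 0"
  proof (rule orthogonal_to_functions_of[OF h _ 0 _ int'])
    show "flow t \<in> borel_measurable \<rho>0" "g \<circ> J \<in> borel_measurable borel" by measurable
  qed
  moreover have "(\<integral>y. h y * g (flow r y) \<partial>\<rho>0) = (\<integral>y. h y * (g \<circ> J) (flow t y) \<partial>\<rho>0)"
    using AEJ by (intro integral_cong_AE) auto
  ultimately show ?thesis by (simp add: h_def)
qed

text \<open>Any probability measure on the times \<open>t \<ge> 0\<close> with the null sets of Lebesgue measure would do.\<close>

definition time_measure :: "real measure" where
  "time_measure = density lborel (exponential_density 1)"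

lemma prob_space_time: "prob_space time_measure"
  unfolding time_measure_def by (rule prob_space_exponential_density) simp

lemma sets_time [measurable_cong]: "sets time_measure = sets borel"
  by (simp add: time_measure_def)

lemma AE_time: "(AE t in time_measure. P t) \<longleftrightarrow> (AE t in lborel. 0 \<le> t \<longrightarrow> P t)"
  unfolding time_measure_def
  by (subst AE_density) (auto simp: exponential_density_def)

section \<open>The velocity as a density in space-time\<close>

text \<open>The joint law of position and time. Conditioning once in space-time, instead of
  separately at each time, provides a version of the velocity that is Borel in both
  variables.\<close>

definition carrier :: "(real \<times> real) measure" where
  "carrier = distr (time_measure \<Otimes>\<^sub>M \<rho>0) borel (\<lambda>p. (flow (fst p) (snd p), fst p))"

text \<open>Since \<open>ennreal\<close> cuts off negative values, \<sigma> = 1 gives the positive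
  and \<sigma> = - 1 the negative part of the impulse, transported to space-time.\<close>

definition impulse_measure :: "real \<Rightarrow> (real \<times> real) measure" where
  "impulse_measure \<sigma> = distr (density (time_measure \<Otimes>\<^sub>M \<rho>0) (\<lambda>p. ennreal (\<sigma> * impulse (fst p) (snd p))))
     borel (\<lambda>p. (flow (fst p) (snd p), fst p))"

definition velocity_part :: "real \<Rightarrow> real \<times> real \<Rightarrow> ennreal" where
  "velocity_part \<sigma> = RN_deriv carrier (impulse_measure \<sigma>)"

definition velocity :: "real \<times> real \<Rightarrow> real" where
  "velocity z = enn2real (velocity_part 1 z) - enn2real (velocity_part (- 1) z)"

lemma velocity_part_measurable [measurable]: "velocity_part \<sigma> \<in> borel_measurable borel"
proof -
  have "velocity_part \<sigma> \<in> borel_measurable carrier" unfolding velocity_part_def by (rule borel_measurable_RN_deriv)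
  then show ?thesis by (simp add: carrier_def)
qed

lemma velocity_measurable [measurable]: "velocity \<in> borel_measurable borel"
  unfolding velocity_def[abs_def] by measurable

lemma spacetime_map [measurable]:
  "(\<lambda>p. (flow (fst p) (snd p), fst p)) \<in> measurable (time_measure \<Otimes>\<^sub>M \<rho>0) borel"
  unfolding borel_prod[symmetric] by measurable

lemma velocity_part_integral:
  assumes [measurable]: "h \<in> borel_measurable borel"
  shows "(\<integral>\<^sup>+p. ennreal (\<sigma> * impulse (fst p) (snd p)) * h (flow (fst p) (snd p), fst p) \<partial>(time_measure \<Otimes>\<^sub>M \<rho>0)) =
     (\<integral>\<^sup>+p. velocity_part \<sigma> (flow (fst p) (snd p), fst p) * h (flow (fst p) (snd p), fst p) \<partial>(time_measure \<Otimes>\<^sub>M \<rho>0))"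
proof -
  let ?P = "time_measure \<Otimes>\<^sub>M \<rho>0" and ?\<Phi> = "\<lambda>p. (flow (fst p) (snd p), fst p)"
  interpret T: prob_space time_measure by (rule prob_space_time)
  interpret P: pair_prob_space time_measure \<rho>0 ..
  have "prob_space carrier" unfolding carrier_def by (rule P.prob_space_distr) measurable
  then interpret C: prob_space carrier .
  have ac: "absolutely_continuous carrier (impulse_measure \<sigma>)"
    unfolding absolutely_continuous_def
  proof
    fix N assume "N \<in> null_sets carrier"
    then have N: "N \<in> sets borel" "emeasure ?P (?\<Phi> -` N \<inter> space ?P) = 0"
      by (auto simp: null_sets_def carrier_def emeasure_distr)
    then have "?\<Phi> -` N \<inter> space ?P \<in> null_sets ?P" using measurable_sets[OF spacetime_map N(1)] by (simp add: null_sets_def)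
    then have "AE p in ?P. p \<notin> ?\<Phi> -` N \<inter> space ?P" by (rule AE_not_in)
    then have "(\<integral>\<^sup>+p. ennreal (\<sigma> * impulse (fst p) (snd p)) * indicator (?\<Phi> -` N \<inter> space ?P) p \<partial>?P) = (\<integral>\<^sup>+p. 0 \<partial>?P)"
      by (intro nn_integral_cong_AE) (auto elim!: eventually_mono simp: indicator_def)
    then have "emeasure (impulse_measure \<sigma>) N = 0"
    proof -
      have "?\<Phi> -` N \<inter> space ?P \<in> sets ?P" by (rule measurable_sets[OF spacetime_map N(1)])
      moreover have "(\<lambda>p. ennreal (\<sigma> * impulse (fst p) (snd p))) \<in> borel_measurable ?P" by measurable
      moreover assume "(\<integral>\<^sup>+p. ennreal (\<sigma> * impulse (fst p) (snd p)) * indicator (?\<Phi> -` N \<inter> space ?P) p \<partial>?P) = (\<integral>\<^sup>+p. 0 \<partial>?P)"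
      ultimately have "emeasure (density ?P (\<lambda>p. ennreal (\<sigma> * impulse (fst p) (snd p)))) (?\<Phi> -` N \<inter> space ?P) = 0"
        by (subst emeasure_density) simp_all
      moreover have "?\<Phi> \<in> measurable (density ?P (\<lambda>p. ennreal (\<sigma> * impulse (fst p) (snd p)))) borel"
        using spacetime_map by simp
      ultimately show ?thesis
        unfolding impulse_measure_def using N(1) by (simp only: emeasure_distr space_density)
    qed
    then show "N \<in> null_sets (impulse_measure \<sigma>)" using N(1) by (auto simp: null_sets_def impulse_measure_def)
  qed
  have dens: "density carrier (velocity_part \<sigma>) = impulse_measure \<sigma>"
    unfolding velocity_part_def
    by (rule C.density_RN_deriv[OF ac]) (simp add: carrier_def impulse_measure_def)
  have "(\<integral>\<^sup>+p. ennreal (\<sigma> * impulse (fst p) (snd p)) * h (?\<Phi> p) \<partial>?P) = (\<integral>\<^sup>+z. h z \<partial>(impulse_measure \<sigma>))"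
    unfolding impulse_measure_def by (subst nn_integral_distr) (auto simp: nn_integral_density)
  also have "\<dots> = (\<integral>\<^sup>+z. velocity_part \<sigma> z * h z \<partial>carrier)"
    unfolding dens[symmetric] by (subst nn_integral_density) (auto simp: carrier_def)
  also have "\<dots> = (\<integral>\<^sup>+p. velocity_part \<sigma> (?\<Phi> p) * h (?\<Phi> p) \<partial>?P)"
    unfolding carrier_def by (subst nn_integral_distr) auto
  finally show ?thesis .
qed

text \<open>The space-time identity is tested on products of A with arbitrary sets of times, which
  determines both sides for almost every t. The null set depends on A.\<close>

lemma velocity_part_slice:
  assumes "A \<in> sets borel"
  shows "AE t in time_measure. (\<integral>\<^sup>+y. ennreal (\<sigma> * impulse t y) * indicator A (flow t y) \<partial>\<rho>0) =
     (\<integral>\<^sup>+y. velocity_part \<sigma> (flow t y, t) * indicator A (flow t y) \<partial>\<rho>0)"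
proof -
  interpret T: prob_space time_measure by (rule prob_space_time)
  have [measurable]: "A \<in> sets borel" by fact
  have pm: "(\<lambda>x. velocity_part \<sigma> (flow (fst x) (snd x), fst x)) \<in> borel_measurable (time_measure \<Otimes>\<^sub>M \<rho>0)"
    by (rule measurable_compose[OF spacetime_map velocity_part_measurable])
  have pm': "(\<lambda>(t, y). velocity_part \<sigma> (flow t y, t) * indicator A (flow t y)) \<in> borel_measurable (time_measure \<Otimes>\<^sub>M \<rho>0)"
    using pm unfolding case_prod_beta by measurable
  have im': "(\<lambda>(t, y). ennreal (\<sigma> * impulse t y) * indicator A (flow t y)) \<in> borel_measurable (time_measure \<Otimes>\<^sub>M \<rho>0)"
    unfolding case_prod_beta by measurable
  show ?thesis
  proof (rule T.density_unique2)
    show "(\<lambda>t. \<integral>\<^sup>+y. ennreal (\<sigma> * impulse t y) * indicator A (flow t y) \<partial>\<rho>0) \<in> borel_measurable time_measure"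
      using borel_measurable_nn_integral[OF im'] by simp
    show "(\<lambda>t. \<integral>\<^sup>+y. velocity_part \<sigma> (flow t y, t) * indicator A (flow t y) \<partial>\<rho>0) \<in> borel_measurable time_measure"
      using borel_measurable_nn_integral[OF pm'] by simp
    fix I assume "I \<in> sets time_measure"
    then have [measurable]: "I \<in> sets borel" by (simp add: sets_time)
    define h :: "real \<times> real \<Rightarrow> ennreal" where "h z = indicator A (fst z) * indicator I (snd z)" for z
    have "h \<in> borel_measurable (borel \<Otimes>\<^sub>M borel)" unfolding h_def by measurable
    then have hm: "h \<in> borel_measurable borel" by (simp add: borel_prod)
    have slice: "(\<integral>\<^sup>+t\<in>I. (\<integral>\<^sup>+y. w t y * indicator A (flow t y) \<partial>\<rho>0) \<partial>time_measure) =
       (\<integral>\<^sup>+p. w (fst p) (snd p) * h (flow (fst p) (snd p), fst p) \<partial>(time_measure \<Otimes>\<^sub>M \<rho>0))"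
      if wm[measurable]: "(\<lambda>p. w (fst p) (snd p)) \<in> borel_measurable (time_measure \<Otimes>\<^sub>M \<rho>0)" for w
    proof -
      have "(\<lambda>p. w (fst p) (snd p) * h (flow (fst p) (snd p), fst p)) \<in> borel_measurable (time_measure \<Otimes>\<^sub>M \<rho>0)"
        unfolding h_def by measurable
      from nn_integral_fst[OF this] have
        "(\<integral>\<^sup>+p. w (fst p) (snd p) * h (flow (fst p) (snd p), fst p) \<partial>(time_measure \<Otimes>\<^sub>M \<rho>0)) =
         (\<integral>\<^sup>+t. (\<integral>\<^sup>+y. w t y * h (flow t y, t) \<partial>\<rho>0) \<partial>time_measure)" by simp
      also have "\<dots> = (\<integral>\<^sup>+t\<in>I. (\<integral>\<^sup>+y. w t y * indicator A (flow t y) \<partial>\<rho>0) \<partial>time_measure)"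
        by (rule nn_integral_cong) (auto simp: h_def indicator_def)
      finally show ?thesis ..
    qed
    show "(\<integral>\<^sup>+t\<in>I. (\<integral>\<^sup>+y. ennreal (\<sigma> * impulse t y) * indicator A (flow t y) \<partial>\<rho>0) \<partial>time_measure) =
       (\<integral>\<^sup>+t\<in>I. (\<integral>\<^sup>+y. velocity_part \<sigma> (flow t y, t) * indicator A (flow t y) \<partial>\<rho>0) \<partial>time_measure)"
      using slice[of "\<lambda>t y. ennreal (\<sigma> * impulse t y)"] slice[of "\<lambda>t y. velocity_part \<sigma> (flow t y, t)"] pm
        velocity_part_integral[OF hm, of \<sigma>]
      by simp
  qed
qed

text \<open>Countably many sets A allow one null set of times for all. \<open>UNIV\<close> makes
  both parts of the velocity integrable, and the rational half lines identify the conditional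
  expectation.\<close>

definition good_time :: "real \<Rightarrow> bool" where
  "good_time t \<longleftrightarrow> 0 \<le> t \<and> (\<forall>\<sigma>\<in>{1, - 1}. \<forall>A\<in>insert UNIV ((\<lambda>q. {q<..}) ` \<rat>).
     (\<integral>\<^sup>+y. ennreal (\<sigma> * impulse t y) * indicator A (flow t y) \<partial>\<rho>0) =
     (\<integral>\<^sup>+y. velocity_part \<sigma> (flow t y, t) * indicator A (flow t y) \<partial>\<rho>0))"

lemma AE_good_time: "AE t in lborel. 0 \<le> t \<longrightarrow> good_time t"
proof -
  have "AE t in time_measure. \<forall>A\<in>insert UNIV ((\<lambda>q. {q<..}) ` \<rat>).
     (\<integral>\<^sup>+y. ennreal (\<sigma> * impulse t y) * indicator A (flow t y) \<partial>\<rho>0) =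
     (\<integral>\<^sup>+y. velocity_part \<sigma> (flow t y, t) * indicator A (flow t y) \<partial>\<rho>0)" for \<sigma>
  proof (subst AE_ball_countable)
    show "countable (insert UNIV ((\<lambda>q. {q<..}) ` \<rat>) :: real set set)" by (auto simp: countable_rat)
    show "\<forall>A\<in>insert UNIV ((\<lambda>q. {q<..}) ` \<rat>). AE t in time_measure.
     (\<integral>\<^sup>+y. ennreal (\<sigma> * impulse t y) * indicator A (flow t y) \<partial>\<rho>0) =
     (\<integral>\<^sup>+y. velocity_part \<sigma> (flow t y, t) * indicator A (flow t y) \<partial>\<rho>0)"
      by (intro ballI velocity_part_slice) auto
  qed
  from this[of 1] this[of "- 1"] have "AE t in time_measure. 0 \<le> t \<longrightarrow> good_time t"
    unfolding good_time_def by eventually_elim auto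
  then show ?thesis by (simp add: AE_time)
qed

text \<open>At a good time, velocity along the flow is the conditional expectation of the impulse
  given the position. Positive and negative parts are compared on rational half lines, and
  \<open>orthogonal_to_functions_of\<close> passes to Borel functions.\<close>

lemma velocity_projection:
  assumes t: "good_time t"
  shows "integrable \<rho>0 (\<lambda>y. velocity (flow t y, t))"
    and "g \<in> borel_measurable borel \<Longrightarrow> integrable \<rho>0 (\<lambda>y. (impulse t y - velocity (flow t y, t)) * g (flow t y)) \<Longrightarrow>
      (\<integral>y. (impulse t y - velocity (flow t y, t)) * g (flow t y) \<partial>\<rho>0) = 0"
proof -
  have t0: "0 \<le> t" using t by (simp add: good_time_def)
  have pm[measurable]: "(\<lambda>y. velocity_part \<sigma> (flow t y, t)) \<in> borel_measurable borel" for \<sigma>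
  proof -
    have "(\<lambda>y. (flow t y, t)) \<in> measurable borel borel" unfolding borel_prod[symmetric] by measurable
    from measurable_compose[OF this velocity_part_measurable] show ?thesis .
  qed
  define w where "w \<sigma> y = enn2real (velocity_part \<sigma> (flow t y, t))" for \<sigma> y
  have [measurable]: "w \<sigma> \<in> borel_measurable borel" for \<sigma> unfolding w_def by measurable
  have part: "integrable \<rho>0 (w \<sigma>) \<and> (\<forall>q\<in>\<rat>. (\<integral>y. w \<sigma> y * indicator {q<..} (flow t y) \<partial>\<rho>0) =
      (\<integral>y. max 0 (\<sigma> * impulse t y) * indicator {q<..} (flow t y) \<partial>\<rho>0))" if \<sigma>: "\<sigma> \<in> {1, - 1}" for \<sigma>
  proof -
    have eq: "(\<integral>\<^sup>+y. ennreal (max 0 (\<sigma> * impulse t y)) * indicator A (flow t y) \<partial>\<rho>0) =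
       (\<integral>\<^sup>+y. velocity_part \<sigma> (flow t y, t) * indicator A (flow t y) \<partial>\<rho>0)"
      if "A \<in> insert UNIV ((\<lambda>q. {q<..}) ` \<rat>)" for A
      using t \<sigma> that unfolding good_time_def ennreal_max_0 by blast
    have i: "integrable \<rho>0 (\<lambda>y. max 0 (\<sigma> * impulse t y))" using impulse_integrable(1)[OF t0] by auto
    have "(\<integral>\<^sup>+y. ennreal (max 0 (\<sigma> * impulse t y)) \<partial>\<rho>0) < \<infinity>"
      using i by (subst nn_integral_eq_integral) auto
    then have fin: "(\<integral>\<^sup>+y. velocity_part \<sigma> (flow t y, t) \<partial>\<rho>0) < \<infinity>" using eq[of UNIV] by simp
    \<comment> \<open>\<open>enn2real\<close> maps infinity to 0, so infinite values have to be
      excluded before the parts are read as real numbers.\<close>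
    then have "AE y in \<rho>0. velocity_part \<sigma> (flow t y, t) \<noteq> \<infinity>"
      by (intro nn_integral_noteq_infinite) (auto simp: less_top)
    then have AEw: "AE y in \<rho>0. ennreal (w \<sigma> y) = velocity_part \<sigma> (flow t y, t)"
      by eventually_elim (simp add: w_def less_top)
    have iw: "integrable \<rho>0 (w \<sigma>)"
    proof (rule integrableI_nonneg)
      have "(\<integral>\<^sup>+y. ennreal (w \<sigma> y) \<partial>\<rho>0) = (\<integral>\<^sup>+y. velocity_part \<sigma> (flow t y, t) \<partial>\<rho>0)"
        by (rule nn_integral_cong_AE[OF AEw])
      then show "(\<integral>\<^sup>+y. ennreal (w \<sigma> y) \<partial>\<rho>0) < \<infinity>" using fin by simp
    qed (auto simp: w_def)
    have "(\<integral>y. w \<sigma> y * indicator {q<..} (flow t y) \<partial>\<rho>0) = (\<integral>y. max 0 (\<sigma> * impulse t y) * indicator {q<..} (flow t y) \<partial>\<rho>0)"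
      if q: "q \<in> \<rat>" for q
    proof -
      have ind: "integrable \<rho>0 (\<lambda>y. k y * indicator {q<..} (flow t y))" if "integrable \<rho>0 k" for k :: "real \<Rightarrow> real"
        by (rule Bochner_Integration.integrable_bound[OF that]) (use that in \<open>auto simp: indicator_def\<close>)
      have nn: "(\<integral>\<^sup>+y. ennreal (k y) * indicator {q<..} (flow t y) \<partial>\<rho>0) = ennreal (\<integral>y. k y * indicator {q<..} (flow t y) \<partial>\<rho>0)"
        if "integrable \<rho>0 k" "\<And>y. 0 \<le> k y" for k
        using that by (subst nn_integral_eq_integral[symmetric, OF ind]) (auto intro!: nn_integral_cong simp: indicator_def)
      have "ennreal (\<integral>y. w \<sigma> y * indicator {q<..} (flow t y) \<partial>\<rho>0) = (\<integral>\<^sup>+y. ennreal (w \<sigma> y) * indicator {q<..} (flow t y) \<partial>\<rho>0)"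
        by (rule nn[symmetric, OF iw]) (simp add: w_def)
      also have "\<dots> = (\<integral>\<^sup>+y. velocity_part \<sigma> (flow t y, t) * indicator {q<..} (flow t y) \<partial>\<rho>0)"
        by (rule nn_integral_cong_AE) (use AEw in eventually_elim, simp)
      also have "\<dots> = (\<integral>\<^sup>+y. ennreal (max 0 (\<sigma> * impulse t y)) * indicator {q<..} (flow t y) \<partial>\<rho>0)"
        using q by (intro eq[symmetric]) auto
      also have "\<dots> = ennreal (\<integral>y. max 0 (\<sigma> * impulse t y) * indicator {q<..} (flow t y) \<partial>\<rho>0)"
        by (rule nn[OF i]) simp
      finally show ?thesis by (subst (asm) ennreal_inj) (auto intro!: integral_nonneg simp: w_def)
    qed
    then show ?thesis using iw by blast
  qed
  have vel: "velocity (flow t y, t) = w 1 y - w (- 1) y" for y by (simp add: velocity_def w_def)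
  have imp: "impulse t y = max 0 (1 * impulse t y) - max 0 (- 1 * impulse t y)" for y by simp
  show iv: "integrable \<rho>0 (\<lambda>y. velocity (flow t y, t))" unfolding vel using part by auto
  have ii: "integrable \<rho>0 (\<lambda>y. impulse t y - velocity (flow t y, t))"
    using iv impulse_integrable(1)[OF t0] by auto
  assume g: "g \<in> borel_measurable borel" "integrable \<rho>0 (\<lambda>y. (impulse t y - velocity (flow t y, t)) * g (flow t y))"
  show "(\<integral>y. (impulse t y - velocity (flow t y, t)) * g (flow t y) \<partial>\<rho>0) = 0"
  proof (rule orthogonal_to_functions_of[OF ii _ _ g])
    show "flow t \<in> borel_measurable \<rho>0" by measurable
    fix q :: real assume q: "q \<in> \<rat>"
    have ind: "integrable \<rho>0 (\<lambda>y. k y * indicator {q<..} (flow t y))" if "integrable \<rho>0 k" for k :: "real \<Rightarrow> real"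
      by (rule Bochner_Integration.integrable_bound[OF that]) (use that in \<open>auto simp: indicator_def\<close>)
    have im: "integrable \<rho>0 (\<lambda>y. max 0 (\<sigma> * impulse t y))" for \<sigma> using impulse_integrable(1)[OF t0] by auto
    let ?i = "\<lambda>y. indicator {q<..} (flow t y) :: real"
    have "(\<integral>y. (impulse t y - velocity (flow t y, t)) * ?i y \<partial>\<rho>0) =
      (\<integral>y. (max 0 (1 * impulse t y) * ?i y - max 0 (- 1 * impulse t y) * ?i y) - (w 1 y * ?i y - w (- 1) y * ?i y) \<partial>\<rho>0)"
      unfolding vel
    proof (rule Bochner_Integration.integral_cong[OF refl])
      fix y
      have "impulse t y - (w 1 y - w (- 1) y) = (max 0 (1 * impulse t y) - max 0 (- 1 * impulse t y)) - (w 1 y - w (- 1) y)"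
        using imp[of y] by linarith
      then show "(impulse t y - (w 1 y - w (- 1) y)) * ?i y =
        (max 0 (1 * impulse t y) * ?i y - max 0 (- 1 * impulse t y) * ?i y) - (w 1 y * ?i y - w (- 1) y * ?i y)"
        by (simp only: left_diff_distrib)
    qed
    also have "\<dots> = ((\<integral>y. max 0 (1 * impulse t y) * ?i y \<partial>\<rho>0) - (\<integral>y. max 0 (- 1 * impulse t y) * ?i y \<partial>\<rho>0)) -
      ((\<integral>y. w 1 y * ?i y \<partial>\<rho>0) - (\<integral>y. w (- 1) y * ?i y \<partial>\<rho>0))"
    proof -
      have "integrable \<rho>0 (w 1)" "integrable \<rho>0 (w (- 1))" using part by auto
      note ind[OF this(1)] ind[OF this(2)] ind[OF im[of 1]] ind[OF im[of "- 1"]]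
      then show ?thesis
        by (simp only: Bochner_Integration.integral_diff Bochner_Integration.integrable_diff)
    qed
    also have "\<dots> = 0" using part[of 1] part[of "- 1"] q by simp
    finally show "(\<integral>y. (impulse t y - velocity (flow t y, t)) * ?i y \<partial>\<rho>0) = 0" .
  qed
qed

end

section \<open>Paths of the flow\<close>

lemma power2_sum_le: "(a + b)\<^sup>2 \<le> 2 * a\<^sup>2 + 2 * b\<^sup>2" for a b :: real
proof -
  have "2 * a\<^sup>2 + 2 * b\<^sup>2 - (a + b)\<^sup>2 = (a - b)\<^sup>2" by (simp add: power2_eq_square algebra_simps)
  then show ?thesis using zero_le_power2[of "a - b"] by linarith
qed

lemma integrable_product_sq:
  fixes f g :: "'a \<Rightarrow> real"
  assumes "integrable M (\<lambda>x. (f x)\<^sup>2)" "integrable M (\<lambda>x. (g x)\<^sup>2)"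
    "f \<in> borel_measurable M" "g \<in> borel_measurable M"
  shows "integrable M (\<lambda>x. f x * g x)"
proof (rule Bochner_Integration.integrable_bound)
  show "integrable M (\<lambda>x. (f x)\<^sup>2 + (g x)\<^sup>2)" using assms by simp
  have "\<bar>f x * g x\<bar> \<le> (f x)\<^sup>2 + (g x)\<^sup>2" for x
    using sum_squares_bound[of "\<bar>f x\<bar>" "\<bar>g x\<bar>"] abs_ge_zero[of "f x * g x"]
    unfolding abs_mult power2_abs by linarith
  then show "AE x in M. norm (f x * g x) \<le> norm ((f x)\<^sup>2 + (g x)\<^sup>2)" by simp
qed (use assms in measurable)

lemma integrable_sum_sq:
  fixes f g :: "'a \<Rightarrow> real"
  assumes "integrable M (\<lambda>x. (f x)\<^sup>2)" "integrable M (\<lambda>x. (g x)\<^sup>2)"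
    "f \<in> borel_measurable M" "g \<in> borel_measurable M"
  shows "integrable M (\<lambda>x. (f x + g x)\<^sup>2)" "integrable M (\<lambda>x. (f x - g x)\<^sup>2)"
proof -
  have "integrable M (\<lambda>x. (f x)\<^sup>2 + (g x)\<^sup>2 + 2 * (f x * g x))" "integrable M (\<lambda>x. (f x)\<^sup>2 + (g x)\<^sup>2 - 2 * (f x * g x))"
    using assms integrable_product_sq[OF assms] by auto
  then show "integrable M (\<lambda>x. (f x + g x)\<^sup>2)" "integrable M (\<lambda>x. (f x - g x)\<^sup>2)"
    by (simp_all add: power2_sum power2_diff mult.assoc)
qed

context euler_data
begin

section \<open>The velocity along paths as an L2 projection\<close>

definition speed :: "real \<Rightarrow> real \<Rightarrow> real" where "speed t y = velocity (flow t y, t)"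

lemma speed_measurable [measurable (raw)]:
  assumes [measurable]: "T \<in> borel_measurable M" "Y \<in> borel_measurable M"
  shows "(\<lambda>x. speed (T x) (Y x)) \<in> borel_measurable M"
proof -
  have "(\<lambda>x. (flow (T x) (Y x), T x)) \<in> measurable M borel"
    unfolding borel_prod[symmetric] by measurable
  from measurable_compose[OF this velocity_measurable] show ?thesis by (simp add: speed_def)
qed

lemma good_time_nonneg: "good_time t \<Longrightarrow> 0 \<le> t"
  by (simp add: good_time_def)

text \<open>Testing the projection property with the velocity itself would presuppose its square
  integrability. It is tested with truncations, whose norms are bounded by that of the impulse, and
  Fatou's lemma removes the truncation.\<close>

lemma speed_L2:
  assumes t: "good_time t"
  shows "integrable \<rho>0 (\<lambda>y. (speed t y)\<^sup>2)" "(\<integral>y. (speed t y)\<^sup>2 \<partial>\<rho>0) \<le> (\<integral>y. (impulse t y)\<^sup>2 \<partial>\<rho>0)"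
proof -
  note t0 = good_time_nonneg[OF t]
  have ispeed: "integrable \<rho>0 (speed t)" using velocity_projection(1)[OF t] by (simp add: speed_def[abs_def])
  define w where "w n y = (if \<bar>speed t y\<bar> \<le> real n then speed t y else 0)" for n :: nat and y
  define g where "g n x = (if \<bar>velocity (x, t)\<bar> \<le> real n then velocity (x, t) else 0)" for n :: nat and x
  have [measurable]: "g n \<in> borel_measurable borel" for n
  proof -
    have "(\<lambda>x::real. (x, t)) \<in> measurable borel borel" unfolding borel_prod[symmetric] by measurable
    from measurable_compose[OF this velocity_measurable] have [measurable]: "(\<lambda>x. velocity (x, t)) \<in> borel_measurable borel" .
    show ?thesis unfolding g_def[abs_def] by measurable
  qed
  have gw: "g n (flow t y) = w n y" for n y by (simp add: g_def w_def speed_def)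
  have [measurable]: "w n \<in> borel_measurable borel" for n unfolding w_def[abs_def] by measurable
  have wb: "\<bar>w n y\<bar> \<le> real n" "w n y * speed t y = (w n y)\<^sup>2" for n y by (auto simp: w_def power2_eq_square)
  have iw2: "integrable \<rho>0 (\<lambda>y. (w n y)\<^sup>2)" for n
  proof (rule Bochner_Integration.integrable_bound)
    show "integrable \<rho>0 (\<lambda>y. (real n)\<^sup>2)" by simp
    show "AE y in \<rho>0. norm ((w n y)\<^sup>2) \<le> norm ((real n)\<^sup>2)"
      using power_mono[OF wb(1), of n _ 2] by simp
  qed measurable
  have ia: "integrable \<rho>0 (\<lambda>y. impulse t y * w n y)" for n
    by (rule integrable_product_sq[OF impulse_integrable(2)[OF t0] iw2]) measurable
  have bound: "(\<integral>y. (w n y)\<^sup>2 \<partial>\<rho>0) \<le> (\<integral>y. (impulse t y)\<^sup>2 \<partial>\<rho>0)" for n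
  proof -
    have e: "(impulse t y - velocity (flow t y, t)) * g n (flow t y) = impulse t y * w n y - (w n y)\<^sup>2" for y
      unfolding gw wb(2)[symmetric] speed_def by (simp add: algebra_simps)
    have "(\<integral>y. impulse t y * w n y - (w n y)\<^sup>2 \<partial>\<rho>0) = 0"
      unfolding e[symmetric] by (rule velocity_projection(2)[OF t]) (use ia iw2 in \<open>simp_all add: e\<close>)
    then have "(\<integral>y. (w n y)\<^sup>2 \<partial>\<rho>0) = (\<integral>y. impulse t y * w n y \<partial>\<rho>0)" using ia iw2 by simp
    also have "\<dots> \<le> (\<integral>y. (impulse t y)\<^sup>2 / 2 + (w n y)\<^sup>2 / 2 \<partial>\<rho>0)"
    proof (rule integral_mono[OF ia])
      show "impulse t y * w n y \<le> (impulse t y)\<^sup>2 / 2 + (w n y)\<^sup>2 / 2" for y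
        using sum_squares_bound[of "impulse t y" "w n y"] by simp
    qed (use iw2 impulse_integrable(2)[OF t0] in auto)
    also have "\<dots> = (\<integral>y. (impulse t y)\<^sup>2 \<partial>\<rho>0) / 2 + (\<integral>y. (w n y)\<^sup>2 \<partial>\<rho>0) / 2"
      using iw2 impulse_integrable(2)[OF t0] by simp
    finally show ?thesis by simp
  qed
  have lim: "(\<lambda>n. (w n y)\<^sup>2) \<longlonglongrightarrow> (speed t y)\<^sup>2" for y
  proof (rule tendsto_eventually)
    obtain N :: nat where "\<bar>speed t y\<bar> \<le> real N" using real_arch_simple by blast
    then show "\<forall>\<^sub>F n in sequentially. (w n y)\<^sup>2 = (speed t y)\<^sup>2"
      by (auto simp: eventually_sequentially w_def intro!: exI[of _ N])
  qed
  have "(\<integral>\<^sup>+y. ennreal ((speed t y)\<^sup>2) \<partial>\<rho>0) = (\<integral>\<^sup>+y. liminf (\<lambda>n. ennreal ((w n y)\<^sup>2)) \<partial>\<rho>0)"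
    by (rule nn_integral_cong) (rule lim_imp_Liminf[symmetric], simp, rule tendsto_ennrealI[OF lim])
  also have "\<dots> \<le> liminf (\<lambda>n. \<integral>\<^sup>+y. ennreal ((w n y)\<^sup>2) \<partial>\<rho>0)"
    by (rule nn_integral_liminf) measurable
  also have "\<dots> \<le> ennreal (\<integral>y. (impulse t y)\<^sup>2 \<partial>\<rho>0)"
    by (rule Liminf_le) (auto simp: nn_integral_eq_integral[OF iw2] bound ennreal_leI)
  finally have le: "(\<integral>\<^sup>+y. ennreal ((speed t y)\<^sup>2) \<partial>\<rho>0) \<le> ennreal (\<integral>y. (impulse t y)\<^sup>2 \<partial>\<rho>0)" .
  show i: "integrable \<rho>0 (\<lambda>y. (speed t y)\<^sup>2)"
    by (rule integrableI_nonneg) (use le in \<open>auto intro: le_less_trans\<close>)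
  show "(\<integral>y. (speed t y)\<^sup>2 \<partial>\<rho>0) \<le> (\<integral>y. (impulse t y)\<^sup>2 \<partial>\<rho>0)"
    using le unfolding nn_integral_eq_integral[OF i AE_I2[OF zero_le_power2]] by (subst (asm) ennreal_le_iff) auto
qed

text \<open>Functions of a later position are allowed as test functions: by
  \<open>flow_factors\<close> they are functions of the position at t.\<close>

lemma speed_projection:
  assumes t: "good_time t" "t \<le> r" and g[measurable]: "g \<in> borel_measurable borel"
    and g2: "integrable \<rho>0 (\<lambda>y. (g (flow r y))\<^sup>2)"
  shows "(\<integral>y. (impulse t y - speed t y) * g (flow r y) \<partial>\<rho>0) = 0"
proof -
  note t0 = good_time_nonneg[OF t(1)]
  have i2: "integrable \<rho>0 (\<lambda>y. (impulse t y - speed t y)\<^sup>2)"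
    by (intro integrable_sum_sq impulse_integrable speed_L2 t0 t) measurable
  have ip: "integrable \<rho>0 (\<lambda>y. (impulse t y - speed t y) * g (flow r y))"
    by (rule integrable_product_sq[OF i2 g2]) measurable
  obtain J where J[measurable]: "J \<in> borel_measurable borel" and J_eq: "\<And>y. y \<in> good \<Longrightarrow> flow r y = J (flow t y)"
    by (rule flow_factors[OF t0 t(2)]) blast
  have AEJ: "AE y in \<rho>0. (impulse t y - speed t y) * g (flow r y) = (impulse t y - velocity (flow t y, t)) * (g \<circ> J) (flow t y)"
    using AE_good by eventually_elim (simp add: J_eq speed_def)
  have m: "(\<lambda>y. (impulse t y - velocity (flow t y, t)) * (g \<circ> J) (flow t y)) \<in> borel_measurable \<rho>0"
    unfolding speed_def[symmetric] comp_def by measurable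
  have "(\<integral>y. (impulse t y - speed t y) * g (flow r y) \<partial>\<rho>0) = (\<integral>y. (impulse t y - velocity (flow t y, t)) * (g \<circ> J) (flow t y) \<partial>\<rho>0)"
    by (rule integral_cong_AE[OF _ m AEJ]) measurable
  also have "\<dots> = 0"
  proof (rule velocity_projection(2)[OF t(1)])
    show "integrable \<rho>0 (\<lambda>y. (impulse t y - velocity (flow t y, t)) * (g \<circ> J) (flow t y))"
      by (rule integrable_cong_AE_imp[OF ip m]) (use AEJ in eventually_elim, simp)
  qed measurable
  finally show ?thesis .
qed

lemma L2_bounds:
  obtains M where "\<And>T. 0 < M T"
    "\<And>t T. 0 \<le> t \<Longrightarrow> t \<le> T \<Longrightarrow> (\<integral>y. (flow t y)\<^sup>2 \<partial>\<rho>0) \<le> M T"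
    "\<And>t T. 0 \<le> t \<Longrightarrow> t \<le> T \<Longrightarrow> (\<integral>y. (drag t y)\<^sup>2 \<partial>\<rho>0) \<le> M T"
    "\<And>t T. good_time t \<Longrightarrow> t \<le> T \<Longrightarrow> (\<integral>y. (speed t y)\<^sup>2 \<partial>\<rho>0) \<le> M T"
proof -
  obtain B where B: "\<And>T. 0 < B T"
    "\<And>t T y. 0 \<le> t \<Longrightarrow> t \<le> T \<Longrightarrow> \<bar>flow t y\<bar> \<le> B T * (1 + \<bar>y\<bar>)"
    "\<And>t T y. 0 \<le> t \<Longrightarrow> t \<le> T \<Longrightarrow> \<bar>drag t y\<bar> \<le> B T * (1 + \<bar>y\<bar>)"
    "\<And>t T y. 0 \<le> t \<Longrightarrow> t \<le> T \<Longrightarrow> \<bar>impulse t y\<bar> \<le> B T * (1 + \<bar>y\<bar>)"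
    by (rule growth_bound) blast
  define M where "M T = (\<integral>y. (B T + B T * \<bar>y\<bar>)\<^sup>2 \<partial>\<rho>0) + 1" for T
  have le: "(\<integral>y. (h y)\<^sup>2 \<partial>\<rho>0) \<le> M T"
    if "\<And>y. \<bar>h y\<bar> \<le> B T * (1 + \<bar>y\<bar>)" "integrable \<rho>0 (\<lambda>y. (h y)\<^sup>2)" for h T
  proof -
    have "(\<integral>y. (h y)\<^sup>2 \<partial>\<rho>0) \<le> (\<integral>y. (B T + B T * \<bar>y\<bar>)\<^sup>2 \<partial>\<rho>0)"
    proof (rule integral_mono[OF that(2) integrable_affine_sq])
      show "(h y)\<^sup>2 \<le> (B T + B T * \<bar>y\<bar>)\<^sup>2" for y
        using power_mono[OF that(1)[of y], of 2] by (simp add: distrib_left)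
    qed
    then show ?thesis by (simp add: M_def)
  qed
  show ?thesis
  proof (rule that[of M])
    show "0 < M T" for T unfolding M_def by (intro add_nonneg_pos integral_nonneg) auto
    show "(\<integral>y. (flow t y)\<^sup>2 \<partial>\<rho>0) \<le> M T" if "0 \<le> t" "t \<le> T" for t T
      by (rule le[OF B(2)[OF that] flow_integrable(2)[OF that(1)]])
    show "(\<integral>y. (drag t y)\<^sup>2 \<partial>\<rho>0) \<le> M T" if "0 \<le> t" "t \<le> T" for t T
      by (rule le[OF B(3)[OF that] drag_integrable(2)[OF that(1)]])
    show "(\<integral>y. (speed t y)\<^sup>2 \<partial>\<rho>0) \<le> M T" if "good_time t" "t \<le> T" for t T
      using speed_L2(2)[OF that(1)] le[OF B(4)[OF good_time_nonneg[OF that(1)] that(2)] impulse_integrable(2)[OF good_time_nonneg[OF that(1)]]]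
      by simp
  qed
qed

lemma pair_sigma: "pair_sigma_finite lborel \<rho>0"
  by (simp add: pair_sigma_finite_def sigma_finite_lborel sigma_finite_measure_axioms)

lemma pair_integrable_bounded:
  fixes h :: "real \<Rightarrow> real \<Rightarrow> real"
  assumes [measurable]: "(\<lambda>p. h (fst p) (snd p)) \<in> borel_measurable (borel \<Otimes>\<^sub>M borel)" and st: "s \<le> t"
    and i: "AE r in lborel. s \<le> r \<longrightarrow> r < t \<longrightarrow> integrable \<rho>0 (h r) \<and> (\<integral>y. \<bar>h r y\<bar> \<partial>\<rho>0) \<le> C"
  shows "integrable (lborel \<Otimes>\<^sub>M \<rho>0) (\<lambda>(r, y). indicator {s..<t} r * h r y)"
proof -
  interpret pair_sigma_finite lborel \<rho>0 by (rule pair_sigma)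
  have m[measurable]: "(\<lambda>(r, y). indicator {s..<t} r * h r y) \<in> borel_measurable (lborel \<Otimes>\<^sub>M \<rho>0)"
    unfolding case_prod_beta by measurable
  show ?thesis
  proof (rule Fubini_integrable[OF m])
    show "AE r in lborel. integrable \<rho>0 (\<lambda>y. case (r, y) of (r, y) \<Rightarrow> indicator {s..<t} r * h r y)"
      using i by eventually_elim (auto simp: indicator_def)
    show "integrable lborel (\<lambda>r. \<integral>y. norm (case (r, y) of (r, y) \<Rightarrow> indicator {s..<t} r * h r y) \<partial>\<rho>0)"
    proof (rule Bochner_Integration.integrable_bound)
      show "integrable lborel (\<lambda>r. indicator {s..<t} r * C)" using st by (intro integrable_mult_left) simp
      show "AE r in lborel. norm (\<integral>y. norm (case (r, y) of (r, y) \<Rightarrow> indicator {s..<t} r * h r y) \<partial>\<rho>0) \<le> norm (indicator {s..<t} r * C)"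
        using i
      proof eventually_elim
        case (elim r)
        show ?case
        proof (cases "r \<in> {s..<t}")
          case True
          then have "0 \<le> (\<integral>y. \<bar>h r y\<bar> \<partial>\<rho>0)" "(\<integral>y. \<bar>h r y\<bar> \<partial>\<rho>0) \<le> C" using elim by auto
          then show ?thesis using True by simp
        qed simp
      qed
    qed measurable
  qed
qed

lemma pair_fubini:
  fixes h :: "real \<Rightarrow> real \<Rightarrow> real"
  assumes "integrable (lborel \<Otimes>\<^sub>M \<rho>0) (\<lambda>(r, y). indicator {s..<t} r * h r y)"
  shows "AE y in \<rho>0. set_integrable lborel {s..<t} (\<lambda>r. h r y)"
    and "integrable \<rho>0 (\<lambda>y. LBINT r:{s..<t}. h r y)"
    and "(\<integral>y. (LBINT r:{s..<t}. h r y) \<partial>\<rho>0) = (LBINT r:{s..<t}. \<integral>y. h r y \<partial>\<rho>0)"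
    and "set_integrable lborel {s..<t} (\<lambda>r. \<integral>y. h r y \<partial>\<rho>0)"
proof -
  interpret pair_sigma_finite lborel \<rho>0 by (rule pair_sigma)
  show "AE y in \<rho>0. set_integrable lborel {s..<t} (\<lambda>r. h r y)"
    using AE_integrable_snd[OF assms] by (simp add: set_integrable_def)
  show "integrable \<rho>0 (\<lambda>y. LBINT r:{s..<t}. h r y)"
    using integrable_snd[OF assms] by (simp add: set_lebesgue_integral_def)
  show "set_integrable lborel {s..<t} (\<lambda>r. \<integral>y. h r y \<partial>\<rho>0)"
    using integrable_fst[OF assms] by (simp add: set_integrable_def)
  show "(\<integral>y. (LBINT r:{s..<t}. h r y) \<partial>\<rho>0) = (LBINT r:{s..<t}. \<integral>y. h r y \<partial>\<rho>0)"
    using Fubini_integral[OF assms] by (simp add: set_lebesgue_integral_def)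
qed

lemma AE_good_time_within: "AE r in lborel. 0 \<le> s \<longrightarrow> s \<le> r \<longrightarrow> good_time r"
  using AE_good_time by eventually_elim auto

lemma speed_product_integrable:
  assumes st: "0 \<le> s" "s \<le> t" and [measurable]: "g \<in> borel_measurable borel"
    and g: "integrable \<rho>0 (\<lambda>y. (g y)\<^sup>2)"
  shows "integrable (lborel \<Otimes>\<^sub>M \<rho>0) (\<lambda>(r, y). indicator {s..<t} r * (speed r y * g y))"
proof -
  obtain M where M: "\<And>T. 0 < M T" "\<And>t T. good_time t \<Longrightarrow> t \<le> T \<Longrightarrow> (\<integral>y. (speed t y)\<^sup>2 \<partial>\<rho>0) \<le> M T"
    by (rule L2_bounds) blast
  show ?thesis
  proof (rule pair_integrable_bounded[where C="M t + (\<integral>y. (g y)\<^sup>2 \<partial>\<rho>0)"])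
    show "AE r in lborel. s \<le> r \<longrightarrow> r < t \<longrightarrow> integrable \<rho>0 (\<lambda>y. speed r y * g y) \<and>
       (\<integral>y. \<bar>speed r y * g y\<bar> \<partial>\<rho>0) \<le> M t + (\<integral>y. (g y)\<^sup>2 \<partial>\<rho>0)"
      using AE_good_time_within[of s]
    proof (eventually_elim, intro impI conjI)
      fix r assume "0 \<le> s \<longrightarrow> s \<le> r \<longrightarrow> good_time r" "s \<le> r" "r < t"
      then have r: "good_time r" "r \<le> t" using st by auto
      show i: "integrable \<rho>0 (\<lambda>y. speed r y * g y)"
        by (rule integrable_product_sq[OF speed_L2(1)[OF r(1)] g]) measurable
      have "(\<integral>y. \<bar>speed r y * g y\<bar> \<partial>\<rho>0) \<le> (\<integral>y. (speed r y)\<^sup>2 + (g y)\<^sup>2 \<partial>\<rho>0)"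
      proof (rule integral_mono)
        fix y
        show "\<bar>speed r y * g y\<bar> \<le> (speed r y)\<^sup>2 + (g y)\<^sup>2"
          using sum_squares_bound[of "\<bar>speed r y\<bar>" "\<bar>g y\<bar>"] abs_ge_zero[of "speed r y * g y"]
          unfolding abs_mult power2_abs by linarith
      qed (use i speed_L2(1)[OF r(1)] g in auto)
      also have "\<dots> = (\<integral>y. (speed r y)\<^sup>2 \<partial>\<rho>0) + (\<integral>y. (g y)\<^sup>2 \<partial>\<rho>0)" using speed_L2(1)[OF r(1)] g by simp
      finally show "(\<integral>y. \<bar>speed r y * g y\<bar> \<partial>\<rho>0) \<le> M t + (\<integral>y. (g y)\<^sup>2 \<partial>\<rho>0)"
        using M(2)[OF r] by linarith
    qed
  qed (use st in measurable)
qed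

lemma speed_sq_integrable:
  assumes st: "0 \<le> s" "s \<le> t"
  shows "integrable (lborel \<Otimes>\<^sub>M \<rho>0) (\<lambda>(r, y). indicator {s..<t} r * (speed r y)\<^sup>2)"
proof -
  obtain M where M: "\<And>T. 0 < M T" "\<And>t T. good_time t \<Longrightarrow> t \<le> T \<Longrightarrow> (\<integral>y. (speed t y)\<^sup>2 \<partial>\<rho>0) \<le> M T"
    by (rule L2_bounds) blast
  show ?thesis
  proof (rule pair_integrable_bounded[where C="M t"])
    show "AE r in lborel. s \<le> r \<longrightarrow> r < t \<longrightarrow> integrable \<rho>0 (\<lambda>y. (speed r y)\<^sup>2) \<and> (\<integral>y. \<bar>(speed r y)\<^sup>2\<bar> \<partial>\<rho>0) \<le> M t"
      using AE_good_time_within[of s]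
    proof (eventually_elim, intro impI)
      fix r assume "0 \<le> s \<longrightarrow> s \<le> r \<longrightarrow> good_time r" "s \<le> r" "r < t"
      then have r: "good_time r" "r \<le> t" using st by auto
      show "integrable \<rho>0 (\<lambda>y. (speed r y)\<^sup>2) \<and> (\<integral>y. \<bar>(speed r y)\<^sup>2\<bar> \<partial>\<rho>0) \<le> M t"
        using speed_L2(1)[OF r(1)] M(2)[OF r] by simp
    qed
  qed (use st in measurable)
qed

section \<open>Displacements and defects\<close>

definition displacement :: "real \<Rightarrow> real \<Rightarrow> real \<Rightarrow> real" where
  "displacement s t y = (LBINT r:{s..<t}. speed r y)"

lemma displacement_measurable [measurable]: "displacement s t \<in> borel_measurable borel"
  unfolding displacement_def[abs_def] set_lebesgue_integral_def by measurable

lemma AE_speed_integrable: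
  assumes "0 \<le> s" "s \<le> t"
  shows "AE y in \<rho>0. set_integrable lborel {s..<t} (\<lambda>r. speed r y) \<and> set_integrable lborel {s..<t} (\<lambda>r. (speed r y)\<^sup>2)"
proof -
  have "AE y in \<rho>0. set_integrable lborel {s..<t} (\<lambda>r. speed r y * 1)"
    by (rule pair_fubini(1)[OF speed_product_integrable[OF assms]]) auto
  moreover have "AE y in \<rho>0. set_integrable lborel {s..<t} (\<lambda>r. (speed r y)\<^sup>2)"
    by (rule pair_fubini(1)[OF speed_sq_integrable[OF assms]])
  ultimately show ?thesis by eventually_elim simp
qed

lemma set_integral_cauchy_schwarz:
  fixes k :: "real \<Rightarrow> real"
  assumes "s \<le> t" "set_integrable lborel {s..<t} k" "set_integrable lborel {s..<t} (\<lambda>r. (k r)\<^sup>2)"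
  shows "(LBINT r:{s..<t}. k r)\<^sup>2 \<le> (t - s) * (LBINT r:{s..<t}. (k r)\<^sup>2)"
proof (cases "s = t")
  case True
  then show ?thesis by (simp add: set_lebesgue_integral_def)
next
  case False
  \<comment> \<open>The mean of k; the inequality says that the variance is nonnegative.\<close>
  define a where "a = (LBINT r:{s..<t}. k r) / (t - s)"
  have len: "(LBINT r:{s..<t}. a) = a * (t - s)" for a
    using assms(1) by (simp add: set_lebesgue_integral_def)
  have ic: "set_integrable lborel {s..<t} (\<lambda>r. a)" for a :: real
    using assms(1) unfolding set_integrable_def real_scaleR_def by (intro integrable_mult_left) simp
  have "0 \<le> (LBINT r:{s..<t}. (k r - a)\<^sup>2)"
    unfolding set_lebesgue_integral_def by (intro Bochner_Integration.integral_nonneg) auto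
  also have "\<dots> = (LBINT r:{s..<t}. (k r)\<^sup>2 + (a\<^sup>2 + (- 2 * a) * k r))"
    by (simp add: power2_diff algebra_simps)
  also have "\<dots> = (LBINT r:{s..<t}. (k r)\<^sup>2) + ((LBINT r:{s..<t}. a\<^sup>2) + (LBINT r:{s..<t}. (- 2 * a) * k r))"
    using assms ic by (simp only: set_integral_add set_integrable_mult_right)
  also have "\<dots> = (LBINT r:{s..<t}. (k r)\<^sup>2) + (a\<^sup>2 * (t - s) + (- 2 * a) * (LBINT r:{s..<t}. k r))"
    by (simp only: len set_integral_mult_right)
  also have "(LBINT r:{s..<t}. k r) = a * (t - s)" using False by (simp add: a_def)
  also have "a\<^sup>2 * (t - s) + (- 2 * a) * (a * (t - s)) = - (a\<^sup>2 * (t - s))"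
    by (simp add: power2_eq_square algebra_simps)
  finally have "a\<^sup>2 * (t - s) \<le> (LBINT r:{s..<t}. (k r)\<^sup>2)" by simp
  then have "(t - s) * (a\<^sup>2 * (t - s)) \<le> (t - s) * (LBINT r:{s..<t}. (k r)\<^sup>2)"
    using assms(1) by (intro mult_left_mono) auto
  moreover have "(LBINT r:{s..<t}. k r)\<^sup>2 = (t - s) * (a\<^sup>2 * (t - s))"
    using False by (simp add: a_def power2_eq_square)
  ultimately show ?thesis by simp
qed

text \<open>Cauchy-Schwarz in time and Fubini. The square of the length t - s is what makes a fine
  subdivision profitable in \<open>defect_zero\<close>.\<close>

lemma displacement_L2:
  assumes st: "0 \<le> s" "s \<le> t"
  shows "integrable \<rho>0 (\<lambda>y. (displacement s t y)\<^sup>2)"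
    and "(\<And>r. good_time r \<Longrightarrow> r \<le> t \<Longrightarrow> (\<integral>y. (speed r y)\<^sup>2 \<partial>\<rho>0) \<le> M) \<Longrightarrow> (\<integral>y. (displacement s t y)\<^sup>2 \<partial>\<rho>0) \<le> M * (t - s)\<^sup>2"
proof -
  note F = pair_fubini[OF speed_sq_integrable[OF st]]
  have AE: "AE y in \<rho>0. (displacement s t y)\<^sup>2 \<le> (t - s) * (LBINT r:{s..<t}. (speed r y)\<^sup>2)"
    using AE_speed_integrable[OF st]
    by eventually_elim (unfold displacement_def, rule set_integral_cauchy_schwarz[OF st(2)], auto)
  have im: "integrable \<rho>0 (\<lambda>y. (t - s) * (LBINT r:{s..<t}. (speed r y)\<^sup>2))" using F(2) by simp
  show i: "integrable \<rho>0 (\<lambda>y. (displacement s t y)\<^sup>2)"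
    by (rule Bochner_Integration.integrable_bound[OF im]) (measurable, use AE in eventually_elim, auto)
  assume M: "\<And>r. good_time r \<Longrightarrow> r \<le> t \<Longrightarrow> (\<integral>y. (speed r y)\<^sup>2 \<partial>\<rho>0) \<le> M"
  have "(\<integral>y. (displacement s t y)\<^sup>2 \<partial>\<rho>0) \<le> (\<integral>y. (t - s) * (LBINT r:{s..<t}. (speed r y)\<^sup>2) \<partial>\<rho>0)"
    by (rule integral_mono_AE[OF i im AE])
  also have "\<dots> = (t - s) * (LBINT r:{s..<t}. \<integral>y. (speed r y)\<^sup>2 \<partial>\<rho>0)" using F(3) by simp
  also have "(LBINT r:{s..<t}. \<integral>y. (speed r y)\<^sup>2 \<partial>\<rho>0) \<le> (\<integral>r. indicator {s..<t} r * M \<partial>lborel)"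
    unfolding set_lebesgue_integral_def
  proof (rule integral_mono_AE)
    show "AE r in lborel. indicator {s..<t} r *\<^sub>R (\<integral>y. (speed r y)\<^sup>2 \<partial>\<rho>0) \<le> indicator {s..<t} r * M"
      using AE_good_time_within[of s] by eventually_elim (use st M in \<open>auto simp: indicator_def\<close>)
    show "integrable lborel (\<lambda>r. indicator {s..<t} r * M)" using st by (intro integrable_mult_left) simp
  qed (use F(4) in \<open>simp add: set_integrable_def\<close>)
  also have "(\<integral>r. indicator {s..<t} r * M \<partial>lborel) = M * (t - s)" using st by simp
  also have "(t - s) * (M * (t - s)) = M * (t - s)\<^sup>2" by (simp add: power2_eq_square)
  finally show "(\<integral>y. (displacement s t y)\<^sup>2 \<partial>\<rho>0) \<le> M * (t - s)\<^sup>2" using st by (simp add: mult_left_mono)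
qed


lemma flow_increment_L2:
  obtains C where "\<And>T. 0 < C T"
    "\<And>s t T. 0 \<le> s \<Longrightarrow> s \<le> t \<Longrightarrow> t \<le> T \<Longrightarrow> (\<integral>y. (flow t y - flow s y)\<^sup>2 \<partial>\<rho>0) \<le> C T * (t - s)\<^sup>2"
proof -
  obtain Q where Q: "\<And>T. 0 < Q T"
    "\<And>k s t T. 0 \<le> s \<Longrightarrow> s \<le> t \<Longrightarrow> t \<le> T \<Longrightarrow> (\<integral>y. (path k t y - path k s y)\<^sup>2 \<partial>\<rho>0) \<le> ((t - s + mesh k) * Q T)\<^sup>2"
    by (rule path_L2) blast
  obtain B where B: "\<And>T. 1 \<le> B T"
    "\<And>k t T y. 0 \<le> t \<Longrightarrow> t \<le> T \<Longrightarrow> y \<in> good \<Longrightarrow> \<bar>path k t y\<bar> \<le> B T * (1 + \<bar>y\<bar>)"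
    by (rule path_flow_bound) blast
  show ?thesis
  proof (rule that[of "\<lambda>T. (Q T)\<^sup>2"])
    show "0 < (Q T)\<^sup>2" for T using Q(1)[of T] by simp
    fix s t T :: real assume st: "0 \<le> s" "s \<le> t" "t \<le> T"
    have "(\<lambda>k. \<integral>y. (path (selection k) t y - path (selection k) s y)\<^sup>2 \<partial>\<rho>0) \<longlonglongrightarrow> (\<integral>y. (flow t y - flow s y)\<^sup>2 \<partial>\<rho>0)"
    proof (rule integral_dominated_convergence[where w="\<lambda>y. (2 * B T + 2 * B T * \<bar>y\<bar>)\<^sup>2"])
      show "AE y in \<rho>0. (\<lambda>k. (path (selection k) t y - path (selection k) s y)\<^sup>2) \<longlonglongrightarrow> (flow t y - flow s y)\<^sup>2"
        using AE_good by eventually_elim (use st in \<open>auto intro!: tendsto_intros flow_limit\<close>)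
      show "AE y in \<rho>0. norm ((path (selection k) t y - path (selection k) s y)\<^sup>2) \<le> (2 * B T + 2 * B T * \<bar>y\<bar>)\<^sup>2" for k
        using AE_good
      proof eventually_elim
        case (elim y)
        have "\<bar>path (selection k) t y - path (selection k) s y\<bar> \<le> B T * (1 + \<bar>y\<bar>) + B T * (1 + \<bar>y\<bar>)"
          using B(2)[of t T y "selection k"] B(2)[of s T y "selection k"] st elim by linarith
        also have "\<dots> = 2 * B T + 2 * B T * \<bar>y\<bar>" by (simp add: algebra_simps)
        finally show ?case using power_mono[of "\<bar>path (selection k) t y - path (selection k) s y\<bar>" _ 2] by simp
      qed
    qed (auto intro: integrable_affine_sq)
    moreover have "(\<lambda>k. ((t - s + mesh (selection k)) * Q T)\<^sup>2) \<longlonglongrightarrow> ((t - s + 0) * Q T)\<^sup>2"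
      by (intro tendsto_intros selection_tendsto mesh_tendsto)
    ultimately have "(\<integral>y. (flow t y - flow s y)\<^sup>2 \<partial>\<rho>0) \<le> ((t - s + 0) * Q T)\<^sup>2"
      by (rule LIMSEQ_le) (use Q(2)[OF st] in auto)
    then show "(\<integral>y. (flow t y - flow s y)\<^sup>2 \<partial>\<rho>0) \<le> (Q T)\<^sup>2 * (t - s)\<^sup>2" by (simp add: power_mult_distrib mult.commute)
  qed
qed

definition defect :: "real \<Rightarrow> real \<Rightarrow> real \<Rightarrow> real" where
  "defect s t y = flow t y - flow s y - displacement s t y"

lemma defect_measurable [measurable]: "defect s t \<in> borel_measurable borel"
  unfolding defect_def[abs_def] by measurable

lemma flow_diff_sq_integrable: "0 \<le> s \<Longrightarrow> s \<le> t \<Longrightarrow> integrable \<rho>0 (\<lambda>y. (flow t y - flow s y)\<^sup>2)"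
  by (intro integrable_sum_sq flow_integrable) auto

lemma defect_L2:
  assumes "0 \<le> s" "s \<le> t"
  shows "integrable \<rho>0 (\<lambda>y. (defect s t y)\<^sup>2)"
  unfolding defect_def
  by (intro integrable_sum_sq(2) flow_diff_sq_integrable displacement_L2(1) assms) measurable

lemma defect_L2_bound:
  obtains C where "\<And>T. 0 < C T"
    "\<And>s t T. 0 \<le> s \<Longrightarrow> s \<le> t \<Longrightarrow> t \<le> T \<Longrightarrow> (\<integral>y. (defect s t y)\<^sup>2 \<partial>\<rho>0) \<le> C T * (t - s)\<^sup>2"
proof -
  obtain C where C: "\<And>T. 0 < C T"
    "\<And>s t T. 0 \<le> s \<Longrightarrow> s \<le> t \<Longrightarrow> t \<le> T \<Longrightarrow> (\<integral>y. (flow t y - flow s y)\<^sup>2 \<partial>\<rho>0) \<le> C T * (t - s)\<^sup>2"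
    by (rule flow_increment_L2) blast
  obtain M where M: "\<And>T. 0 < M T" "\<And>t T. good_time t \<Longrightarrow> t \<le> T \<Longrightarrow> (\<integral>y. (speed t y)\<^sup>2 \<partial>\<rho>0) \<le> M T"
    by (rule L2_bounds) blast
  show ?thesis
  proof (rule that[of "\<lambda>T. 2 * C T + 2 * M T"])
    show "0 < 2 * C T + 2 * M T" for T using C(1)[of T] M(1)[of T] by simp
    fix s t T :: real assume st: "0 \<le> s" "s \<le> t" "t \<le> T"
    have "(\<integral>y. (defect s t y)\<^sup>2 \<partial>\<rho>0) \<le> (\<integral>y. 2 * (flow t y - flow s y)\<^sup>2 + 2 * (displacement s t y)\<^sup>2 \<partial>\<rho>0)"
    proof (rule integral_mono)
      fix y
      show "(defect s t y)\<^sup>2 \<le> 2 * (flow t y - flow s y)\<^sup>2 + 2 * (displacement s t y)\<^sup>2"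
        using zero_le_power2[of "(flow t y - flow s y) + displacement s t y"]
        unfolding defect_def power2_diff[of "flow t y - flow s y" "displacement s t y"] power2_sum by simp
    qed (use defect_L2 displacement_L2(1) flow_diff_sq_integrable st in auto)
    also have "\<dots> = 2 * (\<integral>y. (flow t y - flow s y)\<^sup>2 \<partial>\<rho>0) + 2 * (\<integral>y. (displacement s t y)\<^sup>2 \<partial>\<rho>0)"
      using displacement_L2(1)[OF st(1,2)] flow_diff_sq_integrable[OF st(1,2)] by simp
    also have "\<dots> \<le> 2 * (C T * (t - s)\<^sup>2) + 2 * (M T * (t - s)\<^sup>2)"
      using C(2)[OF st] displacement_L2(2)[OF st(1,2), of "M T"] M(2) st(3) by (intro add_mono mult_left_mono) auto
    also have "\<dots> = (2 * C T + 2 * M T) * (t - s)\<^sup>2" by (simp add: algebra_simps)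
    finally show "(\<integral>y. (defect s t y)\<^sup>2 \<partial>\<rho>0) \<le> (2 * C T + 2 * M T) * (t - s)\<^sup>2" .
  qed
qed

lemma impulse_product_integrable:
  assumes st: "0 \<le> s" "s \<le> t" and [measurable]: "g \<in> borel_measurable borel"
    and g: "integrable \<rho>0 (\<lambda>y. (g y)\<^sup>2)"
  shows "integrable (lborel \<Otimes>\<^sub>M \<rho>0) (\<lambda>(r, y). indicator {s..<t} r * (impulse r y * g y))"
proof -
  obtain B where B: "\<And>t T y. 0 \<le> t \<Longrightarrow> t \<le> T \<Longrightarrow> \<bar>impulse t y\<bar> \<le> B T * (1 + \<bar>y\<bar>)"
    by (rule growth_bound) blast
  have ig: "integrable \<rho>0 (\<lambda>y. (B t + B t * \<bar>y\<bar>) * \<bar>g y\<bar>)"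
    by (rule integrable_product_sq[OF integrable_affine_sq]) (use g in auto)
  show ?thesis
  proof (rule pair_integrable_bounded[where C="\<integral>y. (B t + B t * \<bar>y\<bar>) * \<bar>g y\<bar> \<partial>\<rho>0"])
    show "AE r in lborel. s \<le> r \<longrightarrow> r < t \<longrightarrow> integrable \<rho>0 (\<lambda>y. impulse r y * g y) \<and>
       (\<integral>y. \<bar>impulse r y * g y\<bar> \<partial>\<rho>0) \<le> (\<integral>y. (B t + B t * \<bar>y\<bar>) * \<bar>g y\<bar> \<partial>\<rho>0)"
    proof (intro AE_I2 impI conjI)
      fix r assume r: "s \<le> r" "r < t"
      have r0: "0 \<le> r" using r st by simp
      show i: "integrable \<rho>0 (\<lambda>y. impulse r y * g y)"
        by (rule integrable_product_sq[OF impulse_integrable(2)[OF r0] g]) measurable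
      show "(\<integral>y. \<bar>impulse r y * g y\<bar> \<partial>\<rho>0) \<le> (\<integral>y. (B t + B t * \<bar>y\<bar>) * \<bar>g y\<bar> \<partial>\<rho>0)"
      proof (rule integral_mono[OF integrable_abs[OF i] ig])
        fix y
        have "\<bar>impulse r y\<bar> \<le> B t + B t * \<bar>y\<bar>" using B[of r t y] r0 r by (simp add: distrib_left)
        then show "\<bar>impulse r y * g y\<bar> \<le> (B t + B t * \<bar>y\<bar>) * \<bar>g y\<bar>"
          unfolding abs_mult by (rule mult_right_mono) simp
      qed
    qed
  qed (use st in measurable)
qed

text \<open>The defect is the flow increment minus the integrated impulse, plus the integral of
  impulse minus speed. The first part is orthogonal to functions of later positions by
  \<open>flow_momentum_le\<close>, the second by \<open>speed_projection\<close> at almost every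
  time in between.\<close>

lemma defect_orthogonal_function:
  assumes st: "0 \<le> s" "s \<le> t" "t \<le> r" and g[measurable]: "g \<in> borel_measurable borel"
    and g2: "integrable \<rho>0 (\<lambda>y. (g (flow r y))\<^sup>2)"
  shows "(\<integral>y. defect s t y * g (flow r y) \<partial>\<rho>0) = 0"
proof -
  define h where "h y = g (flow r y)" for y
  have [measurable]: "h \<in> borel_measurable borel" unfolding h_def by measurable
  have h2: "integrable \<rho>0 (\<lambda>y. (h y)\<^sup>2)" using g2 by (simp add: h_def)
  define I where "I y = (LBINT u:{s..<t}. impulse u y)" for y
  have [measurable]: "I \<in> borel_measurable borel" unfolding I_def set_lebesgue_integral_def by measurable
  note S = speed_product_integrable[OF st(1,2) _ h2, simplified]
  note A = impulse_product_integrable[OF st(1,2) _ h2, simplified]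
  have D: "integrable (lborel \<Otimes>\<^sub>M \<rho>0) (\<lambda>(u, y). indicator {s..<t} u * ((impulse u y - speed u y) * h y))"
  proof -
    have "(\<lambda>(u, y). indicator {s..<t} u * ((impulse u y - speed u y) * h y)) =
      (\<lambda>p. (case p of (u, y) \<Rightarrow> indicator {s..<t} u * (impulse u y * h y)) - (case p of (u, y) \<Rightarrow> indicator {s..<t} u * (speed u y * h y)))"
      by (auto simp: fun_eq_iff algebra_simps)
    then show ?thesis using Bochner_Integration.integrable_diff[OF A S] by simp
  qed
  have "AE y in \<rho>0. set_integrable lborel {s..<t} (\<lambda>u. impulse u y * 1)"
    by (rule pair_fubini(1)[OF impulse_product_integrable[OF st(1,2)]]) auto
  then have AED: "AE y in \<rho>0. (LBINT u:{s..<t}. (impulse u y - speed u y) * h y) = (I y - displacement s t y) * h y"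
    using AE_speed_integrable[OF st(1,2)]
    by eventually_elim (simp add: I_def displacement_def set_integral_diff set_integral_mult_left)
  have Dm: "(\<lambda>y. LBINT u:{s..<t}. (impulse u y - speed u y) * h y) \<in> borel_measurable \<rho>0"
    using pair_fubini(2)[OF D] by simp
  have "(\<integral>y. (I y - displacement s t y) * h y \<partial>\<rho>0) = (\<integral>y. (LBINT u:{s..<t}. (impulse u y - speed u y) * h y) \<partial>\<rho>0)"
    by (rule integral_cong_AE[OF _ Dm]) (measurable, use AED in eventually_elim, erule sym)
  also have "\<dots> = (LBINT u:{s..<t}. \<integral>y. (impulse u y - speed u y) * h y \<partial>\<rho>0)" by (rule pair_fubini(3)[OF D])
  also have "\<dots> = (\<integral>u. 0 \<partial>(lborel :: real measure))"
    unfolding set_lebesgue_integral_def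
  proof (rule integral_cong_AE)
    show "AE u in lborel. indicator {s..<t} u *\<^sub>R (\<integral>y. (impulse u y - speed u y) * h y \<partial>\<rho>0) = 0"
      using AE_good_time_within[of s]
    proof eventually_elim
      case (elim u)
      show ?case
      proof (cases "u \<in> {s..<t}")
        case True
        then have "(\<integral>y. (impulse u y - speed u y) * h y \<partial>\<rho>0) = 0"
          unfolding h_def using elim st g2 by (intro speed_projection) auto
        then show ?thesis by simp
      qed simp
    qed
  qed measurable
  finally have 1: "(\<integral>y. (I y - displacement s t y) * h y \<partial>\<rho>0) = 0" by simp
  have i1: "integrable \<rho>0 (\<lambda>y. (I y - displacement s t y) * h y)"
    by (rule integrable_cong_AE_imp[OF pair_fubini(2)[OF D]]) (measurable, use AED in eventually_elim, (assumption | erule sym))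
  have id: "integrable \<rho>0 (\<lambda>y. defect s t y * h y)"
    by (rule integrable_product_sq[OF defect_L2[OF st(1,2)] h2]) measurable
  have i2: "integrable \<rho>0 (\<lambda>y. (flow t y - flow s y - I y) * h y)"
    using Bochner_Integration.integrable_diff[OF id i1] by (simp add: defect_def algebra_simps)
  have 2: "(\<integral>y. (flow t y - flow s y - I y) * h y \<partial>\<rho>0) = 0"
    using flow_momentum_le[OF st g] i2 by (simp add: I_def h_def)
  have "(\<integral>y. defect s t y * h y \<partial>\<rho>0) = (\<integral>y. (flow t y - flow s y - I y) * h y + (I y - displacement s t y) * h y \<partial>\<rho>0)"
    by (simp add: defect_def algebra_simps)
  also have "\<dots> = 0" using 1 2 i1 i2 by simp
  finally show ?thesis by (simp add: h_def)
qed

text \<open>The later defect consists of positions at s' and t' and of a time integral of speeds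
  between them. All of these are functions of positions at times after t, to which the earlier
  defect is orthogonal.\<close>

lemma defect_orthogonal:
  assumes st: "0 \<le> s" "s \<le> t" "t \<le> s'" "s' \<le> t'"
  shows "(\<integral>y. defect s t y * defect s' t' y \<partial>\<rho>0) = 0"
proof -
  have 0: "0 \<le> s'" "0 \<le> t'" "t \<le> t'" using st by auto
  note d2 = defect_L2[OF st(1,2)]
  have f: "integrable \<rho>0 (\<lambda>y. defect s t y * flow r y)" "(\<integral>y. defect s t y * flow r y \<partial>\<rho>0) = 0"
    if "t \<le> r" for r
  proof -
    have r: "0 \<le> r" using that st by simp
    show "integrable \<rho>0 (\<lambda>y. defect s t y * flow r y)"
      by (rule integrable_product_sq[OF d2 flow_integrable(2)[OF r]]) measurable
    show "(\<integral>y. defect s t y * flow r y \<partial>\<rho>0) = 0"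
      by (rule defect_orthogonal_function[OF st(1,2) that, of "\<lambda>x. x"]) (auto intro: flow_integrable r)
  qed
  have F: "integrable (lborel \<Otimes>\<^sub>M \<rho>0) (\<lambda>(r, y). indicator {s'..<t'} r * (speed r y * defect s t y))"
    by (rule speed_product_integrable[OF 0(1) st(4) _ d2]) measurable
  have D: "integrable \<rho>0 (\<lambda>y. defect s t y * displacement s' t' y)"
    by (rule integrable_product_sq[OF d2 displacement_L2(1)[OF 0(1) st(4)]]) measurable
  have "(\<integral>y. defect s t y * displacement s' t' y \<partial>\<rho>0) = (\<integral>y. (LBINT r:{s'..<t'}. speed r y * defect s t y) \<partial>\<rho>0)"
    by (simp add: displacement_def set_integral_mult_left mult.commute)
  also have "\<dots> = (LBINT r:{s'..<t'}. \<integral>y. speed r y * defect s t y \<partial>\<rho>0)" by (rule pair_fubini(3)[OF F])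
  also have "\<dots> = (\<integral>r. 0 \<partial>(lborel :: real measure))"
    unfolding set_lebesgue_integral_def
  proof (rule integral_cong_AE)
    show "AE r in lborel. indicator {s'..<t'} r *\<^sub>R (\<integral>y. speed r y * defect s t y \<partial>\<rho>0) = 0"
      using AE_good_time_within[of s']
    proof eventually_elim
      case (elim r)
      show ?case
      proof (cases "r \<in> {s'..<t'}")
        case True
        then have r: "good_time r" "t \<le> r" using elim st 0 by auto
        have "(\<lambda>x::real. (x, r)) \<in> measurable borel borel" unfolding borel_prod[symmetric] by measurable
        from measurable_compose[OF this velocity_measurable]
        have "(\<integral>y. defect s t y * velocity (flow r y, r) \<partial>\<rho>0) = 0"
          by (rule defect_orthogonal_function[OF st(1,2) r(2), of "\<lambda>x. velocity (x, r)"])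
             (use speed_L2(1)[OF r(1)] in \<open>simp add: speed_def\<close>)
        then show ?thesis by (simp add: speed_def mult.commute)
      qed simp
    qed
  qed measurable
  finally have 3: "(\<integral>y. defect s t y * displacement s' t' y \<partial>\<rho>0) = 0" by simp
  have "(\<integral>y. defect s t y * defect s' t' y \<partial>\<rho>0) =
    (\<integral>y. defect s t y * flow t' y - defect s t y * flow s' y - defect s t y * displacement s' t' y \<partial>\<rho>0)"
    by (simp add: defect_def[of s' t'] algebra_simps)
  also have "\<dots> = 0"
    using f[OF 0(3)] f[OF st(3)] D 3 by simp
  finally show ?thesis .
qed

lemma displacement_add:
  assumes "s \<le> t" "t \<le> u" "set_integrable lborel {s..<u} (\<lambda>r. speed r y)"
  shows "displacement s u y = displacement s t y + displacement t u y"
proof -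
  have "{s..<u} = {s..<t} \<union> {t..<u}" using assms by auto
  moreover have "set_integrable lborel {s..<t} (\<lambda>r. speed r y)" "set_integrable lborel {t..<u} (\<lambda>r. speed r y)"
    using assms by (auto intro: set_integrable_subset[OF assms(3)])
  ultimately show ?thesis unfolding displacement_def by (simp add: set_integral_Un)
qed

text \<open>The defects of disjoint time intervals are orthogonal and of size at most the length of the
  interval, so that a subdivision into short intervals shows that they vanish.\<close>

lemma defect_zero:
  assumes st: "0 \<le> s" "s \<le> t"
  shows "AE y in \<rho>0. flow t y = flow s y + displacement s t y"
proof -
  obtain C where C: "\<And>T. 0 < C T"
    "\<And>s t T. 0 \<le> s \<Longrightarrow> s \<le> t \<Longrightarrow> t \<le> T \<Longrightarrow> (\<integral>y. (defect s t y)\<^sup>2 \<partial>\<rho>0) \<le> C T * (t - s)\<^sup>2"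
    by (rule defect_L2_bound) blast
  have sub: "(\<integral>y. (defect s (s + real n * \<delta>) y)\<^sup>2 \<partial>\<rho>0) \<le> real n * (C T * \<delta>\<^sup>2)"
    if \<delta>: "0 \<le> \<delta>" and "s + real n * \<delta> \<le> T" for n \<delta> T
    using that(2)
  proof (induction n)
    case 0
    have "defect s s y = 0" for y by (simp add: defect_def displacement_def set_lebesgue_integral_def)
    then show ?case by simp
  next
    case (Suc n)
    let ?t = "s + real n * \<delta>" and ?u = "s + real (Suc n) * \<delta>"
    have tu: "s \<le> ?t" "?t \<le> ?u" "?u - ?t = \<delta>" using \<delta> by (simp_all add: algebra_simps)
    then have 0: "0 \<le> ?t" "s \<le> ?u" using st(1) by auto
    have uT: "?u \<le> T" "?t \<le> T" using Suc.prems tu(2) by auto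
    note i1 = defect_L2[OF st(1) tu(1)] and i2 = defect_L2[OF 0(1) tu(2)]
    have i3: "integrable \<rho>0 (\<lambda>y. defect s ?t y * defect ?t ?u y)"
      by (rule integrable_product_sq[OF i1 i2]) measurable
    have "AE y in \<rho>0. (defect s ?u y)\<^sup>2 = (defect s ?t y)\<^sup>2 + (defect ?t ?u y)\<^sup>2 + 2 * (defect s ?t y * defect ?t ?u y)"
      using AE_speed_integrable[OF st(1) 0(2)]
    proof eventually_elim
      case (elim y)
      then have "defect s ?u y = defect s ?t y + defect ?t ?u y"
        using displacement_add[OF tu(1,2), of y] by (simp add: defect_def)
      then show ?case by (simp add: power2_sum)
    qed
    then have "(\<integral>y. (defect s ?u y)\<^sup>2 \<partial>\<rho>0) = (\<integral>y. (defect s ?t y)\<^sup>2 + (defect ?t ?u y)\<^sup>2 + 2 * (defect s ?t y * defect ?t ?u y) \<partial>\<rho>0)"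
      by (intro integral_cong_AE) auto
    also have "\<dots> = (\<integral>y. (defect s ?t y)\<^sup>2 \<partial>\<rho>0) + (\<integral>y. (defect ?t ?u y)\<^sup>2 \<partial>\<rho>0)"
      using i1 i2 i3 defect_orthogonal[OF st(1) tu(1) order_refl tu(2)] by simp
    also have "\<dots> \<le> real n * (C T * \<delta>\<^sup>2) + C T * \<delta>\<^sup>2"
      using Suc.IH[OF uT(2)] C(2)[OF 0(1) tu(2) uT(1)] tu(3) by simp
    finally show ?case by (simp add: algebra_simps)
  qed
  have "(\<integral>y. (defect s t y)\<^sup>2 \<partial>\<rho>0) \<le> C t * (t - s)\<^sup>2 / real (Suc n)" for n
  proof -
    have e: "s + real (Suc n) * ((t - s) / real (Suc n)) = t" by simp
    have "(\<integral>y. (defect s t y)\<^sup>2 \<partial>\<rho>0) \<le> real (Suc n) * (C t * ((t - s) / real (Suc n))\<^sup>2)"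
      using sub[of "(t - s) / real (Suc n)" "Suc n" t] st unfolding e by simp
    also have "\<dots> = C t * (t - s)\<^sup>2 / real (Suc n)" 
    proof -
      have "N * (C t * (d / N)\<^sup>2) = C t * d\<^sup>2 / N" if "N \<noteq> 0" for N d :: real
        using that by (simp add: power2_eq_square)
      then show ?thesis by simp
    qed
    finally show ?thesis .
  qed
  moreover have "(\<lambda>n. C t * (t - s)\<^sup>2 / real (Suc n)) \<longlonglongrightarrow> 0"
    using tendsto_mult_right_zero[OF LIMSEQ_inverse_real_of_nat] by (simp add: divide_inverse)
  ultimately have "(\<integral>y. (defect s t y)\<^sup>2 \<partial>\<rho>0) \<le> 0" by (intro LIMSEQ_le_const) auto
  moreover have "0 \<le> (\<integral>y. (defect s t y)\<^sup>2 \<partial>\<rho>0)" by (intro Bochner_Integration.integral_nonneg) auto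
  ultimately have "AE y in \<rho>0. (defect s t y)\<^sup>2 = 0"
    using integral_nonneg_eq_0_iff_AE[OF defect_L2[OF st]] by auto
  then show ?thesis by eventually_elim (simp add: defect_def)
qed

section \<open>Integral curves for all times at once\<close>

definition regular :: "real \<Rightarrow> bool" where
  "regular y \<longleftrightarrow> y \<in> good \<and> (\<forall>T\<ge>0. set_integrable lborel {0..<T} (\<lambda>r. speed r y) \<and>
     set_integrable lborel {0..<T} (\<lambda>r. (speed r y)\<^sup>2)) \<and>
     (\<forall>s t. 0 \<le> s \<longrightarrow> s \<le> t \<longrightarrow> flow t y = flow s y + displacement s t y)"

text \<open>The exceptional set in \<open>defect_zero\<close> depends on the times. Using it for
  rational end times only leaves one null set, and continuity of the flow and of the time integral
  reaches all real times.\<close>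

lemma AE_regular: "AE y in \<rho>0. regular y"
proof -
  have "AE y in \<rho>0. \<forall>n::nat. set_integrable lborel {0..<real n} (\<lambda>r. speed r y) \<and> set_integrable lborel {0..<real n} (\<lambda>r. (speed r y)\<^sup>2)"
    using AE_speed_integrable[of 0] by (simp add: AE_all_countable)
  moreover have "AE y in \<rho>0. \<forall>q\<in>\<rat>. 0 \<le> q \<longrightarrow> flow q y = flow 0 y + displacement 0 q y"
    using defect_zero[of 0] by (subst AE_ball_countable) (auto simp: countable_rat)
  ultimately show ?thesis using AE_good
  proof eventually_elim
    case (elim y)
    have i: "set_integrable lborel {0..<T} (\<lambda>r. speed r y)" "set_integrable lborel {0..<T} (\<lambda>r. (speed r y)\<^sup>2)" for T
    proof -
      obtain n :: nat where "T \<le> real n" using real_arch_simple by blast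
      then have "{0..<T} \<subseteq> {0..<real n}" by auto
      then show "set_integrable lborel {0..<T} (\<lambda>r. speed r y)" "set_integrable lborel {0..<T} (\<lambda>r. (speed r y)\<^sup>2)"
        using elim(1) by (auto intro: set_integrable_subset[of _ "{0..<real n}"])
    qed
    have from_0: "flow t y = flow 0 y + displacement 0 t y" if t: "0 \<le> t" for t
    proof -
      have "\<exists>q\<in>\<rat>. t < q \<and> q < t + 1 / real (Suc n)" for n
        using Rats_dense_in_real[of t "t + 1 / real (Suc n)"] by auto
      then obtain q where q: "\<And>n. q n \<in> \<rat>" "\<And>n. t < q n" "\<And>n. q n < t + 1 / real (Suc n)" by metis
      have qt: "q \<longlonglongrightarrow> t"
      proof (rule tendsto_sandwich)
        show "\<forall>\<^sub>F n in sequentially. t \<le> q n" "\<forall>\<^sub>F n in sequentially. q n \<le> t + 1 / real (Suc n)"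
          by (rule always_eventually, rule allI, rule less_imp_le, rule q)+
        show "(\<lambda>n. t + 1 / real (Suc n)) \<longlonglongrightarrow> t"
          using tendsto_add[OF tendsto_const LIMSEQ_inverse_real_of_nat] by (simp add: inverse_eq_divide)
      qed simp
      have "(\<lambda>n. displacement 0 (q n) y) \<longlonglongrightarrow> displacement 0 t y"
        unfolding displacement_def set_lebesgue_integral_def
      proof (rule integral_dominated_convergence[where w="\<lambda>r. \<bar>indicator {0..<t + 1} r *\<^sub>R speed r y\<bar>"])
        show "integrable lborel (\<lambda>r. \<bar>indicator {0..<t + 1} r *\<^sub>R speed r y\<bar>)"
          using i(1)[of "t + 1"] by (intro integrable_abs) (simp add: set_integrable_def)
        \<comment> \<open>At r = t convergence may fail: the point belongs to every approximating
          interval but not to the limiting one.\<close>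
        show "AE r in lborel. (\<lambda>n. indicator {0..<q n} r *\<^sub>R speed r y) \<longlonglongrightarrow> indicator {0..<t} r *\<^sub>R speed r y"
          using AE_lborel_singleton[of t]
        proof eventually_elim
          case (elim r)
          have "\<forall>\<^sub>F n in sequentially. indicator {0..<q n} r = (indicator {0..<t} r :: real)"
          proof (cases "r < t")
            case True
            then have "r < q n" for n using q(2)[of n] by simp
            then show ?thesis using True by (simp add: indicator_def)
          next
            case False
            then have "\<forall>\<^sub>F n in sequentially. q n < r" using elim order_tendstoD(2)[OF qt, of r] by simp
            then show ?thesis by eventually_elim (use False in \<open>simp add: indicator_def\<close>)
          qed
          then have "\<forall>\<^sub>F n in sequentially. indicator {0..<q n} r *\<^sub>R speed r y = indicator {0..<t} r *\<^sub>R speed r y"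
            by eventually_elim simp
          then show ?case by (rule tendsto_eventually)
        qed
        show "AE r in lborel. norm (indicator {0..<q n} r *\<^sub>R speed r y) \<le> \<bar>indicator {0..<t + 1} r *\<^sub>R speed r y\<bar>" for n
        proof (rule AE_I2)
          fix r
          have "q n \<le> t + 1"
          proof -
            have "1 / real (Suc n) \<le> 1" by simp
            then show ?thesis using q(3)[of n] by linarith
          qed
          then show "norm (indicator {0..<q n} r *\<^sub>R speed r y) \<le> \<bar>indicator {0..<t + 1} r *\<^sub>R speed r y\<bar>"
            by (auto simp: indicator_def)
        qed
      qed measurable
      then have "(\<lambda>n. flow 0 y + displacement 0 (q n) y) \<longlonglongrightarrow> flow 0 y + displacement 0 t y" by (intro tendsto_intros)
      moreover have "flow 0 y + displacement 0 (q n) y = flow (q n) y" for n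
        by (rule elim(2)[rule_format, symmetric]) (use q(1,2)[of n] t in simp_all)
      moreover have "(\<lambda>n. flow (q n) y) \<longlonglongrightarrow> flow t y"
        by (rule continuous_on_tendsto_compose[OF flow_continuous qt]) auto
      ultimately show ?thesis by (simp only: LIMSEQ_unique)
    qed
    show ?case unfolding regular_def
    proof (intro conjI allI impI)
      fix s t :: real assume st: "0 \<le> s" "s \<le> t"
      then show "flow t y = flow s y + displacement s t y"
        using from_0[OF st(1)] from_0[of t] displacement_add[OF st i(1)] by linarith
    qed (use elim(3) i in auto)
  qed
qed

end

section \<open>A chain rule and test functions\<close>

lemma mean_value_segment:
  fixes F Fx Fy :: "real \<Rightarrow> real \<Rightarrow> real"
  assumes F: "\<And>x y. ((\<lambda>z. F (fst z) (snd z)) has_derivative (\<lambda>h. Fx x y * fst h + Fy x y * snd h)) (at (x, y))"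
  obtains \<theta> where "0 < \<theta>" "\<theta> < 1"
    "F x' y' - F x y = Fx (x + \<theta> * (x' - x)) (y + \<theta> * (y' - y)) * (x' - x) + Fy (x + \<theta> * (x' - x)) (y + \<theta> * (y' - y)) * (y' - y)"
proof -
  define G where "G \<theta> = F (x + \<theta> * (x' - x)) (y + \<theta> * (y' - y))" for \<theta>
  define G' where "G' \<theta> = Fx (x + \<theta> * (x' - x)) (y + \<theta> * (y' - y)) * (x' - x) + Fy (x + \<theta> * (x' - x)) (y + \<theta> * (y' - y)) * (y' - y)" for \<theta>
  have "(G has_real_derivative G' \<theta>) (at \<theta>)" for \<theta>
  proof -
    have "((\<lambda>\<theta>. (x + \<theta> * (x' - x), y + \<theta> * (y' - y))) has_derivative (\<lambda>h. (h * (x' - x), h * (y' - y)))) (at \<theta>)"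
      by (auto intro!: derivative_eq_intros)
    from has_derivative_compose[OF this F]
    have "(G has_derivative (\<lambda>h. Fx (x + \<theta> * (x' - x)) (y + \<theta> * (y' - y)) * (h * (x' - x)) + Fy (x + \<theta> * (x' - x)) (y + \<theta> * (y' - y)) * (h * (y' - y)))) (at \<theta>)"
      by (simp add: G_def[abs_def])
    then show ?thesis unfolding has_field_derivative_def
      by (rule has_derivative_eq_rhs) (auto simp: fun_eq_iff G'_def algebra_simps)
  qed
  then obtain \<theta> where "0 < \<theta>" "\<theta> < 1" "G 1 - G 0 = (1 - 0) * G' \<theta>"
    using MVT2[of 0 1 G G'] by auto
  then show ?thesis using that by (simp add: G_def G'_def)
qed

lemma set_integral_abs_bound:
  fixes g w :: "real \<Rightarrow> real"
  assumes "set_integrable lborel A g" "set_integrable lborel A w" "\<And>r. r \<in> A \<Longrightarrow> \<bar>g r\<bar> \<le> w r"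
  shows "\<bar>LBINT r:A. g r\<bar> \<le> (LBINT r:A. w r)"
  unfolding set_lebesgue_integral_def
  by (rule integral_abs_le_AE) (use assms in \<open>auto simp: set_integrable_def indicator_def\<close>)

lemma set_integrable_continuous_mult:
  fixes g u :: "real \<Rightarrow> real"
  assumes "continuous_on UNIV g" "set_integrable lborel {a..<b} u"
  shows "set_integrable lborel {a..<b} (\<lambda>r. g r * u r)"
proof -
  have "compact (g ` {a..b})"
    by (intro compact_continuous_image continuous_on_subset[OF assms(1)]) auto
  then obtain B where B: "\<And>r. r \<in> {a..b} \<Longrightarrow> \<bar>g r\<bar> \<le> B"
    using compact_imp_bounded bounded_iff by (metis imageI real_norm_def)
  have [measurable]: "g \<in> borel_measurable borel" using assms(1) by (rule borel_measurable_continuous_onI)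
  have [measurable]: "(\<lambda>r. indicator {a..<b} r *\<^sub>R u r) \<in> borel_measurable lborel"
    using assms(2) by (auto simp: set_integrable_def)
  show ?thesis unfolding set_integrable_def
  proof (rule Bochner_Integration.integrable_bound)
    show "integrable lborel (\<lambda>r. \<bar>B\<bar> * (indicator {a..<b} r *\<^sub>R u r))"
      using assms(2) by (simp add: set_integrable_def)
    show "AE r in lborel. norm (indicator {a..<b} r *\<^sub>R (g r * u r)) \<le> norm (\<bar>B\<bar> * (indicator {a..<b} r *\<^sub>R u r))"
    proof (rule AE_I2)
      fix r
      have "\<bar>g r\<bar> * \<bar>u r\<bar> \<le> \<bar>B\<bar> * \<bar>u r\<bar>" if "r \<in> {a..<b}" using B[of r] that by (intro mult_right_mono) auto
      then show "norm (indicator {a..<b} r *\<^sub>R (g r * u r)) \<le> norm (\<bar>B\<bar> * (indicator {a..<b} r *\<^sub>R u r))"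
        by (cases "r \<in> {a..<b}") (auto simp: abs_mult)
    qed
    have "(\<lambda>r. g r * (indicator {a..<b} r *\<^sub>R u r)) \<in> borel_measurable lborel" by measurable
    then show "(\<lambda>r. indicator {a..<b} r *\<^sub>R (g r * u r)) \<in> borel_measurable lborel" by (simp add: mult_ac)
  qed
qed

text \<open>On a short interval the increment of \<open>F\<close> is, by the mean value theorem, the integral
  with the partial derivatives frozen at an intermediate point.\<close>

lemma absolutely_continuous_chain_rule:
  fixes X Y u w :: "real \<Rightarrow> real" and F Fx Fy :: "real \<Rightarrow> real \<Rightarrow> real"
  assumes ab: "a \<le> b" and u: "set_integrable lborel {a..<b} u" and w: "set_integrable lborel {a..<b} w"
    and X: "\<And>s t. a \<le> s \<Longrightarrow> s \<le> t \<Longrightarrow> t \<le> b \<Longrightarrow> X t = X s + (LBINT r:{s..<t}. u r)"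
    and Y: "\<And>s t. a \<le> s \<Longrightarrow> s \<le> t \<Longrightarrow> t \<le> b \<Longrightarrow> Y t = Y s + (LBINT r:{s..<t}. w r)"
    and cX: "continuous_on UNIV X" and cY: "continuous_on UNIV Y"
    and F: "\<And>x y. ((\<lambda>z. F (fst z) (snd z)) has_derivative (\<lambda>h. Fx x y * fst h + Fy x y * snd h)) (at (x, y))"
    and cFx: "continuous_on UNIV (\<lambda>z. Fx (fst z) (snd z))" and cFy: "continuous_on UNIV (\<lambda>z. Fy (fst z) (snd z))"
  shows "set_integrable lborel {a..<b} (\<lambda>r. Fx (X r) (Y r) * u r + Fy (X r) (Y r) * w r)"
    and "F (X b) (Y b) = F (X a) (Y a) + (LBINT r:{a..<b}. Fx (X r) (Y r) * u r + Fy (X r) (Y r) * w r)"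
proof -
  define k where "k r = Fx (X r) (Y r) * u r + Fy (X r) (Y r) * w r" for r
  have cFxX: "continuous_on UNIV (\<lambda>r. Fx (X r) (Y r))" and cFyX: "continuous_on UNIV (\<lambda>r. Fy (X r) (Y r))"
    using continuous_on_compose2[OF cFx, of UNIV "\<lambda>r. (X r, Y r)"] continuous_on_compose2[OF cFy, of UNIV "\<lambda>r. (X r, Y r)"]
    by (auto intro!: continuous_intros cX cY)
  have ik: "set_integrable lborel {a..<b} k" unfolding k_def[abs_def]
    by (intro set_integral_add set_integrable_continuous_mult cFxX cFyX u w)
  then show "set_integrable lborel {a..<b} (\<lambda>r. Fx (X r) (Y r) * u r + Fy (X r) (Y r) * w r)" by (simp add: k_def[abs_def])
  have sub: "set_integrable lborel {s..<t} g" if "set_integrable lborel {a..<b} g" "a \<le> s" "t \<le> b" for g :: "real \<Rightarrow> real" and s t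
    by (rule set_integrable_subset[OF that(1)]) (use that in auto)
  define q where "q r = \<bar>u r\<bar> + \<bar>w r\<bar>" for r
  have iq: "set_integrable lborel {a..<b} q"
    unfolding q_def[abs_def] using u w by (intro set_integral_add set_integrable_abs)
  \<comment> \<open>The error of the chain rule. On short intervals it grows by at most \<epsilon>
    times the integral of |u| + |w|; summing over a subdivision and letting \<epsilon> tend to 0
    gives H b = 0.\<close>
  define H where "H t = F (X t) (Y t) - F (X a) (Y a) - (LBINT r:{a..<t}. k r)" for t
  have split: "(LBINT r:{a..<t}. g r) = (LBINT r:{a..<s}. g r) + (LBINT r:{s..<t}. g r)"
    if "set_integrable lborel {a..<b} g" "a \<le> s" "s \<le> t" "t \<le> b" for g :: "real \<Rightarrow> real" and s t
  proof -
    have "{a..<t} = {a..<s} \<union> {s..<t}" using that by auto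
    then show ?thesis using sub[OF that(1)] that by (simp add: set_integral_Un)
  qed
  obtain R where R: "\<And>r. r \<in> {a..b} \<Longrightarrow> \<bar>X r\<bar> \<le> R" "\<And>r. r \<in> {a..b} \<Longrightarrow> \<bar>Y r\<bar> \<le> R"
  proof -
    have "compact (X ` {a..b})" "compact (Y ` {a..b})"
      by (intro compact_continuous_image continuous_on_subset[OF cX] continuous_on_subset[OF cY]; simp)+
    then obtain B C where "\<And>r. r \<in> {a..b} \<Longrightarrow> \<bar>X r\<bar> \<le> B" "\<And>r. r \<in> {a..b} \<Longrightarrow> \<bar>Y r\<bar> \<le> C"
      using compact_imp_bounded bounded_iff by (metis imageI real_norm_def)
    then show ?thesis by (intro that[of "max B C"]) (auto simp: le_max_iff_disj)
  qed
  define Q where "Q = {- R..R} \<times> {- R..R}"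
  have cQ: "compact Q" unfolding Q_def by (intro compact_Times) auto
  have main: "\<bar>H b\<bar> \<le> \<epsilon> * (LBINT r:{a..<b}. q r)" if \<epsilon>: "0 < \<epsilon>" for \<epsilon>
  proof -
    have ucx: "uniformly_continuous_on Q (\<lambda>z. Fx (fst z) (snd z))" "uniformly_continuous_on Q (\<lambda>z. Fy (fst z) (snd z))"
      by (intro compact_uniformly_continuous cQ continuous_on_subset[OF cFx] continuous_on_subset[OF cFy]; simp)+
    obtain \<eta>1 where \<eta>1: "0 < \<eta>1" "\<And>z z'. z \<in> Q \<Longrightarrow> z' \<in> Q \<Longrightarrow> dist z' z < \<eta>1 \<Longrightarrow> dist (Fx (fst z') (snd z')) (Fx (fst z) (snd z)) < \<epsilon>"
      using ucx(1) \<epsilon> unfolding uniformly_continuous_on_def by meson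
    obtain \<eta>2 where \<eta>2: "0 < \<eta>2" "\<And>z z'. z \<in> Q \<Longrightarrow> z' \<in> Q \<Longrightarrow> dist z' z < \<eta>2 \<Longrightarrow> dist (Fy (fst z') (snd z')) (Fy (fst z) (snd z)) < \<epsilon>"
      using ucx(2) \<epsilon> unfolding uniformly_continuous_on_def by meson
    \<comment> \<open>Half, because the distance in the plane is bounded by the sum of the two
      coordinate differences.\<close>
    define \<eta> where "\<eta> = min \<eta>1 \<eta>2 / 2"
    have \<eta>: "0 < \<eta>" using \<eta>1(1) \<eta>2(1) by (simp add: \<eta>_def)
    have ucX: "uniformly_continuous_on {a..b} X" "uniformly_continuous_on {a..b} Y"
      by (intro compact_uniformly_continuous continuous_on_subset[OF cX] continuous_on_subset[OF cY]; simp)+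
    obtain \<delta>1 where \<delta>1: "0 < \<delta>1" "\<And>s t. s \<in> {a..b} \<Longrightarrow> t \<in> {a..b} \<Longrightarrow> dist t s < \<delta>1 \<Longrightarrow> dist (X t) (X s) < \<eta>"
      using ucX(1) \<eta> unfolding uniformly_continuous_on_def by meson
    obtain \<delta>2 where \<delta>2: "0 < \<delta>2" "\<And>s t. s \<in> {a..b} \<Longrightarrow> t \<in> {a..b} \<Longrightarrow> dist t s < \<delta>2 \<Longrightarrow> dist (Y t) (Y s) < \<eta>"
      using ucX(2) \<eta> unfolding uniformly_continuous_on_def by meson
    have local: "\<bar>H t - H s\<bar> \<le> \<epsilon> * (LBINT r:{s..<t}. q r)"
      if st: "a \<le> s" "s \<le> t" "t \<le> b" "t - s < min \<delta>1 \<delta>2" for s t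
    proof -
      obtain \<theta> where \<theta>: "0 < \<theta>" "\<theta> < 1"
        "F (X t) (Y t) - F (X s) (Y s) = Fx (X s + \<theta> * (X t - X s)) (Y s + \<theta> * (Y t - Y s)) * (X t - X s) +
           Fy (X s + \<theta> * (X t - X s)) (Y s + \<theta> * (Y t - Y s)) * (Y t - Y s)"
        by (rule mean_value_segment[OF F])
      define \<xi> where "\<xi> = X s + \<theta> * (X t - X s)"
      define \<zeta> where "\<zeta> = Y s + \<theta> * (Y t - Y s)"
      \<comment> \<open>Balls are convex. With z = 0 the intermediate point stays in the compact
        square Q, and with z on the path it stays close to the path.\<close>
      have conv: "\<bar>x + \<theta> * (x' - x) - z\<bar> \<le> d" if "\<bar>x - z\<bar> \<le> d" "\<bar>x' - z\<bar> \<le> d" for x x' z d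
      proof -
        have "x + \<theta> * (x' - x) - z = (1 - \<theta>) * (x - z) + \<theta> * (x' - z)" by (simp add: algebra_simps)
        also have "\<bar>\<dots>\<bar> \<le> \<bar>(1 - \<theta>) * (x - z)\<bar> + \<bar>\<theta> * (x' - z)\<bar>" by (rule abs_triangle_ineq)
        also have "\<dots> = (1 - \<theta>) * \<bar>x - z\<bar> + \<theta> * \<bar>x' - z\<bar>" using \<theta>(1,2) by (simp add: abs_mult)
        also have "\<dots> \<le> (1 - \<theta>) * d + \<theta> * d" using \<theta>(1,2) that by (intro add_mono mult_left_mono) auto
        finally show ?thesis by (simp add: algebra_simps)
      qed
      have sab: "s \<in> {a..b}" "t \<in> {a..b}" using st by auto
      have \<xi>Q: "(\<xi>, \<zeta>) \<in> Q"
        using conv[of "X s" 0 R "X t"] conv[of "Y s" 0 R "Y t"] R sab by (simp add: Q_def \<xi>_def \<zeta>_def abs_le_iff)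
      have near: "\<bar>Fx \<xi> \<zeta> - Fx (X r) (Y r)\<bar> \<le> \<epsilon> \<and> \<bar>Fy \<xi> \<zeta> - Fy (X r) (Y r)\<bar> \<le> \<epsilon>" if r: "r \<in> {s..<t}" for r
      proof -
        have rab: "r \<in> {a..b}" using r st by auto
        have "(X r, Y r) \<in> Q" using R[OF rab] by (simp add: Q_def abs_le_iff)
        have "\<bar>X s - X r\<bar> \<le> \<eta>" "\<bar>X t - X r\<bar> \<le> \<eta>" "\<bar>Y s - Y r\<bar> \<le> \<eta>" "\<bar>Y t - Y r\<bar> \<le> \<eta>"
          using \<delta>1(2)[OF rab sab(1)] \<delta>1(2)[OF rab sab(2)] \<delta>2(2)[OF rab sab(1)] \<delta>2(2)[OF rab sab(2)] r st
          by (auto simp: dist_real_def)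
        then have "\<bar>\<xi> - X r\<bar> \<le> \<eta>" "\<bar>\<zeta> - Y r\<bar> \<le> \<eta>" unfolding \<xi>_def \<zeta>_def by (auto intro: conv)
        moreover have "dist (\<xi>, \<zeta>) (X r, Y r) \<le> \<bar>\<xi> - X r\<bar> + \<bar>\<zeta> - Y r\<bar>"
          by (simp add: dist_Pair_Pair dist_real_def) (rule sqrt_sum_squares_le_sum_abs[THEN order_trans], simp)
        ultimately have "dist (\<xi>, \<zeta>) (X r, Y r) \<le> 2 * \<eta>" by simp
        moreover have "\<bar>\<xi> - X r\<bar> < \<eta>"
        proof -
          have "\<bar>X s - X r\<bar> < \<eta>" "\<bar>X t - X r\<bar> < \<eta>"
            using \<delta>1(2)[OF rab sab(1)] \<delta>1(2)[OF rab sab(2)] r st by (auto simp: dist_real_def)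
          then have "\<bar>\<xi> - X r\<bar> \<le> max \<bar>X s - X r\<bar> \<bar>X t - X r\<bar>" unfolding \<xi>_def by (intro conv) auto
          then show ?thesis using \<open>\<bar>X s - X r\<bar> < \<eta>\<close> \<open>\<bar>X t - X r\<bar> < \<eta>\<close> by simp
        qed
        ultimately have "dist (\<xi>, \<zeta>) (X r, Y r) < min \<eta>1 \<eta>2"
          using \<open>\<bar>\<zeta> - Y r\<bar> \<le> \<eta>\<close> \<open>dist (\<xi>, \<zeta>) (X r, Y r) \<le> \<bar>\<xi> - X r\<bar> + \<bar>\<zeta> - Y r\<bar>\<close>
          unfolding \<eta>_def by linarith
        then show ?thesis
          using \<eta>1(2)[OF \<open>(X r, Y r) \<in> Q\<close> \<xi>Q] \<eta>2(2)[OF \<open>(X r, Y r) \<in> Q\<close> \<xi>Q] by (auto simp: dist_real_def)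
      qed
      note si = sub[OF _ st(1,3)]
      have "F (X t) (Y t) - F (X s) (Y s) = Fx \<xi> \<zeta> * (LBINT r:{s..<t}. u r) + Fy \<xi> \<zeta> * (LBINT r:{s..<t}. w r)"
        using \<theta>(3) X[OF st(1-3)] Y[OF st(1-3)] by (simp add: \<xi>_def \<zeta>_def)
      also have "\<dots> = (LBINT r:{s..<t}. Fx \<xi> \<zeta> * u r + Fy \<xi> \<zeta> * w r)"
        using si[OF u] si[OF w] by (simp add: set_integral_add)
      finally have "H t - H s = (LBINT r:{s..<t}. Fx \<xi> \<zeta> * u r + Fy \<xi> \<zeta> * w r) - (LBINT r:{s..<t}. k r)"
        using split[OF ik st(1-3)] by (simp add: H_def)
      also have "\<dots> = (LBINT r:{s..<t}. (Fx \<xi> \<zeta> * u r + Fy \<xi> \<zeta> * w r) - k r)"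
        using si[OF u] si[OF w] si[OF ik] by (intro set_integral_diff(2)[symmetric]) (auto intro: set_integral_add)
      also have "\<bar>\<dots>\<bar> \<le> (LBINT r:{s..<t}. \<epsilon> * q r)"
      proof (rule set_integral_abs_bound)
        show "set_integrable lborel {s..<t} (\<lambda>r. (Fx \<xi> \<zeta> * u r + Fy \<xi> \<zeta> * w r) - k r)"
          using si[OF u] si[OF w] si[OF ik] by (intro set_integral_diff(1) set_integral_add(1)) auto
        show "set_integrable lborel {s..<t} (\<lambda>r. \<epsilon> * q r)" using si[OF iq] by simp
        fix r assume r: "r \<in> {s..<t}"
        have "(Fx \<xi> \<zeta> * u r + Fy \<xi> \<zeta> * w r) - k r = (Fx \<xi> \<zeta> - Fx (X r) (Y r)) * u r + (Fy \<xi> \<zeta> - Fy (X r) (Y r)) * w r"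
          by (simp add: k_def algebra_simps)
        also have "\<bar>\<dots>\<bar> \<le> \<bar>Fx \<xi> \<zeta> - Fx (X r) (Y r)\<bar> * \<bar>u r\<bar> + \<bar>Fy \<xi> \<zeta> - Fy (X r) (Y r)\<bar> * \<bar>w r\<bar>"
          unfolding abs_mult[symmetric] by (rule abs_triangle_ineq)
        also have "\<dots> \<le> \<epsilon> * \<bar>u r\<bar> + \<epsilon> * \<bar>w r\<bar>" using near[OF r] by (intro add_mono mult_right_mono) auto
        finally show "\<bar>(Fx \<xi> \<zeta> * u r + Fy \<xi> \<zeta> * w r) - k r\<bar> \<le> \<epsilon> * q r" by (simp add: q_def algebra_simps)
      qed
      finally show ?thesis by simp
    qed
    obtain N :: nat where N: "(b - a) / min \<delta>1 \<delta>2 < real N" using reals_Archimedean2 by blast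
    have d: "0 < min \<delta>1 \<delta>2" using \<delta>1(1) \<delta>2(1) by simp
    have N0: "0 < N"
    proof (rule ccontr)
      assume "\<not> 0 < N"
      then have "(b - a) / min \<delta>1 \<delta>2 < 0" using N by simp
      moreover have "0 \<le> (b - a) / min \<delta>1 \<delta>2" using ab d by (intro divide_nonneg_nonneg) auto
      ultimately show False by simp
    qed
    define e where "e = (b - a) / real N"
    have e: "0 \<le> e" "e < min \<delta>1 \<delta>2" "a + real N * e = b"
    proof -
      show "0 \<le> e" "a + real N * e = b" using N0 ab by (simp_all add: e_def)
      have "b - a < min \<delta>1 \<delta>2 * real N" using N d by (simp only: pos_divide_less_eq mult.commute)
      then show "e < min \<delta>1 \<delta>2" unfolding e_def using N0 by (simp only: pos_divide_less_eq of_nat_0_less_iff)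
    qed
    have "\<bar>H (a + real n * e)\<bar> \<le> \<epsilon> * (LBINT r:{a..<a + real n * e}. q r)" if "n \<le> N" for n
      using that
    proof (induction n)
      case 0
      then show ?case by (simp add: H_def set_lebesgue_integral_def)
    next
      case (Suc n)
      let ?s = "a + real n * e" and ?t = "a + real (Suc n) * e"
      have "real (Suc n) * e \<le> real N * e" using Suc.prems e(1) by (intro mult_right_mono) auto
      then have st: "a \<le> ?s" "?s \<le> ?t" "?t \<le> b" "?t - ?s < min \<delta>1 \<delta>2"
        using e by (simp_all add: algebra_simps)
      have "\<bar>H ?t\<bar> \<le> \<bar>H ?s\<bar> + \<bar>H ?t - H ?s\<bar>" by linarith
      also have "\<dots> \<le> \<epsilon> * (LBINT r:{a..<?s}. q r) + \<epsilon> * (LBINT r:{?s..<?t}. q r)"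
        using Suc local[OF st] by simp
      also have "\<dots> = \<epsilon> * (LBINT r:{a..<?t}. q r)" using split[OF iq st(1-3)] by (simp add: distrib_left)
      finally show ?case .
    qed
    from this[of N] show ?thesis unfolding e(3) by simp
  qed
  have "\<bar>H b\<bar> \<le> 0"
  proof (rule field_le_epsilon)
    fix e :: real assume e: "0 < e"
    define I where "I = (LBINT r:{a..<b}. q r)"
    have I: "0 \<le> I" unfolding I_def set_lebesgue_integral_def by (intro Bochner_Integration.integral_nonneg) (simp add: q_def)
    have "\<bar>H b\<bar> \<le> e / (I + 1) * I" using main[of "e / (I + 1)"] e I by (simp add: I_def)
    also have "\<dots> = e * (I / (I + 1))" by simp
    also have "\<dots> \<le> e * 1" using e I by (intro mult_left_mono) auto
    finally show "\<bar>H b\<bar> \<le> 0 + e" by simp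
  qed
  then show "F (X b) (Y b) = F (X a) (Y a) + (LBINT r:{a..<b}. Fx (X r) (Y r) * u r + Fy (X r) (Y r) * w r)"
    by (simp add: H_def k_def)
qed

section \<open>Test functions\<close>

lemma test_function_derivatives:
  assumes "test_function \<phi>"
  shows "((\<lambda>z. \<phi> (fst z, snd z)) has_derivative (\<lambda>h. partial_x \<phi> x t * fst h + partial_t \<phi> x t * snd h)) (at (x, t))"
    and "continuous_on UNIV (\<lambda>z. partial_x \<phi> (fst z) (snd z))" "continuous_on UNIV (\<lambda>z. partial_t \<phi> (fst z) (snd z))"
    and "continuous_on UNIV \<phi>"
proof -
  have "times_cont_diff (Suc 0) \<phi>" using assms unfolding test_function_def by blast
  then have d: "\<phi> differentiable_on UNIV" and c: "\<And>v. continuous_on UNIV (\<lambda>z. frechet_derivative \<phi> (at z) v)" by auto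
  define D where "D z = frechet_derivative \<phi> (at z)" for z
  have D: "(\<phi> has_derivative D z) (at z)" for z
  proof -
    have "\<phi> differentiable at z within UNIV" using d UNIV_I unfolding differentiable_on_def by blast
    then show ?thesis unfolding D_def by (simp add: frechet_derivative_works)
  qed
  have lin: "D z h = D z (1, 0) * fst h + D z (0, 1) * snd h" for z h
  proof -
    interpret linear "D z" using D has_derivative_linear by blast
    have "h = fst h *\<^sub>R (1, 0) + snd h *\<^sub>R (0, 1)" by (simp add: prod_eq_iff)
    then have "D z h = D z (fst h *\<^sub>R (1, 0) + snd h *\<^sub>R (0, 1))" by simp
    also have "\<dots> = D z (1, 0) * fst h + D z (0, 1) * snd h" by (simp only: add scale real_scaleR_def mult.commute)
    finally show ?thesis .
  qed
  have px: "partial_x \<phi> x t = D (x, t) (1, 0)" for x t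
    unfolding partial_x_def
  proof (rule DERIV_imp_deriv)
    have "((\<lambda>y. (y, t)) has_derivative (\<lambda>h. (h, 0))) (at x)" by (auto intro!: derivative_eq_intros)
    from has_derivative_compose[OF this D] have "((\<lambda>y. \<phi> (y, t)) has_derivative (\<lambda>h. D (x, t) (h, 0))) (at x)" .
    moreover have "(\<lambda>h. D (x, t) (h, 0)) = (*) (D (x, t) (1, 0))"
    proof
      fix h show "D (x, t) (h, 0) = D (x, t) (1, 0) * h" using lin[of "(x, t)" "(h, 0)"] by simp
    qed
    ultimately show "((\<lambda>y. \<phi> (y, t)) has_real_derivative D (x, t) (1, 0)) (at x)"
      unfolding has_field_derivative_def by (rule has_derivative_eq_rhs)
  qed
  have pt: "partial_t \<phi> x t = D (x, t) (0, 1)" for x t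
    unfolding partial_t_def
  proof (rule DERIV_imp_deriv)
    have "((\<lambda>s. (x, s)) has_derivative (\<lambda>h. (0, h))) (at t)" by (auto intro!: derivative_eq_intros)
    from has_derivative_compose[OF this D] have "((\<lambda>s. \<phi> (x, s)) has_derivative (\<lambda>h. D (x, t) (0, h))) (at t)" .
    moreover have "(\<lambda>h. D (x, t) (0, h)) = (*) (D (x, t) (0, 1))"
    proof
      fix h show "D (x, t) (0, h) = D (x, t) (0, 1) * h" using lin[of "(x, t)" "(0, h)"] by simp
    qed
    ultimately show "((\<lambda>s. \<phi> (x, s)) has_real_derivative D (x, t) (0, 1)) (at t)"
      unfolding has_field_derivative_def by (rule has_derivative_eq_rhs)
  qed
  show "((\<lambda>z. \<phi> (fst z, snd z)) has_derivative (\<lambda>h. partial_x \<phi> x t * fst h + partial_t \<phi> x t * snd h)) (at (x, t))"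
    unfolding px pt using D[of "(x, t)"] by (simp add: lin[symmetric])
  show "continuous_on UNIV (\<lambda>z. partial_x \<phi> (fst z) (snd z))" "continuous_on UNIV (\<lambda>z. partial_t \<phi> (fst z) (snd z))"
    unfolding px pt using c by (simp_all add: D_def)
  show "continuous_on UNIV \<phi>" using d by (rule differentiable_imp_continuous_on)
qed

text \<open>R bounds the norm of the points of the support, hence also their time coordinate. The
  partial derivatives vanish off the support because its complement is open; on it they are bounded
  by compactness.\<close>

lemma test_function_bounds:
  assumes "test_function \<phi>"
  obtains b R where "0 < R" "\<And>x t. \<bar>\<phi> (x, t)\<bar> \<le> b" "\<And>x t. \<bar>partial_x \<phi> x t\<bar> \<le> b" "\<And>x t. \<bar>partial_t \<phi> x t\<bar> \<le> b"
    "\<And>x t. R \<le> t \<Longrightarrow> \<phi> (x, t) = 0" "\<And>x t. R \<le> t \<Longrightarrow> partial_x \<phi> x t = 0" "\<And>x t. R \<le> t \<Longrightarrow> partial_t \<phi> x t = 0"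
proof -
  define C where "C = closure {z. \<phi> z \<noteq> 0}"
  have C: "compact C" using assms by (simp add: test_function_def C_def)
  have out: "\<phi> z = 0 \<and> partial_x \<phi> (fst z) (snd z) = 0 \<and> partial_t \<phi> (fst z) (snd z) = 0" if z: "z \<notin> C" for z
  proof -
    have op: "open (- C)" using C by (simp add: compact_imp_closed open_Compl)
    have 0: "\<phi> z' = 0" if "z' \<in> - C" for z' using that closure_subset[of "{z. \<phi> z \<noteq> 0}"] by (auto simp: C_def)
    have ev: "\<forall>\<^sub>F y in nhds (fst z). \<phi> (y, snd z) = 0" "\<forall>\<^sub>F s in nhds (snd z). \<phi> (fst z, s) = 0"
    proof -
      have "((\<lambda>y. (y, snd z)) \<longlongrightarrow> (fst z, snd z)) (nhds (fst z))" "((\<lambda>s. (fst z, s)) \<longlongrightarrow> (fst z, snd z)) (nhds (snd z))"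
        by (rule tendsto_Pair[OF filterlim_ident tendsto_const], rule tendsto_Pair[OF tendsto_const filterlim_ident])
      then have "((\<lambda>y. (y, snd z)) \<longlongrightarrow> z) (nhds (fst z))" "((\<lambda>s. (fst z, s)) \<longlongrightarrow> z) (nhds (snd z))" by simp_all
      from this[THEN topological_tendstoD, OF op] z
      show "\<forall>\<^sub>F y in nhds (fst z). \<phi> (y, snd z) = 0" "\<forall>\<^sub>F s in nhds (snd z). \<phi> (fst z, s) = 0"
        by (auto elim!: eventually_mono intro: 0)
    qed
    show ?thesis unfolding partial_x_def partial_t_def
      using deriv_cong_ev[OF ev(1) refl] deriv_cong_ev[OF ev(2) refl] 0[of z] z by simp
  qed
  have bd: "\<exists>B. \<forall>z. \<bar>g z\<bar> \<le> B" if "continuous_on UNIV g" "\<And>z. z \<notin> C \<Longrightarrow> g z = 0" for g :: "real \<times> real \<Rightarrow> real"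
  proof -
    have "bounded (g ` C)" by (intro compact_imp_bounded compact_continuous_image C continuous_on_subset[OF that(1)]) simp
    then obtain B where "\<And>z. z \<in> C \<Longrightarrow> \<bar>g z\<bar> \<le> B" unfolding bounded_iff by auto
    then have "\<bar>g z\<bar> \<le> max 0 B" for z using that(2)[of z] by (cases "z \<in> C") (auto simp: le_max_iff_disj)
    then show ?thesis by blast
  qed
  note d = test_function_derivatives[OF assms]
  obtain B1 where B1: "\<And>z. \<bar>\<phi> z\<bar> \<le> B1" using bd[OF d(4)] out by blast
  obtain B2 where B2: "\<And>z. \<bar>partial_x \<phi> (fst z) (snd z)\<bar> \<le> B2" using bd[OF d(2)] out by blast
  obtain B3 where B3: "\<And>z. \<bar>partial_t \<phi> (fst z) (snd z)\<bar> \<le> B3" using bd[OF d(3)] out by blast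
  obtain R where R: "0 < R" "\<And>z. z \<in> C \<Longrightarrow> norm z < R"
    using C compact_imp_bounded bounded_pos_less by metis
  have Rout: "(x, t) \<notin> C" if "R \<le> t" for x t
    using R(2)[of "(x, t)"] that norm_snd_le[of t x] by fastforce
  show ?thesis
  proof (rule that[of R "max B1 (max B2 B3)"])
    show "\<bar>\<phi> (x, t)\<bar> \<le> max B1 (max B2 B3)" "\<bar>partial_x \<phi> x t\<bar> \<le> max B1 (max B2 B3)"
      "\<bar>partial_t \<phi> x t\<bar> \<le> max B1 (max B2 B3)" for x t
      using B1[of "(x, t)"] B2[of "(x, t)"] B3[of "(x, t)"] by (auto simp: le_max_iff_disj)
  qed (use R(1) out[OF Rout] in auto)
qed

section \<open>The weak equations\<close>

context euler_data
begin

section \<open>The law of the flow and its integrability\<close>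

definition law :: "real \<Rightarrow> real measure" where "law t = distr \<rho>0 borel (flow t)"

lemma law_distribution: "real_distribution (law t)"
  unfolding law_def by (rule real_distribution_distr) measurable

lemma law_sets [measurable_cong]: "sets (law t) = sets borel" by (simp add: law_def)

lemma law_integral: "g \<in> borel_measurable borel \<Longrightarrow> (\<integral>x. g x \<partial>law t) = (\<integral>y. g (flow t y) \<partial>\<rho>0)"
  for g :: "real \<Rightarrow> real"
  unfolding law_def by (rule integral_distr) measurable

lemma law_nn_integral: "g \<in> borel_measurable borel \<Longrightarrow> (\<integral>\<^sup>+x. g x \<partial>law t) = (\<integral>\<^sup>+y. g (flow t y) \<partial>\<rho>0)"
  unfolding law_def by (rule nn_integral_distr) measurable

lemma law_integrable: "g \<in> borel_measurable borel \<Longrightarrow> integrable (law t) g \<longleftrightarrow> integrable \<rho>0 (\<lambda>y. g (flow t y))"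
  for g :: "real \<Rightarrow> real"
  unfolding law_def by (rule integrable_distr_eq) measurable

lemma law_pair: "law t \<Otimes>\<^sub>M law t = distr (\<rho>0 \<Otimes>\<^sub>M \<rho>0) (borel \<Otimes>\<^sub>M borel) (\<lambda>(y, z). (flow t y, flow t z))"
proof -
  interpret L: real_distribution "law t" by (rule law_distribution)
  show ?thesis unfolding law_def
  proof (rule pair_measure_distr)
    show "sigma_finite_measure (distr \<rho>0 borel (flow t))"
      using L.sigma_finite_measure_axioms by (simp add: law_def)
  qed measurable
qed

lemma conv_measure_law: "conv_measure f (law t) x = (\<integral>z. f (x - flow t z) \<partial>\<rho>0)"
  unfolding conv_measure_def by (rule law_integral) measurable

lemma conv_measure_flow: "conv_measure f (law t) (flow t y) = drag t y"
  by (simp add: conv_measure_law drag_def)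

lemma conv_measure_measurable [measurable]: "conv_measure f (law t) \<in> borel_measurable borel"
proof -
  have "(\<lambda>x. \<integral>z. f (x - flow t z) \<partial>\<rho>0) \<in> borel_measurable borel" by measurable
  then show ?thesis by (simp add: conv_measure_law[abs_def])
qed

lemma pair_integrable_components:
  fixes g :: "real \<Rightarrow> real"
  assumes "integrable \<rho>0 g"
  shows "integrable (\<rho>0 \<Otimes>\<^sub>M \<rho>0) (\<lambda>p. g (fst p))" "(\<integral>p. g (fst p) \<partial>(\<rho>0 \<Otimes>\<^sub>M \<rho>0)) = (\<integral>y. g y \<partial>\<rho>0)"
    "integrable (\<rho>0 \<Otimes>\<^sub>M \<rho>0) (\<lambda>p. g (snd p))" "(\<integral>p. g (snd p) \<partial>(\<rho>0 \<Otimes>\<^sub>M \<rho>0)) = (\<integral>y. g y \<partial>\<rho>0)"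
proof -
  interpret P: pair_sigma_finite \<rho>0 \<rho>0 ..
  have [measurable]: "g \<in> borel_measurable \<rho>0" using assms by simp
  have d: "distr (\<rho>0 \<Otimes>\<^sub>M \<rho>0) \<rho>0 fst = \<rho>0" by (rule distr_pair_fst)
  show 1: "integrable (\<rho>0 \<Otimes>\<^sub>M \<rho>0) (\<lambda>p. g (fst p))"
    using integrable_distr[of fst "\<rho>0 \<Otimes>\<^sub>M \<rho>0" \<rho>0 g] assms unfolding d by simp
  show 2: "(\<integral>p. g (fst p) \<partial>(\<rho>0 \<Otimes>\<^sub>M \<rho>0)) = (\<integral>y. g y \<partial>\<rho>0)"
    using integral_distr[of fst "\<rho>0 \<Otimes>\<^sub>M \<rho>0" \<rho>0 g] unfolding d by simp
  show "integrable (\<rho>0 \<Otimes>\<^sub>M \<rho>0) (\<lambda>p. g (snd p))"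
    using P.integrable_product_swap[OF 1] unfolding case_prod_beta by simp
  have "(\<integral>p. g (snd p) \<partial>(\<rho>0 \<Otimes>\<^sub>M \<rho>0)) = (\<integral>p. g (fst p) \<partial>(\<rho>0 \<Otimes>\<^sub>M \<rho>0))"
    using P.integral_product_swap[of "\<lambda>p. g (fst p)"] unfolding case_prod_beta by simp
  then show "(\<integral>p. g (snd p) \<partial>(\<rho>0 \<Otimes>\<^sub>M \<rho>0)) = (\<integral>y. g y \<partial>\<rho>0)" using 2 by simp
qed

text \<open>Inherited from the continuity of each single path by dominated convergence.\<close>

lemma law_narrowly_continuous: "narrowly_continuous law"
  unfolding narrowly_continuous_def
proof (intro allI impI)
  fix g :: "real \<Rightarrow> real" assume g: "continuous_on UNIV g \<and> bounded (range g)"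
  then have [measurable]: "g \<in> borel_measurable borel" by (intro borel_measurable_continuous_onI) simp
  obtain B where B: "\<And>x. \<bar>g x\<bar> \<le> B" using g unfolding bounded_iff by auto
  have "continuous_on {0..} (\<lambda>t. \<integral>y. g (flow t y) \<partial>\<rho>0)"
    unfolding continuous_on_sequentially
  proof (intro allI ballI impI)
    fix x :: "nat \<Rightarrow> real" and a assume "a \<in> {0..}" "(\<forall>n. x n \<in> {0..}) \<and> x \<longlonglongrightarrow> a"
    then have x: "x \<longlonglongrightarrow> a" by simp
    show "((\<lambda>t. \<integral>y. g (flow t y) \<partial>\<rho>0) \<circ> x) \<longlonglongrightarrow> (\<integral>y. g (flow a y) \<partial>\<rho>0)"
      unfolding comp_def
    proof (rule integral_dominated_convergence[where w="\<lambda>_. B"])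
      show "AE y in \<rho>0. (\<lambda>n. g (flow (x n) y)) \<longlonglongrightarrow> g (flow a y)"
      proof (rule AE_I2)
        fix y
        have "(\<lambda>n. flow (x n) y) \<longlonglongrightarrow> flow a y"
          by (rule continuous_on_tendsto_compose[OF flow_continuous x]) auto
        from continuous_on_tendsto_compose[OF conjunct1[OF g] this]
        show "(\<lambda>n. g (flow (x n) y)) \<longlonglongrightarrow> g (flow a y)" by simp
      qed
    qed (use B in auto)
  qed
  then show "continuous_on {0..} (\<lambda>t. \<integral>x. g x \<partial>law t)" by (simp add: law_integral)
qed

lemma velocity_slice [measurable]: "(\<lambda>x. velocity (x, t)) \<in> borel_measurable borel"
proof -
  have "(\<lambda>x::real. (x, t)) \<in> measurable borel borel" unfolding borel_prod[symmetric] by measurable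
  from measurable_compose[OF this velocity_measurable] show ?thesis .
qed

lemma kinetic_interaction_finite:
  assumes T: "0 < T"
  shows "(\<integral>\<^sup>+t\<in>{0..T}. ((\<integral>\<^sup>+x. ennreal ((velocity (x, t))\<^sup>2) \<partial>law t) +
      (\<integral>\<^sup>+z. ennreal \<bar>f (fst z - snd z)\<bar> \<partial>(law t \<Otimes>\<^sub>M law t))) \<partial>lborel) < \<infinity>"
proof -
  obtain M where M: "\<And>T. 0 < M T" "\<And>t T. good_time t \<Longrightarrow> t \<le> T \<Longrightarrow> (\<integral>y. (speed t y)\<^sup>2 \<partial>\<rho>0) \<le> M T"
    by (rule L2_bounds) blast
  obtain C where C: "\<And>r T y z. 0 \<le> r \<Longrightarrow> r \<le> T \<Longrightarrow> \<bar>f (flow r y - flow r z)\<bar> \<le> C T * (1 + \<bar>y\<bar>) + C T * \<bar>z\<bar>"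
    by (rule drag_limit) blast
  define k where "k p = (C T + C T * \<bar>fst p\<bar>) + (0 + C T * \<bar>snd p\<bar>)" for p :: "real \<times> real"
  have k: "integrable (\<rho>0 \<Otimes>\<^sub>M \<rho>0) k" unfolding k_def[abs_def]
    by (rule Bochner_Integration.integrable_add[OF pair_integrable_components(1)[OF integrable_affine[of "C T" "C T"]]
          pair_integrable_components(3)[OF integrable_affine[of 0 "C T"]]])
  define D where "D = ennreal (M T) + ennreal (\<integral>p. \<bar>k p\<bar> \<partial>(\<rho>0 \<Otimes>\<^sub>M \<rho>0))"
  have bound: "(\<integral>\<^sup>+x. ennreal ((velocity (x, t))\<^sup>2) \<partial>law t) +
      (\<integral>\<^sup>+z. ennreal \<bar>f (fst z - snd z)\<bar> \<partial>(law t \<Otimes>\<^sub>M law t)) \<le> D" if t: "good_time t" "t \<le> T" for t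
    unfolding D_def
  proof (rule add_mono)
    have "(\<integral>\<^sup>+x. ennreal ((velocity (x, t))\<^sup>2) \<partial>law t) = (\<integral>\<^sup>+y. ennreal ((speed t y)\<^sup>2) \<partial>\<rho>0)"
      unfolding speed_def by (rule law_nn_integral) measurable
    also have "\<dots> = ennreal (\<integral>y. (speed t y)\<^sup>2 \<partial>\<rho>0)"
      by (rule nn_integral_eq_integral[OF speed_L2(1)[OF t(1)]]) simp
    also have "\<dots> \<le> ennreal (M T)" by (rule ennreal_leI[OF M(2)[OF t]])
    finally show "(\<integral>\<^sup>+x. ennreal ((velocity (x, t))\<^sup>2) \<partial>law t) \<le> ennreal (M T)" .
    have "(\<integral>\<^sup>+z. ennreal \<bar>f (fst z - snd z)\<bar> \<partial>(law t \<Otimes>\<^sub>M law t)) =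
      (\<integral>\<^sup>+p. ennreal \<bar>f (flow t (fst p) - flow t (snd p))\<bar> \<partial>(\<rho>0 \<Otimes>\<^sub>M \<rho>0))"
      unfolding law_pair by (subst nn_integral_distr) (auto simp: case_prod_beta)
    also have "\<dots> \<le> (\<integral>\<^sup>+p. ennreal \<bar>k p\<bar> \<partial>(\<rho>0 \<Otimes>\<^sub>M \<rho>0))"
    proof (intro nn_integral_mono ennreal_leI)
      fix p
      have "\<bar>f (flow t (fst p) - flow t (snd p))\<bar> \<le> k p"
        using C[OF good_time_nonneg[OF t(1)] t(2), of "fst p" "snd p"] by (simp add: k_def distrib_left)
      then show "\<bar>f (flow t (fst p) - flow t (snd p))\<bar> \<le> \<bar>k p\<bar>" by simp
    qed
    also have "\<dots> = ennreal (\<integral>p. \<bar>k p\<bar> \<partial>(\<rho>0 \<Otimes>\<^sub>M \<rho>0))"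
      by (rule nn_integral_eq_integral[OF integrable_abs[OF k]]) simp
    finally show "(\<integral>\<^sup>+z. ennreal \<bar>f (fst z - snd z)\<bar> \<partial>(law t \<Otimes>\<^sub>M law t)) \<le> ennreal (\<integral>p. \<bar>k p\<bar> \<partial>(\<rho>0 \<Otimes>\<^sub>M \<rho>0))" .
  qed
  have "(\<integral>\<^sup>+t\<in>{0..T}. ((\<integral>\<^sup>+x. ennreal ((velocity (x, t))\<^sup>2) \<partial>law t) +
      (\<integral>\<^sup>+z. ennreal \<bar>f (fst z - snd z)\<bar> \<partial>(law t \<Otimes>\<^sub>M law t))) \<partial>lborel) \<le> (\<integral>\<^sup>+t. D * indicator {0..T} t \<partial>lborel)"
  proof (rule nn_integral_mono_AE)
    show "AE t in lborel. ((\<integral>\<^sup>+x. ennreal ((velocity (x, t))\<^sup>2) \<partial>law t) +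
      (\<integral>\<^sup>+z. ennreal \<bar>f (fst z - snd z)\<bar> \<partial>(law t \<Otimes>\<^sub>M law t))) * indicator {0..T} t \<le> D * indicator {0..T} t"
      using AE_good_time by eventually_elim (auto simp: indicator_def intro: bound)
  qed
  also have "\<dots> = D * ennreal T" using T by (simp add: nn_integral_cmult)
  also have "\<dots> < \<infinity>" by (simp add: D_def ennreal_mult_less_top)
  finally show ?thesis .
qed

lemma impulse_L2_bound: obtains M where "\<And>T. 0 < M T"
  "\<And>t T. 0 \<le> t \<Longrightarrow> t \<le> T \<Longrightarrow> (\<integral>y. (impulse t y)\<^sup>2 \<partial>\<rho>0) \<le> M T"
proof -
  obtain B where B: "\<And>T. 0 < B T" "\<And>t T y. 0 \<le> t \<Longrightarrow> t \<le> T \<Longrightarrow> \<bar>impulse t y\<bar> \<le> B T * (1 + \<bar>y\<bar>)"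
    by (rule growth_bound) blast
  show ?thesis
  proof (rule that[of "\<lambda>T. (\<integral>y. (B T + B T * \<bar>y\<bar>)\<^sup>2 \<partial>\<rho>0) + 1"])
    show "0 < (\<integral>y. (B T + B T * \<bar>y\<bar>)\<^sup>2 \<partial>\<rho>0) + 1" for T
      by (intro add_nonneg_pos Bochner_Integration.integral_nonneg) auto
    fix t T :: real assume t: "0 \<le> t" "t \<le> T"
    have "(\<integral>y. (impulse t y)\<^sup>2 \<partial>\<rho>0) \<le> (\<integral>y. (B T + B T * \<bar>y\<bar>)\<^sup>2 \<partial>\<rho>0)"
    proof (rule integral_mono[OF impulse_integrable(2)[OF t(1)] integrable_affine_sq])
      show "(impulse t y)\<^sup>2 \<le> (B T + B T * \<bar>y\<bar>)\<^sup>2" for y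
        using power_mono[OF B(2)[OF t, of y], of 2] by (simp add: distrib_left)
    qed
    then show "(\<integral>y. (impulse t y)\<^sup>2 \<partial>\<rho>0) \<le> (\<integral>y. (B T + B T * \<bar>y\<bar>)\<^sup>2 \<partial>\<rho>0) + 1" by simp
  qed
qed

lemma impulse_lipschitz:
  obtains L where "\<And>T. 0 < L T"
    "\<And>s t T y. 0 \<le> s \<Longrightarrow> s \<le> t \<Longrightarrow> t \<le> T \<Longrightarrow> \<bar>impulse t y - impulse s y\<bar> \<le> L T * (1 + \<bar>y\<bar>) * (t - s)"
proof -
  obtain B where B: "\<And>T. 0 < B T" "\<And>t T y. 0 \<le> t \<Longrightarrow> t \<le> T \<Longrightarrow> \<bar>drag t y\<bar> \<le> B T * (1 + \<bar>y\<bar>)"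
    by (rule growth_bound) blast
  have "\<bar>impulse t y - impulse s y\<bar> \<le> B T * (1 + \<bar>y\<bar>) * (t - s)" if "0 \<le> s" "s \<le> t" "t \<le> T" for s t T y
  proof -
    have "\<bar>LBINT r:{s..<t}. drag r y\<bar> \<le> B T * (1 + \<bar>y\<bar>) * (t - s)"
      using that by (intro set_integral_abs_le impulse_diff(2) B(2)) auto
    then show ?thesis using impulse_diff(1)[OF that(1,2)] by simp
  qed
  then show ?thesis using B(1) that by blast
qed

lemma impulse_continuous: "continuous_on UNIV (\<lambda>t. impulse t y)"
proof -
  obtain B where B: "\<And>T. 0 < B T"
    "\<And>s t T. 0 \<le> s \<Longrightarrow> s \<le> t \<Longrightarrow> t \<le> T \<Longrightarrow> \<bar>impulse t y - impulse s y\<bar> \<le> B T * (1 + \<bar>y\<bar>) * (t - s)"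
    by (rule impulse_lipschitz) blast
  have "continuous_on {0..} (\<lambda>t. impulse t y)"
    unfolding continuous_on_iff
  proof (intro ballI allI impI)
    fix t e :: real assume t: "t \<in> {0..}" and e: "0 < e"
    define L where "L = B (t + 1) * (1 + \<bar>y\<bar>)"
    have L: "0 < L" using B(1)[of "t + 1"] by (simp add: L_def add_pos_nonneg)
    show "\<exists>d>0. \<forall>x'\<in>{0..}. dist x' t < d \<longrightarrow> dist (impulse x' y) (impulse t y) < e"
    proof (intro exI[of _ "min 1 (e / L)"] conjI ballI impI)
      fix x' assume x': "x' \<in> {0..}" "dist x' t < min 1 (e / L)"
      have "\<bar>impulse x' y - impulse t y\<bar> \<le> L * \<bar>x' - t\<bar>"
      proof (cases "x' \<le> t")
        case True
        then show ?thesis using B(2)[of x' t "t + 1"] x' by (simp add: L_def abs_minus_commute)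
      next
        case False
        then show ?thesis using B(2)[of t x' "t + 1"] x' t by (simp add: L_def dist_real_def)
      qed
      also have "\<dots> < e" using x'(2) L by (simp add: dist_real_def pos_less_divide_eq mult.commute)
      finally show "dist (impulse x' y) (impulse t y) < e" by (simp add: dist_real_def)
    qed (use e L in simp)
  qed
  then have "continuous_on UNIV (\<lambda>t. impulse (max 0 t) y)"
    by (rule continuous_on_compose2) (auto intro!: continuous_intros)
  moreover have "impulse (max 0 t) y = impulse t y" for t
    by (cases "0 \<le> t") (auto simp: impulse_def set_lebesgue_integral_def)
  ultimately show ?thesis by simp
qed

end

section \<open>The two equations for a fixed test function\<close>

locale euler_test = euler_data +
  fixes \<phi> :: "real \<times> real \<Rightarrow> real" and b R :: real
  assumes test: "test_function \<phi>" and R: "0 < R"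
    and bounds: "\<And>x t. \<bar>\<phi> (x, t)\<bar> \<le> b" "\<And>x t. \<bar>partial_x \<phi> x t\<bar> \<le> b" "\<And>x t. \<bar>partial_t \<phi> x t\<bar> \<le> b"
    and vanish: "\<And>x t. R \<le> t \<Longrightarrow> \<phi> (x, t) = 0" "\<And>x t. R \<le> t \<Longrightarrow> partial_x \<phi> x t = 0"
      "\<And>x t. R \<le> t \<Longrightarrow> partial_t \<phi> x t = 0"
begin

lemma test_measurable [measurable (raw)]:
  assumes [measurable]: "X \<in> borel_measurable M" "T \<in> borel_measurable M"
  shows "(\<lambda>y. \<phi> (X y, T y)) \<in> borel_measurable M" "(\<lambda>y. partial_x \<phi> (X y) (T y)) \<in> borel_measurable M"
    "(\<lambda>y. partial_t \<phi> (X y) (T y)) \<in> borel_measurable M"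
proof -
  have p: "(\<lambda>y. (X y, T y)) \<in> measurable M borel" unfolding borel_prod[symmetric] by measurable
  note d = test_function_derivatives[OF test]
  show "(\<lambda>y. \<phi> (X y, T y)) \<in> borel_measurable M" "(\<lambda>y. partial_x \<phi> (X y) (T y)) \<in> borel_measurable M"
    "(\<lambda>y. partial_t \<phi> (X y) (T y)) \<in> borel_measurable M"
    using measurable_compose[OF p borel_measurable_continuous_onI[OF d(4)]]
      measurable_compose[OF p borel_measurable_continuous_onI[OF d(2)]]
      measurable_compose[OF p borel_measurable_continuous_onI[OF d(3)]] by simp_all
qed

text \<open>The time derivative of \<phi> along the path of y. It is the integrand of the continuity
  equation, and \<open>speed\<close> times it is that of the momentum equation.\<close>

definition rate :: "real \<Rightarrow> real \<Rightarrow> real" where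
  "rate t y = partial_t \<phi> (flow t y) t + speed t y * partial_x \<phi> (flow t y) t"

lemma rate_measurable [measurable (raw)]:
  assumes [measurable]: "T \<in> borel_measurable M" "Y \<in> borel_measurable M"
  shows "(\<lambda>x. rate (T x) (Y x)) \<in> borel_measurable M"
  unfolding rate_def by measurable

lemma rate_vanish: "R \<le> t \<Longrightarrow> rate t y = 0" by (simp add: rate_def vanish)

lemma test_path:
  assumes y: "regular y" and st: "0 \<le> s" "s \<le> t"
  shows "\<phi> (flow t y, t) = \<phi> (flow s y, s) + (LBINT r:{s..<t}. rate r y)" "set_integrable lborel {s..<t} (\<lambda>r. rate r y)"
proof -
  have one: "set_integrable lborel {s..<t} (\<lambda>r. 1::real)" unfolding set_integrable_def using st by simp
  have u: "set_integrable lborel {s..<t} (\<lambda>r. speed r y)"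
  proof -
    have "set_integrable lborel {0..<t} (\<lambda>r. speed r y)" using y st unfolding regular_def by simp
    then show ?thesis by (rule set_integrable_subset) (use st in auto)
  qed
  have X: "flow t' y = flow s' y + (LBINT r:{s'..<t'}. speed r y)" if "s \<le> s'" "s' \<le> t'" "t' \<le> t" for s' t'
  proof -
    have "0 \<le> s'" using that st by simp
    then show ?thesis using y that(2) unfolding regular_def displacement_def by blast
  qed
  have Y: "t' = s' + (LBINT r:{s'..<t'}. 1)" if "s' \<le> t'" for s' t' :: real
    using that by (simp add: set_lebesgue_integral_def)
  note d = test_function_derivatives[OF test]
  have e: "rate r y = partial_x \<phi> (flow r y) r * speed r y + partial_t \<phi> (flow r y) r * 1" for r
    by (simp add: rate_def)
  show "set_integrable lborel {s..<t} (\<lambda>r. rate r y)" unfolding e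
    by (rule absolutely_continuous_chain_rule(1)[where F="\<lambda>x t. \<phi> (x, t)" and X="\<lambda>t. flow t y" and Y="\<lambda>t. t" and a=s and b=t,
          OF st(2) u one X Y flow_continuous continuous_on_id d(1-3)])
  show "\<phi> (flow t y, t) = \<phi> (flow s y, s) + (LBINT r:{s..<t}. rate r y)" unfolding e
    by (rule absolutely_continuous_chain_rule(2)[where F="\<lambda>x t. \<phi> (x, t)" and X="\<lambda>t. flow t y" and Y="\<lambda>t. t" and a=s and b=t,
          OF st(2) u one X Y flow_continuous continuous_on_id d(1-3)])
qed

text \<open>Integration by parts in time: the chain rule for the product of the impulse, whose
  derivative is minus the drag, and \<phi> along the path. At R the product vanishes because \<phi>
  does.\<close>

lemma impulse_path:
  assumes y: "regular y"
  shows "(LBINT r:{0..<R}. impulse r y * rate r y) = - (v0 y * \<phi> (y, 0)) + (LBINT r:{0..<R}. drag r y * \<phi> (flow r y, r))"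
    and "set_integrable lborel {0..<R} (\<lambda>r. drag r y * \<phi> (flow r y, r))"
proof -
  note d = test_function_derivatives[OF test]
  have R0: "0 \<le> R" using R by simp
  have cX: "continuous_on UNIV (\<lambda>t. \<phi> (flow t y, t))"
    by (rule continuous_on_compose2[OF d(4)]) (auto intro!: continuous_intros flow_continuous)
  have nd: "set_integrable lborel {0..<R} (\<lambda>r. - drag r y)" using impulse_diff(2)[OF order_refl R0, of y]
    unfolding set_integrable_def by simp
  have X: "impulse t y = impulse s y + (LBINT r:{s..<t}. - drag r y)" if "0 \<le> s" "s \<le> t" for s t
    using impulse_diff(1)[OF that, of y] by (simp add: set_lebesgue_integral_def)
  have F: "((\<lambda>z. fst z * snd z) has_derivative (\<lambda>h. y' * fst h + x' * snd h)) (at (x', y'))" for x' y' :: real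
    by (auto intro!: derivative_eq_intros simp: algebra_simps)
  have i0: "impulse 0 y = v0 y" by (simp add: impulse_def set_lebesgue_integral_def)
  show i: "set_integrable lborel {0..<R} (\<lambda>r. drag r y * \<phi> (flow r y, r))"
    using set_integrable_continuous_mult[OF cX impulse_diff(2)[OF order_refl R0, of y]] by (simp add: mult.commute)
  have ii: "set_integrable lborel {0..<R} (\<lambda>r. impulse r y * rate r y)"
    by (rule set_integrable_continuous_mult[OF impulse_continuous test_path(2)[OF y order_refl R0]])
  have "impulse R y * \<phi> (flow R y, R) = impulse 0 y * \<phi> (flow 0 y, 0) +
     (LBINT r:{0..<R}. \<phi> (flow r y, r) * - drag r y + impulse r y * rate r y)"
    by (rule absolutely_continuous_chain_rule(2)[where F="\<lambda>a b. a * b" and Fx="\<lambda>a b. b" and Fy="\<lambda>a b. a" and X="\<lambda>t. impulse t y"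
          and Y="\<lambda>t. \<phi> (flow t y, t)", OF R0 nd test_path(2)[OF y order_refl R0] X test_path(1)[OF y] impulse_continuous cX F])
      (auto intro!: continuous_intros)
  also have "(LBINT r:{0..<R}. \<phi> (flow r y, r) * - drag r y + impulse r y * rate r y) =
     (LBINT r:{0..<R}. impulse r y * rate r y - drag r y * \<phi> (flow r y, r))"
    by (simp add: mult.commute)
  also have "\<dots> = (LBINT r:{0..<R}. impulse r y * rate r y) - (LBINT r:{0..<R}. drag r y * \<phi> (flow r y, r))"
    by (rule set_integral_diff(2)[OF ii i])
  finally show "(LBINT r:{0..<R}. impulse r y * rate r y) = - (v0 y * \<phi> (y, 0)) + (LBINT r:{0..<R}. drag r y * \<phi> (flow r y, r))"
    by (simp add: vanish i0 flow_0)
qed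

lemma rate_L2:
  obtains C where "\<And>r. good_time r \<Longrightarrow> r \<le> R \<Longrightarrow> integrable \<rho>0 (\<lambda>y. (rate r y)\<^sup>2) \<and> (\<integral>y. (rate r y)\<^sup>2 \<partial>\<rho>0) \<le> C"
proof -
  obtain M where M: "\<And>T. 0 < M T" "\<And>t T. good_time t \<Longrightarrow> t \<le> T \<Longrightarrow> (\<integral>y. (speed t y)\<^sup>2 \<partial>\<rho>0) \<le> M T"
    by (rule L2_bounds) blast
  have sq: "(rate r y)\<^sup>2 \<le> 2 * b\<^sup>2 + 2 * b\<^sup>2 * (speed r y)\<^sup>2" for r y
  proof -
    let ?p = "partial_t \<phi> (flow r y) r" and ?q = "speed r y * partial_x \<phi> (flow r y) r"
    have "(?p + ?q)\<^sup>2 \<le> 2 * ?p\<^sup>2 + 2 * ?q\<^sup>2" by (rule power2_sum_le)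
    moreover have "?p\<^sup>2 \<le> b\<^sup>2" using power_mono[OF bounds(3), of _ _ 2] by simp
    moreover have "?q\<^sup>2 \<le> b\<^sup>2 * (speed r y)\<^sup>2"
    proof -
      have "(partial_x \<phi> (flow r y) r)\<^sup>2 \<le> b\<^sup>2" using power_mono[OF bounds(2), of _ _ 2] by simp
      then show ?thesis unfolding power_mult_distrib by (subst mult.commute) (rule mult_right_mono, auto)
    qed
    ultimately show ?thesis unfolding rate_def by linarith
  qed
  show ?thesis
  proof (rule that[of "2 * b\<^sup>2 + 2 * b\<^sup>2 * M R"])
    fix r assume r: "good_time r" "r \<le> R"
    have ib: "integrable \<rho>0 (\<lambda>y. 2 * b\<^sup>2 + 2 * b\<^sup>2 * (speed r y)\<^sup>2)" using speed_L2(1)[OF r(1)] by auto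
    have i: "integrable \<rho>0 (\<lambda>y. (rate r y)\<^sup>2)"
      by (rule Bochner_Integration.integrable_bound[OF ib]) (measurable, auto intro!: AE_I2 order_trans[OF sq])
    have "(\<integral>y. (rate r y)\<^sup>2 \<partial>\<rho>0) \<le> (\<integral>y. 2 * b\<^sup>2 + 2 * b\<^sup>2 * (speed r y)\<^sup>2 \<partial>\<rho>0)"
      by (rule integral_mono[OF i ib sq])
    also have "\<dots> = 2 * b\<^sup>2 + 2 * b\<^sup>2 * (\<integral>y. (speed r y)\<^sup>2 \<partial>\<rho>0)" using speed_L2(1)[OF r(1)] by (simp add: prob_UNIV)
    also have "\<dots> \<le> 2 * b\<^sup>2 + 2 * b\<^sup>2 * M R" using M(2)[OF r] by (intro add_left_mono mult_left_mono) auto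
    finally show "integrable \<rho>0 (\<lambda>y. (rate r y)\<^sup>2) \<and> (\<integral>y. (rate r y)\<^sup>2 \<partial>\<rho>0) \<le> 2 * b\<^sup>2 + 2 * b\<^sup>2 * M R" using i by simp
  qed
qed

lemma product_pair_integrable:
  fixes h k :: "real \<Rightarrow> real \<Rightarrow> real"
  assumes [measurable]: "(\<lambda>p. h (fst p) (snd p)) \<in> borel_measurable (borel \<Otimes>\<^sub>M borel)" "(\<lambda>p. k (fst p) (snd p)) \<in> borel_measurable (borel \<Otimes>\<^sub>M borel)"
    and h: "\<And>r. good_time r \<Longrightarrow> r \<le> R \<Longrightarrow> integrable \<rho>0 (\<lambda>y. (h r y)\<^sup>2) \<and> (\<integral>y. (h r y)\<^sup>2 \<partial>\<rho>0) \<le> C"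
    and k: "\<And>r. good_time r \<Longrightarrow> r \<le> R \<Longrightarrow> integrable \<rho>0 (\<lambda>y. (k r y)\<^sup>2) \<and> (\<integral>y. (k r y)\<^sup>2 \<partial>\<rho>0) \<le> D"
  shows "integrable (lborel \<Otimes>\<^sub>M \<rho>0) (\<lambda>(r, y). indicator {0..<R} r * (h r y * k r y))"
proof (rule pair_integrable_bounded[where C="C + D"])
  show "AE r in lborel. 0 \<le> r \<longrightarrow> r < R \<longrightarrow> integrable \<rho>0 (\<lambda>y. h r y * k r y) \<and> (\<integral>y. \<bar>h r y * k r y\<bar> \<partial>\<rho>0) \<le> C + D"
    using AE_good_time
  proof (eventually_elim, intro impI conjI)
    fix r assume "0 \<le> r \<longrightarrow> good_time r" "0 \<le> r" "r < R"
    then have r: "good_time r" "r \<le> R" by auto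
    have hm: "h r \<in> borel_measurable \<rho>0" "k r \<in> borel_measurable \<rho>0"
      using measurable_compose[OF measurable_Pair1'[of r borel borel] assms(1)] measurable_compose[OF measurable_Pair1'[of r borel borel] assms(2)]
      by simp_all
    show i: "integrable \<rho>0 (\<lambda>y. h r y * k r y)"
      by (rule integrable_product_sq) (use h[OF r] k[OF r] hm in auto)
    have "(\<integral>y. \<bar>h r y * k r y\<bar> \<partial>\<rho>0) \<le> (\<integral>y. (h r y)\<^sup>2 + (k r y)\<^sup>2 \<partial>\<rho>0)"
    proof (rule integral_mono)
      fix y
      show "\<bar>h r y * k r y\<bar> \<le> (h r y)\<^sup>2 + (k r y)\<^sup>2"
        using sum_squares_bound[of "\<bar>h r y\<bar>" "\<bar>k r y\<bar>"] abs_ge_zero[of "h r y * k r y"]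
        unfolding abs_mult power2_abs by linarith
    qed (use i h[OF r] k[OF r] in auto)
    also have "\<dots> = (\<integral>y. (h r y)\<^sup>2 \<partial>\<rho>0) + (\<integral>y. (k r y)\<^sup>2 \<partial>\<rho>0)" using h[OF r] k[OF r] by simp
    also have "\<dots> \<le> C + D" using h[OF r] k[OF r] by (intro add_mono) auto
    finally show "(\<integral>y. \<bar>h r y * k r y\<bar> \<partial>\<rho>0) \<le> C + D" .
  qed
qed (use R in \<open>measurable, simp\<close>)

lemma time_cutoff:
  fixes G :: "real \<Rightarrow> real"
  assumes "\<And>t. R \<le> t \<Longrightarrow> G t = 0"
  shows "(LBINT t:{0..}. G t) = (LBINT t:{0..<R}. G t)"
  unfolding set_lebesgue_integral_def
  by (rule Bochner_Integration.integral_cong[OF refl]) (use assms in \<open>auto simp: indicator_def\<close>)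

lemma continuity_equation:
  "(LBINT t:{0..}. \<integral>x. partial_t \<phi> x t + velocity (x, t) * partial_x \<phi> x t \<partial>law t) + (\<integral>x. \<phi> (x, 0) \<partial>\<rho>0) = 0"
proof -
  have law: "(\<integral>x. partial_t \<phi> x t + velocity (x, t) * partial_x \<phi> x t \<partial>law t) = (\<integral>y. rate t y \<partial>\<rho>0)" for t
    unfolding rate_def speed_def by (rule law_integral) measurable
  obtain C where C: "\<And>r. good_time r \<Longrightarrow> r \<le> R \<Longrightarrow> integrable \<rho>0 (\<lambda>y. (rate r y)\<^sup>2) \<and> (\<integral>y. (rate r y)\<^sup>2 \<partial>\<rho>0) \<le> C"
    by (rule rate_L2) blast
  have P: "integrable (lborel \<Otimes>\<^sub>M \<rho>0) (\<lambda>(r, y). indicator {0..<R} r * (rate r y * 1))"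
    by (rule product_pair_integrable[OF _ _ C, where D=1]) (auto simp: prob_UNIV)
  have "(LBINT t:{0..}. \<integral>y. rate t y \<partial>\<rho>0) = (LBINT t:{0..<R}. \<integral>y. rate t y * 1 \<partial>\<rho>0)"
  proof -
    have "(\<integral>y. rate t y \<partial>\<rho>0) = 0" if "R \<le> t" for t
    proof -
      have "rate t = (\<lambda>_. 0)" using that by (auto simp: rate_vanish fun_eq_iff)
      then show ?thesis by simp
    qed
    then show ?thesis by (subst time_cutoff) simp_all
  qed
  also have "\<dots> = (\<integral>y. (LBINT t:{0..<R}. rate t y * 1) \<partial>\<rho>0)" by (rule pair_fubini(3)[OF P, symmetric])
  also have "\<dots> = (\<integral>y. - \<phi> (y, 0) \<partial>\<rho>0)"
  proof (rule integral_cong_AE)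
    show "(\<lambda>y. LBINT t:{0..<R}. rate t y * 1) \<in> borel_measurable \<rho>0" using pair_fubini(2)[OF P] by simp
    show "AE y in \<rho>0. (LBINT t:{0..<R}. rate t y * 1) = - \<phi> (y, 0)"
      using AE_regular
    proof eventually_elim
      case (elim y)
      from test_path(1)[OF elim order_refl less_imp_le[OF R]] show ?case by (simp add: vanish flow_0)
    qed
  qed measurable
  finally show ?thesis by (simp add: law)
qed

text \<open>The flux is quadratic in the velocity, but speed times \<open>rate\<close> has the same
  integral as impulse times \<open>rate\<close>. The latter is computed path by path with
  \<open>impulse_path\<close>, and Fubini exchanges the integrals.\<close>

lemma momentum_equation:
  "(LBINT t:{0..}. \<integral>x. velocity (x, t) * partial_t \<phi> x t + (velocity (x, t))\<^sup>2 * partial_x \<phi> x t \<partial>law t)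
     + (\<integral>x. \<phi> (x, 0) * v0 x \<partial>\<rho>0) = (LBINT t:{0..}. \<integral>x. \<phi> (x, t) * conv_measure f (law t) x \<partial>law t)"
proof -
  have law: "(\<integral>x. velocity (x, t) * partial_t \<phi> x t + (velocity (x, t))\<^sup>2 * partial_x \<phi> x t \<partial>law t) = (\<integral>y. speed t y * rate t y \<partial>\<rho>0)" for t
  proof -
    have "(\<integral>x. velocity (x, t) * partial_t \<phi> x t + (velocity (x, t))\<^sup>2 * partial_x \<phi> x t \<partial>law t) =
      (\<integral>y. velocity (flow t y, t) * partial_t \<phi> (flow t y) t + (velocity (flow t y, t))\<^sup>2 * partial_x \<phi> (flow t y) t \<partial>\<rho>0)"
      by (rule law_integral) measurable
    then show ?thesis by (simp add: rate_def speed_def power2_eq_square algebra_simps)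
  qed
  have lawF: "(\<integral>x. \<phi> (x, t) * conv_measure f (law t) x \<partial>law t) = (\<integral>y. drag t y * \<phi> (flow t y, t) \<partial>\<rho>0)" for t
    by (subst law_integral) (simp_all add: conv_measure_flow mult.commute)
  obtain C where C: "\<And>r. good_time r \<Longrightarrow> r \<le> R \<Longrightarrow> integrable \<rho>0 (\<lambda>y. (rate r y)\<^sup>2) \<and> (\<integral>y. (rate r y)\<^sup>2 \<partial>\<rho>0) \<le> C"
    by (rule rate_L2) blast
  obtain MI where MI: "\<And>t T. 0 \<le> t \<Longrightarrow> t \<le> T \<Longrightarrow> (\<integral>y. (impulse t y)\<^sup>2 \<partial>\<rho>0) \<le> MI T"
    by (rule impulse_L2_bound) blast
  obtain M where M: "\<And>t T. 0 \<le> t \<Longrightarrow> t \<le> T \<Longrightarrow> (\<integral>y. (drag t y)\<^sup>2 \<partial>\<rho>0) \<le> M T"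
    by (rule L2_bounds) blast
  have I2: "integrable \<rho>0 (\<lambda>y. (impulse r y)\<^sup>2) \<and> (\<integral>y. (impulse r y)\<^sup>2 \<partial>\<rho>0) \<le> MI R" if "good_time r" "r \<le> R" for r
    using impulse_integrable(2) MI good_time_nonneg[OF that(1)] that by blast
  have D2: "integrable \<rho>0 (\<lambda>y. (drag r y)\<^sup>2) \<and> (\<integral>y. (drag r y)\<^sup>2 \<partial>\<rho>0) \<le> M R" if "good_time r" "r \<le> R" for r
    using drag_integrable(2) M good_time_nonneg[OF that(1)] that by blast
  have \<phi>2: "integrable \<rho>0 (\<lambda>y. (\<phi> (flow r y, r))\<^sup>2) \<and> (\<integral>y. (\<phi> (flow r y, r))\<^sup>2 \<partial>\<rho>0) \<le> b\<^sup>2" for r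
  proof -
    have sq: "(\<phi> (flow r y, r))\<^sup>2 \<le> b\<^sup>2" for y using power_mono[OF bounds(1), of _ _ 2] by simp
    have i: "integrable \<rho>0 (\<lambda>y. (\<phi> (flow r y, r))\<^sup>2)"
      by (rule Bochner_Integration.integrable_bound[of _ "\<lambda>_. b\<^sup>2"]) (auto simp: sq)
    have "(\<integral>y. (\<phi> (flow r y, r))\<^sup>2 \<partial>\<rho>0) \<le> (\<integral>y. b\<^sup>2 \<partial>\<rho>0)" by (rule integral_mono[OF i]) (auto simp: sq)
    then show ?thesis using i by (simp add: prob_UNIV)
  qed
  have P: "integrable (lborel \<Otimes>\<^sub>M \<rho>0) (\<lambda>(r, y). indicator {0..<R} r * (impulse r y * rate r y))"
    by (rule product_pair_integrable[OF _ _ I2 C]) auto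
  have Q: "integrable (lborel \<Otimes>\<^sub>M \<rho>0) (\<lambda>(r, y). indicator {0..<R} r * (drag r y * \<phi> (flow r y, r)))"
    by (rule product_pair_integrable[OF _ _ D2 \<phi>2]) auto
  \<comment> \<open>At a fixed time \<open>rate\<close> is a function of the position, so the
    projection property may be tested with it.\<close>
  have swap: "(\<integral>y. speed t y * rate t y \<partial>\<rho>0) = (\<integral>y. impulse t y * rate t y \<partial>\<rho>0)" if t: "good_time t" "t < R" for t
  proof -
    have t': "t \<le> R" using t by simp
    have r2: "integrable \<rho>0 (\<lambda>y. (rate t y)\<^sup>2)" using C[OF t(1) t'] by blast
    define g where "g x = partial_t \<phi> x t + velocity (x, t) * partial_x \<phi> x t" for x
    have [measurable]: "g \<in> borel_measurable borel" unfolding g_def[abs_def] by measurable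
    have gr: "g (flow t y) = rate t y" for y by (simp add: g_def rate_def speed_def)
    have "(\<integral>y. (impulse t y - speed t y) * g (flow t y) \<partial>\<rho>0) = 0"
      by (rule speed_projection[OF t(1) order_refl]) (simp_all add: gr r2)
    then have "(\<integral>y. impulse t y * rate t y - speed t y * rate t y \<partial>\<rho>0) = 0" by (simp add: gr left_diff_distrib)
    moreover have "integrable \<rho>0 (\<lambda>y. impulse t y * rate t y)" "integrable \<rho>0 (\<lambda>y. speed t y * rate t y)"
      by (intro integrable_product_sq impulse_integrable(2) good_time_nonneg speed_L2(1) t(1) r2; measurable)+
    ultimately show ?thesis by simp
  qed
  have "(LBINT t:{0..}. \<integral>y. speed t y * rate t y \<partial>\<rho>0) = (LBINT t:{0..<R}. \<integral>y. speed t y * rate t y \<partial>\<rho>0)"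
    by (rule time_cutoff) (simp add: rate_vanish)
  also have "\<dots> = (LBINT t:{0..<R}. \<integral>y. impulse t y * rate t y \<partial>\<rho>0)"
    unfolding set_lebesgue_integral_def
  proof (rule integral_cong_AE)
    show "AE t in lborel. indicator {0..<R} t *\<^sub>R (\<integral>y. speed t y * rate t y \<partial>\<rho>0) = indicator {0..<R} t *\<^sub>R (\<integral>y. impulse t y * rate t y \<partial>\<rho>0)"
      using AE_good_time by eventually_elim (auto simp: indicator_def swap)
  qed measurable
  also have "\<dots> = (\<integral>y. (LBINT t:{0..<R}. impulse t y * rate t y) \<partial>\<rho>0)" by (rule pair_fubini(3)[OF P, symmetric])
  also have "\<dots> = (\<integral>y. - (v0 y * \<phi> (y, 0)) + (LBINT r:{0..<R}. drag r y * \<phi> (flow r y, r)) \<partial>\<rho>0)"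
  proof (rule integral_cong_AE)
    show "(\<lambda>y. LBINT t:{0..<R}. impulse t y * rate t y) \<in> borel_measurable \<rho>0" using pair_fubini(2)[OF P] by simp
    show "(\<lambda>y. - (v0 y * \<phi> (y, 0)) + (LBINT r:{0..<R}. drag r y * \<phi> (flow r y, r))) \<in> borel_measurable \<rho>0"
      using pair_fubini(2)[OF Q] by measurable
    show "AE y in \<rho>0. (LBINT t:{0..<R}. impulse t y * rate t y) = - (v0 y * \<phi> (y, 0)) + (LBINT r:{0..<R}. drag r y * \<phi> (flow r y, r))"
      using AE_regular by eventually_elim (rule impulse_path)
  qed
  also have "\<dots> = - (\<integral>y. v0 y * \<phi> (y, 0) \<partial>\<rho>0) + (\<integral>y. (LBINT r:{0..<R}. drag r y * \<phi> (flow r y, r)) \<partial>\<rho>0)"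
  proof -
    obtain L where L: "0 \<le> L" "\<And>x. \<bar>v0 x\<bar> \<le> L * (1 + \<bar>x\<bar>)" by (rule v0_affine) blast
    have "integrable \<rho>0 (\<lambda>y. v0 y * \<phi> (y, 0))"
      using integrable_product_sq[OF integrable_affine_bounded(2)[OF v0_measurable L(2)], of "\<lambda>y. \<phi> (y, 0)"] \<phi>2[of 0]
      by (simp add: flow_0)
    then show ?thesis using pair_fubini(2)[OF Q] by simp
  qed
  also have "(\<integral>y. (LBINT r:{0..<R}. drag r y * \<phi> (flow r y, r)) \<partial>\<rho>0) = (LBINT r:{0..<R}. \<integral>y. drag r y * \<phi> (flow r y, r) \<partial>\<rho>0)"
    by (rule pair_fubini(3)[OF Q])
  also have "\<dots> = (LBINT r:{0..}. \<integral>y. drag r y * \<phi> (flow r y, r) \<partial>\<rho>0)"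
    by (rule time_cutoff[symmetric]) (simp add: vanish)
  finally have "(LBINT t:{0..}. \<integral>y. speed t y * rate t y \<partial>\<rho>0) + (\<integral>y. v0 y * \<phi> (y, 0) \<partial>\<rho>0) =
    (LBINT r:{0..}. \<integral>y. drag r y * \<phi> (flow r y, r) \<partial>\<rho>0)" by simp
  then show ?thesis unfolding law lawF by (simp only: mult.commute[of "v0 _"])
qed

end

section \<open>The entropy inequality\<close>

context euler_data
begin

lemma impulse_set_integrable: "set_integrable lborel {s..<t} (\<lambda>r. impulse r y)"
proof (rule set_integrable_subset)
  show "set_integrable lborel {s..t} (\<lambda>r. impulse r y)"
    by (rule borel_integrable_atLeastAtMost') (rule continuous_on_subset[OF impulse_continuous], simp)
qed auto

text \<open>By stickiness the increment of the flow before time \<open>t\<close> may be tested against functions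
  of \<open>flow t\<close>, and the impulse is Lipschitz in time.\<close>

lemma flow_backward_difference:
  obtains C where "\<And>T. 0 < C T"
    "\<And>s t T g b. \<lbrakk>0 \<le> s; s \<le> t; t \<le> T; good_time t; g \<in> borel_measurable borel; \<And>y. \<bar>g (flow t y)\<bar> \<le> b * (1 + \<bar>y\<bar>)\<rbrakk> \<Longrightarrow>
      \<bar>(\<integral>y. (flow t y - flow s y) * g (flow t y) \<partial>\<rho>0) - (t - s) * (\<integral>y. speed t y * g (flow t y) \<partial>\<rho>0)\<bar> \<le> b * C T * (t - s)\<^sup>2"
proof -
  obtain B where B: "\<And>T. 0 < B T" "\<And>t T y. 0 \<le> t \<Longrightarrow> t \<le> T \<Longrightarrow> \<bar>impulse t y\<bar> \<le> B T * (1 + \<bar>y\<bar>)"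
    by (rule growth_bound) blast
  obtain L where L: "\<And>T. 0 < L T"
    "\<And>s t T y. 0 \<le> s \<Longrightarrow> s \<le> t \<Longrightarrow> t \<le> T \<Longrightarrow> \<bar>impulse t y - impulse s y\<bar> \<le> L T * (1 + \<bar>y\<bar>) * (t - s)"
    by (rule impulse_lipschitz) blast
  \<comment> \<open>Two affine bounds get multiplied, one for the change of the impulse and one for
    g; the factor 1 matches \<open>integrable_affine_sq\<close>.\<close>
  define m where "m = (\<integral>y. (1 + 1 * \<bar>y\<bar>)\<^sup>2 \<partial>\<rho>0)"
  have m: "1 \<le> m"
  proof -
    have "(\<integral>y. 1 \<partial>\<rho>0) \<le> m" unfolding m_def
      by (rule integral_mono[OF _ integrable_affine_sq]) (auto simp: power2_sum)
    then show ?thesis by (simp add: prob_UNIV)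
  qed
  show ?thesis
  proof (rule that[of "\<lambda>T. L T * m"])
    show "0 < L T * m" for T using L(1)[of T] m by simp
    fix s t T :: real and g :: "real \<Rightarrow> real" and b
    assume st: "0 \<le> s" "s \<le> t" "t \<le> T" and t: "good_time t" and g[measurable]: "g \<in> borel_measurable borel"
      and b: "\<And>y. \<bar>g (flow t y)\<bar> \<le> b * (1 + \<bar>y\<bar>)"
    define h where "h y = g (flow t y)" for y
    define I where "I y = (LBINT u:{s..<t}. impulse u y)" for y
    have [measurable]: "h \<in> borel_measurable borel" unfolding h_def[abs_def] by measurable
    have [measurable]: "I \<in> borel_measurable borel" unfolding I_def[abs_def] set_lebesgue_integral_def by measurable
    have h: "\<bar>h y\<bar> \<le> b * (1 + \<bar>y\<bar>)" for y using b by (simp add: h_def)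
    have t0: "0 \<le> t" using st by simp
    have h2: "integrable \<rho>0 (\<lambda>y. (h y)\<^sup>2)" by (rule integrable_affine_bounded(2)[OF _ h]) simp
    have Ib: "\<bar>I y\<bar> \<le> (B T * (t - s)) * (1 + \<bar>y\<bar>)" for y
    proof -
      have "\<bar>I y\<bar> \<le> (B T * (1 + \<bar>y\<bar>)) * (t - s)" unfolding I_def
        by (rule set_integral_abs_le[OF st(2) impulse_set_integrable]) (use B(2) st in auto)
      then show ?thesis by (simp add: mult_ac)
    qed
    have I2: "integrable \<rho>0 (\<lambda>y. (I y)\<^sup>2)" by (rule integrable_affine_bounded(2)[OF _ Ib]) simp
    have iI: "integrable \<rho>0 (\<lambda>y. I y * h y)" by (rule integrable_product_sq[OF I2 h2]) measurable
    have iF: "integrable \<rho>0 (\<lambda>y. (flow t y - flow s y) * h y)"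
      by (rule integrable_product_sq[OF flow_diff_sq_integrable[OF st(1,2)] h2]) measurable
    have iA: "integrable \<rho>0 (\<lambda>y. impulse t y * h y)"
      by (rule integrable_product_sq[OF impulse_integrable(2)[OF t0] h2]) measurable
    have iS: "integrable \<rho>0 (\<lambda>y. speed t y * h y)"
      by (rule integrable_product_sq[OF speed_L2(1)[OF t] h2]) measurable
    have "(\<integral>y. (flow t y - flow s y - I y) * h y \<partial>\<rho>0) = 0" unfolding h_def I_def
    proof (rule flow_momentum_le[OF st(1,2) order_refl g])
      show "integrable \<rho>0 (\<lambda>y. (flow t y - flow s y - (LBINT u:{s..<t}. impulse u y)) * g (flow t y))"
        using Bochner_Integration.integrable_diff[OF iF iI] by (simp add: left_diff_distrib h_def I_def)
    qed
    then have e1: "(\<integral>y. (flow t y - flow s y) * h y \<partial>\<rho>0) = (\<integral>y. I y * h y \<partial>\<rho>0)"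
      using iF iI by (simp add: left_diff_distrib[of _ "I _"])
    have "(\<integral>y. (impulse t y - speed t y) * h y \<partial>\<rho>0) = 0" unfolding h_def
      by (rule speed_projection[OF t order_refl g]) (use h2 in \<open>simp add: h_def\<close>)
    then have e2: "(\<integral>y. speed t y * h y \<partial>\<rho>0) = (\<integral>y. impulse t y * h y \<partial>\<rho>0)"
      using iA iS by (simp add: left_diff_distrib)
    have near: "\<bar>I y - (t - s) * impulse t y\<bar> \<le> L T * (1 + \<bar>y\<bar>) * (t - s) * (t - s)" for y
    proof -
      have c: "set_integrable lborel {s..<t} (\<lambda>u. impulse t y)" unfolding set_integrable_def using st(2) by simp
      have "I y - (t - s) * impulse t y = (LBINT u:{s..<t}. impulse u y - impulse t y)"
        using set_integral_diff(2)[OF impulse_set_integrable c] st(2)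
        by (simp add: I_def) (simp add: set_lebesgue_integral_def)
      also have "\<bar>\<dots>\<bar> \<le> (L T * (1 + \<bar>y\<bar>) * (t - s)) * (t - s)"
      proof (rule set_integral_abs_le[OF st(2) set_integral_diff(1)[OF impulse_set_integrable c]])
        fix u assume u: "s \<le> u" "u < t"
        have "\<bar>impulse t y - impulse u y\<bar> \<le> L T * (1 + \<bar>y\<bar>) * (t - u)" by (rule L(2)) (use u st in auto)
        also have "\<dots> \<le> L T * (1 + \<bar>y\<bar>) * (t - s)" using u L(1)[of T] by (intro mult_left_mono) auto
        finally show "\<bar>impulse u y - impulse t y\<bar> \<le> L T * (1 + \<bar>y\<bar>) * (t - s)" by (simp add: abs_minus_commute)
      qed
      finally show ?thesis .
    qed
    have e: "(\<integral>y. (flow t y - flow s y) * h y \<partial>\<rho>0) - (t - s) * (\<integral>y. speed t y * h y \<partial>\<rho>0) =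
      (\<integral>y. I y * h y - (t - s) * (impulse t y * h y) \<partial>\<rho>0)"
      unfolding e1 e2 using iI iA by simp
    have "\<bar>\<integral>y. I y * h y - (t - s) * (impulse t y * h y) \<partial>\<rho>0\<bar> \<le> (\<integral>y. b * L T * (t - s)\<^sup>2 * (1 + 1 * \<bar>y\<bar>)\<^sup>2 \<partial>\<rho>0)"
    proof (rule integral_abs_le_AE)
      show "integrable \<rho>0 (\<lambda>y. I y * h y - (t - s) * (impulse t y * h y))" using iI iA by simp
      show "integrable \<rho>0 (\<lambda>y. b * L T * (t - s)\<^sup>2 * (1 + 1 * \<bar>y\<bar>)\<^sup>2)"
        by (rule integrable_mult_right[OF integrable_affine_sq])
      show "AE y in \<rho>0. \<bar>I y * h y - (t - s) * (impulse t y * h y)\<bar> \<le> b * L T * (t - s)\<^sup>2 * (1 + 1 * \<bar>y\<bar>)\<^sup>2"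
      proof (rule AE_I2)
        fix y
        have "I y * h y - (t - s) * (impulse t y * h y) = (I y - (t - s) * impulse t y) * h y" by (simp add: algebra_simps)
        then have "\<bar>I y * h y - (t - s) * (impulse t y * h y)\<bar> = \<bar>I y - (t - s) * impulse t y\<bar> * \<bar>h y\<bar>" by (simp add: abs_mult)
        also have "\<dots> \<le> (L T * (1 + \<bar>y\<bar>) * (t - s) * (t - s)) * (b * (1 + \<bar>y\<bar>))"
          using near[of y] h[of y] by (intro mult_mono) auto
        also have "\<dots> = b * L T * (t - s)\<^sup>2 * (1 + 1 * \<bar>y\<bar>)\<^sup>2" by (simp add: power2_eq_square)
        finally show "\<bar>I y * h y - (t - s) * (impulse t y * h y)\<bar> \<le> b * L T * (t - s)\<^sup>2 * (1 + 1 * \<bar>y\<bar>)\<^sup>2" .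
      qed
    qed
    also have "\<dots> = b * L T * (t - s)\<^sup>2 * m" unfolding m_def by (rule integral_mult_right_zero)
    finally show "\<bar>(\<integral>y. (flow t y - flow s y) * g (flow t y) \<partial>\<rho>0) - (t - s) * (\<integral>y. speed t y * g (flow t y) \<partial>\<rho>0)\<bar> \<le>
      b * (L T * m) * (t - s)\<^sup>2" unfolding h_def[symmetric] e by (simp only: mult_ac)
  qed
qed

lemma integrable_indicator_flow:
  fixes h :: "real \<Rightarrow> real"
  assumes h: "integrable \<rho>0 h" and [measurable]: "D \<in> sets borel"
  shows "integrable \<rho>0 (\<lambda>y. h y * indicator D (flow t y))"
proof (rule Bochner_Integration.integrable_bound[OF h])
  have [measurable]: "h \<in> borel_measurable \<rho>0" using h by simp
  show "(\<lambda>y. h y * indicator D (flow t y)) \<in> borel_measurable \<rho>0" by measurable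
qed (auto simp: indicator_def)

section \<open>From the contraction estimate to the entropy inequality\<close>

text \<open>\<open>G r\<close> is the integral of flow r z - flow r y over the pairs of labels that
  are in A and A' respectively at time t. Since A lies to the left of A', these pairs are ordered,
  and \<open>flow_contraction\<close> is integrated over them.\<close>

lemma flow_contraction_integrated:
  assumes s: "0 \<le> s" "s \<le> t" and [measurable]: "A \<in> sets borel" "A' \<in> sets borel"
    and lt: "\<And>x x'. x \<in> A \<Longrightarrow> x' \<in> A' \<Longrightarrow> x < x'"
    and a_def: "a = (\<integral>y. indicator A (flow t y) \<partial>\<rho>0)" and a'_def: "a' = (\<integral>y. indicator A' (flow t y) \<partial>\<rho>0)"
    and G_def: "\<And>r. G r = a * (\<integral>y. flow r y * indicator A' (flow t y) \<partial>\<rho>0) - a' * (\<integral>y. flow r y * indicator A (flow t y) \<partial>\<rho>0)"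
  shows "G t * sinh (sqrt c * s) \<le> G s * sinh (sqrt c * t)"
proof -
  have i1: "integrable \<rho>0 (\<lambda>y. indicator D (flow t y) :: real)" if "D \<in> sets borel" for D
    using integrable_indicator_flow[OF _ that, of "\<lambda>_. 1"] by simp
  have t: "0 \<le> t" using s by simp
  define S where "S r = sinh (sqrt c * r)" for r
  \<comment> \<open>The contraction estimate says exactly that k is nondecreasing on good
    labels.\<close>
  define k where "k z = S t * flow s z - S s * flow t z" for z
  have ik: "integrable \<rho>0 k" unfolding k_def[abs_def]
    using flow_integrable(1)[OF s(1)] flow_integrable(1)[OF t] by simp
  have ik': "integrable \<rho>0 (\<lambda>z. k z * indicator A' (flow t z))" "integrable \<rho>0 (\<lambda>z. k z * indicator A (flow t z))"
    by (rule integrable_indicator_flow[OF ik], simp)+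
  have kI: "(\<integral>z. k z * indicator D (flow t z) \<partial>\<rho>0) =
    S t * (\<integral>z. flow s z * indicator D (flow t z) \<partial>\<rho>0) - S s * (\<integral>z. flow t z * indicator D (flow t z) \<partial>\<rho>0)"
    if "D \<in> sets borel" for D
  proof -
    have "(\<integral>z. k z * indicator D (flow t z) \<partial>\<rho>0) = (\<integral>z. S t * (flow s z * indicator D (flow t z)) - S s * (flow t z * indicator D (flow t z)) \<partial>\<rho>0)"
      by (simp add: k_def algebra_simps)
    also have "\<dots> = S t * (\<integral>z. flow s z * indicator D (flow t z) \<partial>\<rho>0) - S s * (\<integral>z. flow t z * indicator D (flow t z) \<partial>\<rho>0)"
      using integrable_indicator_flow[OF flow_integrable(1)[OF s(1)] that] integrable_indicator_flow[OF flow_integrable(1)[OF t] that] by simp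
    finally show ?thesis .
  qed
  have inner: "0 \<le> indicator A (flow t y) * (\<integral>z. k z * indicator A' (flow t z) \<partial>\<rho>0) - k y * indicator A (flow t y) * a'"
    if y: "y \<in> good" for y
  proof (cases "flow t y \<in> A")
    case True
    have "0 \<le> (\<integral>z. k z * indicator A' (flow t z) - k y * indicator A' (flow t z) \<partial>\<rho>0)"
    proof (rule integral_nonneg_AE)
      show "AE z in \<rho>0. 0 \<le> k z * indicator A' (flow t z) - k y * indicator A' (flow t z)"
        using AE_good
      proof eventually_elim
        case (elim z)
        show ?case
        proof (cases "flow t z \<in> A'")
          case z: True
          have "y \<le> z"
          proof (rule ccontr)
            assume "\<not> y \<le> z"
            then have "flow t z \<le> flow t y" using elim y t by (intro flow_mono) auto
            then show False using lt[OF True z] by simp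
          qed
          from flow_contraction[OF s y elim this] show ?thesis using z by (simp add: k_def S_def algebra_simps)
        qed simp
      qed
    qed
    also have "\<dots> = (\<integral>z. k z * indicator A' (flow t z) \<partial>\<rho>0) - k y * a'"
      unfolding a'_def using ik'(1) i1[of A'] by simp
    finally show ?thesis using True by simp
  qed simp
  have "0 \<le> (\<integral>y. indicator A (flow t y) * (\<integral>z. k z * indicator A' (flow t z) \<partial>\<rho>0) - k y * indicator A (flow t y) * a' \<partial>\<rho>0)"
  proof (rule integral_nonneg_AE)
    show "AE y in \<rho>0. 0 \<le> indicator A (flow t y) * (\<integral>z. k z * indicator A' (flow t z) \<partial>\<rho>0) - k y * indicator A (flow t y) * a'"
      using AE_good by eventually_elim (rule inner)
  qed
  also have "\<dots> = a * (\<integral>z. k z * indicator A' (flow t z) \<partial>\<rho>0) - (\<integral>y. k y * indicator A (flow t y) \<partial>\<rho>0) * a'"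
    unfolding a_def using ik' i1[of A] by simp
  finally show ?thesis unfolding kI[OF assms(3)] kI[OF assms(4)] G_def S_def by (simp add: algebra_simps)
qed

text \<open>The integrated contraction is divided by t - s, and s tends to t from the left. The
  difference quotients of \<open>G\<close> turn into integrals of the speed by
  \<open>flow_backward_difference\<close>, and those of sinh give the factor sqrt c / tanh. Thus the
  mean of \<omega> over A' is at most its mean over A.\<close>

lemma entropy_integrated:
  assumes t: "good_time t" "0 < t" and [measurable]: "A \<in> sets borel" "A' \<in> sets borel"
    and lt: "\<And>x x'. x \<in> A \<Longrightarrow> x' \<in> A' \<Longrightarrow> x < x'"
  defines "\<omega> y \<equiv> speed t y - sqrt c / tanh (sqrt c * t) * flow t y"
  shows "(\<integral>y. indicator A (flow t y) \<partial>\<rho>0) * (\<integral>y. \<omega> y * indicator A' (flow t y) \<partial>\<rho>0) \<le>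
    (\<integral>y. indicator A' (flow t y) \<partial>\<rho>0) * (\<integral>y. \<omega> y * indicator A (flow t y) \<partial>\<rho>0)"
proof -
  have t0: "0 \<le> t" using t by simp
  define S where "S r = sinh (sqrt c * r)" for r
  define k where "k = sqrt c / tanh (sqrt c * t)"
  define a where "a = (\<integral>y. indicator A (flow t y) \<partial>\<rho>0 :: real)"
  define a' where "a' = (\<integral>y. indicator A' (flow t y) \<partial>\<rho>0 :: real)"
  define F where "F r D = (\<integral>y. flow r y * indicator D (flow t y) \<partial>\<rho>0)" for r D
  define m where "m D = (\<integral>y. speed t y * indicator D (flow t y) \<partial>\<rho>0)" for D
  define G where "G r = a * F r A' - a' * F r A" for r
  define \<mu> where "\<mu> = a * m A' - a' * m A"
  have ispeed: "integrable \<rho>0 (speed t)" using velocity_projection(1)[OF t(1)] by (simp add: speed_def[abs_def])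
  obtain C where C: "\<And>T. 0 < C T"
    "\<And>s t T g b. \<lbrakk>0 \<le> s; s \<le> t; t \<le> T; good_time t; g \<in> borel_measurable borel; \<And>y. \<bar>g (flow t y)\<bar> \<le> b * (1 + \<bar>y\<bar>)\<rbrakk> \<Longrightarrow>
      \<bar>(\<integral>y. (flow t y - flow s y) * g (flow t y) \<partial>\<rho>0) - (t - s) * (\<integral>y. speed t y * g (flow t y) \<partial>\<rho>0)\<bar> \<le> b * C T * (t - s)\<^sup>2"
    by (rule flow_backward_difference) blast
  have diff: "\<bar>F t D - F s D - (t - s) * m D\<bar> \<le> C t * (t - s)\<^sup>2" if s: "0 \<le> s" "s \<le> t" and [measurable]: "D \<in> sets borel" for s D
  proof -
    have "(\<integral>y. (flow t y - flow s y) * indicator D (flow t y) \<partial>\<rho>0) = F t D - F s D"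
      unfolding F_def left_diff_distrib by (intro Bochner_Integration.integral_diff integrable_indicator_flow flow_integrable t0 s(1)) measurable
    then show ?thesis using C(2)[OF s order_refl t(1), of "indicator D" 1] by (simp add: m_def indicator_def)
  qed
  have a: "0 \<le> a" "0 \<le> a'" unfolding a_def a'_def by (auto intro!: Bochner_Integration.integral_nonneg)
  have step: "\<mu> \<le> G t / S t * ((S s - S t) / (s - t)) + (a + a') * C t * (t - s)" if s: "0 < s" "s < t" for s
  proof -
    have St: "0 < S t" unfolding S_def using t(2) c_gt_0 by (simp add: sinh_real_pos_iff)
    have s0: "0 \<le> s" "s \<le> t" using s by auto
    have "(t - s) * m A' \<le> F t A' - F s A' + C t * (t - s)\<^sup>2" "F t A - F s A - C t * (t - s)\<^sup>2 \<le> (t - s) * m A"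
      using diff[OF s0, of A'] diff[OF s0, of A] by (simp_all add: abs_le_iff)
    from mult_left_mono[OF this(1) a(1)] mult_left_mono[OF this(2) a(2)]
    have "(t - s) * \<mu> \<le> G t - G s + (a + a') * C t * (t - s)\<^sup>2" by (simp add: \<mu>_def G_def algebra_simps)
    moreover have "G t * S s \<le> G s * S t"
      unfolding S_def by (rule flow_contraction_integrated[OF s0 _ _ lt a_def a'_def]) (simp_all add: G_def F_def)
    then have "G t * S s / S t \<le> G s" using St by (simp add: pos_divide_le_eq)
    moreover have "G t - G t * S s / S t = G t / S t * (S t - S s)" using St by (simp add: field_simps)
    ultimately have "(t - s) * \<mu> \<le> G t / S t * (S t - S s) + (a + a') * C t * (t - s)\<^sup>2" by linarith
    also have "\<dots> = (t - s) * (G t / S t * ((S s - S t) / (s - t)) + (a + a') * C t * (t - s))"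
      using s by (simp add: power2_eq_square distrib_left minus_divide_left[symmetric] divide_simps) (simp add: algebra_simps)
    finally show ?thesis using s by (simp only: mult_le_cancel_left_pos diff_gt_0_iff_gt)
  qed
  have dS: "(S has_real_derivative cosh (sqrt c * t) * sqrt c) (at t)" unfolding S_def[abs_def]
    by (auto intro!: derivative_eq_intros)
  have "((\<lambda>s. G t / S t * ((S s - S t) / (s - t)) + (a + a') * C t * (t - s)) \<longlongrightarrow>
     G t / S t * (cosh (sqrt c * t) * sqrt c) + (a + a') * C t * (t - t)) (at_left t)"
    by (intro tendsto_intros tendsto_within_subset[OF dS[unfolded has_field_derivative_iff]]) auto
  then have "\<mu> \<le> G t / S t * (cosh (sqrt c * t) * sqrt c) + (a + a') * C t * (t - t)"
  proof (rule tendsto_lowerbound)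
    show "\<forall>\<^sub>F s in at_left t. \<mu> \<le> G t / S t * ((S s - S t) / (s - t)) + (a + a') * C t * (t - s)"
      unfolding eventually_at_left_field using step t(2) by (intro exI[of _ 0]) auto
  qed simp
  also have "\<dots> = k * G t" by (simp add: k_def S_def tanh_def)
  finally have "a * (m A' - k * F t A') \<le> a' * (m A - k * F t A)" by (simp add: \<mu>_def G_def algebra_simps)
  moreover have "(\<integral>y. \<omega> y * indicator D (flow t y) \<partial>\<rho>0) = m D - k * F t D" if D: "D \<in> sets borel" for D
  proof -
    have "(\<integral>y. \<omega> y * indicator D (flow t y) \<partial>\<rho>0) = (\<integral>y. speed t y * indicator D (flow t y) - k * (flow t y * indicator D (flow t y)) \<partial>\<rho>0)"
      by (simp add: \<omega>_def k_def algebra_simps)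
    then show ?thesis using integrable_indicator_flow[OF ispeed D] integrable_indicator_flow[OF flow_integrable(1)[OF t0] D] by (simp add: m_def F_def)
  qed
  ultimately show ?thesis by (simp add: a_def a'_def)
qed

lemma AE_not_in_if_integral_le:
  fixes u :: "real \<Rightarrow> real"
  assumes i: "integrable \<rho>0 u" and [measurable]: "B \<in> sets borel" and pos: "\<And>y. y \<in> B \<Longrightarrow> r < u y"
    and le: "(\<integral>y. u y * indicator B y \<partial>\<rho>0) \<le> r * (\<integral>y. indicator B y \<partial>\<rho>0)"
  shows "AE y in \<rho>0. y \<notin> B"
proof -
  have [measurable]: "u \<in> borel_measurable \<rho>0" using i by simp
  have iB: "integrable \<rho>0 (\<lambda>y. u y * indicator B y)"
    by (rule Bochner_Integration.integrable_bound[OF i]) (measurable, auto simp: indicator_def)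
  have i1: "integrable \<rho>0 (\<lambda>y. indicator B y :: real)"
    by (rule Bochner_Integration.integrable_bound[of _ "\<lambda>_. 1::real"]) (auto simp: indicator_def)
  have iw: "integrable \<rho>0 (\<lambda>y. u y * indicator B y - r * indicator B y)" using iB i1 by simp
  have nn: "0 \<le> u y * indicator B y - r * indicator B y" for y using pos[of y] by (auto simp: indicator_def)
  have "(\<integral>y. u y * indicator B y - r * indicator B y \<partial>\<rho>0) \<le> 0" using le iB i1 by simp
  moreover have "0 \<le> (\<integral>y. u y * indicator B y - r * indicator B y \<partial>\<rho>0)" by (rule Bochner_Integration.integral_nonneg[OF nn])
  ultimately have "(\<integral>y. u y * indicator B y - r * indicator B y \<partial>\<rho>0) = 0" by simp
  then have "AE y in \<rho>0. u y * indicator B y - r * indicator B y = 0"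
    using integral_nonneg_eq_0_iff_AE[OF iw AE_I2[OF nn]] by simp
  then show ?thesis
  proof eventually_elim
    case (elim y)
    then show ?case using pos[of y] by (auto simp: indicator_def split: if_splits)
  qed
qed

text \<open>If both sets had positive mass, \<open>w\<close> would have mean below r on the left one
  and above r on the right one, contrary to \<open>entropy_integrated\<close>.\<close>

lemma entropy_dichotomy:
  fixes t q r :: real
  assumes t: "good_time t" "0 < t"
  defines "w x \<equiv> velocity (x, t) - sqrt c / tanh (sqrt c * t) * x"
  shows "(AE x in law t. \<not> (x \<le> q \<and> w x < r)) \<or> (AE x in law t. \<not> (q < x \<and> r < w x))"
proof -
  have [measurable]: "w \<in> borel_measurable borel" unfolding w_def by measurable
  define A where "A = {x. x \<le> q \<and> w x < r}"
  define A' where "A' = {x. q < x \<and> r < w x}"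
  have [measurable]: "A \<in> sets borel" "A' \<in> sets borel" unfolding A_def A'_def by measurable
  define B where "B = flow t -` A"
  define B' where "B' = flow t -` A'"
  have fm: "flow t \<in> borel_measurable borel" by measurable
  have [measurable]: "B \<in> sets borel" "B' \<in> sets borel" 
    using measurable_sets[OF fm, of A] measurable_sets[OF fm, of A'] by (simp_all add: B_def B'_def)
  have law: "(AE x in law t. \<not> P x) \<longleftrightarrow> (AE y in \<rho>0. y \<notin> flow t -` {x. P x})" if "{x. P x} \<in> sets borel" for P
  proof -
    have "{x. \<not> P x} \<in> sets borel" using sets.compl_sets[OF that] by (simp add: Collect_neg_eq Compl_eq_Diff_UNIV)
    then show ?thesis unfolding law_def by (subst AE_distr_iff) auto
  qed
  define a where "a = (\<integral>y. indicator B y \<partial>\<rho>0 :: real)"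
  define a' where "a' = (\<integral>y. indicator B' y \<partial>\<rho>0 :: real)"
  have a0: "0 \<le> a" "0 \<le> a'" unfolding a_def a'_def by (auto intro!: Bochner_Integration.integral_nonneg)
  define \<omega> where "\<omega> y = speed t y - sqrt c / tanh (sqrt c * t) * flow t y" for y
  have \<omega>w: "\<omega> y = w (flow t y)" for y by (simp add: \<omega>_def w_def speed_def)
  have i: "integrable \<rho>0 \<omega>" unfolding \<omega>_def[abs_def]
    using velocity_projection(1)[OF t(1)] flow_integrable(1)[OF good_time_nonneg[OF t(1)]] by (simp add: speed_def[abs_def])
  have ni: "integrable \<rho>0 (\<lambda>y. - \<omega> y)" using i by simp
  have indB: "indicator A (flow t y) = (indicator B y :: real)" "indicator A' (flow t y) = (indicator B' y :: real)" for y
    by (auto simp: B_def B'_def indicator_def)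
  have main: "a * (\<integral>y. \<omega> y * indicator B' y \<partial>\<rho>0) \<le> a' * (\<integral>y. \<omega> y * indicator B y \<partial>\<rho>0)"
  proof -
    have lt: "x < x'" if "x \<in> A" "x' \<in> A'" for x x' using that by (simp add: A_def A'_def)
    have "A \<in> sets borel" "A' \<in> sets borel" by measurable
    from entropy_integrated[OF t this lt] show ?thesis
      unfolding \<omega>_def[symmetric] indB a_def[symmetric] a'_def[symmetric] by simp
  qed
  show ?thesis
  proof (rule ccontr)
    assume *: "\<not> ?thesis"
    then have n: "\<not> (AE y in \<rho>0. y \<notin> B)" "\<not> (AE y in \<rho>0. y \<notin> B')"
      using law[of "\<lambda>x. x \<le> q \<and> w x < r"] law[of "\<lambda>x. q < x \<and> r < w x"]
      by (simp_all add: A_def[symmetric] A'_def[symmetric] B_def B'_def)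
    have 1: "r * a' < (\<integral>y. \<omega> y * indicator B' y \<partial>\<rho>0)"
    proof (rule ccontr)
      assume "\<not> ?thesis"
      then have "AE y in \<rho>0. y \<notin> B'"
        by (intro AE_not_in_if_integral_le[OF i, of B' r]) (simp_all add: \<omega>w B'_def A'_def a'_def)
      then show False using n by simp
    qed
    have 2: "(\<integral>y. \<omega> y * indicator B y \<partial>\<rho>0) < r * a"
    proof (rule ccontr)
      assume "\<not> ?thesis"
      then have "AE y in \<rho>0. y \<notin> B"
        by (intro AE_not_in_if_integral_le[OF ni, of B "- r"]) (simp_all add: \<omega>w B_def A_def a_def)
      then show False using n by simp
    qed
    have "0 < a'"
    proof (rule ccontr)
      assume "\<not> 0 < a'"
      then have "a' = 0" using a0 by simp
      then have "AE y in \<rho>0. y \<notin> B'"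
        by (intro AE_not_in_if_integral_le[of "\<lambda>_. 1" B' 0]) (simp_all add: a'_def)
      then show False using n by simp
    qed
    have "a' * (\<integral>y. \<omega> y * indicator B y \<partial>\<rho>0) < a' * (r * a)" using 2 \<open>0 < a'\<close> by simp
    also have "\<dots> = a * (r * a')" by simp
    also have "\<dots> \<le> a * (\<integral>y. \<omega> y * indicator B' y \<partial>\<rho>0)" using 1 a0 by (intro mult_left_mono) auto
    finally show False using main by simp
  qed
qed

lemma entropy_inequality_law: "entropy_inequality c law velocity"
  unfolding entropy_inequality_def using AE_good_time
proof (eventually_elim, intro impI)
  fix t assume "0 \<le> t \<longrightarrow> good_time t" "0 < t"
  then have t: "good_time t" "0 < t" by auto
  define k where "k = sqrt c / tanh (sqrt c * t)"
  define w where "w x = velocity (x, t) - k * x" for x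
  define P where "P q r x \<longleftrightarrow> x \<le> q \<and> w x < r" for q r x
  define Q where "Q q r x \<longleftrightarrow> q < x \<and> r < w x" for q r x
  have dich: "(AE x in law t. \<not> P q r x) \<or> (AE x in law t. \<not> Q q r x)" for q r
    unfolding P_def Q_def w_def k_def by (rule entropy_dichotomy[OF t])
  \<comment> \<open>Which alternative holds depends on q and r. Recording the null alternatives lets
    the countably many null sets be merged into one; outside it \<open>w\<close> is nonincreasing,
    since a violation would be separated by rational q and r.\<close>
  define nP where "nP q r \<longleftrightarrow> (AE x in law t. \<not> P q r x)" for q r
  define nQ where "nQ q r \<longleftrightarrow> (AE x in law t. \<not> Q q r x)" for q r
  have "AE x in law t. \<forall>q\<in>\<rat>. \<forall>r\<in>\<rat>. (nP q r \<longrightarrow> \<not> P q r x) \<and> (nQ q r \<longrightarrow> \<not> Q q r x)"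
    by (intro AE_ball_countable' countable_rat AE_conjI AE_impI) (simp_all only: nP_def nQ_def)
  then obtain N where N: "N \<in> null_sets (law t)"
    "\<And>x q r. x \<notin> N \<Longrightarrow> q \<in> \<rat> \<Longrightarrow> r \<in> \<rat> \<Longrightarrow> (nP q r \<longrightarrow> \<not> P q r x) \<and> (nQ q r \<longrightarrow> \<not> Q q r x)"
    unfolding eventually_ae_filter by (auto simp: law_def)
  have mono: "w y \<le> w x" if xy: "x \<notin> N" "y \<notin> N" "x < y" for x y
  proof (rule ccontr)
    assume "\<not> w y \<le> w x"
    then obtain r where r: "r \<in> \<rat>" "w x < r" "r < w y" using Rats_dense_in_real[of "w x" "w y"] by auto
    obtain q where q: "q \<in> \<rat>" "x < q" "q < y" using Rats_dense_in_real[OF xy(3)] by auto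
    have "P q r x" "Q q r y" using q r by (auto simp: P_def Q_def)
    then show False using dich[of q r, folded nP_def nQ_def] N(2)[OF xy(1) q(1) r(1)] N(2)[OF xy(2) q(1) r(1)] by blast
  qed
  have le: "(velocity (y, t) - velocity (x, t)) * (y - x) \<le> k * (y - x)\<^sup>2" if "x \<notin> N" "y \<notin> N" "x < y" for x y
  proof -
    have "velocity (y, t) - velocity (x, t) \<le> k * (y - x)" using mono[OF that] by (simp add: w_def algebra_simps)
    then have "(velocity (y, t) - velocity (x, t)) * (y - x) \<le> (k * (y - x)) * (y - x)" using that by (intro mult_right_mono) auto
    then show ?thesis by (simp add: power2_eq_square mult.assoc)
  qed
  have "(velocity (x, t) - velocity (y, t)) * (x - y) \<le> k * (x - y)\<^sup>2" if "x \<notin> N" "y \<notin> N" for x y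
  proof -
    consider "x < y" | "x = y" | "y < x" by linarith
    then show ?thesis
    proof cases
      case 1
      have "(velocity (x, t) - velocity (y, t)) * (x - y) = (velocity (y, t) - velocity (x, t)) * (y - x)" by (simp add: algebra_simps)
      then show ?thesis using le[OF that 1] by (simp add: power2_commute)
    qed (use le[OF that(2,1)] in simp_all)
  qed
  then show "\<exists>N\<in>null_sets (law t). \<forall>x y. x \<notin> N \<and> y \<notin> N \<longrightarrow>
      (velocity (x, t) - velocity (y, t)) * (x - y) \<le> sqrt c / tanh (sqrt c * t) * (x - y)\<^sup>2"
    using N(1) unfolding k_def by blast
qed

end

section \<open>The energy inequality\<close>

locale euler_potential = euler_data +
  fixes W :: "real \<Rightarrow> real"
  assumes W_deriv: "\<And>x. (W has_real_derivative f x) (at x)" and W_even: "\<And>x. W (- x) = W x"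
begin

lemma f_odd: "f (- x) = - f x"
proof -
  have "((\<lambda>x. W (- x)) has_real_derivative f (- x) * - 1) (at x)"
    by (rule DERIV_chain2[OF W_deriv]) (auto intro!: derivative_eq_intros)
  then have "(W has_real_derivative f (- x) * - 1) (at x)" by (simp add: W_even)
  from DERIV_unique[OF this W_deriv] show ?thesis by simp
qed

lemma W_continuous: "continuous_on UNIV W"
  by (rule DERIV_continuous_on) (rule has_field_derivative_at_within[OF W_deriv])

lemma W_measurable [measurable]: "W \<in> borel_measurable borel"
  using W_continuous by (rule borel_measurable_continuous_onI)

lemma W_increment: "\<exists>\<xi>. min a b \<le> \<xi> \<and> \<xi> \<le> max a b \<and> W b - W a = f \<xi> * (b - a)"
proof -
  consider "a < b" | "a = b" | "b < a" by linarith
  then show ?thesis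
  proof cases
    case 1
    then obtain z where "a < z" "z < b" "W b - W a = (b - a) * f z" using MVT2[OF 1 W_deriv] by auto
    then show ?thesis by (intro exI[of _ z]) (auto simp: algebra_simps)
  next
    case 3
    then obtain z where "b < z" "z < a" "W a - W b = (a - b) * f z" using MVT2[OF 3 W_deriv] by auto
    then show ?thesis by (intro exI[of _ z]) (auto simp: algebra_simps)
  qed auto
qed

text \<open>Semiconvexity, read as an upper bound with the slope at the final point b. The mean
  value theorem together with the one-sided bound gives c rather than c / 2; any multiple of (b -
  a)^2 serves.\<close>

lemma W_le_tangent: "W b - W a \<le> f b * (b - a) + c * (b - a)\<^sup>2"
proof -
  obtain \<xi> where \<xi>: "min a b \<le> \<xi>" "\<xi> \<le> max a b" "W b - W a = f \<xi> * (b - a)" using W_increment by blast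
  have "(f \<xi> - f b) * (b - a) \<le> c * (b - a) * (b - a)"
  proof (cases "a \<le> b")
    case True
    have "f \<xi> - f b \<le> c * (b - \<xi>)" using \<xi> True by (intro f_one_sided) auto
    also have "\<dots> \<le> c * (b - a)" using \<xi> True c_gt_0 by (intro mult_left_mono) auto
    finally show ?thesis using True by (intro mult_right_mono) auto
  next
    case False
    have "f b - f \<xi> \<le> c * (\<xi> - b)" using \<xi> False by (intro f_one_sided) auto
    also have "\<dots> \<le> c * (a - b)" using \<xi> False c_gt_0 by (intro mult_left_mono) auto
    finally have "(f b - f \<xi>) * (a - b) \<le> c * (a - b) * (a - b)" using False by (intro mult_right_mono) auto
    then show ?thesis by (simp add: algebra_simps)
  qed
  then show ?thesis using \<xi>(3) by (simp add: algebra_simps power2_eq_square)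
qed

lemma W_growth: "\<bar>W x\<bar> \<le> (\<bar>W 0\<bar> + 2 * K) * (1 + x\<^sup>2)"
proof -
  obtain \<xi> where \<xi>: "min 0 x \<le> \<xi>" "\<xi> \<le> max 0 x" "W x - W 0 = f \<xi> * (x - 0)" using W_increment by blast
  have "\<bar>\<xi>\<bar> \<le> \<bar>x\<bar>" using \<xi>(1,2) by auto
  then have "\<bar>f \<xi>\<bar> \<le> K * (1 + \<bar>x\<bar>)"
    using f_growth[of \<xi>] mult_left_mono[OF _ K_nonneg, of "1 + \<bar>\<xi>\<bar>" "1 + \<bar>x\<bar>"] by simp
  then have "\<bar>f \<xi>\<bar> * \<bar>x\<bar> \<le> K * (1 + \<bar>x\<bar>) * \<bar>x\<bar>" by (intro mult_right_mono) auto
  also have "\<dots> \<le> K * (2 * (1 + x\<^sup>2))"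
  proof -
    have "\<bar>x\<bar> \<le> 1 + x\<^sup>2" using sum_squares_bound[of "\<bar>x\<bar>" 1] by simp
    then have "(1 + \<bar>x\<bar>) * \<bar>x\<bar> \<le> 2 * (1 + x\<^sup>2)" by (simp add: distrib_right power2_eq_square)
    then show ?thesis unfolding mult.assoc using K_nonneg by (rule mult_left_mono)
  qed
  finally have "\<bar>W x - W 0\<bar> \<le> 2 * K * (1 + x\<^sup>2)" using \<xi>(3) by (simp add: abs_mult algebra_simps)
  moreover have "\<bar>W 0\<bar> \<le> \<bar>W 0\<bar> * (1 + x\<^sup>2)" by (simp add: mult_le_cancel_left1)
  ultimately show ?thesis by (simp add: distrib_right)
qed

lemma pair_integrable_affine:
  fixes g h :: "real \<Rightarrow> real"
  assumes "integrable \<rho>0 g" "integrable \<rho>0 h"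
  shows "integrable (\<rho>0 \<Otimes>\<^sub>M \<rho>0) (\<lambda>p. g (fst p) + h (snd p))"
    "(\<integral>p. g (fst p) + h (snd p) \<partial>(\<rho>0 \<Otimes>\<^sub>M \<rho>0)) = (\<integral>y. g y \<partial>\<rho>0) + (\<integral>y. h y \<partial>\<rho>0)"
  using pair_integrable_components[OF assms(1)] pair_integrable_components[OF assms(2)] by simp_all

lemma W_flow_integrable:
  assumes t: "0 \<le> t"
  shows "integrable (\<rho>0 \<Otimes>\<^sub>M \<rho>0) (\<lambda>p. W (flow t (fst p) - flow t (snd p)))"
proof -
  define A where "A = \<bar>W 0\<bar> + 2 * K"
  have A: "0 \<le> A" using K_nonneg by (simp add: A_def)
  show ?thesis
  proof (rule Bochner_Integration.integrable_bound)
    have i: "integrable \<rho>0 (\<lambda>y. A + A * (2 * (flow t y)\<^sup>2))" "integrable \<rho>0 (\<lambda>y. A * (2 * (flow t y)\<^sup>2))"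
      using flow_integrable(2)[OF t] by auto
    show "integrable (\<rho>0 \<Otimes>\<^sub>M \<rho>0) (\<lambda>p. (A + A * (2 * (flow t (fst p))\<^sup>2)) + A * (2 * (flow t (snd p))\<^sup>2))"
      by (rule pair_integrable_affine[OF i])
    show "AE p in \<rho>0 \<Otimes>\<^sub>M \<rho>0. norm (W (flow t (fst p) - flow t (snd p))) \<le>
        norm ((A + A * (2 * (flow t (fst p))\<^sup>2)) + A * (2 * (flow t (snd p))\<^sup>2))"
    proof (rule AE_I2)
      fix p
      let ?a = "flow t (fst p)" and ?b = "flow t (snd p)"
      have "(?a - ?b)\<^sup>2 \<le> 2 * ?a\<^sup>2 + 2 * ?b\<^sup>2"
        using power2_sum_le[of ?a "- ?b"] by simp
      then have "A * (1 + (?a - ?b)\<^sup>2) \<le> A * (1 + (2 * ?a\<^sup>2 + 2 * ?b\<^sup>2))" using A by (intro mult_left_mono) auto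
      then have "\<bar>W (?a - ?b)\<bar> \<le> (A + A * (2 * ?a\<^sup>2)) + A * (2 * ?b\<^sup>2)"
        using W_growth[of "?a - ?b"] unfolding A_def[symmetric] by (simp add: distrib_left)
      then show "norm (W (?a - ?b)) \<le> norm ((A + A * (2 * ?a\<^sup>2)) + A * (2 * ?b\<^sup>2))" by simp
    qed
  qed measurable
qed

lemma energy_flow:
  "energy W law velocity t = (\<integral>y. (speed t y)\<^sup>2 \<partial>\<rho>0) / 2 + (\<integral>p. W (flow t (fst p) - flow t (snd p)) \<partial>(\<rho>0 \<Otimes>\<^sub>M \<rho>0)) / 2"
proof -
  have "(\<integral>x. 1/2 * (velocity (x, t))\<^sup>2 \<partial>law t) = (\<integral>y. 1/2 * (speed t y)\<^sup>2 \<partial>\<rho>0)"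
    unfolding speed_def by (rule law_integral) measurable
  moreover have "(\<integral>z. 1/2 * W (fst z - snd z) \<partial>(law t \<Otimes>\<^sub>M law t)) = (\<integral>p. 1/2 * W (flow t (fst p) - flow t (snd p)) \<partial>(\<rho>0 \<Otimes>\<^sub>M \<rho>0))"
    unfolding law_pair by (subst integral_distr) (auto simp: case_prod_beta)
  ultimately show ?thesis by (simp add: energy_def)
qed

lemma energy_integrable:
  assumes "good_time t"
  shows "integrable (law t) (\<lambda>x. (velocity (x, t))\<^sup>2)" "integrable (law t \<Otimes>\<^sub>M law t) (\<lambda>z. W (fst z - snd z))"
proof -
  show "integrable (law t) (\<lambda>x. (velocity (x, t))\<^sup>2)"
    by (subst law_integrable) (use speed_L2(1)[OF assms] in \<open>simp_all add: speed_def\<close>)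
  show "integrable (law t \<Otimes>\<^sub>M law t) (\<lambda>z. W (fst z - snd z))"
    unfolding law_pair
    by (subst integrable_distr_eq) (use W_flow_integrable[OF good_time_nonneg[OF assms]] in \<open>simp_all add: case_prod_beta\<close>)
qed

text \<open>Since f is odd, exchanging the two labels turns the term with
  \<open>\<delta> (snd p)\<close> into the one with \<open>\<delta> (fst p)\<close>, whose inner
  integral is the drag.\<close>

lemma interaction_symmetric:
  assumes t: "0 \<le> t" and [measurable]: "\<delta> \<in> borel_measurable borel" and \<delta>: "integrable \<rho>0 (\<lambda>y. (\<delta> y)\<^sup>2)"
  shows "integrable (\<rho>0 \<Otimes>\<^sub>M \<rho>0) (\<lambda>p. f (flow t (fst p) - flow t (snd p)) * (\<delta> (fst p) - \<delta> (snd p)))"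
    "(\<integral>p. f (flow t (fst p) - flow t (snd p)) * (\<delta> (fst p) - \<delta> (snd p)) \<partial>(\<rho>0 \<Otimes>\<^sub>M \<rho>0)) = 2 * (\<integral>y. drag t y * \<delta> y \<partial>\<rho>0)"
proof -
  interpret P: pair_sigma_finite \<rho>0 \<rho>0 ..
  define k where "k p = f (flow t (fst p) - flow t (snd p)) * \<delta> (fst p)" for p
  obtain C where C: "\<And>T. 0 < C T" "\<And>r T y z. 0 \<le> r \<Longrightarrow> r \<le> T \<Longrightarrow> \<bar>f (flow r y - flow r z)\<bar> \<le> C T * (1 + \<bar>y\<bar>) + C T * \<bar>z\<bar>"
    by (rule drag_limit) blast
  have k: "integrable (\<rho>0 \<Otimes>\<^sub>M \<rho>0) k"
  proof (rule Bochner_Integration.integrable_bound)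
    have i: "integrable \<rho>0 (\<lambda>y. 2 * (C t + C t * \<bar>y\<bar>)\<^sup>2 + (\<delta> y)\<^sup>2)" "integrable \<rho>0 (\<lambda>y. 2 * (0 + C t * \<bar>y\<bar>)\<^sup>2)"
      using integrable_affine_sq[of "C t" "C t"] integrable_affine_sq[of 0 "C t"] \<delta> by auto
    show "integrable (\<rho>0 \<Otimes>\<^sub>M \<rho>0) (\<lambda>p. (2 * (C t + C t * \<bar>fst p\<bar>)\<^sup>2 + (\<delta> (fst p))\<^sup>2) + 2 * (0 + C t * \<bar>snd p\<bar>)\<^sup>2)"
      by (rule pair_integrable_affine[OF i])
    show "k \<in> borel_measurable (\<rho>0 \<Otimes>\<^sub>M \<rho>0)" unfolding k_def[abs_def] by measurable
    show "AE p in \<rho>0 \<Otimes>\<^sub>M \<rho>0. norm (k p) \<le> norm ((2 * (C t + C t * \<bar>fst p\<bar>)\<^sup>2 + (\<delta> (fst p))\<^sup>2) + 2 * (0 + C t * \<bar>snd p\<bar>)\<^sup>2)"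
    proof (rule AE_I2)
      fix p :: "real \<times> real"
      let ?a = "C t + C t * \<bar>fst p\<bar>" and ?b = "C t * \<bar>snd p\<bar>" and ?f = "f (flow t (fst p) - flow t (snd p))"
      have "\<bar>?f\<bar> \<le> ?a + ?b" using C(2)[OF t order_refl, of "fst p" "snd p"] by (simp add: distrib_left)
      then have "?f\<^sup>2 \<le> (?a + ?b)\<^sup>2" using power_mono[of "\<bar>?f\<bar>" "?a + ?b" 2] by simp
      also have "\<dots> \<le> 2 * ?a\<^sup>2 + 2 * ?b\<^sup>2" by (rule power2_sum_le)
      finally have "?f\<^sup>2 \<le> 2 * ?a\<^sup>2 + 2 * ?b\<^sup>2" .
      moreover have "\<bar>k p\<bar> \<le> ?f\<^sup>2 + (\<delta> (fst p))\<^sup>2"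
        using sum_squares_bound[of "\<bar>?f\<bar>" "\<bar>\<delta> (fst p)\<bar>"] abs_ge_zero[of "k p"]
        unfolding k_def abs_mult power2_abs by linarith
      ultimately show "norm (k p) \<le> norm ((2 * (C t + C t * \<bar>fst p\<bar>)\<^sup>2 + (\<delta> (fst p))\<^sup>2) + 2 * (0 + C t * \<bar>snd p\<bar>)\<^sup>2)" by simp
    qed
  qed
  have swap: "k (snd p, fst p) = - (f (flow t (fst p) - flow t (snd p)) * \<delta> (snd p))" for p
    using f_odd[of "flow t (fst p) - flow t (snd p)"] by (simp add: k_def)
  have e: "f (flow t (fst p) - flow t (snd p)) * (\<delta> (fst p) - \<delta> (snd p)) = k p + k (snd p, fst p)" for p
    unfolding swap by (simp add: k_def right_diff_distrib)
  have k': "integrable (\<rho>0 \<Otimes>\<^sub>M \<rho>0) (\<lambda>p. k (snd p, fst p))" using P.integrable_product_swap[OF k] unfolding case_prod_beta .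
  show "integrable (\<rho>0 \<Otimes>\<^sub>M \<rho>0) (\<lambda>p. f (flow t (fst p) - flow t (snd p)) * (\<delta> (fst p) - \<delta> (snd p)))"
    unfolding e using k k' by (rule Bochner_Integration.integrable_add)
  have [measurable]: "k \<in> borel_measurable (\<rho>0 \<Otimes>\<^sub>M \<rho>0)" using k by simp
  have "(\<integral>p. k p \<partial>(\<rho>0 \<Otimes>\<^sub>M \<rho>0)) = (\<integral>y. (\<integral>z. k (y, z) \<partial>\<rho>0) \<partial>\<rho>0)" by (rule P.integral_fst'[OF k, symmetric])
  also have "\<dots> = (\<integral>y. drag t y * \<delta> y \<partial>\<rho>0)" by (simp add: k_def drag_def)
  finally have "(\<integral>p. k p \<partial>(\<rho>0 \<Otimes>\<^sub>M \<rho>0)) = (\<integral>y. drag t y * \<delta> y \<partial>\<rho>0)" .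
  moreover have "(\<integral>p. k (snd p, fst p) \<partial>(\<rho>0 \<Otimes>\<^sub>M \<rho>0)) = (\<integral>p. k p \<partial>(\<rho>0 \<Otimes>\<^sub>M \<rho>0))"
    using P.integral_product_swap[of k] unfolding case_prod_beta by simp
  ultimately show "(\<integral>p. f (flow t (fst p) - flow t (snd p)) * (\<delta> (fst p) - \<delta> (snd p)) \<partial>(\<rho>0 \<Otimes>\<^sub>M \<rho>0)) = 2 * (\<integral>y. drag t y * \<delta> y \<partial>\<rho>0)"
    unfolding e using k k' by simp
qed

section \<open>Increments of potential and kinetic energy\<close>

text \<open>The slope is taken at the later time t, because only functions of the later position may
  be tested against the increment of the flow. The linear term becomes twice the drag against that
  increment, which \<open>flow_backward_difference\<close> evaluates.\<close>

lemma potential_increment: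
  obtains C where "\<And>T. 0 < C T"
    "\<And>s t T. 0 \<le> s \<Longrightarrow> s \<le> t \<Longrightarrow> t \<le> T \<Longrightarrow> good_time t \<Longrightarrow>
      (\<integral>p. W (flow t (fst p) - flow t (snd p)) \<partial>(\<rho>0 \<Otimes>\<^sub>M \<rho>0)) - (\<integral>p. W (flow s (fst p) - flow s (snd p)) \<partial>(\<rho>0 \<Otimes>\<^sub>M \<rho>0))
        \<le> 2 * (t - s) * (\<integral>y. speed t y * drag t y \<partial>\<rho>0) + C T * (t - s)\<^sup>2"
proof -
  obtain Q where Q: "\<And>T. 0 < Q T"
    "\<And>s t T. 0 \<le> s \<Longrightarrow> s \<le> t \<Longrightarrow> t \<le> T \<Longrightarrow> (\<integral>y. (flow t y - flow s y)\<^sup>2 \<partial>\<rho>0) \<le> Q T * (t - s)\<^sup>2"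
    by (rule flow_increment_L2) blast
  obtain D where D: "\<And>T. 0 < D T"
    "\<And>s t T g b. \<lbrakk>0 \<le> s; s \<le> t; t \<le> T; good_time t; g \<in> borel_measurable borel; \<And>y. \<bar>g (flow t y)\<bar> \<le> b * (1 + \<bar>y\<bar>)\<rbrakk> \<Longrightarrow>
      \<bar>(\<integral>y. (flow t y - flow s y) * g (flow t y) \<partial>\<rho>0) - (t - s) * (\<integral>y. speed t y * g (flow t y) \<partial>\<rho>0)\<bar> \<le> b * D T * (t - s)\<^sup>2"
    by (rule flow_backward_difference) blast
  obtain B where B: "\<And>T. 0 < B T" "\<And>t T y. 0 \<le> t \<Longrightarrow> t \<le> T \<Longrightarrow> \<bar>drag t y\<bar> \<le> B T * (1 + \<bar>y\<bar>)"
    by (rule growth_bound) blast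
  show ?thesis
  \<comment> \<open>The first part comes from the linear term. The second is c (\<delta> y -
    \<delta> z)^2 \<le> 2 c (\<delta> y)^2 + 2 c (\<delta> z)^2, integrated over pairs.\<close>
  proof (rule that[of "\<lambda>T. 2 * (B T * D T) + 4 * c * Q T"])
    show "0 < 2 * (B T * D T) + 4 * c * Q T" for T using B(1)[of T] D(1)[of T] Q(1)[of T] c_gt_0 by (intro add_pos_pos mult_pos_pos) auto
    fix s t T :: real assume st: "0 \<le> s" "s \<le> t" "t \<le> T" and t: "good_time t"
    note t0 = good_time_nonneg[OF t]
    define \<delta> where "\<delta> y = flow t y - flow s y" for y
    have [measurable]: "\<delta> \<in> borel_measurable borel" unfolding \<delta>_def[abs_def] by measurable
    have \<delta>2: "integrable \<rho>0 (\<lambda>y. (\<delta> y)\<^sup>2)" using flow_diff_sq_integrable[OF st(1,2)] by (simp add: \<delta>_def)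
    let ?W = "\<lambda>r p. W (flow r (fst p) - flow r (snd p))"
    let ?F = "\<lambda>p. f (flow t (fst p) - flow t (snd p)) * (\<delta> (fst p) - \<delta> (snd p))"
    have i\<delta>: "integrable \<rho>0 (\<lambda>y. c * (2 * (\<delta> y)\<^sup>2))" using \<delta>2 by auto
    note S = pair_integrable_affine[OF i\<delta> i\<delta>] and F = interaction_symmetric[OF t0 _ \<delta>2]
    have iF: "integrable (\<rho>0 \<Otimes>\<^sub>M \<rho>0) ?F" by (rule F(1)) measurable
    have "(\<integral>p. ?W t p - ?W s p \<partial>(\<rho>0 \<Otimes>\<^sub>M \<rho>0)) \<le> (\<integral>p. ?F p + (c * (2 * (\<delta> (fst p))\<^sup>2) + c * (2 * (\<delta> (snd p))\<^sup>2)) \<partial>(\<rho>0 \<Otimes>\<^sub>M \<rho>0))"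
    proof (rule integral_mono)
      show "integrable (\<rho>0 \<Otimes>\<^sub>M \<rho>0) (\<lambda>p. ?W t p - ?W s p)" using W_flow_integrable[OF t0] W_flow_integrable[OF st(1)] by simp
      show "integrable (\<rho>0 \<Otimes>\<^sub>M \<rho>0) (\<lambda>p. ?F p + (c * (2 * (\<delta> (fst p))\<^sup>2) + c * (2 * (\<delta> (snd p))\<^sup>2)))"
        using iF S(1) by (rule Bochner_Integration.integrable_add)
      fix p
      let ?u = "\<delta> (fst p)" and ?v = "\<delta> (snd p)"
      have d: "(flow t (fst p) - flow t (snd p)) - (flow s (fst p) - flow s (snd p)) = ?u - ?v" by (simp add: \<delta>_def)
      have "(?u - ?v)\<^sup>2 \<le> 2 * ?u\<^sup>2 + 2 * ?v\<^sup>2" using power2_sum_le[of ?u "- ?v"] by simp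
      then have "c * (?u - ?v)\<^sup>2 \<le> c * (2 * ?u\<^sup>2 + 2 * ?v\<^sup>2)" using c_gt_0 by (intro mult_left_mono) auto
      then show "?W t p - ?W s p \<le> ?F p + (c * (2 * ?u\<^sup>2) + c * (2 * ?v\<^sup>2))"
        using W_le_tangent[of "flow t (fst p) - flow t (snd p)" "flow s (fst p) - flow s (snd p)"] unfolding d distrib_left by linarith
    qed
    also have "\<dots> = 2 * (\<integral>y. drag t y * \<delta> y \<partial>\<rho>0) + 4 * c * (\<integral>y. (\<delta> y)\<^sup>2 \<partial>\<rho>0)"
      using iF S F(2) by simp
    also have "\<dots> \<le> 2 * ((t - s) * (\<integral>y. speed t y * drag t y \<partial>\<rho>0) + B T * D T * (t - s)\<^sup>2) + 4 * c * (Q T * (t - s)\<^sup>2)"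
    proof (intro add_mono mult_left_mono)
      \<comment> \<open>The drag is written as a convolution evaluated at the flow, which exhibits
        it as a function of the position.\<close>
      have "\<bar>(\<integral>y. \<delta> y * conv_measure f (law t) (flow t y) \<partial>\<rho>0) - (t - s) * (\<integral>y. speed t y * conv_measure f (law t) (flow t y) \<partial>\<rho>0)\<bar> \<le> B T * D T * (t - s)\<^sup>2"
        unfolding \<delta>_def by (rule D(2)[OF st t]) (use B(2)[OF t0 st(3)] in \<open>simp_all add: conv_measure_flow\<close>)
      then show "(\<integral>y. drag t y * \<delta> y \<partial>\<rho>0) \<le> (t - s) * (\<integral>y. speed t y * drag t y \<partial>\<rho>0) + B T * D T * (t - s)\<^sup>2"
        by (simp add: conv_measure_flow mult.commute[of "drag t _"] abs_le_iff)
      show "(\<integral>y. (\<delta> y)\<^sup>2 \<partial>\<rho>0) \<le> Q T * (t - s)\<^sup>2" unfolding \<delta>_def by (rule Q(2)[OF st])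
    qed (use c_gt_0 in auto)
    also have "\<dots> = 2 * (t - s) * (\<integral>y. speed t y * drag t y \<partial>\<rho>0) + (2 * (B T * D T) + 4 * c * Q T) * (t - s)\<^sup>2"
      by (simp add: algebra_simps)
    finally show "(\<integral>p. ?W t p \<partial>(\<rho>0 \<Otimes>\<^sub>M \<rho>0)) - (\<integral>p. ?W s p \<partial>(\<rho>0 \<Otimes>\<^sub>M \<rho>0)) \<le>
      2 * (t - s) * (\<integral>y. speed t y * drag t y \<partial>\<rho>0) + (2 * (B T * D T) + 4 * c * Q T) * (t - s)\<^sup>2"
      using W_flow_integrable[OF t0] W_flow_integrable[OF st(1)] by simp
  qed
qed

text \<open>By convexity the increment is at most twice the integral of speed t times (speed t -
  speed s). As speed t is a function of the later position, both speeds may be replaced by impulses,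
  whose difference is minus the integrated drag.\<close>

lemma kinetic_increment:
  assumes s: "good_time s" and t: "good_time t" and st: "s \<le> t"
  shows "(\<integral>y. (speed t y)\<^sup>2 \<partial>\<rho>0) - (\<integral>y. (speed s y)\<^sup>2 \<partial>\<rho>0) \<le> - 2 * (\<integral>y. (LBINT r:{s..<t}. drag r y) * speed t y \<partial>\<rho>0)"
proof -
  note s0 = good_time_nonneg[OF s] and t0 = good_time_nonneg[OF t]
  note tt = speed_L2(1)[OF t] and ss = speed_L2(1)[OF s]
  have prod: "integrable \<rho>0 (\<lambda>y. speed s y * speed t y)" "integrable \<rho>0 (\<lambda>y. impulse s y * speed t y)" "integrable \<rho>0 (\<lambda>y. impulse t y * speed t y)"
    by (intro integrable_product_sq tt ss impulse_integrable(2) s0 t0; measurable)+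
  have p: "(\<integral>y. (impulse r y - speed r y) * speed t y \<partial>\<rho>0) = 0" if "good_time r" "r \<le> t" for r
    using speed_projection[OF that, of "\<lambda>x. velocity (x, t)"] tt by (simp add: speed_def)
  have "(\<integral>y. (speed t y)\<^sup>2 \<partial>\<rho>0) = (\<integral>y. impulse t y * speed t y \<partial>\<rho>0)"
    using p[OF t order_refl] prod(3) tt by (simp add: left_diff_distrib power2_eq_square)
  moreover have "(\<integral>y. speed s y * speed t y \<partial>\<rho>0) = (\<integral>y. impulse s y * speed t y \<partial>\<rho>0)"
    using p[OF s st] prod by (simp add: left_diff_distrib)
  moreover have "(\<integral>y. (LBINT r:{s..<t}. drag r y) * speed t y \<partial>\<rho>0) = (\<integral>y. impulse s y * speed t y \<partial>\<rho>0) - (\<integral>y. impulse t y * speed t y \<partial>\<rho>0)"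
  proof -
    have "(LBINT r:{s..<t}. drag r y) = impulse s y - impulse t y" for y using impulse_diff(1)[OF s0 st, of y] by simp
    then show ?thesis using prod by (simp add: left_diff_distrib)
  qed
  moreover have "0 \<le> (\<integral>y. (speed t y)\<^sup>2 + (speed s y)\<^sup>2 - 2 * (speed s y * speed t y) \<partial>\<rho>0)"
  proof (rule Bochner_Integration.integral_nonneg)
    show "0 \<le> (speed t y)\<^sup>2 + (speed s y)\<^sup>2 - 2 * (speed s y * speed t y)" for y
      using sum_squares_bound[of "speed s y" "speed t y"] by linarith
  qed
  then have "0 \<le> (\<integral>y. (speed t y)\<^sup>2 \<partial>\<rho>0) + (\<integral>y. (speed s y)\<^sup>2 \<partial>\<rho>0) - 2 * (\<integral>y. speed s y * speed t y \<partial>\<rho>0)"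
    using tt ss prod by simp
  ultimately show ?thesis by linarith
qed

lemma drag_tendsto:
  assumes u: "u \<longlonglongrightarrow> t" and b: "\<And>n. 0 \<le> u n" "\<And>n. u n \<le> T"
  shows "(\<lambda>n. drag (u n) y) \<longlonglongrightarrow> drag t y"
proof -
  obtain C where C: "\<And>r T y z. 0 \<le> r \<Longrightarrow> r \<le> T \<Longrightarrow> \<bar>f (flow r y - flow r z)\<bar> \<le> C T * (1 + \<bar>y\<bar>) + C T * \<bar>z\<bar>"
    by (rule drag_limit) blast
  show ?thesis unfolding drag_def
  proof (rule integral_dominated_convergence[where w="\<lambda>z. C T * (1 + \<bar>y\<bar>) + C T * \<bar>z\<bar>"])
    show "integrable \<rho>0 (\<lambda>z. C T * (1 + \<bar>y\<bar>) + C T * \<bar>z\<bar>)" by (rule integrable_affine)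
    show "AE z in \<rho>0. (\<lambda>n. f (flow (u n) y - flow (u n) z)) \<longlonglongrightarrow> f (flow t y - flow t z)"
    proof (rule AE_I2)
      fix z
      have fl: "(\<lambda>n. flow (u n) x) \<longlonglongrightarrow> flow t x" for x
        by (rule continuous_on_tendsto_compose[OF flow_continuous u]) auto
      show "(\<lambda>n. f (flow (u n) y - flow (u n) z)) \<longlonglongrightarrow> f (flow t y - flow t z)"
        by (rule continuous_on_tendsto_compose[OF f_cont tendsto_diff[OF fl fl]]) auto
    qed
    show "AE z in \<rho>0. norm (f (flow (u n) y - flow (u n) z)) \<le> C T * (1 + \<bar>y\<bar>) + C T * \<bar>z\<bar>" for n
      using C[OF b] by simp
  qed measurable
qed

text \<open>The squared L2 distance of the drags at two times is continuous on a compact square,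
  hence uniformly continuous, and it vanishes on the diagonal.\<close>

lemma drag_L2_uniform:
  assumes \<epsilon>: "0 < \<epsilon>"
  shows "\<exists>\<delta>>0. \<forall>r t. 0 \<le> r \<and> r \<le> t \<and> t \<le> T \<and> t - r < \<delta> \<longrightarrow> (\<integral>y. (drag t y - drag r y)\<^sup>2 \<partial>\<rho>0) < \<epsilon>"
proof -
  obtain B where B: "\<And>T. 0 < B T" "\<And>t T y. 0 \<le> t \<Longrightarrow> t \<le> T \<Longrightarrow> \<bar>drag t y\<bar> \<le> B T * (1 + \<bar>y\<bar>)"
    by (rule growth_bound) blast
  define \<Phi> where "\<Phi> p = (\<integral>y. (drag (fst p) y - drag (snd p) y)\<^sup>2 \<partial>\<rho>0)" for p
  have "continuous_on ({0..T} \<times> {0..T}) \<Phi>"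
    unfolding continuous_on_sequentially
  proof (intro allI ballI impI)
    fix x :: "nat \<Rightarrow> real \<times> real" and a assume "a \<in> {0..T} \<times> {0..T}" and x: "(\<forall>n. x n \<in> {0..T} \<times> {0..T}) \<and> x \<longlonglongrightarrow> a"
    have b: "0 \<le> fst (x n)" "fst (x n) \<le> T" "0 \<le> snd (x n)" "snd (x n) \<le> T" for n using x by (auto simp: mem_Times_iff)
    show "(\<Phi> \<circ> x) \<longlonglongrightarrow> \<Phi> a"
      unfolding comp_def \<Phi>_def
    proof (rule integral_dominated_convergence[where w="\<lambda>y. (2 * B T + 2 * B T * \<bar>y\<bar>)\<^sup>2"])
      show "integrable \<rho>0 (\<lambda>y. (2 * B T + 2 * B T * \<bar>y\<bar>)\<^sup>2)" by (rule integrable_affine_sq)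
      show "AE y in \<rho>0. (\<lambda>n. (drag (fst (x n)) y - drag (snd (x n)) y)\<^sup>2) \<longlonglongrightarrow> (drag (fst a) y - drag (snd a) y)\<^sup>2"
      proof (rule AE_I2)
        fix y
        have "(\<lambda>n. fst (x n)) \<longlonglongrightarrow> fst a" "(\<lambda>n. snd (x n)) \<longlonglongrightarrow> snd a" using x by (auto intro: tendsto_intros)
        then show "(\<lambda>n. (drag (fst (x n)) y - drag (snd (x n)) y)\<^sup>2) \<longlonglongrightarrow> (drag (fst a) y - drag (snd a) y)\<^sup>2"
          by (intro tendsto_power tendsto_diff drag_tendsto[where T=T] b)
      qed
      show "AE y in \<rho>0. norm ((drag (fst (x n)) y - drag (snd (x n)) y)\<^sup>2) \<le> (2 * B T + 2 * B T * \<bar>y\<bar>)\<^sup>2" for n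
      proof (rule AE_I2)
        fix y
        have "\<bar>drag (fst (x n)) y - drag (snd (x n)) y\<bar> \<le> 2 * B T + 2 * B T * \<bar>y\<bar>"
          using B(2)[OF b(1,2), of n y] B(2)[OF b(3,4), of n y] unfolding distrib_left by linarith
        from power_mono[OF this, of 2]
        show "norm ((drag (fst (x n)) y - drag (snd (x n)) y)\<^sup>2) \<le> (2 * B T + 2 * B T * \<bar>y\<bar>)\<^sup>2" by simp
      qed
    qed measurable
  qed
  then have "uniformly_continuous_on ({0..T} \<times> {0..T}) \<Phi>"
    by (rule compact_uniformly_continuous) (intro compact_Times compact_Icc)
  then obtain \<delta> where \<delta>: "0 < \<delta>" "\<And>p q. p \<in> {0..T} \<times> {0..T} \<Longrightarrow> q \<in> {0..T} \<times> {0..T} \<Longrightarrow> dist q p < \<delta> \<Longrightarrow> dist (\<Phi> q) (\<Phi> p) < \<epsilon>"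
    using \<epsilon> unfolding uniformly_continuous_on_def by meson
  have "(\<integral>y. (drag t y - drag r y)\<^sup>2 \<partial>\<rho>0) < \<epsilon>" if "0 \<le> r \<and> r \<le> t \<and> t \<le> T \<and> t - r < \<delta>" for r t
    using \<delta>(2)[of "(t, t)" "(t, r)"] that by (simp add: \<Phi>_def dist_Pair_Pair dist_real_def)
  then show ?thesis using \<delta>(1) by blast
qed

text \<open>Measures the mismatch between the drag frozen at time t, which appears in the potential
  increment, and the integrated drag of the kinetic one.\<close>

lemma drag_speed_increment:
  assumes s: "0 \<le> s" "s \<le> t" and t: "good_time t" and \<eta>: "0 < \<eta>"
    and close: "\<And>r. s \<le> r \<Longrightarrow> r < t \<Longrightarrow> (\<integral>y. (drag t y - drag r y)\<^sup>2 \<partial>\<rho>0) \<le> \<eta>\<^sup>2"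
    and M: "(\<integral>y. (speed t y)\<^sup>2 \<partial>\<rho>0) \<le> M"
  shows "(t - s) * (\<integral>y. speed t y * drag t y \<partial>\<rho>0) - (\<integral>y. (LBINT r:{s..<t}. drag r y) * speed t y \<partial>\<rho>0) \<le> \<eta> * (1 + M) * (t - s)"
proof -
  note t0 = good_time_nonneg[OF t] and tt = speed_L2(1)[OF t]
  obtain B where B: "\<And>T. 0 < B T" "\<And>t T y. 0 \<le> t \<Longrightarrow> t \<le> T \<Longrightarrow> \<bar>drag t y\<bar> \<le> B T * (1 + \<bar>y\<bar>)"
    by (rule growth_bound) blast
  define h where "h r y = (drag t y - drag r y) * speed t y" for r y
  have iw: "integrable \<rho>0 (\<lambda>y. (2 * B t + 2 * B t * \<bar>y\<bar>) * \<bar>speed t y\<bar>)"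
    by (rule integrable_product_sq[OF integrable_affine_sq]) (use tt in \<open>simp_all\<close>)
  have hb: "\<bar>h r y\<bar> \<le> (2 * B t + 2 * B t * \<bar>y\<bar>) * \<bar>speed t y\<bar>" if r: "0 \<le> r" "r \<le> t" for r y
  proof -
    have "\<bar>drag t y - drag r y\<bar> \<le> 2 * B t + 2 * B t * \<bar>y\<bar>"
      using B(2)[OF t0 order_refl, of y] B(2)[OF r, of y] unfolding distrib_left by linarith
    then show ?thesis unfolding h_def abs_mult by (rule mult_right_mono) simp
  qed
  have ih: "integrable \<rho>0 (h r)" if r: "0 \<le> r" "r \<le> t" for r
  proof (rule Bochner_Integration.integrable_bound[OF iw])
    show "h r \<in> borel_measurable \<rho>0" unfolding h_def[abs_def] by measurable
    show "AE y in \<rho>0. norm (h r y) \<le> norm ((2 * B t + 2 * B t * \<bar>y\<bar>) * \<bar>speed t y\<bar>)"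
      by (rule AE_I2) (use hb[OF r] abs_ge_self order_trans in \<open>unfold real_norm_def, blast\<close>)
  qed
  have P: "integrable (lborel \<Otimes>\<^sub>M \<rho>0) (\<lambda>(r, y). indicator {s..<t} r * h r y)"
  proof (rule pair_integrable_bounded[OF _ s(2), where C="\<integral>y. (2 * B t + 2 * B t * \<bar>y\<bar>) * \<bar>speed t y\<bar> \<partial>\<rho>0"])
    show "(\<lambda>p. h (fst p) (snd p)) \<in> borel_measurable (borel \<Otimes>\<^sub>M borel)" unfolding h_def by measurable
    show "AE r in lborel. s \<le> r \<longrightarrow> r < t \<longrightarrow> integrable \<rho>0 (h r) \<and>
        (\<integral>y. \<bar>h r y\<bar> \<partial>\<rho>0) \<le> (\<integral>y. (2 * B t + 2 * B t * \<bar>y\<bar>) * \<bar>speed t y\<bar> \<partial>\<rho>0)"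
    proof (rule AE_I2, intro impI conjI)
      fix r assume "s \<le> r" "r < t"
      then have r: "0 \<le> r" "r \<le> t" using s by auto
      show "integrable \<rho>0 (h r)" by (rule ih[OF r])
      show "(\<integral>y. \<bar>h r y\<bar> \<partial>\<rho>0) \<le> (\<integral>y. (2 * B t + 2 * B t * \<bar>y\<bar>) * \<bar>speed t y\<bar> \<partial>\<rho>0)"
        by (rule integral_mono[OF integrable_abs[OF ih[OF r]] iw hb[OF r]])
    qed
  qed
  note F = pair_fubini[OF P]
  have inner: "(LBINT r:{s..<t}. h r y) = ((t - s) * drag t y - (LBINT r:{s..<t}. drag r y)) * speed t y" for y
  proof -
    have c: "set_integrable lborel {s..<t} (\<lambda>r. drag t y)" unfolding set_integrable_def using s by simp
    have "(LBINT r:{s..<t}. drag t y - drag r y) = (t - s) * drag t y - (LBINT r:{s..<t}. drag r y)"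
      using set_integral_diff(2)[OF c impulse_diff(2)[OF s]] s(2) by (simp add: set_lebesgue_integral_def)
    then show ?thesis unfolding h_def by simp
  qed
  have iI: "integrable \<rho>0 (\<lambda>y. (LBINT r:{s..<t}. drag r y) * speed t y)"
  proof -
    have e: "(LBINT r:{s..<t}. drag r y) = impulse s y - impulse t y" for y using impulse_diff(1)[OF s, of y] by simp
    show ?thesis unfolding e
      by (intro integrable_product_sq integrable_sum_sq(2) impulse_integrable(2) s t0 tt) measurable
  qed
  have iD: "integrable \<rho>0 (\<lambda>y. speed t y * drag t y)"
    by (intro integrable_product_sq tt drag_integrable(2) t0) measurable
  have "(t - s) * (\<integral>y. speed t y * drag t y \<partial>\<rho>0) - (\<integral>y. (LBINT r:{s..<t}. drag r y) * speed t y \<partial>\<rho>0) =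
    (\<integral>y. (t - s) * (speed t y * drag t y) - (LBINT r:{s..<t}. drag r y) * speed t y \<partial>\<rho>0)" using iI iD by simp
  also have "\<dots> = (\<integral>y. (LBINT r:{s..<t}. h r y) \<partial>\<rho>0)"
    unfolding inner by (rule Bochner_Integration.integral_cong[OF refl]) (simp add: algebra_simps)
  also have "\<dots> = (LBINT r:{s..<t}. \<integral>y. h r y \<partial>\<rho>0)" by (rule F(3))
  also have "\<dots> \<le> \<bar>LBINT r:{s..<t}. \<integral>y. h r y \<partial>\<rho>0\<bar>" by simp
  also have "\<dots> \<le> \<eta> * (1 + M) * (t - s)"
  proof (rule set_integral_abs_le[OF s(2) F(4)])
    fix r assume r: "s \<le> r" "r < t"
    have r': "0 \<le> r" "r \<le> t" using r s by auto
    have id: "integrable \<rho>0 (\<lambda>y. (drag t y - drag r y)\<^sup>2)"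
      by (intro integrable_sum_sq(2) drag_integrable(2) t0 r') measurable
    \<comment> \<open>Young's inequality with weight \<eta>: the drags are \<eta>-close in L2, so
      the first term is at most \<eta> and the second at most \<eta> M.\<close>
    have "\<bar>\<integral>y. h r y \<partial>\<rho>0\<bar> \<le> (\<integral>y. (drag t y - drag r y)\<^sup>2 / \<eta> + \<eta> * (speed t y)\<^sup>2 \<partial>\<rho>0)"
    proof (rule integral_abs_le_AE[OF ih[OF r']])
      show "integrable \<rho>0 (\<lambda>y. (drag t y - drag r y)\<^sup>2 / \<eta> + \<eta> * (speed t y)\<^sup>2)" using id tt by simp
      show "AE y in \<rho>0. \<bar>h r y\<bar> \<le> (drag t y - drag r y)\<^sup>2 / \<eta> + \<eta> * (speed t y)\<^sup>2"
      proof (rule AE_I2)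
        fix y
        let ?a = "\<bar>drag t y - drag r y\<bar>" and ?b = "\<bar>speed t y\<bar>"
        have "0 \<le> (?a - \<eta> * ?b)\<^sup>2 / \<eta>" using \<eta> by simp
        also have "\<dots> = ?a\<^sup>2 / \<eta> + \<eta> * ?b\<^sup>2 - 2 * (?a * ?b)"
          using \<eta> by (simp add: power2_eq_square field_simps)
        finally have "2 * (?a * ?b) \<le> ?a\<^sup>2 / \<eta> + \<eta> * ?b\<^sup>2" by simp
        moreover have "0 \<le> ?a * ?b" by simp
        ultimately show "\<bar>h r y\<bar> \<le> (drag t y - drag r y)\<^sup>2 / \<eta> + \<eta> * (speed t y)\<^sup>2"
          unfolding h_def abs_mult power2_abs by linarith
      qed
    qed
    also have "\<dots> = (\<integral>y. (drag t y - drag r y)\<^sup>2 \<partial>\<rho>0) / \<eta> + \<eta> * (\<integral>y. (speed t y)\<^sup>2 \<partial>\<rho>0)" using id tt by simp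
    also have "\<dots> \<le> \<eta>\<^sup>2 / \<eta> + \<eta> * M"
      using close[OF r] M \<eta> by (intro add_mono mult_left_mono divide_right_mono) auto
    also have "\<dots> = \<eta> * (1 + M)" using \<eta> by (simp add: power2_eq_square distrib_left)
    finally show "\<bar>\<integral>y. h r y \<partial>\<rho>0\<bar> \<le> \<eta> * (1 + M)" .
  qed
  finally show ?thesis .
qed

section \<open>Monotonicity of the energy\<close>

text \<open>The first order terms of the kinetic and the potential increment cancel up to the
  mismatch of \<open>drag_speed_increment\<close>. The factor 1 / 2 of the energy turns the
  potential remainder into C (t - s)^2 / 2.\<close>

lemma energy_local_decrease:
  assumes \<epsilon>: "0 < \<epsilon>"
  shows "\<exists>\<delta>>0. \<forall>s t. good_time s \<and> good_time t \<and> s \<le> t \<and> t \<le> T \<and> t - s < \<delta> \<longrightarrow>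
    energy W law velocity t - energy W law velocity s \<le> \<epsilon> * (t - s)"
proof -
  obtain M where M: "\<And>T. 0 < M T" "\<And>t T. good_time t \<Longrightarrow> t \<le> T \<Longrightarrow> (\<integral>y. (speed t y)\<^sup>2 \<partial>\<rho>0) \<le> M T"
    by (rule L2_bounds) blast
  obtain C where C: "\<And>T. 0 < C T"
    "\<And>s t T. 0 \<le> s \<Longrightarrow> s \<le> t \<Longrightarrow> t \<le> T \<Longrightarrow> good_time t \<Longrightarrow>
      (\<integral>p. W (flow t (fst p) - flow t (snd p)) \<partial>(\<rho>0 \<Otimes>\<^sub>M \<rho>0)) - (\<integral>p. W (flow s (fst p) - flow s (snd p)) \<partial>(\<rho>0 \<Otimes>\<^sub>M \<rho>0))
        \<le> 2 * (t - s) * (\<integral>y. speed t y * drag t y \<partial>\<rho>0) + C T * (t - s)\<^sup>2"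
    by (rule potential_increment) blast
  \<comment> \<open>Half of \<epsilon> is spent on the mismatch of the drags; the other half covers
    the quadratic remainder once t - s < \<epsilon> / C.\<close>
  define \<eta> where "\<eta> = \<epsilon> / (2 * (1 + M T))"
  have "0 < 1 + M T" using M(1)[of T] by simp
  then have \<eta>: "0 < \<eta>" "\<eta> * (1 + M T) = \<epsilon> / 2" using \<epsilon> by (simp_all add: \<eta>_def field_simps)
  obtain \<delta> where \<delta>: "0 < \<delta>" "\<And>r t. 0 \<le> r \<and> r \<le> t \<and> t \<le> T \<and> t - r < \<delta> \<Longrightarrow> (\<integral>y. (drag t y - drag r y)\<^sup>2 \<partial>\<rho>0) < \<eta>\<^sup>2"
    using drag_L2_uniform[of "\<eta>\<^sup>2" T] \<eta>(1) by auto
  show ?thesis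
  proof (intro exI[of _ "min \<delta> (\<epsilon> / C T)"] conjI allI impI)
    show "0 < min \<delta> (\<epsilon> / C T)" using \<delta>(1) \<epsilon> C(1)[of T] by simp
    fix s t assume *: "good_time s \<and> good_time t \<and> s \<le> t \<and> t \<le> T \<and> t - s < min \<delta> (\<epsilon> / C T)"
    then have s: "good_time s" and t: "good_time t" and st: "s \<le> t" "t \<le> T" and d: "t - s < \<delta>" "t - s < \<epsilon> / C T" by auto
    note s0 = good_time_nonneg[OF s]
    have "(t - s) * (\<integral>y. speed t y * drag t y \<partial>\<rho>0) - (\<integral>y. (LBINT r:{s..<t}. drag r y) * speed t y \<partial>\<rho>0) \<le> \<eta> * (1 + M T) * (t - s)"
    proof (rule drag_speed_increment[OF s0 st(1) t \<eta>(1) _ M(2)[OF t st(2)]])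
      show "(\<integral>y. (drag t y - drag r y)\<^sup>2 \<partial>\<rho>0) \<le> \<eta>\<^sup>2" if "s \<le> r" "r < t" for r
        using \<delta>(2)[of r t] that s0 st d by auto
    qed
    moreover have "C T * (t - s) * (t - s) \<le> \<epsilon> * (t - s)"
    proof (rule mult_right_mono)
      show "C T * (t - s) \<le> \<epsilon>" using d(2) C(1)[of T] by (simp add: pos_less_divide_eq mult.commute)
    qed (use st in simp)
    moreover have "(x - x') / 2 + (z - z') / 2 \<le> \<epsilon> * d"
      if "x - x' \<le> - 2 * q" "z - z' \<le> 2 * d * p + k * d\<^sup>2" "d * p - q \<le> \<epsilon> / 2 * d" "k * d * d \<le> \<epsilon> * d"
      for x x' z z' q p k d :: real
      using that by (simp add: power2_eq_square field_simps)
    ultimately show "energy W law velocity t - energy W law velocity s \<le> \<epsilon> * (t - s)"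
      using kinetic_increment[OF s t st(1)] C(2)[OF s0 st t]
      unfolding energy_flow \<eta>(2) by (simp only: diff_divide_distrib add_diff_add)
  qed
qed

lemma good_time_dense:
  assumes "0 \<le> a" "a < b"
  shows "\<exists>u. a < u \<and> u < b \<and> good_time u"
proof (rule ccontr)
  assume "\<not> ?thesis"
  then have "AE r in lborel. r \<notin> {a<..<b}"
    using AE_good_time by (auto elim!: eventually_mono simp: assms order.trans[OF assms(1) less_imp_le])
  then have "emeasure lborel {a<..<b} = 0" by (subst (asm) AE_iff_measurable[of "{a<..<b}"]) auto
  then show False using assms by simp
qed

lemma energy_decreasing:
  assumes s: "good_time s" and t: "good_time t" and st: "s \<le> t"
  shows "energy W law velocity t \<le> energy W law velocity s"
proof (rule field_le_epsilon)
  define e where "e = energy W law velocity"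
  fix \<epsilon> :: real assume \<epsilon>: "0 < \<epsilon>"
  \<comment> \<open>The summand 1 avoids division by zero when s = t.\<close>
  define \<kappa> where "\<kappa> = \<epsilon> / (t - s + 1)"
  have \<kappa>: "0 < \<kappa>" using \<epsilon> st by (simp add: \<kappa>_def add_nonneg_pos)
  obtain \<delta> where \<delta>: "0 < \<delta>" "\<And>s u. good_time s \<and> good_time u \<and> s \<le> u \<and> u \<le> t \<and> u - s < \<delta> \<Longrightarrow> e u - e s \<le> \<kappa> * (u - s)"
    unfolding e_def using energy_local_decrease[OF \<kappa>, of t] by auto
  have chain: "e u - e s \<le> \<kappa> * (u - s)" if "good_time u" "s \<le> u" "u \<le> t" "u - s \<le> real n * (\<delta> / 2)" for n u
    using that
  proof (induction n arbitrary: u)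
    case 0
    then have "u = s" by simp
    then show ?case by simp
  next
    case (Suc n)
    show ?case
    proof (cases "u - s < \<delta>")
      case True
      then show ?thesis using \<delta>(2) s Suc.prems by blast
    next
      case False
      then have "0 \<le> u - \<delta>" using good_time_nonneg[OF s] by simp
      \<comment> \<open>Intermediate times have to be good, so the step back from u is only confined
        to lie between \<delta> / 2 and \<delta>: long enough for the induction on the number of
        half steps, short enough for the local estimate.\<close>
      then obtain r where r: "u - \<delta> < r" "r < u - \<delta> / 2" "good_time r" using good_time_dense[of "u - \<delta>" "u - \<delta> / 2"] \<delta>(1) by auto
      have "e r - e s \<le> \<kappa> * (r - s)"
        by (rule Suc.IH) (use r False Suc.prems \<delta>(1) in \<open>auto simp: algebra_simps\<close>)
      moreover have "e u - e r \<le> \<kappa> * (u - r)"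
        using \<delta>(2)[of r u] r Suc.prems \<delta>(1) by auto
      ultimately show ?thesis by (simp add: algebra_simps)
    qed
  qed
  obtain n :: nat where "(t - s) / (\<delta> / 2) \<le> real n" using real_arch_simple by blast
  then have "t - s \<le> real n * (\<delta> / 2)" using \<delta>(1) by (subst (asm) pos_divide_le_eq) auto
  from chain[OF t st order_refl this] have "e t - e s \<le> \<kappa> * (t - s)" .
  also have "\<dots> \<le> \<kappa> * (t - s + 1)" using \<kappa> by simp
  also have "\<dots> = \<epsilon>" using st by (simp add: \<kappa>_def)
  finally show "energy W law velocity t \<le> energy W law velocity s + \<epsilon>" by (simp add: e_def)
qed

lemma energy_nonincreasing_law: "energy_nonincreasing W law velocity"
proof -
  obtain N where N: "N \<in> null_sets lborel" "\<And>t. 0 \<le> t \<Longrightarrow> t \<notin> N \<Longrightarrow> good_time t"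
    using AE_good_time unfolding eventually_ae_filter by auto
  show ?thesis unfolding energy_nonincreasing_def
    by (rule bexI[OF _ N(1)]) (auto intro!: energy_integrable energy_decreasing N(2))
qed

lemma weak_solution_law:
  assumes fW: "deriv W = f"
  shows "weak_solution_pair W \<rho>0 v0 law velocity"
  unfolding weak_solution_pair_def fW
proof (intro conjI allI impI)
  show "real_distribution (law t)" for t by (rule law_distribution)
  show "narrowly_continuous law" by (rule law_narrowly_continuous)
  show "velocity \<in> borel_measurable (restrict_space borel (UNIV \<times> {0..}))"
    by (rule measurable_restrict_space1[OF velocity_measurable])
  fix \<phi> :: "real \<times> real \<Rightarrow> real" assume \<phi>: "test_function \<phi>"
  obtain b R where "euler_test \<rho>0 v0 f c K \<phi> b R"
  proof (rule test_function_bounds[OF \<phi>])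
    fix b R :: real assume "0 < R" "\<And>x t. \<bar>\<phi> (x, t)\<bar> \<le> b" "\<And>x t. \<bar>partial_x \<phi> x t\<bar> \<le> b" "\<And>x t. \<bar>partial_t \<phi> x t\<bar> \<le> b"
      "\<And>x t. R \<le> t \<Longrightarrow> \<phi> (x, t) = 0" "\<And>x t. R \<le> t \<Longrightarrow> partial_x \<phi> x t = 0" "\<And>x t. R \<le> t \<Longrightarrow> partial_t \<phi> x t = 0"
    then show ?thesis by (intro that[of b R] euler_test.intro euler_test_axioms.intro euler_data_axioms \<phi>) auto
  qed
  then interpret euler_test \<rho>0 v0 f c K \<phi> b R .
  show "(LBINT t:{0..}. \<integral>x. partial_t \<phi> x t + velocity (x, t) * partial_x \<phi> x t \<partial>law t) + (\<integral>x. \<phi> (x, 0) \<partial>\<rho>0) = 0"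
    by (rule continuity_equation)
  show "(LBINT t:{0..}. \<integral>x. velocity (x, t) * partial_t \<phi> x t + (velocity (x, t))\<^sup>2 * partial_x \<phi> x t \<partial>law t)
     + (\<integral>x. \<phi> (x, 0) * v0 x \<partial>\<rho>0) = (LBINT t:{0..}. \<integral>x. \<phi> (x, t) * conv_measure f (law t) x \<partial>law t)"
    by (rule momentum_equation)
qed (rule kinetic_interaction_finite)

end

section \<open>Passing from the hypotheses on \<open>v0\<close> and W to the setting of the
  proof\<close>

text \<open>A single interval, n = 1; \<delta> is halved because the conclusion allows distances
  equal to it.\<close>

lemma abs_continuous_real_uniform:
  assumes "abs_continuous_real g" "0 < \<epsilon>"
  shows "\<exists>\<delta>>0. \<forall>x y. \<bar>x - y\<bar> \<le> \<delta> \<longrightarrow> \<bar>g x - g y\<bar> \<le> \<epsilon>"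
proof -
  obtain \<delta> where \<delta>: "0 < \<delta>" "\<And>(n::nat) a b. (\<forall>i<n. a i < b i) \<and> disjoint_family_on (\<lambda>i. {a i<..<b i}) {..<n} \<and>
      (\<Sum>i<n. b i - a i) < \<delta> \<Longrightarrow> (\<Sum>i<n. \<bar>g (b i) - g (a i)\<bar>) < \<epsilon>"
    using assms unfolding abs_continuous_real_def by meson
  have lt: "\<bar>g y - g x\<bar> < \<epsilon>" if "x < y" "y - x < \<delta>" for x y
    using \<delta>(2)[of 1 "\<lambda>_. x" "\<lambda>_. y"] that by (simp add: disjoint_family_on_def)
  have "\<bar>g x - g y\<bar> \<le> \<epsilon>" if "\<bar>x - y\<bar> \<le> \<delta> / 2" for x y
  proof -
    consider "x < y" | "x = y" | "y < x" by linarith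
    then show ?thesis using lt[of x y] lt[of y x] that \<delta>(1) assms(2) by cases auto
  qed
  then show ?thesis using \<delta>(1) by (intro exI[of _ "\<delta> / 2"]) auto
qed

text \<open>The tangent inequalities at x and at y are added.\<close>

lemma convex_deriv_mono:
  fixes g :: "real \<Rightarrow> real"
  assumes convex: "convex_on UNIV g" and d: "\<And>x. (g has_real_derivative g' x) (at x)" and xy: "x \<le> y"
  shows "g' x \<le> g' y"
proof -
  have tangent: "g' u * (w - u) \<le> g w - g u" for u w
    using convex_on_imp_above_tangent[OF convex, of u w "g' u"] d[of u] by simp
  have "(g' y - g' x) * (y - x) \<ge> 0" using tangent[of x y] tangent[of y x] by (simp add: algebra_simps)
  then show ?thesis using xy by (cases "x = y") (auto simp: zero_le_mult_iff)
qed

theorem corollary4p4: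
  fixes \<rho>0 :: "real measure" and v0 W :: "real \<Rightarrow> real" and c :: real
  assumes "real_distribution \<rho>0"
    and "integrable \<rho>0 (\<lambda>x. x\<^sup>2)"
    and "abs_continuous_real v0"
    and "W C1_differentiable_on UNIV"
    and "\<And>x. W (- x) = W x"
    and "bdd_above (range (\<lambda>x. \<bar>deriv W x\<bar> / (1 + \<bar>x\<bar>)))"
    and "c > 0"
    and "convex_on UNIV (\<lambda>x. W x + c / 2 * x\<^sup>2)"
  shows "\<exists>\<rho> v. weak_solution_pair W \<rho>0 v0 \<rho> v \<and>
               energy_nonincreasing W \<rho> v \<and>
               entropy_inequality c \<rho> v"
proof -
  obtain D where D: "\<And>x. (W has_vector_derivative D x) (at x)" "continuous_on UNIV D"
    using assms(4) unfolding C1_differentiable_on_def by auto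
  have "(W has_real_derivative D x) (at x)" for x using D(1) by (simp add: has_real_derivative_iff_has_vector_derivative)
  then have dW: "deriv W = D" "(W has_real_derivative deriv W x) (at x)" for x
    by (auto intro!: DERIV_imp_deriv simp: fun_eq_iff DERIV_deriv_iff_real_differentiable real_differentiable_def)
  obtain K where K: "\<And>x. \<bar>deriv W x\<bar> / (1 + \<bar>x\<bar>) \<le> K" using assms(6) unfolding bdd_above_def by auto
  have growth: "\<bar>deriv W x\<bar> \<le> K * (1 + \<bar>x\<bar>)" for x
    using K[of x] by (simp add: pos_divide_le_eq add_pos_nonneg)
  have one_sided: "deriv W x - deriv W y \<le> c * (y - x)" if "x \<le> y" for x y
  proof -
    have "((\<lambda>x. W x + c / 2 * x\<^sup>2) has_real_derivative deriv W x + c * x) (at x)" for x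
      by (auto intro!: derivative_eq_intros dW(2))
    from convex_deriv_mono[OF assms(8) this that] show ?thesis by (simp add: algebra_simps)
  qed
  have "0 \<le> K" using order_trans[OF _ K[of 0]] by simp
  then have "euler_data \<rho>0 v0 (deriv W) c K"
    using assms(1,2,7) abs_continuous_real_uniform[OF assms(3)] D(2) growth one_sided
    by (auto simp: euler_data_def euler_data_axioms_def dW(1))
  then interpret euler_potential \<rho>0 v0 "deriv W" c K W
    using dW(2) assms(5) by (simp add: euler_potential_def euler_potential_axioms_def)
  show ?thesis
    using weak_solution_law[OF refl] energy_nonincreasing_law entropy_inequality_law by blast
qed

end
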